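(* Let $N\in\mathbb N$, $s\in(0,1)$, $N>2s$, $2^*_s=2N/(N-2s)$, $\alpha,\beta>1$, $2<\alpha+\beta<2^*_s$, $0<p\le q<1$, $\theta>0$. Let $a\in L^{\frac{2}{1+p}}(\mathbb R^N)$, $b\in L^{\frac{2}{1+q}}(\mathbb R^N)$ with $a(x),b(x)>0$ for all $x\in\mathbb R^N$. Let $V_1,V_2:\mathbb R^N\to\mathbb R$ be continuous with $V_i(x)\ge V_0>0$ for all $x$ (for some constant $V_0$) and $|\{x\in\mathbb R^N: V_i(x)\le M\}|<+\infty$ for all $M>0$, $i=1,2$. Then $0<\lambda_*<\lambda^*<\infty$. Furthermore, for each $\lambda\in(0,\lambda^* )$, the system $(S_\lambda)$ admits at least one ground state solution $(u,v)\in\mathcal A$. Moreover, $(u,v)$ satisfies: (i) $E_\lambda''(u,v)(u,v)^2>0$, that is, $(u,v)\in\mathcal N_\lambda^+\cap\mathcal A$; (ii) there exists $C<0$ such that $E_\lambda(u,v)\le C$.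
   Context: All integrals are over $\mathbb R^N$; $|\cdot|$ of a set is Lebesgue measure. $X=X_1\times X_2$, $X_j=\{u\in H^s(\mathbb R^N):\int V_ju^2dx<\infty\}$, with inner product $\langle(u,v),(\varphi,\psi)\rangle=\iint\frac{[u(x)-u(y)][\varphi(x)-\varphi(y)]+[v(x)-v(y)][\psi(x)-\psi(y)]}{|x-y|^{N+2s}}dxdy+\int V_1u\varphi+V_2v\psi\,dx$ and norm $\|(u,v)\|^2=\langle(u,v),(u,v)\rangle$. The system $(S_\lambda)$ is $(-\Delta)^su+V_1(x)u=\lambda\frac{a(x)}{u^p}+\frac{\alpha}{\alpha+\beta}\theta|u|^{\alpha-2}u|v|^\beta$, $\ (-\Delta)^sv+V_2(x)v=\lambda\frac{b(x)}{v^q}+\frac{\beta}{\alpha+\beta}\theta|u|^\alpha|v|^{\beta-2}v$ in $\mathbb R^N$. A pair $(u,v)\in X$ is a weak solution of $(S_\lambda)$ if for every $(\varphi_1,\varphi_2)\in X$ (all integrals being well defined and finite, with $|0|^{-p}=|0|^{-q}=+\infty$) $\langle(u,v),(\varphi_1,\varphi_2)\rangle-\frac{\theta}{\alpha+\beta}\int(\alpha|u|^{\alpha-2}u\varphi_1|v|^\beta+\beta|u|^\alpha|v|^{\beta-2}v\varphi_2)dx-\lambda\int(a|u|^{-p}\varphi_1+b|v|^{-q}\varphi_2)dx=0.$ Energy: $E_\lambda(u,v)=\frac12\|(u,v)\|^2-\frac{\lambda}{1-p}\int a|u|^{1-p}dx-\frac{\lambda}{1-q}\int b|v|^{1-q}dx-\frac{\theta}{\alpha+\beta}\int|u|^\alpha|v|^\beta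 dx$. A ground state solution is a nontrivial weak solution having minimal energy $E_\lambda$ among all nontrivial weak solutions. Notation (defined by these formulas): $E_\lambda'(u,v)(u,v)=\|(u,v)\|^2-\lambda\int a|u|^{1-p}-\lambda\int b|v|^{1-q}-\theta\int|u|^\alpha|v|^\beta$, $E_\lambda''(u,v)(u,v)^2=2\|(u,v)\|^2-\lambda(1-p)\int a|u|^{1-p}-\lambda(1-q)\int b|v|^{1-q}-\theta(\alpha+\beta)\int|u|^\alpha|v|^\beta$. $\mathcal N_\lambda=\{(u,v)\in X\setminus\{(0,0)\}:E_\lambda'(u,v)(u,v)=0\}$, $\mathcal N_\lambda^+=\{(u,v)\in\mathcal N_\lambda:E_\lambda''(u,v)(u,v)^2>0\}$. $\mathcal A=\{(u,v)\in X:\int|u|^\alpha|v|^\beta dx>0\}$. For $(u,v)\in\mathcal A$, $R_n(u,v)=\dfrac{\|(u,v)\|^2-\theta\int|u|^\alpha|v|^\beta dx}{\int a|u|^{1-p}dx+\int b|v|^{1-q}dx}$, $\quad R_e(u,v)=\dfrac{\frac12\|(u,v)\|^2-\frac{\theta}{\alpha+\beta}\int|u|^\alpha|v|^\beta dx}{\frac1{1-p}\int a|u|^{1-p}dx+\frac1{1-q}\int b|v|^{1-q}dx}$, $\lambda^*=\inf_{(u,v)\in\mathcal A}\max_{t>0}R_n(tu,tv)$, $\lambda_*=\inf_{(u,v)\in\mathcal A}\max_{t>0}R_e(tu,tv)$.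
   Formalization: Weak solutions are additionally required to satisfy u, v ≥ 0 a.e., so a ground state minimizes energy among nontrivial nonnegative weak solutions; with sign-changing or negative pairs admitted, the claim that the ground state lies in N_λ^+ fails. *)

theory Defs
  imports "HOL-Analysis.Analysis"
begin

text \<open>
  Elements of function spaces are represented by Lebesgue measurable functions; equality
  of elements, in particular being the zero element, is meant almost everywhere.
\<close>

definition Lspace :: "real \<Rightarrow> (real ^ 'n \<Rightarrow> real) set" where
  "Lspace r = {f \<in> borel_measurable lebesgue. integrable lebesgue (\<lambda>x. \<bar>f x\<bar> powr r)}"

text \<open>On the diagonal the quotient is \<open>0 / 0 = 0\<close>; the diagonal is a null set.\<close>

definition gagliardo_kernel ::
    "real \<Rightarrow> (real ^ 'n \<Rightarrow> real) \<Rightarrow> (real ^ 'n \<Rightarrow> real) \<Rightarrow> (real ^ 'n) \<times> (real ^ 'n) \<Rightarrow> real" where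
  "gagliardo_kernel s u \<phi> = (\<lambda>(x, y).
     (u x - u y) * (\<phi> x - \<phi> y) / norm (x - y) powr (real CARD('n) + 2 * s))"

definition frac_sobolev :: "real \<Rightarrow> (real ^ 'n \<Rightarrow> real) set" where
  "frac_sobolev s = {u \<in> Lspace 2.
     integrable (lebesgue \<Otimes>\<^sub>M lebesgue) (gagliardo_kernel s u u)}"

definition Xcomp :: "real \<Rightarrow> (real ^ 'n \<Rightarrow> real) \<Rightarrow> (real ^ 'n \<Rightarrow> real) set" where
  "Xcomp s V = {u \<in> frac_sobolev s. integrable lebesgue (\<lambda>x. V x * (u x)\<^sup>2)}"

definition Xspace :: "real \<Rightarrow> (real ^ 'n \<Rightarrow> real) \<Rightarrow> (real ^ 'n \<Rightarrow> real)
    \<Rightarrow> ((real ^ 'n \<Rightarrow> real) \<times> (real ^ 'n \<Rightarrow> real)) set" where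
  "Xspace s V1 V2 = Xcomp s V1 \<times> Xcomp s V2"

definition nontrivial :: "(real ^ 'n \<Rightarrow> real) \<Rightarrow> (real ^ 'n \<Rightarrow> real) \<Rightarrow> bool" where
  "nontrivial u v \<longleftrightarrow> \<not> (AE x in lebesgue. u x = 0 \<and> v x = 0)"

definition ip :: "real \<Rightarrow> (real ^ 'n \<Rightarrow> real) \<Rightarrow> (real ^ 'n \<Rightarrow> real)
    \<Rightarrow> (real ^ 'n \<Rightarrow> real) \<Rightarrow> (real ^ 'n \<Rightarrow> real)
    \<Rightarrow> (real ^ 'n \<Rightarrow> real) \<Rightarrow> (real ^ 'n \<Rightarrow> real) \<Rightarrow> real" where
  "ip s V1 V2 u v \<phi> \<psi> =
     (LINT z|(lebesgue \<Otimes>\<^sub>M lebesgue). gagliardo_kernel s u \<phi> z + gagliardo_kernel s v \<psi> z)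
     + (LINT x|lebesgue. V1 x * u x * \<phi> x + V2 x * v x * \<psi> x)"

definition normsq :: "real \<Rightarrow> (real ^ 'n \<Rightarrow> real) \<Rightarrow> (real ^ 'n \<Rightarrow> real)
    \<Rightarrow> (real ^ 'n \<Rightarrow> real) \<Rightarrow> (real ^ 'n \<Rightarrow> real) \<Rightarrow> real" where
  "normsq s V1 V2 u v = ip s V1 V2 u v u v"

definition singular_int :: "(real ^ 'n \<Rightarrow> real) \<Rightarrow> real \<Rightarrow> (real ^ 'n \<Rightarrow> real) \<Rightarrow> real" where
  "singular_int a p u = (LINT x|lebesgue. a x * \<bar>u x\<bar> powr (1 - p))"

definition coupling_int :: "real \<Rightarrow> real \<Rightarrow> (real ^ 'n \<Rightarrow> real) \<Rightarrow> (real ^ 'n \<Rightarrow> real) \<Rightarrow> real" where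
  "coupling_int \<alpha> \<beta> u v = (LINT x|lebesgue. \<bar>u x\<bar> powr \<alpha> * \<bar>v x\<bar> powr \<beta>)"

definition energy where
  "energy s V1 V2 a b p q \<alpha> \<beta> \<theta> lam u v =
     normsq s V1 V2 u v / 2
     - lam / (1 - p) * singular_int a p u - lam / (1 - q) * singular_int b q v
     - \<theta> / (\<alpha> + \<beta>) * coupling_int \<alpha> \<beta> u v"

definition energy1 where
  "energy1 s V1 V2 a b p q \<alpha> \<beta> \<theta> lam u v =
     normsq s V1 V2 u v - lam * singular_int a p u - lam * singular_int b q v
     - \<theta> * coupling_int \<alpha> \<beta> u v"

definition energy2 where
  "energy2 s V1 V2 a b p q \<alpha> \<beta> \<theta> lam u v =
     2 * normsq s V1 V2 u v
     - lam * (1 - p) * singular_int a p u - lam * (1 - q) * singular_int b q v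
     - \<theta> * (\<alpha> + \<beta>) * coupling_int \<alpha> \<beta> u v"

definition nehari where
  "nehari s V1 V2 a b p q \<alpha> \<beta> \<theta> lam =
     {(u, v) \<in> Xspace s V1 V2. nontrivial u v \<and> energy1 s V1 V2 a b p q \<alpha> \<beta> \<theta> lam u v = 0}"

definition nehari_plus where
  "nehari_plus s V1 V2 a b p q \<alpha> \<beta> \<theta> lam =
     {(u, v) \<in> nehari s V1 V2 a b p q \<alpha> \<beta> \<theta> lam. energy2 s V1 V2 a b p q \<alpha> \<beta> \<theta> lam u v > 0}"

definition Aset where
  "Aset s V1 V2 \<alpha> \<beta> = {(u, v) \<in> Xspace s V1 V2. coupling_int \<alpha> \<beta> u v > 0}"

definition Rn where
  "Rn s V1 V2 a b p q \<alpha> \<beta> \<theta> u v =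
     (normsq s V1 V2 u v - \<theta> * coupling_int \<alpha> \<beta> u v)
     / (singular_int a p u + singular_int b q v)"

definition Re_quot where
  "Re_quot s V1 V2 a b p q \<alpha> \<beta> \<theta> u v =
     (normsq s V1 V2 u v / 2 - \<theta> / (\<alpha> + \<beta>) * coupling_int \<alpha> \<beta> u v)
     / (1 / (1 - p) * singular_int a p u + 1 / (1 - q) * singular_int b q v)"

definition max_on_ray :: "((real ^ 'n \<Rightarrow> real) \<Rightarrow> (real ^ 'n \<Rightarrow> real) \<Rightarrow> real)
    \<Rightarrow> (real ^ 'n \<Rightarrow> real) \<Rightarrow> (real ^ 'n \<Rightarrow> real) \<Rightarrow> real" where
  "max_on_ray R u v = (GREATEST r. \<exists>t>0. r = R (\<lambda>x. t * u x) (\<lambda>x. t * v x))"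

text \<open>
  The infima are taken in the extended reals, where the infimum of the empty set is \<open>\<infinity>\<close>.
\<close>

definition lambda_upper :: "real \<Rightarrow> (real ^ 'n \<Rightarrow> real) \<Rightarrow> (real ^ 'n \<Rightarrow> real)
    \<Rightarrow> (real ^ 'n \<Rightarrow> real) \<Rightarrow> (real ^ 'n \<Rightarrow> real)
    \<Rightarrow> real \<Rightarrow> real \<Rightarrow> real \<Rightarrow> real \<Rightarrow> real \<Rightarrow> ereal" where
  "lambda_upper s V1 V2 a b p q \<alpha> \<beta> \<theta> =
     (INF (u, v) \<in> Aset s V1 V2 \<alpha> \<beta>. ereal (max_on_ray (Rn s V1 V2 a b p q \<alpha> \<beta> \<theta>) u v))"

definition lambda_lower :: "real \<Rightarrow> (real ^ 'n \<Rightarrow> real) \<Rightarrow> (real ^ 'n \<Rightarrow> real)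
    \<Rightarrow> (real ^ 'n \<Rightarrow> real) \<Rightarrow> (real ^ 'n \<Rightarrow> real)
    \<Rightarrow> real \<Rightarrow> real \<Rightarrow> real \<Rightarrow> real \<Rightarrow> real \<Rightarrow> ereal" where
  "lambda_lower s V1 V2 a b p q \<alpha> \<beta> \<theta> =
     (INF (u, v) \<in> Aset s V1 V2 \<alpha> \<beta>. ereal (max_on_ray (Re_quot s V1 V2 a b p q \<alpha> \<beta> \<theta>) u v))"

text \<open>
  The singular integrands of the weak formulation take values in the extended reals, because
  of the convention that \<open>\<bar>0\<bar>\<close> to a negative power is \<open>\<infinity>\<close> (\<open>powr\<close> would give \<open>0\<close>). As usual,
  \<open>\<infinity> * 0 = 0\<close>.
\<close>

definition neg_power :: "real \<Rightarrow> real \<Rightarrow> ereal" where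
  "neg_power p r = (if r = 0 then \<infinity> else ereal (\<bar>r\<bar> powr (- p)))"

definition singular_integrand ::
    "(real ^ 'n \<Rightarrow> real) \<Rightarrow> real \<Rightarrow> (real ^ 'n \<Rightarrow> real) \<Rightarrow> (real ^ 'n \<Rightarrow> real) \<Rightarrow> real ^ 'n \<Rightarrow> ereal" where
  "singular_integrand a p u \<phi> x = ereal (a x) * neg_power p (u x) * ereal (\<phi> x)"

definition ext_integrable :: "'a measure \<Rightarrow> ('a \<Rightarrow> ereal) \<Rightarrow> bool" where
  "ext_integrable M f \<longleftrightarrow> f \<in> borel_measurable M \<and> (\<integral>\<^sup>+ x. e2ennreal \<bar>f x\<bar> \<partial>M) < \<infinity>"

text \<open>
  Meant for \<open>ext_integrable\<close> functions only. These are finite almost everywhere, so it is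
  harmless that \<open>real_of_ereal\<close> maps infinite values to \<open>0\<close>.
\<close>

definition ext_integral :: "'a measure \<Rightarrow> ('a \<Rightarrow> ereal) \<Rightarrow> real" where
  "ext_integral M f = (LINT x|M. real_of_ereal (f x))"

definition coupling_deriv ::
    "real \<Rightarrow> real \<Rightarrow> (real ^ 'n \<Rightarrow> real) \<Rightarrow> (real ^ 'n \<Rightarrow> real)
      \<Rightarrow> (real ^ 'n \<Rightarrow> real) \<Rightarrow> (real ^ 'n \<Rightarrow> real) \<Rightarrow> real ^ 'n \<Rightarrow> real" where
  "coupling_deriv \<alpha> \<beta> u v \<phi>1 \<phi>2 x =
     \<alpha> * (\<bar>u x\<bar> powr (\<alpha> - 2) * u x * \<phi>1 x * \<bar>v x\<bar> powr \<beta>)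
     + \<beta> * (\<bar>u x\<bar> powr \<alpha> * \<bar>v x\<bar> powr (\<beta> - 2) * v x * \<phi>2 x)"

text \<open>
  The integrals in \<open>ip\<close> are automatically finite on \<open>Xspace\<close>. Finiteness of the integral
  of the two singular terms together, for all \<open>(\<phi>1, \<phi>2)\<close>, amounts to finiteness for each term
  (take \<open>\<phi>2 = 0\<close> or \<open>\<phi>1 = 0\<close>).
\<close>

definition weak_formulation where
  "weak_formulation s V1 V2 a b p q \<alpha> \<beta> \<theta> lam u v \<longleftrightarrow>
     (\<forall>(\<phi>1, \<phi>2) \<in> Xspace s V1 V2.
        integrable lebesgue (coupling_deriv \<alpha> \<beta> u v \<phi>1 \<phi>2) \<and>
        ext_integrable lebesgue (singular_integrand a p u \<phi>1) \<and>
        ext_integrable lebesgue (singular_integrand b q v \<phi>2) \<and>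
        ip s V1 V2 u v \<phi>1 \<phi>2
        - \<theta> / (\<alpha> + \<beta>) * (LINT x|lebesgue. coupling_deriv \<alpha> \<beta> u v \<phi>1 \<phi>2 x)
        - lam * (ext_integral lebesgue (singular_integrand a p u \<phi>1)
               + ext_integral lebesgue (singular_integrand b q v \<phi>2)) = 0)"

text \<open>
  The system contains the real powers \<open>u\<^sup>p\<close> and \<open>v\<^sup>q\<close> with \<open>0 < p \<le> q < 1\<close>, which are only
  meaningful for nonnegative \<open>u\<close> and \<open>v\<close>; so a solution of the system is a pair of nonnegative
  functions. This is also what puts the solutions on \<open>nehari\<close>: the weak formulation tested with
  \<open>(u, v)\<close> gives \<open>energy1 = 0\<close> because \<open>\<bar>u\<bar> powr (- p) * u = \<bar>u\<bar> powr (1 - p)\<close> for \<open>u > 0\<close>. With the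
  absolute values in the weak formulation, a negative \<open>u\<close> would instead satisfy an equation
  with the opposite sign in front of the singular term, and such pairs can have smaller energy
  than every element of \<open>nehari\<close>.
\<close>

definition weak_solution where
  "weak_solution s V1 V2 a b p q \<alpha> \<beta> \<theta> lam u v \<longleftrightarrow>
     (u, v) \<in> Xspace s V1 V2 \<and>
     (AE x in lebesgue. 0 \<le> u x \<and> 0 \<le> v x) \<and>
     weak_formulation s V1 V2 a b p q \<alpha> \<beta> \<theta> lam u v"

definition ground_state where
  "ground_state s V1 V2 a b p q \<alpha> \<beta> \<theta> lam u v \<longleftrightarrow>
     weak_solution s V1 V2 a b p q \<alpha> \<beta> \<theta> lam u v \<and> nontrivial u v \<and>
     (\<forall>u' v'. weak_solution s V1 V2 a b p q \<alpha> \<beta> \<theta> lam u' v' \<and> nontrivial u' v' \<longrightarrow>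
        energy s V1 V2 a b p q \<alpha> \<beta> \<theta> lam u v \<le> energy s V1 V2 a b p q \<alpha> \<beta> \<theta> lam u' v')"

end

theory Submission
  imports Defs "HOL-Complex_Analysis.Great_Picard"
begin

text \<open>
  Along a ray the derivative of the energy is strictly concave, so for \<open>\<lambda>\<close> below the upper
  threshold every nonzero pair has a first positive multiple on the Nehari set, at which the energy
  is negative, and the energy is at least this value at every point of the ray that is followed by
  a point with nonnegative radial derivative. Take a minimizing sequence of such first points. A
  compact embedding gives an almost everywhere limit, along which the lower order terms converge and
  the quadratic form is lower semicontinuous by Fatou's lemma; hence the radial derivative of the
  limit is still nonpositive up to \<open>t = 1\<close>, and the first point on the ray of the limit is a
  minimizer. No strong convergence is needed.

  Because the second derivative along the ray is positive at the minimizer, the ray comparison also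
  applies to small perturbations in arbitrary directions, so the minimizer is a local minimum of the
  energy on the whole space. Nonnegative directions yield the positivity of both components and the
  integrability of the singular terms; after that the energy is differentiable in every direction.

  The Sobolev inequality below the critical exponent comes from iterating a pointwise estimate by
  cell averages, and compactness from the convergence of all cell averages along a subsequence. The
  strict inequality of the two thresholds comes from a uniform bound between the two ray maxima.
\<close>

section \<open>Power functions and the energy along rays\<close>

text \<open>The singular terms need not be differentiable where a component vanishes, so minimality
  cannot be exploited by differentiating the energy on the whole space. It is stored as a comparison
  instead: \<open>E lam u v\<close> is at most the energy of every nontrivial pair for which
  \<open>E1 lam\<close> is nonnegative at some multiple \<open>t >= 1\<close>. For a weak solution
  \<open>t = 1\<close> serves, so the minimizer is compared with all of them at once. For small
  perturbations of \<open>(u, v)\<close> one fixed \<open>t > 1\<close> with \<open>E1 lam\<close>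
  strictly positive serves, since strict positivity survives convergence of the functionals; no
  implicit function theorem is involved. The hypothesis on \<open>lam\<close> enters only through a
  point of positive radial derivative on every ray: for pairs in \<open>Aset\<close>,
  \<open>E1 lam\<close> at a multiple is \<open>Rn\<close> minus \<open>lam\<close>, times the
  positive denominator of \<open>Rn\<close>. The sublevel sets of the potentials have finite measure
  but may be unbounded, so compactness works with averages on a set of finite measure rather than on
  a ball.\<close>

text \<open>Writing \<open>z powr g = z * z powr (g - 1)\<close> with a decreasing second factor
  gives the bound on both sides of \<open>y\<close>; at \<open>x = 0\<close> it is an equality,
  hence the constant 1. The weight depends on \<open>y\<close> only, so with \<open>y\<close> the
  minimizer it yields a majorant of the singular difference quotients that is independent of the
  step size.\<close>

lemma powr_diff_abs_le:
  fixes g x y :: real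
  assumes "0 < g" "g < 1" "0 \<le> x" "0 < y"
  shows "\<bar>x powr g - y powr g\<bar> \<le> y powr (g - 1) * \<bar>x - y\<bar>"
proof -
  have split: "z powr g = z * z powr (g - 1)" if "0 < z" for z :: real
    using that powr_add[of z 1 "g - 1"] by simp
  consider "x = 0" | "0 < x" "x < y" | "0 < x" "y \<le> x" using assms by linarith
  then show ?thesis
  proof cases
    case 1
    then show ?thesis using assms split[of y] by simp
  next
    case 2
    have "y powr (g - 1) \<le> x powr (g - 1)"
      using assms 2 by (intro powr_mono2') auto
    then have "x * y powr (g - 1) \<le> x powr g" using split[of x] 2 by simp
    moreover have "x powr g \<le> y powr g" using assms 2 by (intro powr_mono2) auto
    ultimately show ?thesis using split[of y] assms 2 by (simp add: algebra_simps)
  next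
    case 3
    have "x powr (g - 1) \<le> y powr (g - 1)"
      using assms 3 by (intro powr_mono2') auto
    then have "x powr g \<le> x * y powr (g - 1)" using split[of x] 3 by simp
    moreover have "y powr g \<le> x powr g" using assms 3 by (intro powr_mono2) auto
    ultimately show ?thesis using split[of y] assms 3 by (simp add: algebra_simps)
  qed
qed

lemma powr_add_le:
  fixes g x y :: real
  assumes "0 < g" "g < 1" "0 \<le> x" "0 \<le> y"
  shows "(x + y) powr g \<le> x powr g + y powr g"
proof -
  have split: "z powr g = z * z powr (g - 1)" if "0 < z" for z :: real
    using that powr_add[of z 1 "g - 1"] by simp
  consider "x = 0" | "y = 0" | "0 < x" "0 < y" using assms by linarith
  then show ?thesis
  proof cases
    case 3
    have "(x + y) powr (g - 1) \<le> x powr (g - 1)" "(x + y) powr (g - 1) \<le> y powr (g - 1)"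
      using assms 3 by (auto intro!: powr_mono2')
    then have "x * (x + y) powr (g - 1) \<le> x powr g" "y * (x + y) powr (g - 1) \<le> y powr g"
      using split 3 by auto
    then show ?thesis using split[of "x + y"] 3 by (simp add: algebra_simps)
  qed (use assms in auto)
qed

lemma powr_abs_le_add:
  fixes g x y :: real
  assumes "0 < g" "g < 1"
  shows "\<bar>x\<bar> powr g \<le> \<bar>y\<bar> powr g + \<bar>x - y\<bar> powr g"
proof -
  have "\<bar>x\<bar> powr g \<le> (\<bar>y\<bar> + \<bar>x - y\<bar>) powr g"
    using assms by (intro powr_mono2) auto
  also have "\<dots> \<le> \<bar>y\<bar> powr g + \<bar>x - y\<bar> powr g"
    using assms by (intro powr_add_le) auto
  finally show ?thesis .
qed

text \<open>The tangent of a concave power at the right end point lies above the graph, which is the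
  weighted form of Young's inequality. Taking the slope at the right end keeps the bound meaningful
  at \<open>x = 0\<close>.\<close>

lemma powr_diff_ge:
  fixes g x d :: real
  assumes "0 < g" "g < 1" "0 \<le> x" "0 < d"
  shows "g * d * (x + d) powr (g - 1) \<le> (x + d) powr g - x powr g"
proof -
  let ?y = "x + d"
  have y: "0 < ?y" using assms by simp
  have "x powr g * ?y powr (1 - g) \<le> g * x + (1 - g) * ?y"
    using assms by (cases "x = 0") (auto intro!: Youngs_inequality_0)
  then have "x powr g * ?y powr (1 - g) * ?y powr (g - 1) \<le> (g * x + (1 - g) * ?y) * ?y powr (g - 1)"
    by (intro mult_right_mono) auto
  moreover have "?y powr (1 - g) * ?y powr (g - 1) = 1"
    using y by (simp flip: powr_add)
  moreover have "?y powr g = ?y * ?y powr (g - 1)"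
    using y powr_add[of ?y 1 "g - 1"] by simp
  ultimately show ?thesis by (simp add: algebra_simps)
qed

lemma powr_add_le_two:
  fixes r x y :: real
  assumes "0 \<le> r" "0 \<le> x" "0 \<le> y"
  shows "(x + y) powr r \<le> 2 powr r * (x powr r + y powr r)"
proof -
  have "(x + y) powr r \<le> (2 * max x y) powr r"
    using assms by (intro powr_mono2) auto
  also have "\<dots> = 2 powr r * max x y powr r" using assms by (simp add: powr_mult)
  also have "\<dots> \<le> 2 powr r * (x powr r + y powr r)"
    by (intro mult_left_mono) (auto simp: max_def)
  finally show ?thesis .
qed

lemma powr_mult_le_add:
  fixes x y a b :: real
  assumes "0 \<le> a" "0 \<le> b" "0 \<le> x" "0 \<le> y"
  shows "x powr a * y powr b \<le> x powr (a + b) + y powr (a + b)"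
proof -
  have "x powr a * y powr b \<le> max x y powr a * max x y powr b"
    using assms by (intro mult_mono powr_mono2) auto
  also have "\<dots> = max x y powr (a + b)" by (simp add: powr_add)
  also have "\<dots> \<le> x powr (a + b) + y powr (a + b)" by (auto simp: max_def)
  finally show ?thesis .
qed

text \<open>Above a threshold the higher power wins with factor \<open>e\<close>, below it the
  square wins with a finite constant. The small factor belongs to the power for which only a bound
  is known, while the square integral will tend to zero.\<close>

lemma powr_interpolate:
  fixes r q e :: real
  assumes "2 < r" "r < q" "0 < e"
  shows "\<exists>C\<ge>0. \<forall>x\<ge>0. x powr r \<le> e * x powr q + C * x\<^sup>2"
proof (intro exI conjI allI impI)
  \<comment> \<open>The threshold solves \<open>e * T powr (q - r) = 1\<close>.\<close>
  let ?T = "(1 / e) powr (1 / (q - r))"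
  fix x :: real assume x: "0 \<le> x"
  show "x powr r \<le> e * x powr q + ?T powr (r - 2) * x\<^sup>2"
  proof (cases "x \<le> ?T")
    case True
    show ?thesis
    proof (cases "x = 0")
      case False
      then have x: "x > 0" using x by simp
      have "x powr r = x powr (r - 2) * x\<^sup>2"
        using x powr_add[of x "r - 2" 2] by simp
      also have "\<dots> \<le> ?T powr (r - 2) * x\<^sup>2"
        using x True assms by (intro mult_right_mono powr_mono2) auto
      also have "\<dots> \<le> e * x powr q + ?T powr (r - 2) * x\<^sup>2" using assms by simp
      finally show ?thesis .
    qed (use assms in auto)
  next
    case False
    then have Tx: "?T \<le> x" by simp
    have x: "x > 0" using False x by (metis less_eq_real_def powr_ge_zero)
    have "1 / e = ?T powr (q - r)" using assms by (simp add: powr_powr)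
    also have "\<dots> \<le> x powr (q - r)" using assms Tx by (intro powr_mono2) auto
    finally have "1 \<le> e * x powr (q - r)" using assms by (simp add: field_simps)
    then have "x powr r \<le> e * x powr (q - r) * x powr r" using mult_right_mono[of 1 _ "x powr r"] by simp
    also have "\<dots> = e * x powr q" by (simp flip: powr_add)
    also have "\<dots> \<le> e * x powr q + ?T powr (r - 2) * x\<^sup>2" by simp
    finally show ?thesis .
  qed
qed simp

lemma powr_le_between:
  fixes r q x :: real
  assumes "2 \<le> r" "r \<le> q" "0 \<le> x"
  shows "x powr r \<le> x\<^sup>2 + x powr q"
proof (cases "x \<le> 1")
  case True
  then have "x powr r \<le> x powr 2"
    using assms by (cases "x = 0") (auto intro!: powr_mono' simp del: powr_numeral)
  then have "x powr r \<le> x\<^sup>2" using assms by (cases "x = 0") auto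
  then show ?thesis by (simp add: add_increasing2)
next
  case False
  then have "x powr r \<le> x powr q" using assms by (intro powr_mono) auto
  then show ?thesis by (simp add: add_increasing)
qed

lemma powr_lipschitz:
  fixes al x y :: real
  assumes "1 < al" "0 \<le> x" "0 \<le> y"
  shows "\<bar>x powr al - y powr al\<bar> \<le> al * (x + y) powr (al - 1) * \<bar>x - y\<bar>"
proof -
  \<comment> \<open>The tangent inequality of the convex power at \<open>x\<close>, read off from
    Young's inequality with exponents \<open>al / (al - 1)\<close> and \<open>al\<close>. Symmetry
    then only costs replacing \<open>x\<close> by \<open>x + y\<close> in the slope.\<close>
  have *: "x powr al - y powr al \<le> al * x powr (al - 1) * (x - y)" if "0 \<le> x" "0 \<le> y" for x y :: real
  proof (cases "x = 0")
    case False
    then have x: "x > 0" using that by simp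
    have "x powr (al - 1) * y \<le> (x powr (al - 1)) powr (al / (al - 1)) / (al / (al - 1)) + y powr al / al"
      using assms that by (intro Youngs_inequality) (auto simp: field_simps)
    also have "(x powr (al - 1)) powr (al / (al - 1)) = x powr al"
      using assms by (simp add: powr_powr)
    finally have "al * x powr (al - 1) * y \<le> (al - 1) * x powr al + y powr al"
      using assms by (simp add: field_simps)
    moreover have "x powr al = x powr (al - 1) * x"
      using x powr_add[of x "al - 1" 1] by simp
    ultimately show ?thesis by (simp add: algebra_simps)
  qed (use assms that in auto)
  have **: "al * x powr (al - 1) * (x - y) \<le> al * (x + y) powr (al - 1) * (x - y)"
    if "0 \<le> y" "y \<le> x" for x y :: real
    using assms that by (intro mult_right_mono mult_left_mono powr_mono2) auto
  consider "y \<le> x" | "x \<le> y" by linarith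
  then show ?thesis
  proof cases
    case 1
    then have "y powr al \<le> x powr al" using assms by (intro powr_mono2) auto
    then show ?thesis using order_trans[OF *[of x y] **[of y x]] 1 assms by simp
  next
    case 2
    then have "x powr al \<le> y powr al" using assms by (intro powr_mono2) auto
    then show ?thesis using order_trans[OF *[of y x] **[of x y]] 2 assms by (simp add: add.commute)
  qed
qed

text \<open>The derivative of the energy along a ray is strictly concave, hence has at most two zeros;
  the first one is the local minimum.\<close>

lemma fibering_first_zero:
  fixes A c s1 s2 p q r :: real
  defines "\<phi> \<equiv> \<lambda>t. A * t\<^sup>2 / 2 - s1 / (1 - p) * t powr (1 - p) - s2 / (1 - q) * t powr (1 - q) - c / r * t powr r"
    and "\<psi> \<equiv> \<lambda>t. A * t\<^sup>2 - s1 * t powr (1 - p) - s2 * t powr (1 - q) - c * t powr r"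
  assumes A: "0 < A" and c: "0 \<le> c" and s1: "0 \<le> s1" and s2: "0 \<le> s2" and s: "0 < s1 + s2"
    and p: "0 < p" "p < 1" and q: "0 < q" "q < 1" and r: "2 < r"
    and t0: "0 < t0" "0 < \<psi> t0"
  obtains \<tau> where "0 < \<tau>" "\<psi> \<tau> = 0"
    "0 < 2 * A * \<tau>\<^sup>2 - (1 - p) * s1 * \<tau> powr (1 - p) - (1 - q) * s2 * \<tau> powr (1 - q) - r * c * \<tau> powr r"
    "\<phi> \<tau> < 0" "\<And>t. 0 < t \<Longrightarrow> t \<le> \<tau> \<Longrightarrow> \<psi> t \<le> 0"
    "\<And>t t'. 0 < t \<Longrightarrow> t \<le> t' \<Longrightarrow> 0 \<le> \<psi> t' \<Longrightarrow> \<phi> \<tau> \<le> \<phi> t"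
proof -
  \<comment> \<open>\<open>f\<close> is the derivative of \<open>\<phi>\<close>, and
    \<open>\<psi> t = t * f t\<close>. After division by \<open>t\<close> every summand of
    \<open>f'\<close> is nonincreasing, and one of them strictly, since \<open>s1 + s2\<close> is
    positive.\<close>
  define f where "f t = A * t - s1 * t powr (- p) - s2 * t powr (- q) - c * t powr (r - 1)" for t
  define f' where "f' t = A + p * s1 * t powr (- p - 1) + q * s2 * t powr (- q - 1) - (r - 1) * c * t powr (r - 2)" for t
  have \<psi>f: "\<psi> t = t * f t" if "0 < t" for t
    using that powr_add[of t 1 "-p"] powr_add[of t 1 "-q"] powr_add[of t 1 "r - 1"]
    unfolding \<psi>_def f_def by (simp add: algebra_simps power2_eq_square)
  have d\<phi>: "(\<phi> has_real_derivative f t) (at t)" if "0 < t" for t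
  proof -
    have pw: "((\<lambda>t. S / g * t powr g) has_real_derivative S * t powr (g - 1)) (at t)" if "g \<noteq> 0" for S g :: real
      using that \<open>0 < t\<close> by (auto intro!: derivative_eq_intros)
    have sq: "((\<lambda>t. A * t\<^sup>2 / 2) has_real_derivative A * t) (at t)"
      by (auto intro!: derivative_eq_intros)
    show ?thesis
      unfolding \<phi>_def f_def
      using DERIV_diff[OF DERIV_diff[OF DERIV_diff[OF sq pw[of "1 - p" s1]] pw[of "1 - q" s2]] pw[of r c]] p q r
      by simp
  qed
  have df: "(f has_real_derivative f' t) (at t)" if "0 < t" for t
    unfolding f_def f'_def using that
    by (auto intro!: derivative_eq_intros simp: mult_ac)
  have f'_dec: "f' y < f' x" if "0 < x" "x < y" for x y
  proof -
    have 1: "y powr (- p - 1) < x powr (- p - 1)" "y powr (- q - 1) < x powr (- q - 1)"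
      using that p q by (auto intro!: powr_less_mono2_neg)
    have "p * s1 * y powr (- p - 1) + q * s2 * y powr (- q - 1) < p * s1 * x powr (- p - 1) + q * s2 * x powr (- q - 1)"
    proof (cases "s1 > 0")
      case True
      then show ?thesis using 1 p q s2 by (intro add_less_le_mono mult_left_mono mult_strict_left_mono) auto
    next
      case False
      then show ?thesis using 1 p q s1 s by (intro add_le_less_mono mult_left_mono mult_strict_left_mono) auto
    qed
    moreover have "(r - 1) * c * x powr (r - 2) \<le> (r - 1) * c * y powr (r - 2)"
      using that r c by (intro mult_left_mono powr_mono2) auto
    ultimately show ?thesis unfolding f'_def by simp
  qed
  have mvt: "\<exists>z>x. z < y \<and> f y - f x = (y - x) * f' z" if "0 < x" "x < y" for x y
    using MVT2[of x y f f'] df that by auto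
  have ft0: "f t0 > 0" using t0 \<psi>f[of t0] by (simp add: zero_less_mult_iff)
  obtain t1 where t1: "0 < t1" "t1 < t0" "f t1 < 0"
  proof -
    have *: "\<exists>t>0. t < t0 \<and> f t < 0" if "0 < g" "0 < S" "\<And>t. 0 < t \<Longrightarrow> f t \<le> A * t - S * t powr (- g)" for g S
    proof -
      \<comment> \<open>For \<open>t <= m\<close> the value \<open>A * t powr (1 + g)\<close> is at
        most \<open>S / 2\<close>, so a single negative power already outweighs the linear
        term.\<close>
      define m where "m = (S / (2 * A)) powr (1 / (1 + g))"
      have m: "m > 0" using that A by (simp add: m_def)
      let ?t = "min (t0 / 2) m"
      have t: "?t > 0" using m t0 by simp
      have "?t powr (1 + g) \<le> m powr (1 + g)" using t that by (intro powr_mono2) auto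
      also have "\<dots> = S / (2 * A)" using that A by (simp add: m_def powr_powr)
      finally have "A * ?t powr (1 + g) < S" using A that(2) by (simp add: field_simps)
      then have "A * ?t powr (1 + g) * ?t powr (- g) < S * ?t powr (- g)"
        using t by (intro mult_strict_right_mono) auto
      moreover have "?t powr (1 + g) * ?t powr (- g) = ?t" using t by (simp flip: powr_add)
      ultimately have "A * ?t - S * ?t powr (- g) < 0" by (simp add: mult.assoc)
      then have "f ?t < 0" using that(3)[OF t] by linarith
      then show ?thesis using t t0 by (intro exI[of _ ?t]) auto
    qed
    have "f t \<le> A * t - s1 * t powr (- p)" "f t \<le> A * t - s2 * t powr (- q)" for t
    proof -
      have "0 \<le> s1 * t powr (- p)" "0 \<le> s2 * t powr (- q)" "0 \<le> c * t powr (r - 1)"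
        using s1 s2 c by auto
      then show "f t \<le> A * t - s1 * t powr (- p)" "f t \<le> A * t - s2 * t powr (- q)"
        unfolding f_def by linarith+
    qed
    then show ?thesis using *[of p s1] *[of q s2] p q s s1 s2 that by force
  qed
  have "\<exists>x\<ge>t1. x \<le> t0 \<and> f x = 0"
    using t1 t0 ft0 by (intro IVT') (auto intro!: continuous_at_imp_continuous_on DERIV_isCont df)
  then obtain \<tau> where \<tau>: "t1 \<le> \<tau>" "\<tau> \<le> t0" "f \<tau> = 0" by blast
  have \<tau>0: "0 < \<tau>" "\<tau> < t0" using \<tau> t1 ft0 by (auto simp: less_le)
  \<comment> \<open>\<open>f\<close> rises from 0 to \<open>f t0 > 0\<close>, so its slope is
    positive somewhere to the right of \<open>\<tau>\<close>, and \<open>f'\<close>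
    decreases.\<close>
  have f'\<tau>: "f' \<tau> > 0"
  proof -
    obtain z where z: "z > \<tau>" "z < t0" "f t0 - f \<tau> = (t0 - \<tau>) * f' z" using mvt \<tau>0 by blast
    then have "f' z > 0" using ft0 \<tau> \<tau>0 by (simp add: zero_less_mult_iff)
    then show ?thesis using f'_dec[of \<tau> z] \<tau>0 z by simp
  qed
  have neg: "f t < 0" if t: "0 < t" "t < \<tau>" for t
  proof -
    obtain z where z: "z > t" "z < \<tau>" "f \<tau> - f t = (\<tau> - t) * f' z" using mvt[of t \<tau>] t by blast
    then have "f' z > 0" using f'_dec[of z \<tau>] f'\<tau> that by simp
    then have "(\<tau> - t) * f' z > 0" using that by simp
    then show ?thesis using z \<tau> by simp
  qed
  \<comment> \<open>A negative value between the zero \<open>\<tau>\<close> and \<open>t'\<close>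
    would need a negative slope followed by a positive one.\<close>
  have pos: "0 \<le> f x" if x: "\<tau> < x" "x \<le> t'" "0 \<le> f t'" for x t'
  proof (rule ccontr)
    assume n: "\<not> 0 \<le> f x"
    then have "x < t'" using that by (cases "x = t'") auto
    obtain z1 where z1: "z1 > \<tau>" "z1 < x" "f x - f \<tau> = (x - \<tau>) * f' z1" using mvt x \<tau>0 by blast
    obtain z2 where z2: "z2 > x" "z2 < t'" "f t' - f x = (t' - x) * f' z2"
      using mvt[of x t'] x \<tau>0 \<open>x < t'\<close> by auto
    have "f' z1 < 0" using z1 n \<tau> that
      by (metis diff_gt_0_iff_gt diff_zero linorder_not_le mult_nonneg_nonneg order_less_imp_le)
    moreover have "f' z2 > 0" using z2 n that \<open>x < t'\<close>
      by (smt (verit) mult_nonneg_nonpos)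
    ultimately show False using f'_dec[of z1 z2] z1 z2 \<tau>0 by simp
  qed
  have min: "\<phi> \<tau> \<le> \<phi> t" if "0 < t" "t \<le> t'" "0 \<le> \<psi> t'" for t t'
  proof (cases "t \<le> \<tau>")
    case True
    show ?thesis
    proof (rule DERIV_nonpos_imp_nonincreasing[OF True])
      fix x assume "t \<le> x" "x \<le> \<tau>"
      then show "\<exists>y. (\<phi> has_real_derivative y) (at x) \<and> y \<le> 0"
        using d\<phi>[of x] neg[of x] \<tau> that by (cases "x = \<tau>") (auto intro!: exI[of _ "f x"])
    qed
  next
    case False
    then have "\<tau> \<le> t" by simp
    have ft': "0 \<le> f t'" using \<psi>f[of t'] that by (simp add: zero_le_mult_iff)
    show ?thesis
    proof (rule DERIV_nonneg_imp_nondecreasing[OF \<open>\<tau> \<le> t\<close>])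
      fix x assume "\<tau> \<le> x" "x \<le> t"
      then show "\<exists>y. (\<phi> has_real_derivative y) (at x) \<and> 0 \<le> y"
        using d\<phi>[of x] pos[of x t'] ft' \<tau> \<tau>0 that by (cases "x = \<tau>") (auto intro!: exI[of _ "f x"])
    qed
  qed
  have E2: "2 * A * \<tau>\<^sup>2 - (1 - p) * s1 * \<tau> powr (1 - p) - (1 - q) * s2 * \<tau> powr (1 - q) - r * c * \<tau> powr r
      = \<psi> \<tau> + \<tau>\<^sup>2 * f' \<tau>"
  proof -
    have "\<tau>\<^sup>2 * \<tau> powr (- p - 1) = \<tau> powr (1 - p)" "\<tau>\<^sup>2 * \<tau> powr (- q - 1) = \<tau> powr (1 - q)" "\<tau>\<^sup>2 * \<tau> powr (r - 2) = \<tau> powr r"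
      using \<tau>0 powr_add[of \<tau> 2 "- p - 1"] powr_add[of \<tau> 2 "- q - 1"] powr_add[of \<tau> 2 "r - 2"]
      by simp_all
    then have "\<tau>\<^sup>2 * f' \<tau> = A * \<tau>\<^sup>2 + p * s1 * \<tau> powr (1 - p) + q * s2 * \<tau> powr (1 - q) - (r - 1) * c * \<tau> powr r"
      unfolding f'_def by (simp add: algebra_simps)
    then show ?thesis unfolding \<psi>_def by (simp add: algebra_simps)
  qed
  have \<psi>\<tau>: "\<psi> \<tau> = 0" using \<psi>f \<tau>0 \<tau> by simp
  have E2pos: "0 < 2 * A * \<tau>\<^sup>2 - (1 - p) * s1 * \<tau> powr (1 - p) - (1 - q) * s2 * \<tau> powr (1 - q) - r * c * \<tau> powr r"
    unfolding E2 using \<psi>\<tau> f'\<tau> \<tau>0 by simp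
  \<comment> \<open>The second-order condition is what makes the energy negative: after eliminating
    \<open>x\<close> by \<open>\<psi> \<tau> = 0\<close> it reads
    \<open>(r - 2) * y < (1 + p) * z1 + (1 + q) * z2\<close>, whereas \<open>\<phi> \<tau>\<close>
    is \<open>(1/2 - 1/r) * y\<close> minus the terms \<open>(1 / (1 - p) - 1/2) * z1\<close> and
    \<open>(1 / (1 - q) - 1/2) * z2\<close>.\<close>
  have "\<phi> \<tau> < 0"
  proof -
    define x y z1 z2 where "x = A * \<tau>\<^sup>2" "y = c * \<tau> powr r" "z1 = s1 * \<tau> powr (1 - p)" "z2 = s2 * \<tau> powr (1 - q)"
    note defs = this
    have nn: "0 \<le> y" "0 \<le> z1" "0 \<le> z2" using defs c s1 s2 by auto
    have x: "x = y + z1 + z2" using \<psi>\<tau> unfolding \<psi>_def defs by simp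
    have "(r - 2) * y < (1 + p) * z1 + (1 + q) * z2"
      using E2pos x defs by (simp add: algebra_simps)
    then have "(r - 2) * y / (2 * r) < ((1 + p) * z1 + (1 + q) * z2) / (2 * r)"
      using r by (intro divide_strict_right_mono) auto
    also have "\<dots> \<le> ((1 + p) * z1 + (1 + q) * z2) / 2"
      using r nn p q by (intro divide_left_mono) auto
    also have "\<dots> = (1 + p) / 2 * z1 + (1 + q) / 2 * z2" by (simp add: field_simps)
    also have "\<dots> \<le> (1 / (1 - p) - 1 / 2) * z1 + (1 / (1 - q) - 1 / 2) * z2"
    proof (intro add_mono mult_right_mono nn)
      have "(1 + g) / 2 \<le> 1 / (1 - g) - 1 / 2" if "0 < g" "g < 1" for g :: real
        using that by (simp add: field_simps)
      then show "(1 + p) / 2 \<le> 1 / (1 - p) - 1 / 2" "(1 + q) / 2 \<le> 1 / (1 - q) - 1 / 2" using p q by auto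
    qed
    finally have "(r - 2) * y / (2 * r) < (1 / (1 - p) - 1 / 2) * z1 + (1 / (1 - q) - 1 / 2) * z2" .
    moreover have "(r - 2) * y / (2 * r) = y / 2 - y / r" using r by (simp add: field_simps)
    ultimately have "x / 2 - z1 / (1 - p) - z2 / (1 - q) - y / r < 0"
      unfolding x by (simp add: left_diff_distrib add_divide_distrib)
    then show ?thesis unfolding \<phi>_def defs by simp
  qed
  moreover have "\<psi> t \<le> 0" if "0 < t" "t \<le> \<tau>" for t
    using neg[of t] \<psi>f[of t] \<psi>\<tau> that by (cases "t = \<tau>") (auto simp: mult_le_0_iff)
  ultimately show thesis using that[OF \<tau>0(1) \<psi>\<tau> E2pos] min by blast
qed

text \<open>Near 0 the quotient is at most a multiple of \<open>t powr (2 - g1)\<close>, and for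
  large \<open>t\<close> it is nonpositive. Outside a compact interval it thus stays below its
  positive value at \<open>t1\<close>, and continuity does the rest.\<close>

lemma ray_quotient_max:
  fixes A C D1 D2 g1 g2 r :: real
  defines "R \<equiv> \<lambda>t. (A * t\<^sup>2 - C * t powr r) / (D1 * t powr g1 + D2 * t powr g2)"
  assumes A: "0 < A" and C: "0 < C" and D1: "0 < D1" and D2: "0 < D2"
    and g1: "g1 < 1" and r: "2 < r"
  obtains t0 where "0 < t0" "0 < R t0" "\<And>t. 0 < t \<Longrightarrow> R t \<le> R t0"
proof -
  have den: "0 < D1 * t powr g1 + D2 * t powr g2" if "0 < t" for t
    using that D1 D2 by (simp add: add_pos_pos)
  have tr: "t powr r = t\<^sup>2 * t powr (r - 2)" if "0 < t" for t
    using that powr_add[of t 2 "r - 2"] by simp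
  \<comment> \<open>Here the negative term of the numerator is exactly half of the quadratic
    one.\<close>
  define t1 where "t1 = (A / (2 * C)) powr (1 / (r - 2))"
  have t1: "0 < t1" using A C by (simp add: t1_def)
  have "t1 powr (r - 2) = A / (2 * C)" using A C r by (simp add: t1_def powr_powr)
  then have eq: "A * t1\<^sup>2 - C * t1 powr r = A * t1\<^sup>2 / 2" using tr[OF t1] A C by (simp add: field_simps)
  have R1: "0 < R t1" unfolding R_def eq using den[OF t1] A t1 by (simp add: field_simps)
  \<comment> \<open>Up to \<open>d\<close> the bound \<open>A / D1 * t powr (2 - g1)\<close> does
    not exceed \<open>R t1\<close>; from \<open>T\<close> on the numerator is nonpositive.\<close>
  define d where "d = min t1 ((R t1 * D1 / A) powr (1 / (2 - g1)))"
  have d: "0 < d" using R1 D1 A t1 by (simp add: d_def)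
  define T where "T = max t1 ((A / C) powr (1 / (r - 2)))"
  have small: "R t \<le> R t1" if t: "0 < t" "t \<le> d" for t
  proof -
    have "R t \<le> A * t\<^sup>2 / (D1 * t powr g1)"
      unfolding R_def using t A C D1 D2 by (intro frac_le) auto
    also have "\<dots> = A / D1 * t powr (2 - g1)" using t powr_diff[of t 2 g1] by simp
    also have "\<dots> \<le> A / D1 * ((R t1 * D1 / A) powr (1 / (2 - g1))) powr (2 - g1)"
      using t g1 A D1 by (intro mult_left_mono powr_mono2) (auto simp: d_def)
    also have "\<dots> = R t1" using g1 A D1 R1 by (simp add: powr_powr)
    finally show ?thesis .
  qed
  have large: "R t \<le> R t1" if t: "T \<le> t" for t
  proof -
    have t0: "0 < t" using that t1 by (simp add: T_def)
    have "A / C = ((A / C) powr (1 / (r - 2))) powr (r - 2)" using A C r by (simp add: powr_powr)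
    also have "\<dots> \<le> t powr (r - 2)" using t r by (intro powr_mono2) (auto simp: T_def)
    finally have "A \<le> C * t powr (r - 2)" using C by (simp add: field_simps)
    then have "A * t\<^sup>2 - C * t powr r \<le> 0" using tr[OF t0] t0 by (simp add: mult_right_mono)
    then have "R t \<le> 0" unfolding R_def using den[OF t0] by (simp add: divide_nonpos_pos)
    then show ?thesis using R1 by simp
  qed
  have "continuous_on {d..T} R"
    unfolding R_def
  proof (intro continuous_intros ballI)
    fix t assume "t \<in> {d..T}"
    then have "0 < t" using d by auto
    then show "D1 * t powr g1 + D2 * t powr g2 \<noteq> 0" using den[of t] by simp
  qed (use d in auto)
  moreover have dT: "d \<le> t1" "t1 \<le> T" by (auto simp: d_def T_def)
  ultimately obtain t0 where t0: "t0 \<in> {d..T}" "\<forall>t\<in>{d..T}. R t \<le> R t0"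
    using continuous_attains_sup[of "{d..T}" R] by fastforce
  have *: "R t1 \<le> R t0" using t0 dT by auto
  show thesis
  proof (rule that)
    show "0 < t0" "0 < R t0" using t0 d * R1 by auto
    fix t :: real assume "0 < t"
    then show "R t \<le> R t0"
      using small[of t] large[of t] t0(2) * by (cases "t \<le> d"; cases "T \<le> t") (auto intro: order_trans)
  qed
qed

text \<open>At the maximum point of the second quotient both quotients agree, and the derivative
  of the first one is negative there, by a margin depending on the exponents only.\<close>

lemma ray_quotients_ratio:
  fixes p q r :: real
  assumes p: "0 < p" "p \<le> q" and q: "q < 1" and r: "2 < r"
  obtains k where "1 < k"
    "\<And>A C S1 S2 t0 :: real. 0 < A \<Longrightarrow> 0 < C \<Longrightarrow> 0 < S1 \<Longrightarrow> 0 < S2 \<Longrightarrow> 0 < t0 \<Longrightarrow>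
      0 < (A / 2 * t0\<^sup>2 - C / r * t0 powr r) / (S1 / (1 - p) * t0 powr (1 - p) + S2 / (1 - q) * t0 powr (1 - q)) \<Longrightarrow>
      (\<And>t. 0 < t \<Longrightarrow> (A / 2 * t\<^sup>2 - C / r * t powr r) / (S1 / (1 - p) * t powr (1 - p) + S2 / (1 - q) * t powr (1 - q))
        \<le> (A / 2 * t0\<^sup>2 - C / r * t0 powr r) / (S1 / (1 - p) * t0 powr (1 - p) + S2 / (1 - q) * t0 powr (1 - q))) \<Longrightarrow>
      \<exists>t>0. k * ((A / 2 * t0\<^sup>2 - C / r * t0 powr r) / (S1 / (1 - p) * t0 powr (1 - p) + S2 / (1 - q) * t0 powr (1 - q)))
        \<le> (A * t\<^sup>2 - C * t powr r) / (S1 * t powr (1 - p) + S2 * t powr (1 - q))"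
proof -
  define \<rho> where "\<rho> = (r / 2) * (1 + p) / (r - 1 + p)"
  have rp: "0 < r - 1 + p" using r p by simp
  have \<rho>0: "0 < \<rho>" unfolding \<rho>_def using r p by simp
  have "0 < (r - 2) * (1 - p)" using r p q by simp
  then have \<rho>1: "\<rho> < 1" unfolding \<rho>_def using rp by (simp add: field_simps)
  have slope: "(1 + q) - \<rho> * (r - 1 + q) < 0"
  proof -
    \<comment> \<open>The quantities \<open>(1 + q) * (r - 1 + p)\<close> and
      \<open>(r / 2) * (1 + p) * (r - 1 + q)\<close> agree at \<open>r = 2\<close>; their difference
      is expanded in \<open>e\<close> and has positive coefficients.\<close>
    define e where "e = r - 2"
    have e: "e > 0" "r = 2 + e" using r by (auto simp: e_def)
    have "(1 + q) < (1 + p) * (3 + q) / 2"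
    proof -
      have "0 < p * (3 + q)" using p by simp
      then show ?thesis using q by (simp add: algebra_simps)
    qed
    then have "0 < e * ((1 + p) * (3 + q) / 2 - (1 + q)) + e\<^sup>2 / 2 * (1 + p)"
      using e p by (simp add: add_pos_pos)
    also have "\<dots> = (r / 2) * (1 + p) * (r - 1 + q) - (1 + q) * (r - 1 + p)"
      unfolding e(2) by (simp add: field_simps power2_eq_square)
    finally have "(1 + q) * (r - 1 + p) < (r / 2) * (1 + p) * (r - 1 + q)" by simp
    then show ?thesis unfolding \<rho>_def using rp by (simp add: field_simps)
  qed
  \<comment> \<open>A lower bound for the first quotient at \<open>\<tau> * t0\<close> relative to
    its value at \<open>t0\<close>: the denominator is at most \<open>\<tau> powr (1 - q)\<close>
    times the old one, and the ratio of the numerators is smallest in the extreme case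
    \<open>y = \<rho> * x\<close>. As \<open>h 1 = 1\<close> with negative slope, moving slightly to
    the left gains a factor above 1 that depends on the exponents only.\<close>
  define h where "h \<tau> = (\<tau> powr (1 + q) - \<rho> * \<tau> powr (r - 1 + q)) / (1 - \<rho>)" for \<tau>
  have "(h has_real_derivative ((1 + q) - \<rho> * (r - 1 + q)) / (1 - \<rho>)) (at 1)"
    unfolding h_def by (intro DERIV_cdivide) (auto intro!: derivative_eq_intros)
  moreover have "((1 + q) - \<rho> * (r - 1 + q)) / (1 - \<rho>) < 0"
    using slope \<rho>1 by (simp add: divide_neg_pos)
  ultimately obtain d where d: "d > 0" "\<And>e. 0 < e \<Longrightarrow> e < d \<Longrightarrow> h 1 < h (1 - e)"
    using DERIV_neg_dec_left by blast
  define \<tau> where "\<tau> = 1 - min (d / 2) (1 / 2)"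
  have \<tau>: "0 < \<tau>" "\<tau> < 1" "h 1 < h \<tau>"
    using d(1) d(2)[of "min (d / 2) (1 / 2)"] by (auto simp: \<tau>_def)
  have "h 1 = 1" using \<rho>1 by (simp add: h_def)
  then have k: "1 < h \<tau>" using \<tau> by simp
  show thesis
  proof (rule that[OF k])
    fix A C S1 S2 t0 :: real
    let ?P = "\<lambda>t. A / 2 * t\<^sup>2 - C / r * t powr r"
    let ?Q = "\<lambda>t. S1 / (1 - p) * t powr (1 - p) + S2 / (1 - q) * t powr (1 - q)"
    assume pos: "0 < A" "0 < C" "0 < S1" "0 < S2" "0 < t0"
      and Re0: "0 < ?P t0 / ?Q t0" and max: "\<And>t. 0 < t \<Longrightarrow> ?P t / ?Q t \<le> ?P t0 / ?Q t0"
    define L where "L = ?P t0 / ?Q t0"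
    have Qpos: "0 < ?Q t" if "0 < t" for t using that pos p q by (simp add: add_pos_pos)
    define x y d1 d2 where "x = A * t0\<^sup>2" "y = C * t0 powr r" "d1 = S1 * t0 powr (1 - p)" "d2 = S2 * t0 powr (1 - q)"
    note defs = this
    have xy: "0 < x" "0 < y" "0 < d1" "0 < d2" using defs pos by auto
    have PL: "x / 2 - y / r = L * (d1 / (1 - p) + d2 / (1 - q))"
      using Qpos[OF pos(5)] unfolding L_def defs by simp
    have DL: "x - y = L * (d1 + d2)"
    proof -
      \<comment> \<open>Maximality of the quotient makes \<open>?F\<close> maximal at
        \<open>t0\<close>, with value 0; its derivative times \<open>t0\<close> is the
        claim.\<close>
      let ?F = "\<lambda>t. ?P t - L * ?Q t"
      have pw: "((\<lambda>t. S / g * t powr g) has_real_derivative S * t powr (g - 1)) (at t)" if "g \<noteq> 0" "0 < t" for S g t :: real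
        using that by (auto intro!: derivative_eq_intros)
      have sq: "((\<lambda>t. A / 2 * t\<^sup>2) has_real_derivative A * t) (at t)" for t
        by (auto intro!: derivative_eq_intros)
      have "(?F has_real_derivative (A * t0 - C * t0 powr (r - 1))
          - L * (S1 * t0 powr (1 - p - 1) + S2 * t0 powr (1 - q - 1))) (at t0)"
        using p q r pos
        by (intro DERIV_diff DERIV_cmult DERIV_add pw sq) auto
      moreover have "\<forall>t. \<bar>t0 - t\<bar> < t0 \<longrightarrow> ?F t \<le> ?F t0"
      proof (intro allI impI)
        fix t assume "\<bar>t0 - t\<bar> < t0"
        then have t: "0 < t" by linarith
        have "?P t \<le> L * ?Q t" using max[OF t] Qpos[OF t] by (simp add: L_def pos_divide_le_eq)
        moreover have "?P t0 = L * ?Q t0" using Qpos[OF pos(5)] by (simp add: L_def)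
        ultimately show "?F t \<le> ?F t0" by linarith
      qed
      ultimately have "(A * t0 - C * t0 powr (r - 1)) - L * (S1 * t0 powr (1 - p - 1) + S2 * t0 powr (1 - q - 1)) = 0"
        using DERIV_local_max[of ?F _ t0 t0] pos by blast
      then have "t0 * ((A * t0 - C * t0 powr (r - 1)) - L * (S1 * t0 powr (1 - p - 1) + S2 * t0 powr (1 - q - 1))) = 0"
        by simp
      moreover have "t0 * t0 powr (r - 1) = t0 powr r" "t0 * t0 powr (1 - p - 1) = t0 powr (1 - p)" "t0 * t0 powr (1 - q - 1) = t0 powr (1 - q)"
        using powr_add[of t0 1 "r - 1"] powr_add[of t0 1 "1 - p - 1"] powr_add[of t0 1 "1 - q - 1"] pos by simp_all
      ultimately show ?thesis unfolding defs by (simp add: algebra_simps power2_eq_square)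
    qed
    have L: "0 < L" using Re0 by (simp add: L_def)
    have yx: "y < x" using DL L xy by (smt (verit) mult_pos_pos)
    have "d2 \<le> (1 - p) * (d2 / (1 - q))"
      using p q xy by (simp add: field_simps)
    then have "d1 + d2 \<le> (1 - p) * (d1 / (1 - p) + d2 / (1 - q))"
      using p q by (simp add: distrib_left)
    then have "x - y \<le> L * ((1 - p) * (d1 / (1 - p) + d2 / (1 - q)))"
      unfolding DL using L by simp
    also have "\<dots> = (1 - p) * (x / 2 - y / r)" unfolding PL by (simp add: mult_ac)
    finally have "(r / 2) * (1 + p) * x \<le> y * (r - 1 + p)" using r by (simp add: field_simps)
    then have y\<rho>: "\<rho> * x \<le> y" unfolding \<rho>_def using rp by (simp add: field_simps)
    define c where "c = \<tau> powr (r - 2)"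
    have c: "0 \<le> c" "c \<le> 1" using \<tau> r by (auto simp: c_def intro!: powr_le1)
    have tc: "\<tau> powr (r - 1 + q) = \<tau> powr (1 + q) * c" "\<tau> powr r = \<tau>\<^sup>2 * c" "\<tau>\<^sup>2 = \<tau> powr (1 + q) * \<tau> powr (1 - q)"
      unfolding c_def using \<tau> powr_add[of \<tau> 2 "r - 2"] by (simp_all add: add_ac flip: powr_add)
    have "0 \<le> (y - \<rho> * x) * (1 - c)" using y\<rho> c by simp
    then have "(1 - \<rho> * c) * (x - y) \<le> (x - y * c) * (1 - \<rho>)" by (simp add: algebra_simps)
    then have "(1 - \<rho> * c) * (x - y) / (1 - \<rho>) \<le> x - y * c" using \<rho>1 by (simp add: field_simps)
    then have "\<tau> powr (1 + q) * ((1 - \<rho> * c) * (x - y) / (1 - \<rho>)) \<le> \<tau> powr (1 + q) * (x - y * c)"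
      by (intro mult_left_mono) auto
    then have main: "h \<tau> * (x - y) \<le> \<tau> powr (1 + q) * (x - y * c)"
      unfolding h_def tc by (simp add: algebra_simps)
    let ?t = "\<tau> * t0"
    have num: "A * ?t\<^sup>2 - C * ?t powr r = \<tau> powr (1 - q) * (\<tau> powr (1 + q) * (x - y * c))"
    proof -
      have "A * ?t\<^sup>2 - C * ?t powr r = \<tau>\<^sup>2 * (x - y * c)"
        using \<tau> pos unfolding defs by (simp add: powr_mult tc(2) power_mult_distrib algebra_simps)
      then show ?thesis unfolding tc(3) by simp
    qed
    have den: "S1 * ?t powr (1 - p) + S2 * ?t powr (1 - q) \<le> \<tau> powr (1 - q) * (d1 + d2)"
    proof -
      have "\<tau> powr (1 - p) \<le> \<tau> powr (1 - q)" using \<tau> p by (intro powr_mono') auto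
      then have "\<tau> powr (1 - p) * d1 \<le> \<tau> powr (1 - q) * d1" using xy by (intro mult_right_mono) auto
      then show ?thesis using \<tau> pos unfolding defs by (simp add: powr_mult algebra_simps)
    qed
    have den0: "0 < S1 * ?t powr (1 - p) + S2 * ?t powr (1 - q)" using \<tau> pos by (simp add: add_pos_pos)
    have "h \<tau> * L * (S1 * ?t powr (1 - p) + S2 * ?t powr (1 - q)) \<le> h \<tau> * L * (\<tau> powr (1 - q) * (d1 + d2))"
      using den L k by (intro mult_left_mono) auto
    also have "\<dots> = \<tau> powr (1 - q) * (h \<tau> * (x - y))" unfolding DL by (simp add: mult_ac)
    also have "\<dots> \<le> A * ?t\<^sup>2 - C * ?t powr r"
      unfolding num using main by (intro mult_left_mono) auto
    finally have "h \<tau> * L \<le> (A * ?t\<^sup>2 - C * ?t powr r) / (S1 * ?t powr (1 - p) + S2 * ?t powr (1 - q))"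
      using den0 by (simp add: pos_le_divide_eq)
    then show "\<exists>t>0. h \<tau> * (?P t0 / ?Q t0) \<le> (A * t\<^sup>2 - C * t powr r) / (S1 * t powr (1 - p) + S2 * t powr (1 - q))"
      using \<tau> pos unfolding L_def by (intro exI[of _ ?t]) auto
  qed
qed

section \<open>Fractional Sobolev inequalities\<close>

lemma sigma_finite_lebesgue: "sigma_finite_measure (lebesgue :: 'a::euclidean_space measure)"
proof -
  obtain A where A: "countable A" "A \<subseteq> sets (lborel :: 'a measure)" "\<Union>A = space (lborel :: 'a measure)"
      "\<And>a. a \<in> A \<Longrightarrow> emeasure lborel a \<noteq> \<infinity>"
    using lborel.sigma_finite_countable[where 'a='a] by metis
  show ?thesis
  proof (rule sigma_finite_measure.intro, intro exI conjI ballI)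
    show "A \<subseteq> sets lebesgue" using A(2) by (blast intro: sets_completionI_sets)
    show "emeasure lebesgue a \<noteq> \<infinity>" if "a \<in> A" for a
    proof -
      have "a \<in> sets lborel" using A(2) that by (rule subsetD)
      then have "emeasure lebesgue a = emeasure lborel a" by simp
      then show ?thesis using A(4)[OF that] by (simp only: not_False_eq_True)
    qed
  qed (use A in simp_all)
qed

interpretation leb: sigma_finite_measure "lebesgue :: 'a::euclidean_space measure"
  by (rule sigma_finite_lebesgue)

interpretation leb2: pair_sigma_finite "lebesgue :: 'a::euclidean_space measure" "lebesgue :: 'b::euclidean_space measure"
  by (intro pair_sigma_finite.intro sigma_finite_lebesgue)

lemma measurable_id_lebesgue [measurable]: "(\<lambda>x. x) \<in> lebesgue \<rightarrow>\<^sub>M (borel :: 'a::euclidean_space measure)"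
  by (rule measurable_completion) simp

lemma measurable_fst_snd_lebesgue:
  "fst \<in> (lebesgue \<Otimes>\<^sub>M lebesgue) \<rightarrow>\<^sub>M (borel :: 'a::euclidean_space measure)"
  "snd \<in> (lebesgue \<Otimes>\<^sub>M lebesgue) \<rightarrow>\<^sub>M (borel :: 'a::euclidean_space measure)"
  using measurable_compose[OF measurable_fst measurable_id_lebesgue]
    measurable_compose[OF measurable_snd measurable_id_lebesgue] by auto

lemma gagliardo_kernel_measurable [measurable]:
  fixes u v :: "real ^ 'n \<Rightarrow> real"
  assumes [measurable]: "u \<in> borel_measurable lebesgue" "v \<in> borel_measurable lebesgue"
  shows "gagliardo_kernel s u v \<in> borel_measurable (lebesgue \<Otimes>\<^sub>M lebesgue)"
proof -
  note [measurable] = measurable_fst_snd_lebesgue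
  show ?thesis
    unfolding gagliardo_kernel_def split_beta by measurable
qed

lemma gagliardo_kernel_nonneg: "0 \<le> gagliardo_kernel s u u z"
  by (simp add: gagliardo_kernel_def split_beta)

text \<open>The squared Gagliardo seminorm with values in \<open>ennreal\<close>, usable for limits
  whose integrability is still to be shown.\<close>

definition gagliardo_nn :: "real \<Rightarrow> (real ^ 'n \<Rightarrow> real) \<Rightarrow> ennreal" where
  "gagliardo_nn s u = (\<integral>\<^sup>+ z. ennreal (gagliardo_kernel s u u z) \<partial>(lebesgue \<Otimes>\<^sub>M lebesgue))"

text \<open>By Tonelli's theorem its integral is the seminorm, so a pointwise bound by the slice at
  \<open>x\<close> integrates to a bound by the seminorm.\<close>

definition gagliardo_slice :: "real \<Rightarrow> (real ^ 'n \<Rightarrow> real) \<Rightarrow> real ^ 'n \<Rightarrow> ennreal" where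
  "gagliardo_slice s u x = (\<integral>\<^sup>+ y. ennreal (gagliardo_kernel s u u (x, y)) \<partial>lebesgue)"

lemma gagliardo_slice_measurable [measurable]:
  assumes [measurable]: "u \<in> borel_measurable lebesgue"
  shows "gagliardo_slice s u \<in> borel_measurable lebesgue"
  unfolding gagliardo_slice_def
  by (rule leb.borel_measurable_nn_integral_fst) measurable

lemma nn_integral_gagliardo_slice:
  assumes [measurable]: "u \<in> borel_measurable lebesgue"
  shows "(\<integral>\<^sup>+ x. gagliardo_slice s u x \<partial>lebesgue) = gagliardo_nn s u"
  unfolding gagliardo_slice_def gagliardo_nn_def
  by (rule leb.nn_integral_fst) measurable

section \<open>Lattice cells and the local oscillation\<close>

text \<open>For positive \<open>h\<close> this is the half-open cube of side \<open>h\<close> of the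
  lattice with mesh \<open>h\<close> that contains \<open>x\<close>. Encoded by floors, the cells of
  one size form a partition indexed by integer vectors, which gives both measurability in the pair
  of points and countability.\<close>

definition cell :: "real \<Rightarrow> real ^ 'n \<Rightarrow> (real ^ 'n) set" where
  "cell h x = {y. \<forall>i. \<lfloor>y $ i / h\<rfloor> = \<lfloor>x $ i / h\<rfloor>}"

lemma cell_borel [measurable]: "cell h x \<in> sets borel"
  unfolding cell_def by measurable

lemma cell_lebesgue [measurable]: "cell h x \<in> sets lebesgue"
  using cell_borel by (simp add: sets_completionI_sets)

lemma mem_cell_self: "x \<in> cell h x"
  by (simp add: cell_def)

lemma mem_cell_iff:
  assumes "0 < h"
  shows "y \<in> cell h x \<longleftrightarrow> (\<forall>i. h * \<lfloor>x $ i / h\<rfloor> \<le> y $ i \<and> y $ i < h * \<lfloor>x $ i / h\<rfloor> + h)"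
  unfolding cell_def floor_eq_iff using assms by (simp add: field_simps)

lemma emeasure_cell:
  fixes x :: "real ^ 'n"
  assumes h: "0 < h"
  shows "emeasure lebesgue (cell h x) = ennreal (h ^ CARD('n))"
proof -
  let ?a = "(\<chi> i. h * \<lfloor>x $ i / h\<rfloor>) :: real ^ 'n"
  let ?b = "(\<chi> i. h * \<lfloor>x $ i / h\<rfloor> + h) :: real ^ 'n"
  have sub: "box ?a ?b \<subseteq> cell h x" "cell h x \<subseteq> cbox ?a ?b"
    using h by (auto simp: mem_cell_iff mem_box_cart less_imp_le)
  have ab: "?a \<bullet> b \<le> ?b \<bullet> b" if "b \<in> Basis" for b
    using that h by (auto simp: Basis_vec_def inner_axis)
  have prod: "(\<Prod>b\<in>Basis. (?b - ?a) \<bullet> b) = h ^ CARD('n)"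
  proof -
    have "(\<Prod>b\<in>Basis. (?b - ?a) \<bullet> b) = (\<Prod>b\<in>(Basis :: (real ^ 'n) set). h)"
      by (intro prod.cong) (auto simp: Basis_vec_def inner_axis)
    then show ?thesis by simp
  qed
  have "emeasure lborel (box ?a ?b) = ennreal (h ^ CARD('n))"
    using emeasure_lborel_box[of ?a ?b] ab prod by simp
  moreover have "emeasure lborel (cbox ?a ?b) = ennreal (h ^ CARD('n))"
    using emeasure_lborel_cbox[of ?a ?b] ab prod by simp
  moreover have "emeasure lborel (box ?a ?b) \<le> emeasure lborel (cell h x)"
    "emeasure lborel (cell h x) \<le> emeasure lborel (cbox ?a ?b)"
    using sub by (auto intro!: emeasure_mono)
  ultimately show ?thesis by simp
qed

lemma norm_diff_cell:
  fixes x :: "real ^ 'n"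
  assumes "0 < h" "y \<in> cell h x"
  shows "norm (x - y) \<le> h * real CARD('n)"
proof -
  have "\<bar>(x - y) $ i\<bar> \<le> h" for i
    using assms(2) mem_cell_self[of x h] unfolding mem_cell_iff[OF assms(1)]
    by (simp add: abs_le_iff) (smt (verit))
  then have "(\<Sum>i\<in>UNIV. \<bar>(x - y) $ i\<bar>) \<le> (\<Sum>i\<in>(UNIV :: 'n set). h)"
    by (intro sum_mono)
  then show ?thesis using norm_le_l1_cart[of "x - y"] by (simp add: mult.commute)
qed

text \<open>Two points of a cell are at distance at most \<open>h * N\<close>, which bounds the
  denominator of the kernel from above. This plays the part of a Poincare inequality.\<close>

lemma nn_integral_cell_diff_le:
  fixes u :: "real ^ 'n \<Rightarrow> real"
  assumes h: "0 < h" and s: "0 < s" and [measurable]: "u \<in> borel_measurable lebesgue"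
  shows "(\<integral>\<^sup>+ y. ennreal ((u x - u y)\<^sup>2) * indicator (cell h x) y \<partial>lebesgue)
    \<le> ennreal ((h * real CARD('n)) powr (real CARD('n) + 2 * s)) * gagliardo_slice s u x"
proof -
  let ?e = "real CARD('n) + 2 * s" and ?H = "h * real CARD('n)"
  have [measurable]: "(\<lambda>y. gagliardo_kernel s u u (x, y)) \<in> borel_measurable lebesgue"
    by (rule measurable_compose[OF measurable_Pair1' gagliardo_kernel_measurable]) auto
  have "(\<integral>\<^sup>+ y. ennreal ((u x - u y)\<^sup>2) * indicator (cell h x) y \<partial>lebesgue)
     \<le> (\<integral>\<^sup>+ y. ennreal (?H powr ?e) * ennreal (gagliardo_kernel s u u (x, y)) \<partial>lebesgue)"
  proof (rule nn_integral_mono)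
    fix y
    have "(u x - u y)\<^sup>2 \<le> ?H powr ?e * gagliardo_kernel s u u (x, y)" if "y \<in> cell h x"
    proof (cases "x = y")
      case False
      have "norm (x - y) powr ?e \<le> ?H powr ?e"
        using norm_diff_cell[OF h that] s by (intro powr_mono2) auto
      then have "(u x - u y)\<^sup>2 * norm (x - y) powr ?e \<le> (u x - u y)\<^sup>2 * ?H powr ?e"
        by (intro mult_left_mono) auto
      then show ?thesis using False by (simp add: gagliardo_kernel_def field_simps power2_eq_square)
    qed (simp add: gagliardo_kernel_def)
    then show "ennreal ((u x - u y)\<^sup>2) * indicator (cell h x) y \<le> ennreal (?H powr ?e) * ennreal (gagliardo_kernel s u u (x, y))"
      by (auto simp: indicator_def ennreal_mult[symmetric] gagliardo_kernel_nonneg intro!: ennreal_leI)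
  qed
  also have "\<dots> = ennreal (?H powr ?e) * gagliardo_slice s u x"
    unfolding gagliardo_slice_def by (intro nn_integral_cmult) measurable
  finally show ?thesis .
qed

text \<open>A pointwise bound that gains integrability: compare \<open>u x\<close> with the average of \<open>u\<close> over a
  cell containing \<open>x\<close> whose size is adapted to \<open>\<bar>u x\<bar>\<close>.\<close>

lemma sobolev_pointwise:
  fixes u :: "real ^ 'n \<Rightarrow> real"
  assumes s: "0 < s" and q: "1 < q" and K: "0 < K" and [measurable]: "u \<in> borel_measurable lebesgue"
    and int: "(\<integral>\<^sup>+ y. ennreal (\<bar>u y\<bar> powr q) \<partial>lebesgue) \<le> ennreal K"
  defines "N \<equiv> real CARD('n)"
  defines "e \<equiv> 2 + 2 * s / N * q"
  shows "ennreal (\<bar>u x\<bar> powr e) \<le> ennreal (4 powr e * N powr (N + 2 * s) * K powr (2 * s / N)) * gagliardo_slice s u x"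
proof -
  have N: "N \<ge> 1" unfolding N_def by (simp add: Suc_leI)
  show ?thesis
  proof (cases "u x = 0 \<or> gagliardo_slice s u x = \<infinity>")
    case True
    then show ?thesis
      using N K by (auto simp: ennreal_mult_eq_top_iff ennreal_mult_top)
  next
    case False
    then obtain g where g: "0 \<le> g" "gagliardo_slice s u x = ennreal g"
      by (cases "gagliardo_slice s u x") auto
    \<comment> \<open>Of the \<open>4 * m\<close> integrated over the cell, \<open>2 * m\<close> and
      then one further \<open>m\<close> are absorbed; the remaining \<open>m\<close> is bounded by
      the slice.\<close>
    define m where "m = \<bar>u x\<bar> / 4"
    have m: "0 < m" using False by (simp add: m_def)
    \<comment> \<open>The cell volume becomes \<open>K * m powr (- q)\<close>, the Chebyshev bound
      for the measure of the set where the modulus of \<open>u\<close> exceeds \<open>m\<close>. The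
      last term of \<open>pw\<close> then integrates to at most \<open>m\<close> times the
      volume.\<close>
    define h where "h = (K * m powr (- q)) powr (1 / N)"
    have h: "0 < h" using K m by (simp add: h_def)
    let ?Q = "cell h x" and ?b = "(h * N) powr (N + 2 * s)"
    have hN: "h ^ CARD('n) = K * m powr (- q)"
      using h K m N by (simp add: h_def N_def powr_powr flip: powr_realpow)
    have pw: "4 * m \<le> 2 * m + (u x - u y)\<^sup>2 / m + m powr (1 - q) * \<bar>u y\<bar> powr q" for y
    proof -
      have 1: "\<bar>u x - u y\<bar> \<le> m + (u x - u y)\<^sup>2 / m"
      proof (cases "\<bar>u x - u y\<bar> \<le> m")
        case True
        then show ?thesis using m by (simp add: add_increasing2)
      next
        case False
        then have "\<bar>u x - u y\<bar> * m \<le> \<bar>u x - u y\<bar> * \<bar>u x - u y\<bar>" by (intro mult_left_mono) auto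
        then have "\<bar>u x - u y\<bar> \<le> (u x - u y)\<^sup>2 / m" using m by (simp add: field_simps power2_eq_square)
        then show ?thesis using m by linarith
      qed
      have 2: "\<bar>u y\<bar> \<le> m + m powr (1 - q) * \<bar>u y\<bar> powr q"
      proof (cases "\<bar>u y\<bar> \<le> m")
        case True
        then show ?thesis by (simp add: add_increasing2)
      next
        case False
        then have y: "m \<le> \<bar>u y\<bar>" "0 < \<bar>u y\<bar>" using m by auto
        then have "\<bar>u y\<bar> powr (1 - q) \<le> m powr (1 - q)" using q m by (intro powr_mono2') auto
        then have "\<bar>u y\<bar> powr (1 - q) * \<bar>u y\<bar> powr q \<le> m powr (1 - q) * \<bar>u y\<bar> powr q"
          by (intro mult_right_mono) auto
        moreover have "\<bar>u y\<bar> powr (1 - q) * \<bar>u y\<bar> powr q = \<bar>u y\<bar>" using y by (simp flip: powr_add)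
        ultimately show ?thesis using m by linarith
      qed
      have "4 * m = \<bar>u x\<bar>" by (simp add: m_def)
      then show ?thesis using 1 2 by linarith
    qed
    have "ennreal (4 * m) * ennreal (h ^ CARD('n)) = (\<integral>\<^sup>+ y. ennreal (4 * m) * indicator ?Q y \<partial>lebesgue)"
      using emeasure_cell[OF h, of x] nn_integral_cmult_indicator[of ?Q lebesgue "ennreal (4 * m)"] by simp
    also have "\<dots> \<le> (\<integral>\<^sup>+ y. ennreal (2 * m) * indicator ?Q y
        + ennreal (1 / m) * (ennreal ((u x - u y)\<^sup>2) * indicator ?Q y)
        + ennreal (m powr (1 - q)) * ennreal (\<bar>u y\<bar> powr q) \<partial>lebesgue)"
    proof (rule nn_integral_mono)
      fix y
      show "ennreal (4 * m) * indicator ?Q y \<le> ennreal (2 * m) * indicator ?Q y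
        + ennreal (1 / m) * (ennreal ((u x - u y)\<^sup>2) * indicator ?Q y)
        + ennreal (m powr (1 - q)) * ennreal (\<bar>u y\<bar> powr q)"
        using pw[of y] m
        by (cases "y \<in> ?Q") (auto simp: ennreal_mult[symmetric] ennreal_plus[symmetric] simp del: ennreal_plus intro!: ennreal_leI)
    qed
    also have "\<dots> = ennreal (2 * m) * ennreal (h ^ CARD('n))
        + ennreal (1 / m) * (\<integral>\<^sup>+ y. ennreal ((u x - u y)\<^sup>2) * indicator ?Q y \<partial>lebesgue)
        + ennreal (m powr (1 - q)) * (\<integral>\<^sup>+ y. ennreal (\<bar>u y\<bar> powr q) \<partial>lebesgue)"
      using emeasure_cell[OF h, of x] by (simp add: nn_integral_add nn_integral_cmult)
    also have "\<dots> \<le> ennreal (2 * m) * ennreal (h ^ CARD('n))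
        + ennreal (1 / m) * (ennreal ?b * ennreal g) + ennreal (m powr (1 - q)) * ennreal K"
      using nn_integral_cell_diff_le[OF h s \<open>u \<in> _\<close>, of x] int g(2)
      by (intro add_mono mult_left_mono) (auto simp: N_def)
    also have "\<dots> = ennreal (2 * m * h ^ CARD('n) + 1 / m * (?b * g) + m powr (1 - q) * K)"
    proof -
      have "ennreal a * ennreal b + ennreal c * (ennreal d * ennreal g) + ennreal k * ennreal K = ennreal (a * b + c * (d * g) + k * K)"
        if "0 \<le> a" "0 \<le> b" "0 \<le> c" "0 \<le> d" "0 \<le> k" for a b c d k
        using that g(1) K by (simp add: ennreal_mult)
      then show ?thesis using m h by simp
    qed
    finally have "ennreal (4 * m * h ^ CARD('n)) \<le> ennreal (2 * m * h ^ CARD('n) + 1 / m * (?b * g) + m powr (1 - q) * K)"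
      using m h by (simp add: ennreal_mult)
    then have "4 * m * h ^ CARD('n) \<le> 2 * m * h ^ CARD('n) + 1 / m * (?b * g) + m powr (1 - q) * K"
      using m h g K by (subst (asm) ennreal_le_iff) auto
    moreover have "m powr (1 - q) * K = m * h ^ CARD('n)"
      using m powr_add[of m 1 "- q"] unfolding hN by simp
    ultimately have "m * h ^ CARD('n) \<le> 1 / m * (?b * g)" by linarith
    then have "m\<^sup>2 * h ^ CARD('n) \<le> ?b * g" using m by (simp add: field_simps power2_eq_square)
    moreover have "?b = h ^ CARD('n) * (h powr (2 * s) * N powr (N + 2 * s))"
      using h N by (simp add: powr_mult powr_add N_def flip: powr_realpow)
    ultimately have "h ^ CARD('n) * m\<^sup>2 \<le> h ^ CARD('n) * (h powr (2 * s) * N powr (N + 2 * s) * g)"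
      by (simp add: mult_ac)
    then have "m\<^sup>2 \<le> h powr (2 * s) * N powr (N + 2 * s) * g" using h by simp
    \<comment> \<open>The choice of \<open>h\<close> produces a negative power of \<open>m\<close>;
      moved to the left it raises the exponent from 2 to \<open>e\<close>, which is the
      gain.\<close>
    moreover have "h powr (2 * s) = K powr (2 * s / N) * m powr (- (2 * s / N * q))"
      using K m unfolding h_def by (simp add: powr_powr powr_mult mult_ac)
    ultimately have "m powr (2 * s / N * q) * m\<^sup>2 \<le> m powr (2 * s / N * q) * (K powr (2 * s / N) * m powr (- (2 * s / N * q)) * N powr (N + 2 * s) * g)"
      by (intro mult_left_mono) auto
    also have "\<dots> = (m powr (2 * s / N * q) * m powr (- (2 * s / N * q))) * (K powr (2 * s / N) * N powr (N + 2 * s) * g)"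
      by (simp only: mult_ac)
    also have "m powr (2 * s / N * q) * m powr (- (2 * s / N * q)) = 1"
      using m by (simp flip: powr_add)
    also have "m powr (2 * s / N * q) * m\<^sup>2 = m powr e"
      unfolding e_def using m powr_add[of m 2 "2 * s / N * q"] by simp
    finally have me: "m powr e \<le> K powr (2 * s / N) * N powr (N + 2 * s) * g" by simp
    have "\<bar>u x\<bar> powr e = 4 powr e * m powr e"
      unfolding m_def by (simp flip: powr_mult)
    also have "\<dots> \<le> 4 powr e * (K powr (2 * s / N) * N powr (N + 2 * s) * g)"
      using me by (intro mult_left_mono) auto
    finally show ?thesis unfolding g(2) using g(1) K N
      by (subst ennreal_mult[symmetric]) (auto intro!: ennreal_leI simp: mult_ac)
  qed
qed

section \<open>Iteration up to the critical exponent\<close>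

text \<open>The embedding is phrased as boundedness on bounded sets, the form that one step of the
  iteration passes to the next. The \<open>itself\<close> argument carries the dimension, which
  otherwise occurs only in the type of a bound variable.\<close>

definition sobolev_exponent :: "('n::finite) itself \<Rightarrow> real \<Rightarrow> real \<Rightarrow> bool" where
  "sobolev_exponent _ s q \<longleftrightarrow> (\<forall>M>0. \<exists>K>0. \<forall>u :: real ^ 'n \<Rightarrow> real.
     u \<in> borel_measurable lebesgue \<longrightarrow> (\<integral>\<^sup>+ x. ennreal ((u x)\<^sup>2) \<partial>lebesgue) \<le> ennreal M \<longrightarrow>
     gagliardo_nn s u \<le> ennreal M \<longrightarrow> (\<integral>\<^sup>+ x. ennreal (\<bar>u x\<bar> powr q) \<partial>lebesgue) \<le> ennreal K)"

lemma sobolev_exponent_two: "sobolev_exponent TYPE('n::finite) s 2"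
  unfolding sobolev_exponent_def by auto

lemma sobolev_exponent_step:
  assumes s: "0 < s" and q: "1 < q" and "sobolev_exponent TYPE('n::finite) s q"
  shows "sobolev_exponent TYPE('n) s (2 + 2 * s / real CARD('n) * q)"
  unfolding sobolev_exponent_def
proof (intro allI impI)
  fix M :: real assume M: "0 < M"
  let ?N = "real CARD('n)"
  let ?e = "2 + 2 * s / ?N * q"
  obtain K where K: "0 < K" and Kb: "\<And>u :: real ^ 'n \<Rightarrow> real. u \<in> borel_measurable lebesgue \<Longrightarrow>
      (\<integral>\<^sup>+ x. ennreal ((u x)\<^sup>2) \<partial>lebesgue) \<le> ennreal M \<Longrightarrow>
     gagliardo_nn s u \<le> ennreal M \<Longrightarrow> (\<integral>\<^sup>+ x. ennreal (\<bar>u x\<bar> powr q) \<partial>lebesgue) \<le> ennreal K"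
    using assms(3) M unfolding sobolev_exponent_def by meson
  let ?C = "4 powr ?e * ?N powr (?N + 2 * s) * K powr (2 * s / ?N)"
  have C: "?C > 0" using K by simp
  show "\<exists>K>0. \<forall>u :: real ^ 'n \<Rightarrow> real. u \<in> borel_measurable lebesgue \<longrightarrow>
      (\<integral>\<^sup>+ x. ennreal ((u x)\<^sup>2) \<partial>lebesgue) \<le> ennreal M \<longrightarrow>
     gagliardo_nn s u \<le> ennreal M \<longrightarrow> (\<integral>\<^sup>+ x. ennreal (\<bar>u x\<bar> powr ?e) \<partial>lebesgue) \<le> ennreal K"
  proof (intro exI[of _ "?C * M"] conjI allI impI)
    fix u :: "real ^ 'n \<Rightarrow> real"
    assume u [measurable]: "u \<in> borel_measurable lebesgue"
      and u2: "(\<integral>\<^sup>+ x. ennreal ((u x)\<^sup>2) \<partial>lebesgue) \<le> ennreal M" and ug: "gagliardo_nn s u \<le> ennreal M"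
    have "(\<integral>\<^sup>+ x. ennreal (\<bar>u x\<bar> powr ?e) \<partial>lebesgue) \<le> (\<integral>\<^sup>+ x. ennreal ?C * gagliardo_slice s u x \<partial>lebesgue)"
      using sobolev_pointwise[OF s q K u Kb[OF u u2 ug]] by (intro nn_integral_mono) auto
    also have "\<dots> = ennreal ?C * gagliardo_nn s u"
      using u by (simp add: nn_integral_cmult nn_integral_gagliardo_slice)
    also have "\<dots> \<le> ennreal ?C * ennreal M" using ug by (intro mult_left_mono) auto
    also have "\<dots> = ennreal (?C * M)" using C M by (subst ennreal_mult) auto
    finally show "(\<integral>\<^sup>+ x. ennreal (\<bar>u x\<bar> powr ?e) \<partial>lebesgue) \<le> ennreal (?C * M)" .
  qed (use C M in simp)
qed

lemma sobolev_exponent_between: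
  assumes "2 \<le> r" "r \<le> q" "sobolev_exponent TYPE('n::finite) s q"
  shows "sobolev_exponent TYPE('n) s r"
  unfolding sobolev_exponent_def
proof (intro allI impI)
  fix M :: real assume M: "0 < M"
  obtain K where K: "0 < K" and Kb: "\<And>u :: real ^ 'n \<Rightarrow> real. u \<in> borel_measurable lebesgue \<Longrightarrow>
      (\<integral>\<^sup>+ x. ennreal ((u x)\<^sup>2) \<partial>lebesgue) \<le> ennreal M \<Longrightarrow>
     gagliardo_nn s u \<le> ennreal M \<Longrightarrow> (\<integral>\<^sup>+ x. ennreal (\<bar>u x\<bar> powr q) \<partial>lebesgue) \<le> ennreal K"
    using assms(3) M unfolding sobolev_exponent_def by meson
  show "\<exists>K>0. \<forall>u :: real ^ 'n \<Rightarrow> real. u \<in> borel_measurable lebesgue \<longrightarrow>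
      (\<integral>\<^sup>+ x. ennreal ((u x)\<^sup>2) \<partial>lebesgue) \<le> ennreal M \<longrightarrow>
     gagliardo_nn s u \<le> ennreal M \<longrightarrow> (\<integral>\<^sup>+ x. ennreal (\<bar>u x\<bar> powr r) \<partial>lebesgue) \<le> ennreal K"
  proof (intro exI[of _ "M + K"] conjI allI impI)
    fix u :: "real ^ 'n \<Rightarrow> real"
    assume u [measurable]: "u \<in> borel_measurable lebesgue"
      and u2: "(\<integral>\<^sup>+ x. ennreal ((u x)\<^sup>2) \<partial>lebesgue) \<le> ennreal M" and ug: "gagliardo_nn s u \<le> ennreal M"
    have "(\<integral>\<^sup>+ x. ennreal (\<bar>u x\<bar> powr r) \<partial>lebesgue) \<le> (\<integral>\<^sup>+ x. ennreal ((u x)\<^sup>2) + ennreal (\<bar>u x\<bar> powr q) \<partial>lebesgue)"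
    proof (rule nn_integral_mono)
      fix x
      show "ennreal (\<bar>u x\<bar> powr r) \<le> ennreal ((u x)\<^sup>2) + ennreal (\<bar>u x\<bar> powr q)"
        using powr_le_between[OF assms(1,2), of "\<bar>u x\<bar>"]
        by (simp add: ennreal_plus[symmetric] del: ennreal_plus)
    qed
    also have "\<dots> = (\<integral>\<^sup>+ x. ennreal ((u x)\<^sup>2) \<partial>lebesgue) + (\<integral>\<^sup>+ x. ennreal (\<bar>u x\<bar> powr q) \<partial>lebesgue)"
      by (intro nn_integral_add) auto
    also have "\<dots> \<le> ennreal M + ennreal K" by (intro add_mono u2 Kb u ug)
    finally show "(\<integral>\<^sup>+ x. ennreal (\<bar>u x\<bar> powr r) \<partial>lebesgue) \<le> ennreal (M + K)" using M K by simp
  qed (use M K in simp)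
qed

text \<open>The step maps \<open>q\<close> to \<open>2 + \<sigma> * q\<close>, whose fixed point is
  the critical exponent \<open>L\<close>; the distance to \<open>L\<close> shrinks by the factor
  \<open>\<sigma> < 1\<close>. Started at 2, the exponents increase to \<open>L\<close> without
  reaching it, so each subcritical one is passed after finitely many steps.\<close>

lemma sobolev_exponent_subcritical:
  assumes s: "0 < s" "2 * s < real CARD('n::finite)" and r: "2 \<le> r" "r < 2 * real CARD('n) / (real CARD('n) - 2 * s)"
  shows "sobolev_exponent TYPE('n) s r"
proof -
  define \<sigma> where "\<sigma> = 2 * s / real CARD('n)"
  define L where "L = 2 * real CARD('n) / (real CARD('n) - 2 * s)"
  have \<sigma>: "0 < \<sigma>" "\<sigma> < 1" using s by (auto simp: \<sigma>_def)
  have L: "L = 2 + \<sigma> * L" using s unfolding L_def \<sigma>_def by (simp add: field_simps)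
  have L2: "2 < L" using s unfolding L_def by (simp add: field_simps)
  have ind: "sobolev_exponent TYPE('n) s (L - (L - 2) * \<sigma> ^ k)" for k
  proof (induction k)
    case 0
    show ?case using sobolev_exponent_two by simp
  next
    case (Suc k)
    have "\<sigma> ^ k \<le> 1" using \<sigma> by (simp add: power_le_one)
    then have "(L - 2) * \<sigma> ^ k \<le> (L - 2) * 1" using L2 by (intro mult_left_mono) auto
    then have "1 < L - (L - 2) * \<sigma> ^ k" by simp
    from sobolev_exponent_step[OF s(1) this Suc]
    have "sobolev_exponent TYPE('n) s (2 + \<sigma> * (L - (L - 2) * \<sigma> ^ k))" unfolding \<sigma>_def .
    moreover have "2 + \<sigma> * (L - (L - 2) * \<sigma> ^ k) = L - (L - 2) * \<sigma> ^ Suc k"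
      using L by (simp add: algebra_simps)
    ultimately show ?case by simp
  qed
  have "(\<lambda>k. L - (L - 2) * \<sigma> ^ k) \<longlonglongrightarrow> L - (L - 2) * 0"
    using \<sigma> by (intro tendsto_intros LIMSEQ_realpow_zero) auto
  then have "eventually (\<lambda>k. r < L - (L - 2) * \<sigma> ^ k) sequentially"
    using r by (intro order_tendstoD(1)) (auto simp: L_def)
  then obtain k where "r < L - (L - 2) * \<sigma> ^ k" by (auto simp: eventually_sequentially)
  then show ?thesis using sobolev_exponent_between[OF r(1) _ ind[of k]] by simp
qed

section \<open>Compactness\<close>

lemma gagliardo_nn_diff_le:
  fixes u v :: "real ^ 'n \<Rightarrow> real"
  assumes [measurable]: "u \<in> borel_measurable lebesgue" "v \<in> borel_measurable lebesgue"
  shows "gagliardo_nn s (\<lambda>x. u x - v x) \<le> 2 * gagliardo_nn s u + 2 * gagliardo_nn s v"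
proof -
  have "gagliardo_nn s (\<lambda>x. u x - v x)
      \<le> (\<integral>\<^sup>+ z. 2 * ennreal (gagliardo_kernel s u u z) + 2 * ennreal (gagliardo_kernel s v v z) \<partial>(lebesgue \<Otimes>\<^sub>M lebesgue))"
    unfolding gagliardo_nn_def
  proof (rule nn_integral_mono)
    fix z :: "(real ^ 'n) \<times> (real ^ 'n)"
    have "(a - b) * (a - b) / d \<le> 2 * (a * a / d) + 2 * (b * b / d)" if "0 \<le> d" for a b d :: real
    proof -
      have "0 \<le> (a + b) * (a + b)" by simp
      then have "(a - b) * (a - b) \<le> 2 * (a * a) + 2 * (b * b)" by (simp add: algebra_simps)
      then have "(a - b) * (a - b) / d \<le> (2 * (a * a) + 2 * (b * b)) / d" using that by (rule divide_right_mono)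
      then show ?thesis by (simp add: add_divide_distrib)
    qed
    from this[of "norm (fst z - snd z) powr (real CARD('n) + 2 * s)" "u (fst z) - u (snd z)" "v (fst z) - v (snd z)"]
    have "gagliardo_kernel s (\<lambda>x. u x - v x) (\<lambda>x. u x - v x) z
        \<le> 2 * gagliardo_kernel s u u z + 2 * gagliardo_kernel s v v z"
      by (simp add: gagliardo_kernel_def split_beta algebra_simps)
    then have "ennreal (gagliardo_kernel s (\<lambda>x. u x - v x) (\<lambda>x. u x - v x) z)
        \<le> ennreal (2 * gagliardo_kernel s u u z + 2 * gagliardo_kernel s v v z)"
      by (rule ennreal_leI)
    then show "ennreal (gagliardo_kernel s (\<lambda>x. u x - v x) (\<lambda>x. u x - v x) z)
        \<le> 2 * ennreal (gagliardo_kernel s u u z) + 2 * ennreal (gagliardo_kernel s v v z)"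
      by (simp add: gagliardo_kernel_nonneg ennreal_mult)
  qed
  also have "\<dots> = 2 * gagliardo_nn s u + 2 * gagliardo_nn s v"
    unfolding gagliardo_nn_def by (simp add: nn_integral_add nn_integral_cmult)
  finally show ?thesis .
qed

section \<open>Cell averages\<close>

definition cell_avg :: "real \<Rightarrow> (real ^ 'n \<Rightarrow> real) \<Rightarrow> real ^ 'n \<Rightarrow> real" where
  "cell_avg h u x = (LINT y|lebesgue. u y * indicator (cell h x) y) / h ^ CARD('n)"

text \<open>Measurability of a parameter integral needs the relation between a point and its cell to
  be measurable in the product; it is, being an equality of integer-valued floor maps.\<close>

lemma cell_avg_measurable [measurable]:
  fixes u :: "real ^ 'n \<Rightarrow> real"
  assumes [measurable]: "u \<in> borel_measurable lebesgue"
  shows "cell_avg h u \<in> borel_measurable lebesgue"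
proof -
  have fl: "(\<lambda>x :: real ^ 'n. \<lfloor>x $ i / h\<rfloor>) \<in> lebesgue \<rightarrow>\<^sub>M count_space UNIV" for i
    by (rule measurable_completion) simp
  have [measurable]: "(\<lambda>z :: (real ^ 'n) \<times> (real ^ 'n). \<lfloor>fst z $ i / h\<rfloor>) \<in> (lebesgue \<Otimes>\<^sub>M lebesgue) \<rightarrow>\<^sub>M count_space UNIV"
    "(\<lambda>z :: (real ^ 'n) \<times> (real ^ 'n). \<lfloor>snd z $ i / h\<rfloor>) \<in> (lebesgue \<Otimes>\<^sub>M lebesgue) \<rightarrow>\<^sub>M count_space UNIV" for i
    by (rule measurable_compose[OF measurable_fst fl], rule measurable_compose[OF measurable_snd fl])
  let ?S = "{z \<in> space (lebesgue \<Otimes>\<^sub>M lebesgue). \<forall>i. \<lfloor>snd z $ i / h\<rfloor> = \<lfloor>(fst z :: real ^ 'n) $ i / h\<rfloor>}"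
  have S: "?S \<in> sets (lebesgue \<Otimes>\<^sub>M lebesgue)" by measurable
  have "(\<lambda>z. u (snd z) * indicator ?S z) \<in> borel_measurable (lebesgue \<Otimes>\<^sub>M lebesgue)"
    using S by measurable
  also have "(\<lambda>z. u (snd z) * indicator ?S z) = (\<lambda>(x, y). u y * indicator (cell h x) y)"
    by (auto simp: cell_def indicator_def fun_eq_iff space_pair_measure)
  finally show ?thesis
    unfolding cell_avg_def by (intro borel_measurable_divide leb.borel_measurable_lebesgue_integral) auto
qed

lemma inverse_Suc_tendsto_0: "(\<lambda>n. 1 / real (Suc n)) \<longlonglongrightarrow> 0"
  using LIMSEQ_inverse_real_of_nat by (simp add: inverse_eq_divide)

lemma square_diff_le: "(a - b)\<^sup>2 \<le> 2 * a\<^sup>2 + 2 * (b::real)\<^sup>2"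
proof -
  have "0 \<le> (a + b)\<^sup>2" by simp
  then show ?thesis unfolding power2_diff power2_sum by linarith
qed

lemma integrable_square_diff:
  fixes f g :: "'a \<Rightarrow> real"
  assumes [measurable]: "f \<in> borel_measurable M" "g \<in> borel_measurable M"
    and "integrable M (\<lambda>x. (f x)\<^sup>2)" "integrable M (\<lambda>x. (g x)\<^sup>2)"
  shows "integrable M (\<lambda>x. (f x - g x)\<^sup>2)"
proof (rule Bochner_Integration.integrable_bound[of _ "\<lambda>x. 2 * (f x)\<^sup>2 + 2 * (g x)\<^sup>2"])
  show "integrable M (\<lambda>x. 2 * (f x)\<^sup>2 + 2 * (g x)\<^sup>2)" using assms by auto
  show "AE x in M. norm ((f x - g x)\<^sup>2) \<le> norm (2 * (f x)\<^sup>2 + 2 * (g x)\<^sup>2)"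
    using square_diff_le by (intro always_eventually allI) auto
qed auto

lemma abs_le_one_plus_square: "\<bar>a::real\<bar> \<le> 1 + a\<^sup>2"
proof -
  have "\<bar>a\<bar> \<le> 1 \<or> \<bar>a\<bar> * 1 \<le> \<bar>a\<bar> * \<bar>a\<bar>"
    by (cases "\<bar>a\<bar> \<le> 1") (auto intro!: mult_left_mono simp del: mult_1_right abs_mult_self_eq)
  moreover have "\<bar>a\<bar> * \<bar>a\<bar> = a\<^sup>2" "0 \<le> a\<^sup>2" by (simp_all add: power2_eq_square)
  ultimately show ?thesis by linarith
qed

lemma integrable_cell_indicator:
  assumes "0 < h"
  shows "integrable lebesgue (indicator (cell h x) :: real ^ 'n \<Rightarrow> real)"
    "(LINT y|lebesgue. indicator (cell h x) y) = h ^ CARD('n::finite)"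
  using emeasure_cell[OF assms, of x] assms
  by (auto simp: integrable_indicator_iff measure_def)

lemma integrable_mult_cell:
  fixes u :: "real ^ 'n \<Rightarrow> real"
  assumes h: "0 < h" and [measurable]: "u \<in> borel_measurable lebesgue" and u2: "integrable lebesgue (\<lambda>x. (u x)\<^sup>2)"
  shows "integrable lebesgue (\<lambda>y. u y * indicator (cell h x) y)"
    "\<bar>LINT y|lebesgue. u y * indicator (cell h x) y\<bar> \<le> h ^ CARD('n) + (LINT y|lebesgue. (u y)\<^sup>2)"
proof -
  note ind = integrable_cell_indicator[OF h, of x]
  have bd: "norm (u y * indicator (cell h x) y) \<le> indicator (cell h x) y + (u y)\<^sup>2" for y
    using abs_le_one_plus_square[of "u y"] by (auto simp: indicator_def)
  show int: "integrable lebesgue (\<lambda>y. u y * indicator (cell h x) y)"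
    by (rule Bochner_Integration.integrable_bound[of _ "\<lambda>y. indicator (cell h x) y + (u y)\<^sup>2"])
       (use bd ind u2 in \<open>auto intro!: always_eventually\<close>)
  have "\<bar>LINT y|lebesgue. u y * indicator (cell h x) y\<bar> \<le> (LINT y|lebesgue. norm (u y * indicator (cell h x) y))"
    using integral_norm_bound[of lebesgue "\<lambda>y. u y * indicator (cell h x) y"] by simp
  also have "\<dots> \<le> (LINT y|lebesgue. indicator (cell h x) y + (u y)\<^sup>2)"
    using int ind u2 bd by (intro integral_mono) auto
  finally show "\<bar>LINT y|lebesgue. u y * indicator (cell h x) y\<bar> \<le> h ^ CARD('n) + (LINT y|lebesgue. (u y)\<^sup>2)"
    using ind u2 by simp
qed

text \<open>\<open>u x\<close> is its cell average plus the mean \<open>c\<close> of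
  \<open>u x - u y\<close> over the cell, and Jensen's inequality bounds \<open>c\<^sup>2\<close> by
  the mean square oscillation. Dividing that bound by the cell volume leaves
  \<open>h powr (2 * s)\<close>, which is small for small cells.\<close>

lemma square_le_cell:
  fixes u :: "real ^ 'n \<Rightarrow> real"
  assumes h: "0 < h" and s: "0 < s" and [measurable]: "u \<in> borel_measurable lebesgue" and u2: "integrable lebesgue (\<lambda>x. (u x)\<^sup>2)"
  shows "ennreal ((u x)\<^sup>2) \<le> ennreal (2 * real CARD('n) powr (real CARD('n) + 2 * s) * h powr (2 * s)) * gagliardo_slice s u x
     + ennreal (2 * (cell_avg h u x)\<^sup>2)"
proof -
  let ?N = "real CARD('n)"
  define H where "H = h ^ CARD('n)"
  have H: "0 < H" using h by (simp add: H_def)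
  define d where "d y = (u x - u y) * indicator (cell h x) y" for y
  note ind = integrable_cell_indicator[OF h, of x]
  note iu = integrable_mult_cell[OF h _ u2, of x]
  have d_eq: "d y = u x * indicator (cell h x) y - u y * indicator (cell h x) y" for y
    by (simp add: d_def algebra_simps)
  have di: "integrable lebesgue d" unfolding d_eq using ind iu by auto
  have d2: "integrable lebesgue (\<lambda>y. (d y)\<^sup>2)"
  proof (rule Bochner_Integration.integrable_bound[of _ "\<lambda>y. 2 * (u x)\<^sup>2 * indicator (cell h x) y + 2 * (u y)\<^sup>2"])
    show "integrable lebesgue (\<lambda>y. 2 * (u x)\<^sup>2 * indicator (cell h x) y + 2 * (u y)\<^sup>2)" using ind u2 by auto
    show "AE y in lebesgue. norm ((d y)\<^sup>2) \<le> norm (2 * (u x)\<^sup>2 * indicator (cell h x) y + 2 * (u y)\<^sup>2)"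
    proof (intro always_eventually allI)
      fix y
      show "norm ((d y)\<^sup>2) \<le> norm (2 * (u x)\<^sup>2 * indicator (cell h x) y + 2 * (u y)\<^sup>2)"
        using square_diff_le[of "u x" "u y"] by (auto simp: d_def indicator_def)
    qed
  qed (simp add: d_def)
  define c where "c = (LINT y|lebesgue. d y) / H"
  have dc: "(LINT y|lebesgue. d y) = c * H" using H by (simp add: c_def)
  have "(LINT y|lebesgue. d y) = u x * H - cell_avg h u x * H"
    unfolding d_eq using ind iu h by (simp add: cell_avg_def H_def)
  then have "u x * H = (c + cell_avg h u x) * H" using dc by (simp add: algebra_simps)
  then have ux: "u x = c + cell_avg h u x" using H by simp
  \<comment> \<open>Jensen's inequality on the cell, obtained by expanding the variance of
    \<open>d\<close>.\<close>
  have "0 \<le> (LINT y|lebesgue. (d y - c * indicator (cell h x) y)\<^sup>2)" by simp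
  also have "\<dots> = (LINT y|lebesgue. (d y)\<^sup>2 - 2 * c * d y + c\<^sup>2 * indicator (cell h x) y)"
    by (intro Bochner_Integration.integral_cong) (auto simp: d_def indicator_def power2_eq_square algebra_simps)
  also have "\<dots> = (LINT y|lebesgue. (d y)\<^sup>2) - 2 * c * (c * H) + c\<^sup>2 * H"
    using d2 di ind dc by (simp add: H_def)
  finally have cH: "c\<^sup>2 * H \<le> (LINT y|lebesgue. (d y)\<^sup>2)" by (simp add: power2_eq_square algebra_simps)
  have "ennreal (c\<^sup>2 * H) \<le> ennreal (LINT y|lebesgue. (d y)\<^sup>2)" using cH by (rule ennreal_leI)
  also have "\<dots> = (\<integral>\<^sup>+ y. ennreal ((d y)\<^sup>2) \<partial>lebesgue)"
    using d2 by (simp add: nn_integral_eq_integral)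
  also have "\<dots> = (\<integral>\<^sup>+ y. ennreal ((u x - u y)\<^sup>2) * indicator (cell h x) y \<partial>lebesgue)"
    by (intro nn_integral_cong) (auto simp: d_def indicator_def)
  also have "\<dots> \<le> ennreal ((h * ?N) powr (?N + 2 * s)) * gagliardo_slice s u x"
    by (rule nn_integral_cell_diff_le[OF h s]) simp
  finally have *: "ennreal (c\<^sup>2 * H) \<le> ennreal ((h * ?N) powr (?N + 2 * s)) * gagliardo_slice s u x" .
  have "0 \<le> (c - cell_avg h u x)\<^sup>2" by simp
  then have "(u x)\<^sup>2 \<le> 2 * c\<^sup>2 + 2 * (cell_avg h u x)\<^sup>2" unfolding ux power2_diff power2_sum by linarith
  then have "ennreal ((u x)\<^sup>2) \<le> ennreal (2 * c\<^sup>2 + 2 * (cell_avg h u x)\<^sup>2)" by (rule ennreal_leI)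
  also have "\<dots> = ennreal (2 / H) * ennreal (c\<^sup>2 * H) + ennreal (2 * (cell_avg h u x)\<^sup>2)"
    using H by (simp add: ennreal_mult[symmetric] del: ennreal_plus) (simp flip: ennreal_plus)
  also have "\<dots> \<le> ennreal (2 / H) * (ennreal ((h * ?N) powr (?N + 2 * s)) * gagliardo_slice s u x) + ennreal (2 * (cell_avg h u x)\<^sup>2)"
    using * by (intro add_mono mult_left_mono) auto
  also have "ennreal (2 / H) * (ennreal ((h * ?N) powr (?N + 2 * s)) * gagliardo_slice s u x)
      = ennreal (2 * ?N powr (?N + 2 * s) * h powr (2 * s)) * gagliardo_slice s u x"
  proof -
    have "(h * ?N) powr (?N + 2 * s) = H * (h powr (2 * s) * ?N powr (?N + 2 * s))"
      using h by (simp add: powr_mult powr_add H_def flip: powr_realpow)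
    then have "2 / H * (h * ?N) powr (?N + 2 * s) = 2 * ?N powr (?N + 2 * s) * h powr (2 * s)" using H by simp
    then show ?thesis using H by (simp add: ennreal_mult[symmetric] flip: mult.assoc)
  qed
  finally show ?thesis .
qed

text \<open>The oscillation term may be taken over the whole space, as it is small uniformly on
  bounded sequences; only the averages are localized to \<open>F\<close>, where finite measure will
  permit dominated convergence.\<close>

lemma nn_integral_square_le_cell:
  fixes u :: "real ^ 'n \<Rightarrow> real"
  assumes h: "0 < h" and s: "0 < s" and [measurable]: "u \<in> borel_measurable lebesgue" "F \<in> sets lebesgue"
    and u2: "integrable lebesgue (\<lambda>x. (u x)\<^sup>2)"
  shows "(\<integral>\<^sup>+ x. ennreal ((u x)\<^sup>2) * indicator F x \<partial>lebesgue)
    \<le> ennreal (2 * real CARD('n) powr (real CARD('n) + 2 * s) * h powr (2 * s)) * gagliardo_nn s u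
     + (\<integral>\<^sup>+ x. ennreal (2 * (cell_avg h u x)\<^sup>2) * indicator F x \<partial>lebesgue)"
proof -
  let ?C = "ennreal (2 * real CARD('n) powr (real CARD('n) + 2 * s) * h powr (2 * s))"
  have "(\<integral>\<^sup>+ x. ennreal ((u x)\<^sup>2) * indicator F x \<partial>lebesgue)
    \<le> (\<integral>\<^sup>+ x. ?C * gagliardo_slice s u x + ennreal (2 * (cell_avg h u x)\<^sup>2) * indicator F x \<partial>lebesgue)"
    using square_le_cell[OF h s _ u2] by (intro nn_integral_mono) (auto simp: indicator_def)
  also have "\<dots> = ?C * gagliardo_nn s u + (\<integral>\<^sup>+ x. ennreal (2 * (cell_avg h u x)\<^sup>2) * indicator F x \<partial>lebesgue)"
    by (simp add: nn_integral_add nn_integral_cmult nn_integral_gagliardo_slice)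
  finally show ?thesis .
qed

text \<open>The error is split into three thirds: off a sublevel set of \<open>V\<close> the
  weighted integrals are small by Chebyshev's inequality, on it the oscillation is small for fine
  cells, and for a fixed cell size the averages converge boundedly on a set of finite
  measure.\<close>

lemma rellich_cauchy:
  fixes W :: "nat \<Rightarrow> real ^ 'n \<Rightarrow> real" and V :: "real ^ 'n \<Rightarrow> real"
  assumes s: "0 < s" and [measurable]: "\<And>n. W n \<in> borel_measurable lebesgue" "V \<in> borel_measurable lebesgue"
    and V: "\<And>M. 0 < M \<Longrightarrow> emeasure lebesgue {x. V x \<le> M} < \<infinity>"
    and B: "0 < B" "\<And>n. (\<integral>\<^sup>+ x. ennreal ((W n x)\<^sup>2) \<partial>lebesgue) \<le> ennreal B" "\<And>n. gagliardo_nn s (W n) \<le> ennreal B"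
      "\<And>n. (\<integral>\<^sup>+ x. ennreal (V x * (W n x)\<^sup>2) \<partial>lebesgue) \<le> ennreal B"
    and conv: "\<And>x j. convergent (\<lambda>n. cell_avg (1 / real (Suc j)) (W n) x)"
    and e: "0 < e"
  shows "\<exists>n0. \<forall>n\<ge>n0. \<forall>m\<ge>n0. (\<integral>\<^sup>+ x. ennreal ((W n x - W m x)\<^sup>2) \<partial>lebesgue) \<le> ennreal e"
proof -
  let ?N = "real CARD('n)"
  \<comment> \<open>Off \<open>F\<close> the squared difference is at most \<open>2 / T\<close>
    times two weighted squares, in total \<open>4 * B / T = e / 3\<close>.\<close>
  define T where "T = 12 * B / e"
  have T: "0 < T" using B e by (simp add: T_def)
  define F where "F = {x. V x \<le> T}"
  have F_alt: "F = {x \<in> space lebesgue. V x \<le> T}" by (simp add: F_def)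
  have F [measurable]: "F \<in> sets lebesgue" unfolding F_alt by measurable
  have Ffin: "emeasure lebesgue F < \<infinity>" using V[OF T] by (simp add: F_def)
  have W2: "integrable lebesgue (\<lambda>x. (W n x)\<^sup>2)" for n
    using B(2)[of n] by (intro integrableI_bounded) (auto intro: le_less_trans)
  have W2le: "(LINT x|lebesgue. (W n x)\<^sup>2) \<le> B" for n
    using B(1) B(2)[of n] W2[of n] by (simp add: nn_integral_eq_integral)
  have D2: "integrable lebesgue (\<lambda>x. (W n x - W m x)\<^sup>2)" for n m
    using W2 by (intro integrable_square_diff) auto
  have tail: "(\<integral>\<^sup>+ x. ennreal ((W n x - W m x)\<^sup>2) * indicator (- F) x \<partial>lebesgue) \<le> ennreal (e / 3)" for n m
  proof -
    have "(\<integral>\<^sup>+ x. ennreal ((W n x - W m x)\<^sup>2) * indicator (- F) x \<partial>lebesgue)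
      \<le> (\<integral>\<^sup>+ x. ennreal (2 / T) * (ennreal (V x * (W n x)\<^sup>2) + ennreal (V x * (W m x)\<^sup>2)) \<partial>lebesgue)"
    proof (rule nn_integral_mono)
      fix x
      show "ennreal ((W n x - W m x)\<^sup>2) * indicator (- F) x \<le> ennreal (2 / T) * (ennreal (V x * (W n x)\<^sup>2) + ennreal (V x * (W m x)\<^sup>2))"
      proof (cases "x \<in> F")
        case False
        then have VT: "T < V x" by (simp add: F_def)
        then have V0: "0 < V x" using T by simp
        have "T * ((W n x)\<^sup>2 + (W m x)\<^sup>2) \<le> V x * ((W n x)\<^sup>2 + (W m x)\<^sup>2)" using VT by (intro mult_right_mono) auto
        then have "2 * (W n x)\<^sup>2 + 2 * (W m x)\<^sup>2 \<le> 2 / T * (V x * (W n x)\<^sup>2 + V x * (W m x)\<^sup>2)"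
          using T by (simp add: field_simps)
        then have "(W n x - W m x)\<^sup>2 \<le> 2 / T * (V x * (W n x)\<^sup>2 + V x * (W m x)\<^sup>2)" using square_diff_le[of "W n x" "W m x"] by linarith
        then have "ennreal ((W n x - W m x)\<^sup>2) \<le> ennreal (2 / T * (V x * (W n x)\<^sup>2 + V x * (W m x)\<^sup>2))" by (rule ennreal_leI)
        also have "\<dots> = ennreal (2 / T) * ennreal (V x * (W n x)\<^sup>2 + V x * (W m x)\<^sup>2)"
          using T V0 by (intro ennreal_mult) auto
        also have "ennreal (V x * (W n x)\<^sup>2 + V x * (W m x)\<^sup>2) = ennreal (V x * (W n x)\<^sup>2) + ennreal (V x * (W m x)\<^sup>2)"
          using V0 by (intro ennreal_plus) auto
        finally show ?thesis using False by simp
      qed simp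
    qed
    also have "\<dots> = ennreal (2 / T) * ((\<integral>\<^sup>+ x. ennreal (V x * (W n x)\<^sup>2) \<partial>lebesgue) + (\<integral>\<^sup>+ x. ennreal (V x * (W m x)\<^sup>2) \<partial>lebesgue))"
      by (simp add: nn_integral_cmult nn_integral_add)
    also have "\<dots> \<le> ennreal (2 / T) * (ennreal B + ennreal B)"
      by (intro mult_left_mono add_mono B) auto
    also have "\<dots> = ennreal (2 / T * (B + B))"
    proof -
      have "ennreal a * (ennreal B + ennreal B) = ennreal (a * (B + B))" if "0 \<le> a" for a
        using that B(1) by (simp only: ennreal_mult ennreal_plus add_nonneg_nonneg less_imp_le)
      then show ?thesis using T by simp
    qed
    also have "2 / T * (B + B) = e / 3" using B e by (simp add: T_def)
    finally show ?thesis .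
  qed
  define C where "C = 2 * ?N powr (?N + 2 * s)"
  have C: "0 < C" by (simp add: C_def)
  \<comment> \<open>The factor \<open>4 * B\<close> is the seminorm bound for a difference of two
    members of the sequence.\<close>
  obtain j :: nat where j: "C * (1 / real (Suc j)) powr (2 * s) * (4 * B) \<le> e / 3"
  proof -
    have "(\<lambda>j. (1 / real (Suc j)) powr (2 * s)) \<longlonglongrightarrow> 0 powr (2 * s)"
    proof (rule tendsto_powr2)
      show "(\<lambda>j. 1 / real (Suc j)) \<longlonglongrightarrow> 0" by (rule inverse_Suc_tendsto_0)
    qed (use s in auto)
    then have "(\<lambda>j. C * (1 / real (Suc j)) powr (2 * s) * (4 * B)) \<longlonglongrightarrow> C * 0 powr (2 * s) * (4 * B)"
      by (intro tendsto_mult tendsto_const)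
    then have "eventually (\<lambda>j. C * (1 / real (Suc j)) powr (2 * s) * (4 * B) < e / 3) sequentially"
      using e by (intro order_tendstoD(2)) auto
    then obtain j where "C * (1 / real (Suc j)) powr (2 * s) * (4 * B) < e / 3"
      using eventually_happens'[OF sequentially_bot] by blast
    then show thesis by (rule that[OF less_imp_le])
  qed
  define h where "h = 1 / real (Suc j)"
  have h: "0 < h" by (simp add: h_def)
  define c where "c x = lim (\<lambda>n. cell_avg h (W n) x)" for x
  have c: "(\<lambda>n. cell_avg h (W n) x) \<longlonglongrightarrow> c x" for x
    using conv[of j x] unfolding c_def h_def by (simp add: convergent_LIMSEQ_iff)
  have c_meas [measurable]: "c \<in> borel_measurable lebesgue"
    by (rule borel_measurable_LIMSEQ_real[OF c]) measurable
  define b where "b = (h ^ CARD('n) + B) / h ^ CARD('n)"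
  have b: "\<bar>cell_avg h (W n) x\<bar> \<le> b" for n x
  proof -
    have "\<bar>LINT y|lebesgue. W n y * indicator (cell h x) y\<bar> \<le> h ^ CARD('n) + B"
      using integrable_mult_cell(2)[OF h _ W2, of n x] W2le[of n] by simp
    then show ?thesis unfolding cell_avg_def b_def using h by (simp add: divide_right_mono)
  qed
  have cb: "\<bar>c x\<bar> \<le> b" for x
    using tendsto_rabs[OF c] by (rule LIMSEQ_le_const2) (use b in auto)
  \<comment> \<open>The 4 combines the factor 2 of the cell estimate with the factor 2 from passing
    through the limit \<open>c\<close>. Two such integrals, each below \<open>e / 6\<close>, make up
    one third.\<close>
  define I where "I n = (\<integral>\<^sup>+ x. ennreal (4 * (cell_avg h (W n) x - c x)\<^sup>2) * indicator F x \<partial>lebesgue)" for n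
  have "I \<longlonglongrightarrow> (\<integral>\<^sup>+ (x :: real ^ 'n). 0 \<partial>lebesgue)"
    unfolding I_def
  proof (rule nn_integral_dominated_convergence[where w = "\<lambda>x. ennreal (4 * (2 * b)\<^sup>2) * indicator F x"])
    show "(\<integral>\<^sup>+ x. ennreal (4 * (2 * b)\<^sup>2) * indicator F x \<partial>lebesgue) < \<infinity>"
      using Ffin nn_integral_cmult_indicator[OF F, of "ennreal (4 * (2 * b)\<^sup>2)"] by (simp add: ennreal_mult_less_top)
    show "AE x in lebesgue. ennreal (4 * (cell_avg h (W n) x - c x)\<^sup>2) * indicator F x \<le> ennreal (4 * (2 * b)\<^sup>2) * indicator F x" for n
    proof (intro always_eventually allI mult_right_mono ennreal_leI mult_left_mono)
      fix x
      have "\<bar>cell_avg h (W n) x - c x\<bar> \<le> \<bar>2 * b\<bar>" using b[of n x] cb[of x] by linarith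
      then show "(cell_avg h (W n) x - c x)\<^sup>2 \<le> (2 * b)\<^sup>2" by (simp only: abs_le_square_iff)
    qed auto
    show "AE x in lebesgue. (\<lambda>n. ennreal (4 * (cell_avg h (W n) x - c x)\<^sup>2) * indicator F x) \<longlonglongrightarrow> 0"
    proof (intro always_eventually allI)
      fix x
      have "(\<lambda>n. 4 * (cell_avg h (W n) x - c x)\<^sup>2) \<longlonglongrightarrow> 4 * (c x - c x)\<^sup>2" by (intro tendsto_intros c)
      then have "(\<lambda>n. ennreal (4 * (cell_avg h (W n) x - c x)\<^sup>2)) \<longlonglongrightarrow> ennreal 0" by (intro tendsto_ennrealI) simp
      then show "(\<lambda>n. ennreal (4 * (cell_avg h (W n) x - c x)\<^sup>2) * indicator F x) \<longlonglongrightarrow> 0"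
        by (cases "x \<in> F") auto
    qed
  qed auto
  then have "I \<longlonglongrightarrow> 0" by simp
  then have "eventually (\<lambda>n. I n < ennreal (e / 6)) sequentially" using e by (intro order_tendstoD(2)) auto
  then obtain n0 where n0: "\<And>n. n \<ge> n0 \<Longrightarrow> I n < ennreal (e / 6)" by (auto simp: eventually_sequentially)
  show ?thesis
  proof (intro exI allI impI)
    fix n m assume nm: "n0 \<le> n" "n0 \<le> m"
    let ?d = "\<lambda>x. W n x - W m x"
    have avg: "cell_avg h ?d x = cell_avg h (W n) x - cell_avg h (W m) x" for x
      using integrable_mult_cell(1)[OF h _ W2, of n x] integrable_mult_cell(1)[OF h _ W2, of m x]
      by (simp add: cell_avg_def left_diff_distrib diff_divide_distrib)
    have g: "gagliardo_nn s ?d \<le> ennreal (4 * B)"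
    proof -
      have "gagliardo_nn s ?d \<le> 2 * gagliardo_nn s (W n) + 2 * gagliardo_nn s (W m)" by (rule gagliardo_nn_diff_le) auto
      also have "\<dots> \<le> 2 * ennreal B + 2 * ennreal B" by (intro add_mono mult_left_mono B) auto
      also have "\<dots> = ennreal (4 * B)" using B(1) by (simp flip: distrib_right add: ennreal_mult)
      finally show ?thesis .
    qed
    have a: "(\<integral>\<^sup>+ x. ennreal (2 * (cell_avg h ?d x)\<^sup>2) * indicator F x \<partial>lebesgue) \<le> I n + I m"
    proof -
      have "(\<integral>\<^sup>+ x. ennreal (2 * (cell_avg h ?d x)\<^sup>2) * indicator F x \<partial>lebesgue)
        \<le> (\<integral>\<^sup>+ x. ennreal (4 * (cell_avg h (W n) x - c x)\<^sup>2) * indicator F x + ennreal (4 * (cell_avg h (W m) x - c x)\<^sup>2) * indicator F x \<partial>lebesgue)"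
      proof (rule nn_integral_mono)
        fix x
        have "(cell_avg h ?d x)\<^sup>2 \<le> 2 * (cell_avg h (W n) x - c x)\<^sup>2 + 2 * (cell_avg h (W m) x - c x)\<^sup>2"
          using square_diff_le[of "cell_avg h (W n) x - c x" "cell_avg h (W m) x - c x"] by (simp add: avg)
        then have "ennreal (2 * (cell_avg h ?d x)\<^sup>2) \<le> ennreal (4 * (cell_avg h (W n) x - c x)\<^sup>2 + 4 * (cell_avg h (W m) x - c x)\<^sup>2)"
          by (intro ennreal_leI) simp
        also have "\<dots> = ennreal (4 * (cell_avg h (W n) x - c x)\<^sup>2) + ennreal (4 * (cell_avg h (W m) x - c x)\<^sup>2)"
          by (intro ennreal_plus) auto
        finally show "ennreal (2 * (cell_avg h ?d x)\<^sup>2) * indicator F x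
          \<le> ennreal (4 * (cell_avg h (W n) x - c x)\<^sup>2) * indicator F x + ennreal (4 * (cell_avg h (W m) x - c x)\<^sup>2) * indicator F x"
          by (cases "x \<in> F") auto
      qed
      also have "\<dots> = I n + I m" unfolding I_def by (intro nn_integral_add) auto
      finally show ?thesis .
    qed
    have "(\<integral>\<^sup>+ x. ennreal ((?d x)\<^sup>2) \<partial>lebesgue)
        = (\<integral>\<^sup>+ x. ennreal ((?d x)\<^sup>2) * indicator F x + ennreal ((?d x)\<^sup>2) * indicator (- F) x \<partial>lebesgue)"
      by (intro nn_integral_cong) (auto simp: indicator_def)
    also have "\<dots> = (\<integral>\<^sup>+ x. ennreal ((?d x)\<^sup>2) * indicator F x \<partial>lebesgue) + (\<integral>\<^sup>+ x. ennreal ((?d x)\<^sup>2) * indicator (- F) x \<partial>lebesgue)"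
      using F by (intro nn_integral_add) (auto simp: Compl_in_sets_lebesgue)
    also have "\<dots> \<le> (ennreal (C * h powr (2 * s)) * gagliardo_nn s ?d
        + (\<integral>\<^sup>+ x. ennreal (2 * (cell_avg h ?d x)\<^sup>2) * indicator F x \<partial>lebesgue)) + ennreal (e / 3)"
      unfolding C_def by (intro add_mono nn_integral_square_le_cell[OF h s _ F D2] tail) auto
    also have "\<dots> \<le> (ennreal (C * h powr (2 * s)) * ennreal (4 * B) + (ennreal (e / 6) + ennreal (e / 6))) + ennreal (e / 3)"
      using n0 nm by (intro add_mono mult_left_mono g order_trans[OF a]) (auto intro: less_imp_le)
    also have "\<dots> = ennreal ((C * h powr (2 * s) * (4 * B) + (e / 6 + e / 6)) + e / 3)"
    proof -
      have "ennreal a * ennreal b + (ennreal d + ennreal d) + ennreal k = ennreal (a * b + (d + d) + k)"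
        if "0 \<le> a" "0 \<le> b" "0 \<le> d" "0 \<le> k" for a b d k
        using that by (simp only: ennreal_mult ennreal_plus add_nonneg_nonneg mult_nonneg_nonneg)
      from this[of "C * h powr (2 * s)" "4 * B" "e / 6" "e / 3"] show ?thesis using C B e by (simp only: mult_nonneg_nonneg less_imp_le powr_ge_zero zero_le_numeral divide_nonneg_nonneg)
    qed
    also have "\<dots> \<le> ennreal e" using j by (intro ennreal_leI) (simp add: h_def)
    finally show "(\<integral>\<^sup>+ x. ennreal ((?d x)\<^sup>2) \<partial>lebesgue) \<le> ennreal e" .
  qed
qed

section \<open>From Cauchy sequences to almost everywhere limits\<close>

text \<open>The available subsequence theorem concerns Cauchy sequences in L^1, and on a space of
  infinite measure square integrability does not give that. Multiplying by a strictly positive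
  square-integrable weight does, and positivity lets the pointwise limit be divided out again;
  Fatou's lemma turns the Cauchy property into convergence.\<close>

lemma cauchy_L2_limit:
  fixes W :: "nat \<Rightarrow> 'a::euclidean_space \<Rightarrow> real"
  assumes [measurable]: "\<And>n. W n \<in> borel_measurable lebesgue"
    and W2: "\<And>n. integrable lebesgue (\<lambda>x. (W n x)\<^sup>2)"
    and cauchy: "\<And>e. 0 < e \<Longrightarrow> \<exists>n0. \<forall>n\<ge>n0. \<forall>m\<ge>n0. (\<integral>\<^sup>+ x. ennreal ((W n x - W m x)\<^sup>2) \<partial>lebesgue) \<le> ennreal e"
  obtains r u where "strict_mono (r :: nat \<Rightarrow> nat)" "u \<in> borel_measurable lebesgue"
    "AE x in lebesgue. (\<lambda>n. W (r n) x) \<longlonglongrightarrow> u x"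
    "(\<lambda>n. \<integral>\<^sup>+ x. ennreal ((W (r n) x - u x)\<^sup>2) \<partial>lebesgue) \<longlonglongrightarrow> 0"
proof -
  obtain g :: "'a \<Rightarrow> ennreal" where g [measurable]: "g \<in> borel_measurable lebesgue" and gfin: "(\<integral>\<^sup>+ x. g x \<partial>lebesgue) \<noteq> \<infinity>"
    and gpos: "\<And>x. 0 < g x \<and> g x < \<infinity>"
    using leb.Ex_finite_integrable_function by auto
  \<comment> \<open>The square root of a strictly positive integrable function, which exists by
    sigma-finiteness.\<close>
  define w where "w x = sqrt (enn2real (g x))" for x
  have w [measurable]: "w \<in> borel_measurable lebesgue" unfolding w_def by measurable
  have wpos: "0 < w x" for x using gpos[of x] by (simp add: w_def enn2real_positive_iff)
  have w2: "(w x)\<^sup>2 = enn2real (g x)" for x by (simp add: w_def)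
  have iw2: "integrable lebesgue (\<lambda>x. (w x)\<^sup>2)"
    unfolding w2 using gfin gpos by (intro integrableI_bounded) (auto simp: less_top)
  have D2: "integrable lebesgue (\<lambda>x. (W n x - W m x)\<^sup>2)" for n m
    using W2 by (intro integrable_square_diff) auto
  have young: "\<bar>a * b\<bar> \<le> a\<^sup>2 / d + d * b\<^sup>2" if "0 < d" for a b d :: real
  proof -
    have "0 \<le> (\<bar>a\<bar> - d * \<bar>b\<bar>)\<^sup>2" by simp
    then have "2 * d * \<bar>a * b\<bar> \<le> a\<^sup>2 + d\<^sup>2 * b\<^sup>2" unfolding power2_diff by (simp add: abs_mult power_mult_distrib mult_ac)
    moreover have "0 \<le> d * \<bar>a * b\<bar>" using that by simp
    ultimately have "d * \<bar>a * b\<bar> \<le> a\<^sup>2 + d\<^sup>2 * b\<^sup>2" by linarith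
    then show ?thesis using that by (simp add: field_simps power2_eq_square)
  qed
  have Ww: "integrable lebesgue (\<lambda>x. W n x * w x)" for n
  proof (rule Bochner_Integration.integrable_bound[of _ "\<lambda>x. (W n x)\<^sup>2 + (w x)\<^sup>2"])
    show "AE x in lebesgue. norm (W n x * w x) \<le> norm ((W n x)\<^sup>2 + (w x)\<^sup>2)"
      using young[of 1] by (intro always_eventually allI) auto
  qed (use W2 iw2 in auto)
  let ?w = "LINT x|lebesgue. (w x)\<^sup>2"
  have "\<exists>N. \<forall>i\<ge>N. \<forall>j\<ge>N. (LINT x|lebesgue. norm (W i x * w x - W j x * w x)) < e" if e: "0 < e" for e
  proof -
    \<comment> \<open>The parameter of Young's inequality: the weight contributes
      \<open>d * ?w < e / 2\<close>, and the Cauchy threshold \<open>d * e / 2\<close> becomes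
      \<open>e / 2\<close> after division by \<open>d\<close>.\<close>
    define d where "d = e / (2 * (?w + 1))"
    have w0: "0 \<le> ?w" by simp
    have d: "0 < d" using e w0 by (simp add: d_def add_nonneg_pos)
    have dw: "d * ?w < e / 2"
    proof -
      have "d * (?w + 1) = e / 2" using w0 by (simp add: d_def field_simps add_nonneg_eq_0_iff)
      then show ?thesis using d by (simp add: distrib_left)
    qed
    obtain N where N: "\<And>i j. i \<ge> N \<Longrightarrow> j \<ge> N \<Longrightarrow> (\<integral>\<^sup>+ x. ennreal ((W i x - W j x)\<^sup>2) \<partial>lebesgue) \<le> ennreal (d * e / 2)"
      using cauchy[of "d * e / 2"] d e by auto
    show ?thesis
    proof (intro exI allI impI)
      fix i j assume ij: "N \<le> i" "N \<le> j"
      have "(LINT x|lebesgue. (W i x - W j x)\<^sup>2) \<le> d * e / 2"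
        using N[OF ij] D2[of i j] d e by (simp add: nn_integral_eq_integral)
      then have *: "(LINT x|lebesgue. (W i x - W j x)\<^sup>2) / d \<le> e / 2" using d by (simp add: field_simps)
      have "(LINT x|lebesgue. norm (W i x * w x - W j x * w x)) \<le> (LINT x|lebesgue. (W i x - W j x)\<^sup>2 / d + d * (w x)\<^sup>2)"
        using Ww D2 iw2 young[OF d, of "W i x - W j x" "w x" for x]
        by (intro integral_mono) (auto simp: left_diff_distrib)
      also have "\<dots> = (LINT x|lebesgue. (W i x - W j x)\<^sup>2) / d + d * ?w"
        using D2 iw2 by simp
      finally show "(LINT x|lebesgue. norm (W i x * w x - W j x * w x)) < e" using * dw by linarith
    qed
  qed
  from cauchy_L1_AE_cauchy_subseq[of lebesgue "\<lambda>n x. W n x * w x", OF Ww this]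
  obtain r where r: "strict_mono r" "AE x in lebesgue. Cauchy (\<lambda>i. W (r i) x * w x)" by blast
  have AEc: "AE x in lebesgue. convergent (\<lambda>i. W (r i) x)"
    using r(2)
  proof eventually_elim
    fix x assume "Cauchy (\<lambda>i. W (r i) x * w x)"
    then obtain l where "(\<lambda>i. W (r i) x * w x) \<longlonglongrightarrow> l" by (auto simp: Cauchy_convergent_iff convergent_def)
    then have "(\<lambda>i. W (r i) x * w x / w x) \<longlonglongrightarrow> l / w x" using wpos[of x] by (intro tendsto_intros) auto
    then show "convergent (\<lambda>i. W (r i) x)" using wpos[of x] by (auto simp: convergent_def)
  qed
  define u where "u x = lim (\<lambda>i. W (r i) x)" for x
  have u [measurable]: "u \<in> borel_measurable lebesgue" unfolding u_def by measurable
  have AEu: "AE x in lebesgue. (\<lambda>n. W (r n) x) \<longlonglongrightarrow> u x"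
    using AEc by eventually_elim (simp add: u_def convergent_LIMSEQ_iff)
  have "(\<lambda>n. \<integral>\<^sup>+ x. ennreal ((W (r n) x - u x)\<^sup>2) \<partial>lebesgue) \<longlonglongrightarrow> 0"
  proof (rule order_tendstoI)
    fix a :: ennreal assume "0 < a"
    then obtain e where e: "0 < e" "ennreal e < a"
      by (metis dense ennreal_cases ennreal_less_zero_iff infinity_ennreal_def less_top not_less_iff_gr_or_eq top.not_eq_extremum)
    obtain N where N: "\<And>i j. i \<ge> N \<Longrightarrow> j \<ge> N \<Longrightarrow> (\<integral>\<^sup>+ x. ennreal ((W i x - W j x)\<^sup>2) \<partial>lebesgue) \<le> ennreal e"
      using cauchy[OF e(1)] by auto
    have "(\<integral>\<^sup>+ x. ennreal ((W (r n) x - u x)\<^sup>2) \<partial>lebesgue) < a" if n: "N \<le> n" for n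
    proof -
      have rn: "k \<le> r k" for k by (rule seq_suble[OF r(1)])
      have "(\<integral>\<^sup>+ x. ennreal ((W (r n) x - u x)\<^sup>2) \<partial>lebesgue)
          = (\<integral>\<^sup>+ x. liminf (\<lambda>m. ennreal ((W (r n) x - W (r m) x)\<^sup>2)) \<partial>lebesgue)"
      proof (rule nn_integral_cong_AE)
        show "AE x in lebesgue. ennreal ((W (r n) x - u x)\<^sup>2) = liminf (\<lambda>m. ennreal ((W (r n) x - W (r m) x)\<^sup>2))"
          using AEu
        proof eventually_elim
          fix x assume "(\<lambda>n. W (r n) x) \<longlonglongrightarrow> u x"
          then have "(\<lambda>m. ennreal ((W (r n) x - W (r m) x)\<^sup>2)) \<longlonglongrightarrow> ennreal ((W (r n) x - u x)\<^sup>2)"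
            by (intro tendsto_ennrealI tendsto_intros)
          then show "ennreal ((W (r n) x - u x)\<^sup>2) = liminf (\<lambda>m. ennreal ((W (r n) x - W (r m) x)\<^sup>2))"
            by (intro lim_imp_Liminf[symmetric]) simp_all
        qed
      qed
      also have "\<dots> \<le> liminf (\<lambda>m. \<integral>\<^sup>+ x. ennreal ((W (r n) x - W (r m) x)\<^sup>2) \<partial>lebesgue)"
        by (rule nn_integral_liminf) measurable
      also have "\<dots> \<le> ennreal e"
      proof (rule Liminf_le)
        show "eventually (\<lambda>m. (\<integral>\<^sup>+ x. ennreal ((W (r n) x - W (r m) x)\<^sup>2) \<partial>lebesgue) \<le> ennreal e) sequentially"
          unfolding eventually_sequentially using N rn n by (intro exI[of _ N]) (meson order_trans)
      qed simp
      finally show ?thesis using e by simp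
    qed
    then show "eventually (\<lambda>n. (\<integral>\<^sup>+ x. ennreal ((W (r n) x - u x)\<^sup>2) \<partial>lebesgue) < a) sequentially"
      by (auto simp: eventually_sequentially)
  qed simp
  then show thesis using that[OF r(1) u AEu] by blast
qed

text \<open>Each cell is named by its integer corner, so for one side length there are only
  countably many averages.\<close>

lemma cell_representative:
  assumes "0 < h"
  shows "cell h (\<chi> i. h * real_of_int \<lfloor>x $ i / h\<rfloor>) = cell h x"
  using assms by (simp add: cell_def)

lemma rellich:
  fixes U :: "nat \<Rightarrow> real ^ 'n \<Rightarrow> real" and V :: "real ^ 'n \<Rightarrow> real"
  assumes s: "0 < s" and [measurable]: "\<And>n. U n \<in> borel_measurable lebesgue" "V \<in> borel_measurable lebesgue"
    and V: "\<And>M. 0 < M \<Longrightarrow> emeasure lebesgue {x. V x \<le> M} < \<infinity>"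
    and B: "0 < B" "\<And>n. (\<integral>\<^sup>+ x. ennreal ((U n x)\<^sup>2) \<partial>lebesgue) \<le> ennreal B" "\<And>n. gagliardo_nn s (U n) \<le> ennreal B"
      "\<And>n. (\<integral>\<^sup>+ x. ennreal (V x * (U n x)\<^sup>2) \<partial>lebesgue) \<le> ennreal B"
  obtains r u where "strict_mono (r :: nat \<Rightarrow> nat)" "u \<in> borel_measurable lebesgue"
    "AE x in lebesgue. (\<lambda>n. U (r n) x) \<longlonglongrightarrow> u x"
    "(\<lambda>n. \<integral>\<^sup>+ x. ennreal ((U (r n) x - u x)\<^sup>2) \<partial>lebesgue) \<longlonglongrightarrow> 0"
proof -
  have U2: "integrable lebesgue (\<lambda>x. (U n x)\<^sup>2)" for n
    using B(2)[of n] by (intro integrableI_bounded) (auto intro: le_less_trans)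
  have U2le: "(LINT x|lebesgue. (U n x)\<^sup>2) \<le> B" for n
    using B(1) B(2)[of n] U2[of n] by (simp add: nn_integral_eq_integral)
  define rep where "rep j c = (\<chi> i. 1 / real (Suc j) * real_of_int (c i) :: real ^ 'n)" for j and c :: "'n \<Rightarrow> int"
  \<comment> \<open>All averages, up to normalization, as one bounded function on a countable type:
    the diagonal subsequence theorem applies. Side lengths at most 1 make the bound
    \<open>1 + B\<close> independent of \<open>j\<close>.\<close>
  define f where "f n = (\<lambda>(j, c). LINT y|lebesgue. U n y * indicator (cell (1 / real (Suc j)) (rep j c)) y)" for n
  have "norm (f n z) \<le> 1 + B" for n z
  proof -
    obtain j c where z: "z = (j, c)" by (cases z)
    have "(1 / real (Suc j)) ^ CARD('n) \<le> 1" by (intro power_le_one) auto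
    then show ?thesis
      using integrable_mult_cell(2)[OF _ _ U2, of "1 / real (Suc j)" n "rep j c"] U2le[of n] by (simp add: f_def z)
  qed
  then obtain k where k: "strict_mono (k :: nat \<Rightarrow> nat)" "\<And>z. \<exists>l. (\<lambda>n. f (k n) z) \<longlonglongrightarrow> l"
    by (rule function_convergent_subsequence[of UNIV f "1 + B", OF countableI_type]) blast+
  have conv: "convergent (\<lambda>n. cell_avg (1 / real (Suc j)) (U (k n)) x)" for x j
  proof -
    let ?h = "1 / real (Suc j)"
    obtain l where l: "(\<lambda>n. f (k n) (j, \<lambda>i. \<lfloor>x $ i / ?h\<rfloor>)) \<longlonglongrightarrow> l" using k(2) by blast
    have "f (k n) (j, \<lambda>i. \<lfloor>x $ i / ?h\<rfloor>) = (LINT y|lebesgue. U (k n) y * indicator (cell ?h x) y)" for n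
      using cell_representative[of ?h x] unfolding f_def rep_def by simp
    then have "(\<lambda>n. cell_avg ?h (U (k n)) x) \<longlonglongrightarrow> l / ?h ^ CARD('n)"
      using l unfolding cell_avg_def by (intro tendsto_divide) auto
    then show ?thesis by (auto simp: convergent_def)
  qed
  have cau: "\<exists>n0. \<forall>n\<ge>n0. \<forall>m\<ge>n0. (\<integral>\<^sup>+ x. ennreal ((U (k n) x - U (k m) x)\<^sup>2) \<partial>lebesgue) \<le> ennreal e" if "0 < e" for e
    by (rule rellich_cauchy[where W = "\<lambda>n. U (k n)", OF s _ _ V B conv that]) auto
  obtain r u where ru: "strict_mono (r :: nat \<Rightarrow> nat)" "u \<in> borel_measurable lebesgue"
    "AE x in lebesgue. (\<lambda>n. U (k (r n)) x) \<longlonglongrightarrow> u x"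
    "(\<lambda>n. \<integral>\<^sup>+ x. ennreal ((U (k (r n)) x - u x)\<^sup>2) \<partial>lebesgue) \<longlonglongrightarrow> 0"
  proof (rule cauchy_L2_limit[of "\<lambda>n. U (k n)"])
    show "U (k n) \<in> borel_measurable lebesgue" "integrable lebesgue (\<lambda>x. (U (k n) x)\<^sup>2)" for n
      using U2 by auto
  qed (use cau in blast)+
  show thesis
    using that[of "k \<circ> r" u] ru k(1) by (simp add: strict_mono_o)
qed

section \<open>The energy space\<close>

text \<open>The kernel evaluates a function at two points; the exceptional pairs lie in the two null
  strips over a null set.\<close>

lemma AE_lebesgue_pair:
  fixes P :: "'a::euclidean_space \<Rightarrow> bool"
  assumes "AE x in lebesgue. P x"
  shows "AE z in (lebesgue \<Otimes>\<^sub>M lebesgue). P (fst z) \<and> P (snd z)"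
proof -
  obtain N where N: "{x \<in> space lebesgue. \<not> P x} \<subseteq> N" "emeasure lebesgue N = 0" "N \<in> sets lebesgue"
    using AE_E[OF assms] by blast
  have "N \<times> UNIV \<union> UNIV \<times> N \<in> null_sets (lebesgue \<Otimes>\<^sub>M lebesgue)"
  proof (rule null_sets.Un)
    show "N \<times> UNIV \<in> null_sets (lebesgue \<Otimes>\<^sub>M lebesgue)"
      using N leb.emeasure_pair_measure_Times[of N lebesgue UNIV]
      by (intro null_setsI pair_measureI) (auto simp: sets_completionI_sets)
    show "UNIV \<times> N \<in> null_sets (lebesgue \<Otimes>\<^sub>M lebesgue)"
      using N leb.emeasure_pair_measure_Times[of UNIV lebesgue N]
      by (intro null_setsI pair_measureI) (auto simp: sets_completionI_sets)
  qed
  then show ?thesis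
    by (rule AE_I') (use N in \<open>auto simp: space_pair_measure\<close>)
qed

lemma Xcomp_iff:
  "u \<in> Xcomp s V \<longleftrightarrow> u \<in> borel_measurable lebesgue \<and> integrable lebesgue (\<lambda>x. (u x)\<^sup>2)
    \<and> integrable (lebesgue \<Otimes>\<^sub>M lebesgue) (gagliardo_kernel s u u) \<and> integrable lebesgue (\<lambda>x. V x * (u x)\<^sup>2)"
  by (auto simp: Xcomp_def frac_sobolev_def Lspace_def)

lemma XcompD:
  assumes "u \<in> Xcomp s V"
  shows "u \<in> borel_measurable lebesgue" "integrable lebesgue (\<lambda>x. (u x)\<^sup>2)"
    "integrable (lebesgue \<Otimes>\<^sub>M lebesgue) (gagliardo_kernel s u u)" "integrable lebesgue (\<lambda>x. V x * (u x)\<^sup>2)"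
  using assms by (auto simp: Xcomp_iff)

text \<open>The inner product of a single component. On the energy space \<open>ip\<close> is the
  sum of two such forms, so estimates are done once for a general \<open>V\<close>.\<close>

definition form :: "real \<Rightarrow> (real ^ 'n \<Rightarrow> real) \<Rightarrow> (real ^ 'n \<Rightarrow> real) \<Rightarrow> (real ^ 'n \<Rightarrow> real) \<Rightarrow> real" where
  "form s V u \<phi> = (LINT z|(lebesgue \<Otimes>\<^sub>M lebesgue). gagliardo_kernel s u \<phi> z) + (LINT x|lebesgue. V x * u x * \<phi> x)"

lemma abs_mult_le_squares: "\<bar>a * b\<bar> \<le> a\<^sup>2 + (b::real)\<^sup>2"
proof -
  have "0 \<le> (\<bar>a\<bar> - \<bar>b\<bar>)\<^sup>2" by simp
  then have "2 * \<bar>a * b\<bar> \<le> a\<^sup>2 + b\<^sup>2" unfolding power2_diff by (simp add: abs_mult)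
  then show ?thesis by linarith
qed

lemma kernel_integrable:
  assumes "u \<in> Xcomp s V" "\<phi> \<in> Xcomp s V"
  shows "integrable (lebesgue \<Otimes>\<^sub>M lebesgue) (gagliardo_kernel s u \<phi>)"
proof (rule Bochner_Integration.integrable_bound)
  note [measurable] = XcompD(1)[OF assms(1)] XcompD(1)[OF assms(2)]
  show "integrable (lebesgue \<Otimes>\<^sub>M lebesgue) (\<lambda>z. gagliardo_kernel s u u z + gagliardo_kernel s \<phi> \<phi> z)"
    using XcompD(3)[OF assms(1)] XcompD(3)[OF assms(2)] by auto
  show "AE z in lebesgue \<Otimes>\<^sub>M lebesgue. norm (gagliardo_kernel s u \<phi> z) \<le> norm (gagliardo_kernel s u u z + gagliardo_kernel s \<phi> \<phi> z)"
  proof (intro always_eventually allI)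
    fix z
    have "\<bar>(u (fst z) - u (snd z)) * (\<phi> (fst z) - \<phi> (snd z))\<bar> / norm (fst z - snd z) powr (real CARD('a) + 2 * s)
      \<le> ((u (fst z) - u (snd z))\<^sup>2 + (\<phi> (fst z) - \<phi> (snd z))\<^sup>2) / norm (fst z - snd z) powr (real CARD('a) + 2 * s)"
      by (intro divide_right_mono abs_mult_le_squares) auto
    then show "norm (gagliardo_kernel s u \<phi> z) \<le> norm (gagliardo_kernel s u u z + gagliardo_kernel s \<phi> \<phi> z)"
      by (simp add: gagliardo_kernel_def split_beta abs_mult power2_eq_square add_divide_distrib)
  qed
qed (use XcompD(1)[OF assms(1)] XcompD(1)[OF assms(2)] in measurable)

lemma potential_integrable:
  assumes "u \<in> Xcomp s V" "\<phi> \<in> Xcomp s V" and [measurable]: "V \<in> borel_measurable lebesgue" and V: "\<And>x. 0 \<le> V x"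
  shows "integrable lebesgue (\<lambda>x. V x * u x * \<phi> x)"
proof (rule Bochner_Integration.integrable_bound)
  note [measurable] = XcompD(1)[OF assms(1)] XcompD(1)[OF assms(2)]
  show "integrable lebesgue (\<lambda>x. V x * (u x)\<^sup>2 + V x * (\<phi> x)\<^sup>2)"
    using XcompD(4)[OF assms(1)] XcompD(4)[OF assms(2)] by auto
  show "AE x in lebesgue. norm (V x * u x * \<phi> x) \<le> norm (V x * (u x)\<^sup>2 + V x * (\<phi> x)\<^sup>2)"
  proof (intro always_eventually allI)
    fix x
    have "V x * \<bar>u x * \<phi> x\<bar> \<le> V x * ((u x)\<^sup>2 + (\<phi> x)\<^sup>2)"
      using V[of x] by (intro mult_left_mono abs_mult_le_squares)
    then show "norm (V x * u x * \<phi> x) \<le> norm (V x * (u x)\<^sup>2 + V x * (\<phi> x)\<^sup>2)"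
      using V[of x] by (simp add: abs_mult distrib_left mult.assoc)
  qed
  show "(\<lambda>x. V x * u x * \<phi> x) \<in> borel_measurable lebesgue" by measurable
qed

lemma Xcomp_zero: "(\<lambda>x :: real ^ 'n. 0) \<in> Xcomp s V"
proof -
  have "gagliardo_kernel s (\<lambda>x :: real ^ 'n. 0) (\<lambda>x. 0) = (\<lambda>z. 0)"
    by (simp add: gagliardo_kernel_def fun_eq_iff)
  then show ?thesis by (simp add: Xcomp_iff)
qed

lemma Xcomp_add_scaled:
  assumes "u \<in> Xcomp s V" "\<phi> \<in> Xcomp s V" and V: "V \<in> borel_measurable lebesgue" "\<And>x. 0 \<le> V x"
  shows "(\<lambda>x. u x + t * \<phi> x) \<in> Xcomp s V"
    "form s V (\<lambda>x. u x + t * \<phi> x) (\<lambda>x. u x + t * \<phi> x) = form s V u u + 2 * t * form s V u \<phi> + t\<^sup>2 * form s V \<phi> \<phi>"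
proof -
  note [measurable] = XcompD(1)[OF assms(1)] XcompD(1)[OF assms(2)]
  note k = kernel_integrable[OF assms(1,1)] kernel_integrable[OF assms(1,2)] kernel_integrable[OF assms(2,2)]
  note p = potential_integrable[OF assms(1,1) V] potential_integrable[OF assms(1,2) V] potential_integrable[OF assms(2,2) V]
  let ?w = "\<lambda>x. u x + t * \<phi> x"
  have keq: "gagliardo_kernel s ?w ?w = (\<lambda>z. gagliardo_kernel s u u z + 2 * t * gagliardo_kernel s u \<phi> z + t\<^sup>2 * gagliardo_kernel s \<phi> \<phi> z)"
  proof
    fix z
    have "((A + t * a) - (B + t * b)) * ((A + t * a) - (B + t * b)) / d
      = (A - B) * (A - B) / d + 2 * t * ((A - B) * (a - b) / d) + t\<^sup>2 * ((a - b) * (a - b) / d)" for A B a b d :: real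
      by (simp add: divide_inverse) algebra
    then show "gagliardo_kernel s ?w ?w z = gagliardo_kernel s u u z + 2 * t * gagliardo_kernel s u \<phi> z + t\<^sup>2 * gagliardo_kernel s \<phi> \<phi> z"
      unfolding gagliardo_kernel_def split_beta by blast
  qed
  have peq: "V x * ?w x * ?w x = V x * u x * u x + 2 * t * (V x * u x * \<phi> x) + t\<^sup>2 * (V x * \<phi> x * \<phi> x)" for x
    by (simp add: power2_eq_square algebra_simps)
  have ik: "integrable (lebesgue \<Otimes>\<^sub>M lebesgue) (gagliardo_kernel s ?w ?w)"
    unfolding keq using k by (intro Bochner_Integration.integrable_add integrable_mult_right)
  have ip: "integrable lebesgue (\<lambda>x. V x * ?w x * ?w x)"
    unfolding peq using p by (intro Bochner_Integration.integrable_add integrable_mult_right)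
  have i2: "integrable lebesgue (\<lambda>x. (?w x)\<^sup>2)"
  proof (rule Bochner_Integration.integrable_bound)
    show "integrable lebesgue (\<lambda>x. 2 * (u x)\<^sup>2 + 2 * t\<^sup>2 * (\<phi> x)\<^sup>2)"
      using XcompD(2)[OF assms(1)] XcompD(2)[OF assms(2)] by (intro Bochner_Integration.integrable_add integrable_mult_right)
    show "AE x in lebesgue. norm ((?w x)\<^sup>2) \<le> norm (2 * (u x)\<^sup>2 + 2 * t\<^sup>2 * (\<phi> x)\<^sup>2)"
    proof (intro always_eventually allI)
      fix x
      have "0 \<le> (u x - t * \<phi> x)\<^sup>2" by simp
      then have "(?w x)\<^sup>2 \<le> 2 * (u x)\<^sup>2 + 2 * t\<^sup>2 * (\<phi> x)\<^sup>2" unfolding power2_diff power2_sum power_mult_distrib by linarith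
      then show "norm ((?w x)\<^sup>2) \<le> norm (2 * (u x)\<^sup>2 + 2 * t\<^sup>2 * (\<phi> x)\<^sup>2)" by simp
    qed
  qed simp
  show "?w \<in> Xcomp s V"
    unfolding Xcomp_iff using ik ip i2 by (simp add: power2_eq_square mult.assoc)
  have "(LINT z|(lebesgue \<Otimes>\<^sub>M lebesgue). gagliardo_kernel s ?w ?w z)
     = (LINT z|(lebesgue \<Otimes>\<^sub>M lebesgue). gagliardo_kernel s u u z) + 2 * t * (LINT z|(lebesgue \<Otimes>\<^sub>M lebesgue). gagliardo_kernel s u \<phi> z)
       + t\<^sup>2 * (LINT z|(lebesgue \<Otimes>\<^sub>M lebesgue). gagliardo_kernel s \<phi> \<phi> z)"
    unfolding keq using k by simp
  moreover have "(LINT x|lebesgue. V x * ?w x * ?w x) = (LINT x|lebesgue. V x * u x * u x)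
     + 2 * t * (LINT x|lebesgue. V x * u x * \<phi> x) + t\<^sup>2 * (LINT x|lebesgue. V x * \<phi> x * \<phi> x)"
    unfolding peq using p by simp
  ultimately show "form s V ?w ?w = form s V u u + 2 * t * form s V u \<phi> + t\<^sup>2 * form s V \<phi> \<phi>"
    unfolding form_def by (simp add: algebra_simps)
qed

lemma form_nonneg:
  assumes "\<And>x. 0 \<le> V x"
  shows "0 \<le> form s V u u"
  unfolding form_def using assms
  by (intro add_nonneg_nonneg integral_nonneg_AE always_eventually allI gagliardo_kernel_nonneg)
     (auto simp: mult.assoc)

lemma Xcomp_scale:
  assumes "u \<in> Xcomp s V"
  shows "(\<lambda>x. t * u x) \<in> Xcomp s V" "form s V (\<lambda>x. t * u x) (\<lambda>x. t * u x) = t\<^sup>2 * form s V u u"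
proof -
  note [measurable] = XcompD(1)[OF assms]
  have k: "gagliardo_kernel s (\<lambda>x. t * u x) (\<lambda>x. t * u x) = (\<lambda>z. t\<^sup>2 * gagliardo_kernel s u u z)"
    by (simp add: gagliardo_kernel_def split_beta fun_eq_iff power2_eq_square flip: right_diff_distrib)
  have p: "V x * (t * u x)\<^sup>2 = t\<^sup>2 * (V x * (u x)\<^sup>2)" for x by (simp add: power_mult_distrib)
  show "(\<lambda>x. t * u x) \<in> Xcomp s V"
    unfolding Xcomp_iff k p using XcompD[OF assms]
    by (auto simp: power_mult_distrib)
  have "(LINT x|lebesgue. V x * (t * u x) * (t * u x)) = t\<^sup>2 * (LINT x|lebesgue. V x * u x * u x)"
    by (subst integral_mult_right_zero[symmetric]) (simp add: power2_eq_square mult_ac)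
  then show "form s V (\<lambda>x. t * u x) (\<lambda>x. t * u x) = t\<^sup>2 * form s V u u"
    unfolding form_def k by (simp add: distrib_left)
qed

lemma form_minus_right: "form s V u (\<lambda>x. - \<phi> x) = - form s V u \<phi>"
proof -
  have k: "gagliardo_kernel s u (\<lambda>x. - \<phi> x) z = - gagliardo_kernel s u \<phi> z" for z
    by (simp add: gagliardo_kernel_def split_beta algebra_simps minus_divide_left diff_divide_distrib)
  show ?thesis by (simp add: form_def k)
qed

text \<open>Taking absolute values shortens all differences. This is what permits a nonnegative
  minimizer and, later, test functions of arbitrary sign.\<close>

lemma Xcomp_abs:
  assumes "u \<in> Xcomp s V"
  shows "(\<lambda>x. \<bar>u x\<bar>) \<in> Xcomp s V" "form s V (\<lambda>x. \<bar>u x\<bar>) (\<lambda>x. \<bar>u x\<bar>) \<le> form s V u u"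
proof -
  note [measurable] = XcompD(1)[OF assms]
  have k: "gagliardo_kernel s (\<lambda>x. \<bar>u x\<bar>) (\<lambda>x. \<bar>u x\<bar>) z \<le> gagliardo_kernel s u u z" for z
  proof -
    have "\<bar>\<bar>u (fst z)\<bar> - \<bar>u (snd z)\<bar>\<bar> \<le> \<bar>u (fst z) - u (snd z)\<bar>" by linarith
    then have "(\<bar>u (fst z)\<bar> - \<bar>u (snd z)\<bar>)\<^sup>2 \<le> (u (fst z) - u (snd z))\<^sup>2" by (simp only: abs_le_square_iff)
    then show ?thesis
      by (simp add: gagliardo_kernel_def split_beta power2_eq_square divide_right_mono)
  qed
  have ik: "integrable (lebesgue \<Otimes>\<^sub>M lebesgue) (gagliardo_kernel s (\<lambda>x. \<bar>u x\<bar>) (\<lambda>x. \<bar>u x\<bar>))"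
    by (rule Bochner_Integration.integrable_bound[OF XcompD(3)[OF assms]])
       (use k in \<open>auto intro!: always_eventually simp: gagliardo_kernel_nonneg\<close>)
  show "(\<lambda>x. \<bar>u x\<bar>) \<in> Xcomp s V"
    unfolding Xcomp_iff using ik XcompD[OF assms] by auto
  have "(LINT z|(lebesgue \<Otimes>\<^sub>M lebesgue). gagliardo_kernel s (\<lambda>x. \<bar>u x\<bar>) (\<lambda>x. \<bar>u x\<bar>) z) \<le> (LINT z|(lebesgue \<Otimes>\<^sub>M lebesgue). gagliardo_kernel s u u z)"
    by (intro integral_mono ik XcompD(3)[OF assms] k)
  then show "form s V (\<lambda>x. \<bar>u x\<bar>) (\<lambda>x. \<bar>u x\<bar>) \<le> form s V u u"
    by (simp add: form_def mult.assoc)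
qed

lemma Xcomp_nn:
  assumes "u \<in> Xcomp s V" and V: "\<And>x. 0 \<le> V x"
  shows "gagliardo_nn s u \<le> ennreal (form s V u u)"
    "(\<integral>\<^sup>+ x. ennreal (V x * (u x)\<^sup>2) \<partial>lebesgue) \<le> ennreal (form s V u u)"
    "gagliardo_nn s u + (\<integral>\<^sup>+ x. ennreal (V x * (u x)\<^sup>2) \<partial>lebesgue) = ennreal (form s V u u)"
proof -
  have 1: "gagliardo_nn s u = ennreal (LINT z|(lebesgue \<Otimes>\<^sub>M lebesgue). gagliardo_kernel s u u z)"
    unfolding gagliardo_nn_def using XcompD(3)[OF assms(1)]
    by (intro nn_integral_eq_integral always_eventually allI gagliardo_kernel_nonneg)
  have 2: "(\<integral>\<^sup>+ x. ennreal (V x * (u x)\<^sup>2) \<partial>lebesgue) = ennreal (LINT x|lebesgue. V x * (u x)\<^sup>2)"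
    using XcompD(4)[OF assms(1)] V by (intro nn_integral_eq_integral) auto
  have nn: "0 \<le> (LINT z|(lebesgue \<Otimes>\<^sub>M lebesgue). gagliardo_kernel s u u z)" "0 \<le> (LINT x|lebesgue. V x * (u x)\<^sup>2)"
    using V by (auto intro!: integral_nonneg_AE always_eventually gagliardo_kernel_nonneg)
  have f: "form s V u u = (LINT z|(lebesgue \<Otimes>\<^sub>M lebesgue). gagliardo_kernel s u u z) + (LINT x|lebesgue. V x * (u x)\<^sup>2)"
    by (simp add: form_def power2_eq_square mult.assoc)
  show 3: "gagliardo_nn s u + (\<integral>\<^sup>+ x. ennreal (V x * (u x)\<^sup>2) \<partial>lebesgue) = ennreal (form s V u u)"
    unfolding 1 2 f using nn by simp
  show "gagliardo_nn s u \<le> ennreal (form s V u u)" "(\<integral>\<^sup>+ x. ennreal (V x * (u x)\<^sup>2) \<partial>lebesgue) \<le> ennreal (form s V u u)"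
    unfolding 3[symmetric] by (auto intro: add_increasing add_increasing2)
qed

lemma Xcomp_L2_le:
  assumes "u \<in> Xcomp s V" and V: "0 < V0" "\<And>x. V0 \<le> V x"
  shows "V0 * (LINT x|lebesgue. (u x)\<^sup>2) \<le> form s V u u"
    "(\<integral>\<^sup>+ x. ennreal ((u x)\<^sup>2) \<partial>lebesgue) \<le> ennreal (form s V u u / V0)"
proof -
  have V': "0 \<le> V x" for x using V(1) V(2)[of x] by simp
  have "V0 * (LINT x|lebesgue. (u x)\<^sup>2) = (LINT x|lebesgue. V0 * (u x)\<^sup>2)" by simp
  also have "\<dots> \<le> (LINT x|lebesgue. V x * (u x)\<^sup>2)"
    using XcompD[OF assms(1)] V by (intro integral_mono mult_right_mono) auto
  also have "\<dots> \<le> form s V u u"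
    by (simp add: form_def power2_eq_square mult.assoc integral_nonneg_AE gagliardo_kernel_nonneg)
  finally show *: "V0 * (LINT x|lebesgue. (u x)\<^sup>2) \<le> form s V u u" .
  have "(\<integral>\<^sup>+ x. ennreal ((u x)\<^sup>2) \<partial>lebesgue) = ennreal (LINT x|lebesgue. (u x)\<^sup>2)"
    using XcompD(2)[OF assms(1)] by (intro nn_integral_eq_integral) auto
  also have "\<dots> \<le> ennreal (form s V u u / V0)" using * V(1) by (intro ennreal_leI) (simp add: field_simps)
  finally show "(\<integral>\<^sup>+ x. ennreal ((u x)\<^sup>2) \<partial>lebesgue) \<le> ennreal (form s V u u / V0)" .
qed

lemma XcompI_nn:
  assumes [measurable]: "u \<in> borel_measurable lebesgue" "V \<in> borel_measurable lebesgue" and V: "\<And>x. 0 \<le> V x"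
    and "(\<integral>\<^sup>+ x. ennreal ((u x)\<^sup>2) \<partial>lebesgue) < \<infinity>" "gagliardo_nn s u < \<infinity>"
    "(\<integral>\<^sup>+ x. ennreal (V x * (u x)\<^sup>2) \<partial>lebesgue) < \<infinity>"
  shows "u \<in> Xcomp s V"
  unfolding Xcomp_iff using assms
  by (auto intro!: integrableI_bounded simp: gagliardo_nn_def gagliardo_kernel_nonneg)

text \<open>Allows Fatou's lemma to be applied to the Gagliardo part and to the potential part
  separately.\<close>

lemma ennreal_liminf_add_mono:
  fixes X Y :: "nat \<Rightarrow> ennreal"
  shows "liminf X + liminf Y \<le> liminf (\<lambda>n. X n + Y n)"
proof -
  have inc: "incseq (\<lambda>n. INF m\<in>{n..}. Z m)" for Z :: "nat \<Rightarrow> ennreal"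
    by (intro incseq_SucI INF_superset_mono) auto
  have "liminf X + liminf Y = (SUP n. (INF m\<in>{n..}. X m) + (INF m\<in>{n..}. Y m))"
    unfolding liminf_SUP_INF by (rule ennreal_SUP_add[OF inc inc, symmetric])
  also have "\<dots> \<le> liminf (\<lambda>n. X n + Y n)"
    unfolding liminf_SUP_INF by (intro SUP_mono' INF_greatest add_mono INF_lower)
  finally show ?thesis .
qed

text \<open>Fatou's lemma on both integrals. The limit is merely measurable at first, so membership
  in the space is part of the conclusion; its square integrability follows from the lower bound on
  \<open>V\<close>.\<close>

lemma form_lower_semicontinuous:
  fixes U :: "nat \<Rightarrow> real ^ 'n \<Rightarrow> real"
  assumes U: "\<And>n. U n \<in> Xcomp s V" and [measurable]: "u \<in> borel_measurable lebesgue" "V \<in> borel_measurable lebesgue"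
    and V: "0 < V0" "\<And>x. V0 \<le> V x"
    and AE: "AE x in lebesgue. (\<lambda>n. U n x) \<longlonglongrightarrow> u x" and L: "(\<lambda>n. form s V (U n) (U n)) \<longlonglongrightarrow> L"
  shows "u \<in> Xcomp s V" "form s V u u \<le> L"
proof -
  note [measurable] = XcompD(1)[OF U]
  have V': "0 \<le> V x" for x using V(1) V(2)[of x] by simp
  have "ennreal (gagliardo_kernel s u u z) = liminf (\<lambda>n. ennreal (gagliardo_kernel s (U n) (U n) z))"
    if "(\<lambda>n. U n (fst z)) \<longlonglongrightarrow> u (fst z)" "(\<lambda>n. U n (snd z)) \<longlonglongrightarrow> u (snd z)" for z
  proof -
    have "(\<lambda>n. gagliardo_kernel s (U n) (U n) z) \<longlonglongrightarrow> gagliardo_kernel s u u z"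
      unfolding gagliardo_kernel_def split_beta divide_inverse using that by (intro tendsto_intros)
    then have "(\<lambda>n. ennreal (gagliardo_kernel s (U n) (U n) z)) \<longlonglongrightarrow> ennreal (gagliardo_kernel s u u z)"
      by (rule tendsto_ennrealI)
    then show ?thesis by (intro lim_imp_Liminf[symmetric]) simp_all
  qed
  with AE_lebesgue_pair[OF AE]
  have "AE z in (lebesgue \<Otimes>\<^sub>M lebesgue). ennreal (gagliardo_kernel s u u z) = liminf (\<lambda>n. ennreal (gagliardo_kernel s (U n) (U n) z))"
    by (auto elim: eventually_mono)
  then have "gagliardo_nn s u = (\<integral>\<^sup>+ z. liminf (\<lambda>n. ennreal (gagliardo_kernel s (U n) (U n) z)) \<partial>(lebesgue \<Otimes>\<^sub>M lebesgue))"
    unfolding gagliardo_nn_def by (rule nn_integral_cong_AE)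
  also have "\<dots> \<le> liminf (\<lambda>n. gagliardo_nn s (U n))"
    unfolding gagliardo_nn_def by (rule nn_integral_liminf) measurable
  finally have 1: "gagliardo_nn s u \<le> liminf (\<lambda>n. gagliardo_nn s (U n))" .
  have "AE x in lebesgue. ennreal (V x * (u x)\<^sup>2) = liminf (\<lambda>n. ennreal (V x * (U n x)\<^sup>2))"
    using AE
  proof eventually_elim
    fix x assume "(\<lambda>n. U n x) \<longlonglongrightarrow> u x"
    then have "(\<lambda>n. ennreal (V x * (U n x)\<^sup>2)) \<longlonglongrightarrow> ennreal (V x * (u x)\<^sup>2)"
      by (intro tendsto_ennrealI tendsto_intros)
    then show "ennreal (V x * (u x)\<^sup>2) = liminf (\<lambda>n. ennreal (V x * (U n x)\<^sup>2))" by (intro lim_imp_Liminf[symmetric]) simp_all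
  qed
  then have "(\<integral>\<^sup>+ x. ennreal (V x * (u x)\<^sup>2) \<partial>lebesgue) = (\<integral>\<^sup>+ x. liminf (\<lambda>n. ennreal (V x * (U n x)\<^sup>2)) \<partial>lebesgue)"
    by (rule nn_integral_cong_AE)
  also have "\<dots> \<le> liminf (\<lambda>n. \<integral>\<^sup>+ x. ennreal (V x * (U n x)\<^sup>2) \<partial>lebesgue)"
    by (rule nn_integral_liminf) measurable
  finally have 2: "(\<integral>\<^sup>+ x. ennreal (V x * (u x)\<^sup>2) \<partial>lebesgue) \<le> liminf (\<lambda>n. \<integral>\<^sup>+ x. ennreal (V x * (U n x)\<^sup>2) \<partial>lebesgue)" .
  have "gagliardo_nn s u + (\<integral>\<^sup>+ x. ennreal (V x * (u x)\<^sup>2) \<partial>lebesgue)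
     \<le> liminf (\<lambda>n. gagliardo_nn s (U n)) + liminf (\<lambda>n. \<integral>\<^sup>+ x. ennreal (V x * (U n x)\<^sup>2) \<partial>lebesgue)"
    using 1 2 by (rule add_mono)
  also have "\<dots> \<le> liminf (\<lambda>n. gagliardo_nn s (U n) + (\<integral>\<^sup>+ x. ennreal (V x * (U n x)\<^sup>2) \<partial>lebesgue))"
    by (rule ennreal_liminf_add_mono)
  also have "\<dots> = liminf (\<lambda>n. ennreal (form s V (U n) (U n)))"
    using Xcomp_nn(3)[OF U V'] by simp
  also have "\<dots> = ennreal L"
    using tendsto_ennrealI[OF L] by (intro lim_imp_Liminf) simp_all
  finally have 3: "gagliardo_nn s u + (\<integral>\<^sup>+ x. ennreal (V x * (u x)\<^sup>2) \<partial>lebesgue) \<le> ennreal L" .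
  have fin: "gagliardo_nn s u < \<infinity>" "(\<integral>\<^sup>+ x. ennreal (V x * (u x)\<^sup>2) \<partial>lebesgue) < \<infinity>"
    using le_less_trans[OF 3, of \<infinity>] by auto
  have "(\<integral>\<^sup>+ x. ennreal ((u x)\<^sup>2) \<partial>lebesgue) \<le> (\<integral>\<^sup>+ x. ennreal (1 / V0) * ennreal (V x * (u x)\<^sup>2) \<partial>lebesgue)"
  proof (rule nn_integral_mono)
    fix x
    have "V0 * (u x)\<^sup>2 \<le> V x * (u x)\<^sup>2" using V by (intro mult_right_mono) auto
    then have "(u x)\<^sup>2 \<le> 1 / V0 * (V x * (u x)\<^sup>2)" using V(1) by (simp add: field_simps)
    then show "ennreal ((u x)\<^sup>2) \<le> ennreal (1 / V0) * ennreal (V x * (u x)\<^sup>2)"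
      using V(1) V'[of x] by (subst ennreal_mult[symmetric]) (auto intro: ennreal_leI)
  qed
  also have "\<dots> = ennreal (1 / V0) * (\<integral>\<^sup>+ x. ennreal (V x * (u x)\<^sup>2) \<partial>lebesgue)"
    by (intro nn_integral_cmult) measurable
  also have "\<dots> < \<infinity>" using fin(2) by (simp add: ennreal_mult_less_top)
  finally show X: "u \<in> Xcomp s V" using fin by (intro XcompI_nn V') auto
  have "0 \<le> L"
    using L by (rule LIMSEQ_le_const) (intro exI allI impI form_nonneg V')
  then show "form s V u u \<le> L" using 3 unfolding Xcomp_nn(3)[OF X V'] by simp
qed

section \<open>Explicit test functions\<close>

lemma exists_dyadic:
  assumes "0 < (d::real)" "d \<le> 1"
  shows "\<exists>k::nat. d \<le> 2 powr (- real k) \<and> 2 powr (- real (Suc k)) < d"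
proof -
  obtain n where n: "1 / d < 2 ^ n" using real_arch_pow[of 2 "1 / d"] by auto
  define m where "m = (LEAST n. 1 / d < 2 ^ n)"
  have m: "1 / d < 2 ^ m" unfolding m_def by (rule LeastI[of _ n]) (rule n)
  have "m \<noteq> 0" using m assms by (intro notI) (simp add: field_simps)
  then obtain k where k: "m = Suc k" by (cases m) auto
  have "\<not> 1 / d < 2 ^ k" using not_less_Least[of k "\<lambda>n. 1 / d < 2 ^ n"] k unfolding m_def by simp
  then have 1: "d \<le> 2 powr (- real k)" using assms by (simp add: powr_minus powr_realpow field_simps)
  have "2 powr (- real (Suc k)) < d" using m assms unfolding k
    by (simp only: powr_minus powr_realpow) (simp add: field_simps)
  with 1 show ?thesis by blast
qed

text \<open>Near the diagonal the square of the distance tames the singularity because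
  \<open>s < 1\<close>; far away the constant \<open>R\<^sup>2\<close> is integrable against the
  kernel because \<open>s > 0\<close>. Dyadic shells turn this into two geometric series with ratios
  \<open>2 powr (2 * s - 2)\<close> and \<open>2 powr (- 2 * s)\<close>.\<close>

lemma truncated_kernel_bound:
  fixes s R :: real
  assumes s: "0 < s" "s < 1"
  defines "k \<equiv> \<lambda>(x :: real ^ 'n) y. min ((norm (x - y))\<^sup>2) (R\<^sup>2) / norm (x - y) powr (real CARD('n) + 2 * s)"
  obtains K where "0 < K" "\<And>x. (\<integral>\<^sup>+ y. ennreal (k x y) \<partial>lebesgue) \<le> ennreal K"
proof -
  let ?N = "real CARD('n)" and ?c = "unit_ball_vol (real CARD('n))"
  let ?e = "?N + 2 * s"
  have c: "0 \<le> ?c" by simp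
  \<comment> \<open>\<open>A i\<close> and \<open>B i\<close> bound the kernel on the shells inside
    and outside the unit ball. Integrating over the full ball around each shell only changes
    constants.\<close>
  define A where "A i = 2 powr (- 2 * real i) * 2 powr (real (Suc i) * ?e)" for i :: nat
  define B where "B i = R\<^sup>2 * 2 powr (- real i * ?e)" for i :: nat
  have AB: "0 \<le> A i" "0 \<le> B i" for i by (simp_all add: A_def B_def)
  let ?a = "\<lambda>(x :: real ^ 'n) i y. ennreal (A i) * indicator (cball x (2 powr (- real i))) y"
  let ?b = "\<lambda>(x :: real ^ 'n) i y. ennreal (B i) * indicator (cball x (2 powr (real (Suc i)))) y"
  have pw: "ennreal (k x y) \<le> (\<Sum>i. ?a x i y) + (\<Sum>i. ?b x i y)" for x y
  proof -
    define d where "d = norm (x - y)"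
    have up: "f i \<le> (\<Sum>i. f i)" for f :: "nat \<Rightarrow> ennreal" and i
      using sum_le_suminf[OF summableI, of "{i}" f] by simp
    consider "d = 0" | "0 < d" "d \<le> 1" | "1 < d" unfolding d_def using norm_ge_zero[of "x - y"] by linarith
    then show ?thesis
    proof cases
      case 1
      then show ?thesis by (simp add: k_def d_def)
    next
      case 2
      then obtain i :: nat where i: "d \<le> 2 powr (- real i)" "2 powr (- real (Suc i)) < d" using exists_dyadic by blast
      have "d\<^sup>2 \<le> (2 powr (- real i))\<^sup>2" using i 2 by (intro power_mono) auto
      also have "\<dots> = 2 powr (- 2 * real i)" by (simp add: power2_eq_square flip: powr_add)
      finally have d2: "d\<^sup>2 \<le> 2 powr (- 2 * real i)" .
      have "d powr (- ?e) \<le> (2 powr (- real (Suc i))) powr (- ?e)"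
        using i s by (intro powr_mono2') auto
      also have "\<dots> = 2 powr (real (Suc i) * ?e)" by (simp only: powr_powr) (simp add: algebra_simps)
      finally have "min (d\<^sup>2) (R\<^sup>2) * d powr (- ?e) \<le> A i"
        unfolding A_def using d2 by (intro mult_mono) auto
      then have "k x y \<le> A i" unfolding k_def d_def[symmetric] powr_minus[of d ?e] divide_inverse .
      then have "ennreal (k x y) \<le> ?a x i y"
        using i(1) by (auto simp: indicator_def dist_norm d_def intro!: ennreal_leI)
      also have "\<dots> \<le> (\<Sum>i. ?a x i y)" by (rule up)
      finally show ?thesis by (rule add_increasing2[rotated]) simp
    next
      case 3
      then obtain i :: nat where i: "1 / d \<le> 2 powr (- real i)" "2 powr (- real (Suc i)) < 1 / d" using exists_dyadic[of "1 / d"] by auto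
      have i1: "2 powr (real i) \<le> d" using i(1) 3 by (simp add: powr_minus field_simps)
      have i2: "d \<le> 2 powr (real (Suc i))" using i(2) 3 by (simp only: powr_minus) (simp add: field_simps)
      have "d powr (- ?e) \<le> (2 powr (real i)) powr (- ?e)"
        using i1 s by (intro powr_mono2') auto
      also have "\<dots> = 2 powr (- real i * ?e)" by (simp only: powr_powr) (simp add: algebra_simps)
      finally have "min (d\<^sup>2) (R\<^sup>2) * d powr (- ?e) \<le> B i"
        unfolding B_def by (intro mult_mono) auto
      then have "k x y \<le> B i" unfolding k_def d_def[symmetric] powr_minus[of d ?e] divide_inverse .
      then have "ennreal (k x y) \<le> ?b x i y"
        using i2 by (auto simp: indicator_def dist_norm d_def intro!: ennreal_leI)
      also have "\<dots> \<le> (\<Sum>i. ?b x i y)" by (rule up)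
      finally show ?thesis by (rule add_increasing[rotated]) simp
    qed
  qed
  have ball: "emeasure lebesgue (cball (x :: real ^ 'n) r) = ennreal (?c * r powr ?N)" if "0 < r" for x r
    using emeasure_cball[of r x] that by (simp add: powr_realpow)
  have cb [measurable]: "cball (x :: real ^ 'n) r \<in> sets lebesgue" for x r by simp
  have Ia: "(\<integral>\<^sup>+ y. ?a x i y \<partial>lebesgue) = ennreal (?c * 2 powr ?e * (2 powr (2 * s - 2)) ^ i)" for x i
  proof -
    have "(\<integral>\<^sup>+ y. ?a x i y \<partial>lebesgue) = ennreal (A i) * ennreal (?c * (2 powr (- real i)) powr ?N)"
      using ball[of "2 powr (- real i)" x] by (simp add: nn_integral_cmult_indicator)
    also have "\<dots> = ennreal (A i * (?c * (2 powr (- real i)) powr ?N))" using AB c by (intro ennreal_mult[symmetric]) auto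
    also have "A i * (?c * (2 powr (- real i)) powr ?N) = ?c * (2 powr (- 2 * real i) * 2 powr (real (Suc i) * ?e) * 2 powr (- real i * ?N))"
      by (simp add: A_def powr_powr)
    also have "2 powr (- 2 * real i) * 2 powr (real (Suc i) * ?e) * 2 powr (- real i * ?N) = 2 powr ?e * (2 powr (2 * s - 2)) powr (real i)"
      unfolding powr_powr by (simp only: powr_add[symmetric]) (simp add: algebra_simps)
    finally show ?thesis by (simp add: powr_realpow mult.assoc)
  qed
  have Ib: "(\<integral>\<^sup>+ y. ?b x i y \<partial>lebesgue) = ennreal (R\<^sup>2 * ?c * 2 powr ?N * (2 powr (- 2 * s)) ^ i)" for x i
  proof -
    have "(\<integral>\<^sup>+ y. ?b x i y \<partial>lebesgue) = ennreal (B i) * ennreal (?c * (2 powr (real (Suc i))) powr ?N)"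
      using ball[of "2 powr (real (Suc i))" x] by (simp add: nn_integral_cmult_indicator)
    also have "\<dots> = ennreal (B i * (?c * (2 powr (real (Suc i))) powr ?N))" using AB c by (intro ennreal_mult[symmetric]) auto
    also have "B i * (?c * (2 powr (real (Suc i))) powr ?N) = R\<^sup>2 * ?c * (2 powr (- real i * ?e) * 2 powr (real (Suc i) * ?N))"
      by (simp only: B_def powr_powr) (simp add: mult_ac)
    also have "2 powr (- real i * ?e) * 2 powr (real (Suc i) * ?N) = 2 powr ?N * (2 powr (- 2 * s)) powr (real i)"
      unfolding powr_powr by (simp only: powr_add[symmetric]) (simp add: algebra_simps)
    finally show ?thesis by (simp add: powr_realpow mult.assoc)
  qed
  let ?S1 = "?c * 2 powr ?e * (\<Sum>i. (2 powr (2 * s - 2)) ^ i)" and ?S2 = "R\<^sup>2 * ?c * 2 powr ?N * (\<Sum>i. (2 powr (- 2 * s)) ^ i)"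
  have g1: "2 powr (2 * s - 2) < 1" "2 powr (- 2 * s) < 1" using s by (auto intro!: powr_less_one)
  have s1: "summable (\<lambda>i. (2 powr (2 * s - 2)) ^ i)" "summable (\<lambda>i. (2 powr (- 2 * s)) ^ i)"
    using g1 by (auto intro!: summable_geometric)
  show thesis
  proof (rule that)
    have nn: "0 \<le> ?S1" "0 \<le> ?S2" using s1 c by (auto intro!: mult_nonneg_nonneg suminf_nonneg)
    then show "0 < ?S1 + ?S2 + 1" by linarith
    fix x
    have "(\<integral>\<^sup>+ y. ennreal (k x y) \<partial>lebesgue) \<le> (\<integral>\<^sup>+ y. (\<Sum>i. ?a x i y) + (\<Sum>i. ?b x i y) \<partial>lebesgue)"
      by (intro nn_integral_mono pw)
    also have "\<dots> = (\<Sum>i. \<integral>\<^sup>+ y. ?a x i y \<partial>lebesgue) + (\<Sum>i. \<integral>\<^sup>+ y. ?b x i y \<partial>lebesgue)"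
      by (subst nn_integral_add) (auto intro!: nn_integral_suminf arg_cong2[where f = "(+)"])
    also have "\<dots> = ennreal ?S1 + ennreal ?S2"
    proof -
      have "(\<Sum>i. ennreal (?c * 2 powr ?e * (2 powr (2 * s - 2)) ^ i)) = ennreal (\<Sum>i. ?c * 2 powr ?e * (2 powr (2 * s - 2)) ^ i)"
        using c s1 by (intro suminf_ennreal2 summable_mult) auto
      moreover have "(\<Sum>i. ennreal (R\<^sup>2 * ?c * 2 powr ?N * (2 powr (- 2 * s)) ^ i)) = ennreal (\<Sum>i. R\<^sup>2 * ?c * 2 powr ?N * (2 powr (- 2 * s)) ^ i)"
        using c s1 by (intro suminf_ennreal2 summable_mult) auto
      ultimately show ?thesis unfolding Ia Ib using s1 by (simp only: suminf_mult)
    qed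
    also have "\<dots> \<le> ennreal (?S1 + ?S2 + 1)"
      using nn by (subst ennreal_plus[symmetric]) (auto intro!: ennreal_leI)
    finally show "(\<integral>\<^sup>+ y. ennreal (k x y) \<partial>lebesgue) \<le> ennreal (?S1 + ?S2 + 1)" .
  qed
qed

lemma borel_measurable_lebesgue_continuous:
  fixes f :: "'a::euclidean_space \<Rightarrow> real"
  assumes "continuous_on UNIV f"
  shows "f \<in> borel_measurable lebesgue"
  using borel_measurable_continuous_onI[OF assms] by (intro measurable_completion) simp

text \<open>A tent: Lipschitz with constant 1, bounded by \<open>R\<close> for positive
  \<open>R\<close>, and positive exactly on the open ball. Lipschitz regularity suffices here, so no
  smooth cutoff is built.\<close>

definition bump :: "real \<Rightarrow> real ^ 'n \<Rightarrow> real" where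
  "bump R x = max 0 (R - norm x)"

lemma bump_nonneg: "0 \<le> bump R x" and bump_pos: "norm x < R \<Longrightarrow> 0 < bump R x"
  by (auto simp: bump_def)

text \<open>Differences of the tent are at most the distance and at most \<open>R\<close>, and
  vanish unless one of the points lies in the ball. So the kernel is below the truncated one,
  integrated over a ball in either variable.\<close>

lemma bump_in_Xcomp:
  fixes V :: "real ^ 'n \<Rightarrow> real"
  assumes s: "0 < s" "s < 1" and V: "continuous_on UNIV V" "\<And>x. 0 \<le> V x" and R: "0 < R"
  shows "bump R \<in> Xcomp s V"
proof (rule XcompI_nn)
  have "continuous_on UNIV (bump R :: real ^ 'n \<Rightarrow> real)" unfolding bump_def by (intro continuous_intros)
  then show bump_m [measurable]: "(bump R :: real ^ 'n \<Rightarrow> real) \<in> borel_measurable lebesgue"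
    by (rule borel_measurable_lebesgue_continuous)
  show [measurable]: "V \<in> borel_measurable lebesgue"
    using V(1) by (rule borel_measurable_lebesgue_continuous)
  show "0 \<le> V x" for x by (rule V)
  let ?B = "cball (0 :: real ^ 'n) R"
  have [measurable]: "?B \<in> sets lebesgue" by simp
  have Bfin: "emeasure lebesgue ?B < \<infinity>" by (simp add: emeasure_cball R less_imp_le)
  have out: "bump R x = 0" if "x \<notin> ?B" for x using that by (simp add: bump_def)
  have le: "(bump R x)\<^sup>2 \<le> R\<^sup>2" for x using R by (intro power_mono) (auto simp: bump_def)
  have "(\<integral>\<^sup>+ (x :: real ^ 'n). ennreal ((bump R x)\<^sup>2) \<partial>lebesgue) \<le> (\<integral>\<^sup>+ x. ennreal (R\<^sup>2) * indicator ?B x \<partial>lebesgue)"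
  proof (rule nn_integral_mono)
    fix x :: "real ^ 'n"
    show "ennreal ((bump R x)\<^sup>2) \<le> ennreal (R\<^sup>2) * indicator ?B x"
      using le[of x] out[of x] by (cases "x \<in> ?B") (auto intro: ennreal_leI)
  qed
  also have "\<dots> < \<infinity>" using Bfin by (simp add: nn_integral_cmult_indicator ennreal_mult_less_top)
  finally show "(\<integral>\<^sup>+ x. ennreal ((bump R (x :: real ^ 'n))\<^sup>2) \<partial>lebesgue) < \<infinity>" .
  have "compact (V ` ?B)" using V(1) by (intro compact_continuous_image continuous_on_subset[OF V(1)]) auto
  then have "bdd_above (V ` ?B)" by (intro bounded_imp_bdd_above compact_imp_bounded)
  then have "\<exists>M. \<forall>x\<in>?B. V x \<le> M" unfolding bdd_above_def by auto
  then obtain M where M: "\<And>x. x \<in> ?B \<Longrightarrow> V x \<le> M" by metis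
  have "(\<integral>\<^sup>+ x. ennreal (V x * (bump R x)\<^sup>2) \<partial>lebesgue) \<le> (\<integral>\<^sup>+ x. ennreal (M * R\<^sup>2) * indicator ?B x \<partial>lebesgue)"
  proof (rule nn_integral_mono)
    fix x :: "real ^ 'n"
    show "ennreal (V x * (bump R x)\<^sup>2) \<le> ennreal (M * R\<^sup>2) * indicator ?B x"
    proof (cases "x \<in> ?B")
      case True
      then have "V x * (bump R x)\<^sup>2 \<le> M * R\<^sup>2" using M[OF True] V(2)[of x] le[of x] by (intro mult_mono) auto
      then show ?thesis using True by (auto intro: ennreal_leI)
    qed (simp add: out)
  qed
  also have "\<dots> < \<infinity>" using Bfin by (simp add: nn_integral_cmult_indicator ennreal_mult_less_top)
  finally show "(\<integral>\<^sup>+ x. ennreal (V x * (bump R x)\<^sup>2) \<partial>lebesgue) < \<infinity>" .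
  define k where "k = (\<lambda>(x :: real ^ 'n) y. min ((norm (x - y))\<^sup>2) (R\<^sup>2) / norm (x - y) powr (real CARD('n) + 2 * s))"
  obtain K where K: "0 < K" "\<And>x. (\<integral>\<^sup>+ y. ennreal (k x y) \<partial>lebesgue) \<le> ennreal K"
    using truncated_kernel_bound[OF s, where 'n = 'n and R = R] unfolding k_def by blast
  have ksym: "k x y = k y x" for x y by (simp add: k_def norm_minus_commute)
  note [measurable] = measurable_fst_snd_lebesgue
  have km [measurable]: "(\<lambda>z. k (fst z) (snd z)) \<in> borel_measurable (lebesgue \<Otimes>\<^sub>M lebesgue)"
    unfolding k_def by measurable
  have Bm [measurable]: "(\<lambda>z. indicator ?B (fst z) :: ennreal) \<in> borel_measurable (lebesgue \<Otimes>\<^sub>M lebesgue)"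
    "(\<lambda>z. indicator ?B (snd z) :: ennreal) \<in> borel_measurable (lebesgue \<Otimes>\<^sub>M lebesgue)"
    by measurable
  have Bint: "(\<integral>\<^sup>+ x. indicator ?B x * ennreal K \<partial>lebesgue) < \<infinity>"
    using Bfin by (simp add: nn_integral_multc ennreal_mult_less_top)
  have pw: "ennreal (gagliardo_kernel s (bump R) (bump R) z) \<le> indicator ?B (fst z) * ennreal (k (fst z) (snd z)) + indicator ?B (snd z) * ennreal (k (fst z) (snd z))" for z
  proof (cases "fst z \<in> ?B \<or> snd z \<in> ?B")
    case True
    have "\<bar>bump R (fst z) - bump R (snd z)\<bar> \<le> norm (fst z - snd z)"
      unfolding bump_def using norm_triangle_ineq3[of "fst z" "snd z"] by (auto simp: max_def abs_if split: if_splits)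
    then have 1: "(bump R (fst z) - bump R (snd z))\<^sup>2 \<le> (norm (fst z - snd z))\<^sup>2"
      by (simp only: abs_le_square_iff[symmetric] abs_norm_cancel)
    have "\<bar>bump R (fst z) - bump R (snd z)\<bar> \<le> \<bar>R\<bar>" using R by (auto simp: bump_def max_def abs_if) (smt (verit) norm_ge_zero)+
    then have 2: "(bump R (fst z) - bump R (snd z))\<^sup>2 \<le> R\<^sup>2" by (simp only: abs_le_square_iff)
    have "gagliardo_kernel s (bump R) (bump R) z \<le> k (fst z) (snd z)"
      unfolding gagliardo_kernel_def k_def split_beta power2_eq_square[symmetric]
      using 1 2 by (intro divide_right_mono) auto
    then have *: "ennreal (gagliardo_kernel s (bump R) (bump R) z) \<le> ennreal (k (fst z) (snd z))" by (rule ennreal_leI)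
    from True show ?thesis
    proof
      assume "fst z \<in> ?B"
      then show ?thesis using add_increasing2[OF _ *, of "indicator ?B (snd z) * ennreal (k (fst z) (snd z))"] by simp
    next
      assume "snd z \<in> ?B"
      then show ?thesis using add_increasing[OF _ *, of "indicator ?B (fst z) * ennreal (k (fst z) (snd z))"] by simp
    qed
  qed (simp add: gagliardo_kernel_def split_beta out)
  have "gagliardo_nn s (bump R :: real ^ 'n \<Rightarrow> real) \<le> (\<integral>\<^sup>+ z. indicator ?B (fst z) * ennreal (k (fst z) (snd z)) + indicator ?B (snd z) * ennreal (k (fst z) (snd z)) \<partial>(lebesgue \<Otimes>\<^sub>M lebesgue))"
    unfolding gagliardo_nn_def by (intro nn_integral_mono pw)
  also have "\<dots> = (\<integral>\<^sup>+ z. indicator ?B (fst z) * ennreal (k (fst z) (snd z)) \<partial>(lebesgue \<Otimes>\<^sub>M lebesgue))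
     + (\<integral>\<^sup>+ z. indicator ?B (snd z) * ennreal (k (fst z) (snd z)) \<partial>(lebesgue \<Otimes>\<^sub>M lebesgue))"
    by (intro nn_integral_add) measurable
  also have "(\<integral>\<^sup>+ z. indicator ?B (fst z) * ennreal (k (fst z) (snd z)) \<partial>(lebesgue \<Otimes>\<^sub>M lebesgue))
      = (\<integral>\<^sup>+ x. \<integral>\<^sup>+ y. indicator ?B x * ennreal (k x y) \<partial>lebesgue \<partial>lebesgue)"
    by (subst leb.nn_integral_fst[symmetric]) auto
  also have "(\<integral>\<^sup>+ z. indicator ?B (snd z) * ennreal (k (fst z) (snd z)) \<partial>(lebesgue \<Otimes>\<^sub>M lebesgue))
      = (\<integral>\<^sup>+ y. \<integral>\<^sup>+ x. indicator ?B y * ennreal (k x y) \<partial>lebesgue \<partial>lebesgue)"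
    by (subst leb2.nn_integral_snd[symmetric]) (auto simp: split_beta)
  also have "(\<integral>\<^sup>+ x. \<integral>\<^sup>+ y. indicator ?B x * ennreal (k x y) \<partial>lebesgue \<partial>lebesgue) + (\<integral>\<^sup>+ y. \<integral>\<^sup>+ x. indicator ?B y * ennreal (k x y) \<partial>lebesgue \<partial>lebesgue)
     \<le> (\<integral>\<^sup>+ x. indicator ?B x * ennreal K \<partial>lebesgue) + (\<integral>\<^sup>+ x. indicator ?B x * ennreal K \<partial>lebesgue)"
  proof (intro add_mono nn_integral_mono)
    fix x :: "real ^ 'n"
    show 1: "(\<integral>\<^sup>+ y. indicator ?B x * ennreal (k x y) \<partial>lebesgue) \<le> indicator ?B x * ennreal K"
      using K(2)[of x] by (cases "x \<in> ?B") auto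
    show "(\<integral>\<^sup>+ y. indicator ?B x * ennreal (k y x) \<partial>lebesgue) \<le> indicator ?B x * ennreal K"
      using 1 unfolding ksym[of _ x] .
  qed
  also have "\<dots> < \<infinity>" using Bint by simp
  finally show "gagliardo_nn s (bump R :: real ^ 'n \<Rightarrow> real) < \<infinity>" .
qed

section \<open>The singular and the coupling integral\<close>

text \<open>Young's inequality with the conjugate exponents \<open>2 / (1 + p)\<close> and
  \<open>2 / (1 - p)\<close>, which match the integrability of \<open>a\<close> and of
  \<open>u\<close>. A small \<open>d\<close> gives continuity in L^2; solving for the coefficient of
  \<open>t\<^sup>2\<close> gives absorption into the norm.\<close>

lemma singular_integrand_le:
  fixes a t p d :: real
  assumes p: "0 < p" "p < 1" and d: "0 < d" and a: "0 \<le> a"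
  shows "a * \<bar>t\<bar> powr (1 - p) \<le> d powr (2 / (1 + p)) * \<bar>a\<bar> powr (2 / (1 + p)) + d powr (- 2 / (1 - p)) * t\<^sup>2"
proof -
  have "a * \<bar>t\<bar> powr (1 - p) = (d * a) * (\<bar>t\<bar> powr (1 - p) / d)" using d by simp
  also have "\<dots> \<le> (d * a) powr (2 / (1 + p)) / (2 / (1 + p)) + (\<bar>t\<bar> powr (1 - p) / d) powr (2 / (1 - p)) / (2 / (1 - p))"
    using p d a by (intro Youngs_inequality) (auto simp: field_simps)
  also have "\<dots> \<le> (d * a) powr (2 / (1 + p)) + (\<bar>t\<bar> powr (1 - p) / d) powr (2 / (1 - p))"
  proof -
    have "x / c \<le> x" if "0 \<le> x" "1 \<le> c" for x c :: real
      using that divide_left_mono[of 1 c x] by simp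
    moreover have "1 \<le> 2 / (1 + p)" "1 \<le> 2 / (1 - p)" using p by (auto simp: field_simps)
    ultimately show ?thesis by (intro add_mono) (blast intro: powr_ge_zero)+
  qed
  also have "(\<bar>t\<bar> powr (1 - p) / d) powr (2 / (1 - p)) = d powr (- 2 / (1 - p)) * t\<^sup>2"
  proof -
    have "(\<bar>t\<bar> powr (1 - p)) powr (2 / (1 - p)) = t\<^sup>2"
    proof -
      have "(1 - p) * (2 / (1 - p)) = 2" using p by (simp add: field_simps)
      then show ?thesis by (cases "t = 0") (simp_all only: powr_powr, simp_all)
    qed
    moreover have "d powr (- 2 / (1 - p)) = inverse (d powr (2 / (1 - p)))"
      using powr_minus[of d "2 / (1 - p)"] by simp
    moreover have "(\<bar>t\<bar> powr (1 - p) / d) powr (2 / (1 - p)) = (\<bar>t\<bar> powr (1 - p)) powr (2 / (1 - p)) / d powr (2 / (1 - p))"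
      using d by (simp add: powr_divide)
    ultimately show ?thesis by (simp only: divide_inverse mult.commute)
  qed
  also have "(d * a) powr (2 / (1 + p)) = d powr (2 / (1 + p)) * \<bar>a\<bar> powr (2 / (1 + p))"
    using d a by (simp add: powr_mult)
  finally show ?thesis .
qed

lemma singular_int_bound:
  fixes a :: "real ^ 'n \<Rightarrow> real"
  assumes p: "0 < p" "p < 1" and a: "a \<in> Lspace (2 / (1 + p))" "\<And>x. 0 < a x"
    and [measurable]: "u \<in> borel_measurable lebesgue" and u2: "integrable lebesgue (\<lambda>x. (u x)\<^sup>2)"
  shows "integrable lebesgue (\<lambda>x. a x * \<bar>u x\<bar> powr (1 - p))"
    "0 < d \<Longrightarrow> singular_int a p u \<le> d powr (2 / (1 + p)) * (LINT x|lebesgue. \<bar>a x\<bar> powr (2 / (1 + p)))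
      + d powr (- 2 / (1 - p)) * (LINT x|lebesgue. (u x)\<^sup>2)"
proof -
  have [measurable]: "a \<in> borel_measurable lebesgue" and ia: "integrable lebesgue (\<lambda>x. \<bar>a x\<bar> powr (2 / (1 + p)))"
    using a(1) by (auto simp: Lspace_def)
  have i: "integrable lebesgue (\<lambda>x. d powr (2 / (1 + p)) * \<bar>a x\<bar> powr (2 / (1 + p)) + d powr (- 2 / (1 - p)) * (u x)\<^sup>2)" for d
    using ia u2 by (intro Bochner_Integration.integrable_add integrable_mult_right)
  have le: "a x * \<bar>u x\<bar> powr (1 - p) \<le> d powr (2 / (1 + p)) * \<bar>a x\<bar> powr (2 / (1 + p)) + d powr (- 2 / (1 - p)) * (u x)\<^sup>2"
    if "0 < d" for x d
    using singular_integrand_le[OF p that, of "a x" "u x"] a(2)[of x] by simp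
  show int: "integrable lebesgue (\<lambda>x. a x * \<bar>u x\<bar> powr (1 - p))"
  proof (rule Bochner_Integration.integrable_bound[OF i[of 1]])
    show "AE x in lebesgue. norm (a x * \<bar>u x\<bar> powr (1 - p)) \<le> norm (1 powr (2 / (1 + p)) * \<bar>a x\<bar> powr (2 / (1 + p)) + 1 powr (- 2 / (1 - p)) * (u x)\<^sup>2)"
      using le[of 1] a(2) by (intro always_eventually allI) (auto simp: abs_mult less_imp_le)
  qed measurable
  show "singular_int a p u \<le> d powr (2 / (1 + p)) * (LINT x|lebesgue. \<bar>a x\<bar> powr (2 / (1 + p)))
      + d powr (- 2 / (1 - p)) * (LINT x|lebesgue. (u x)\<^sup>2)" if "0 < d"
  proof -
    have "singular_int a p u \<le> (LINT x|lebesgue. d powr (2 / (1 + p)) * \<bar>a x\<bar> powr (2 / (1 + p)) + d powr (- 2 / (1 - p)) * (u x)\<^sup>2)"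
      unfolding singular_int_def using le[OF that] by (intro integral_mono int i)
    then show ?thesis using ia u2 by simp
  qed
qed

lemma singular_int_nonneg: "(\<And>x. 0 < a x) \<Longrightarrow> 0 \<le> singular_int a p u"
  unfolding singular_int_def by (intro integral_nonneg_AE always_eventually allI) (auto simp: less_imp_le)

lemma singular_int_eq_0:
  assumes a: "\<And>x. 0 < a x" and int: "integrable lebesgue (\<lambda>x. a x * \<bar>u x\<bar> powr (1 - p))" and "singular_int a p u = 0"
  shows "AE x in lebesgue. u x = 0"
proof -
  have "AE x in lebesgue. a x * \<bar>u x\<bar> powr (1 - p) = 0"
    using integral_nonneg_eq_0_iff_AE[OF int] assms(3) a by (auto simp: singular_int_def less_imp_le)
  then show ?thesis by eventually_elim (use a in \<open>auto simp: less_imp_neq[symmetric]\<close>)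
qed

lemma singular_int_AE_0:
  assumes [measurable]: "c \<in> borel_measurable lebesgue" "w \<in> borel_measurable lebesgue" and "AE x in lebesgue. w x = 0"
  shows "singular_int c g w = 0"
proof -
  have "singular_int c g w = (LINT (x :: real ^ 'a)|lebesgue. 0)"
    unfolding singular_int_def by (rule integral_cong_AE) (use assms(3) in \<open>auto elim: eventually_mono\<close>)
  then show ?thesis by simp
qed

lemma singular_int_scale:
  assumes "0 \<le> t"
  shows "singular_int a p (\<lambda>x. t * u x) = t powr (1 - p) * singular_int a p u"
  unfolding singular_int_def using assms
  by (subst integral_mult_right_zero[symmetric]) (simp add: abs_mult powr_mult mult_ac)

text \<open>Subadditivity of the power bounds the difference of the integrals by the singular
  integral of \<open>U n - u\<close>, so only smallness of the latter is needed.\<close>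

lemma singular_int_tendsto:
  fixes a :: "real ^ 'n \<Rightarrow> real"
  assumes p: "0 < p" "p < 1" and a: "a \<in> Lspace (2 / (1 + p))" "\<And>x. 0 < a x"
    and m [measurable]: "\<And>n. U n \<in> borel_measurable lebesgue" "u \<in> borel_measurable lebesgue"
    and i2: "\<And>n. integrable lebesgue (\<lambda>x. (U n x)\<^sup>2)" "integrable lebesgue (\<lambda>x. (u x)\<^sup>2)"
    and d2: "\<And>n. integrable lebesgue (\<lambda>x. (U n x - u x)\<^sup>2)" "(\<lambda>n. LINT x|lebesgue. (U n x - u x)\<^sup>2) \<longlonglongrightarrow> 0"
  shows "(\<lambda>n. singular_int a p (U n)) \<longlonglongrightarrow> singular_int a p u"
proof -
  let ?K = "LINT x|lebesgue. \<bar>a x\<bar> powr (2 / (1 + p))"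
  let ?D = "\<lambda>n. singular_int a p (\<lambda>x. U n x - u x)"
  have K: "0 \<le> ?K" by simp
  have D0: "?D \<longlonglongrightarrow> 0"
  proof (rule order_tendstoI)
    fix e :: real assume e: "e < 0"
    then show "eventually (\<lambda>n. e < ?D n) sequentially"
      using singular_int_nonneg[OF a(2)] by (intro always_eventually allI) (rule less_le_trans)
  next
    fix e :: real assume e: "0 < e"
    \<comment> \<open>Makes the part involving \<open>a\<close> smaller than \<open>e / 2\<close>
      for all \<open>n\<close>; the other part then tends to zero with \<open>d\<close>
      fixed.\<close>
    define d where "d = (e / (2 * (?K + 1))) powr ((1 + p) / 2)"
    have d: "0 < d" using e K by (simp add: d_def add_nonneg_eq_0_iff)
    have "d powr (2 / (1 + p)) = e / (2 * (?K + 1))"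
    proof -
      have "(1 + p) / 2 * (2 / (1 + p)) = 1" using p by (simp add: field_simps)
      then show ?thesis using e K by (simp only: d_def powr_powr) simp
    qed
    then have "d powr (2 / (1 + p)) * (?K + 1) = e / 2" using K by (simp add: field_simps add_nonneg_eq_0_iff)
    then have 1: "d powr (2 / (1 + p)) * ?K < e / 2"
      using d by (simp add: distrib_left) (smt (verit) powr_gt_zero)
    have "(\<lambda>n. d powr (- 2 / (1 - p)) * (LINT x|lebesgue. (U n x - u x)\<^sup>2)) \<longlonglongrightarrow> d powr (- 2 / (1 - p)) * 0"
      by (intro tendsto_mult tendsto_const d2)
    then have "eventually (\<lambda>n. d powr (- 2 / (1 - p)) * (LINT x|lebesgue. (U n x - u x)\<^sup>2) < e / 2) sequentially"
      using e by (intro order_tendstoD(2)) auto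
    then show "eventually (\<lambda>n. ?D n < e) sequentially"
    proof eventually_elim
      case (elim n)
      have "?D n \<le> d powr (2 / (1 + p)) * ?K + d powr (- 2 / (1 - p)) * (LINT x|lebesgue. (U n x - u x)\<^sup>2)"
        using singular_int_bound(2)[OF p a _ d2(1) d, of n] by simp
      then show ?case using 1 elim by linarith
    qed
  qed
  show ?thesis
  proof (rule Lim_transform2[of "\<lambda>_. singular_int a p u"])
    show "(\<lambda>n. singular_int a p u - singular_int a p (U n)) \<longlonglongrightarrow> 0"
    proof (rule Lim_null_comparison[OF always_eventually D0], rule allI)
      fix n
      note i = singular_int_bound(1)[OF p a]
      have iU: "integrable lebesgue (\<lambda>x. a x * \<bar>U n x\<bar> powr (1 - p))" using i i2 m by blast
      have iu: "integrable lebesgue (\<lambda>x. a x * \<bar>u x\<bar> powr (1 - p))" using i i2 m by blast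
      have iD: "integrable lebesgue (\<lambda>x. a x * \<bar>U n x - u x\<bar> powr (1 - p))" by (rule i[OF _ d2(1)]) measurable
      have "norm (singular_int a p u - singular_int a p (U n))
          = \<bar>LINT x|lebesgue. a x * \<bar>u x\<bar> powr (1 - p) - a x * \<bar>U n x\<bar> powr (1 - p)\<bar>"
        unfolding singular_int_def using iU iu by simp
      also have "\<dots> \<le> (LINT x|lebesgue. \<bar>a x * \<bar>u x\<bar> powr (1 - p) - a x * \<bar>U n x\<bar> powr (1 - p)\<bar>)"
        by (rule integral_abs_bound)
      also have "\<dots> \<le> ?D n"
        unfolding singular_int_def
      proof (intro integral_mono iD)
        show "integrable lebesgue (\<lambda>x. \<bar>a x * \<bar>u x\<bar> powr (1 - p) - a x * \<bar>U n x\<bar> powr (1 - p)\<bar>)"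
          using iU iu by auto
        fix x
        have "\<bar>\<bar>u x\<bar> powr (1 - p) - \<bar>U n x\<bar> powr (1 - p)\<bar> \<le> \<bar>U n x - u x\<bar> powr (1 - p)"
        proof -
          have g: "0 < 1 - p" "1 - p < 1" using p by auto
          have "\<bar>u x\<bar> powr (1 - p) \<le> \<bar>U n x\<bar> powr (1 - p) + \<bar>U n x - u x\<bar> powr (1 - p)"
            using powr_abs_le_add[OF g, of "u x" "U n x"] unfolding abs_minus_commute[of "u x"] .
          then show ?thesis using powr_abs_le_add[OF g, of "U n x" "u x"] by linarith
        qed
        then have "a x * \<bar>\<bar>u x\<bar> powr (1 - p) - \<bar>U n x\<bar> powr (1 - p)\<bar> \<le> a x * \<bar>U n x - u x\<bar> powr (1 - p)"
          using a(2)[of x] by (intro mult_left_mono) auto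
        then show "\<bar>a x * \<bar>u x\<bar> powr (1 - p) - a x * \<bar>U n x\<bar> powr (1 - p)\<bar> \<le> a x * \<bar>U n x - u x\<bar> powr (1 - p)"
          using a(2)[of x] by (simp add: abs_mult flip: right_diff_distrib)
      qed
      finally show "norm (singular_int a p u - singular_int a p (U n)) \<le> ?D n" .
    qed
  qed simp
qed

text \<open>Truncating \<open>f n\<close> to the band between \<open>- F\<close> and
  \<open>F\<close> costs at most \<open>G n\<close>, and the truncated functions fall under
  dominated convergence. This replaces a single majorant for the whole sequence.\<close>

lemma integral_tendsto_dominated_plus_small:
  fixes f :: "nat \<Rightarrow> 'a \<Rightarrow> real"
  assumes [measurable]: "\<And>n. f n \<in> borel_measurable M" "f0 \<in> borel_measurable M"
    and F: "integrable M F" and G: "\<And>n. integrable M (G n)" "\<And>n x. 0 \<le> G n x" "(\<lambda>n. integral\<^sup>L M (G n)) \<longlonglongrightarrow> 0"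
    and le: "\<And>n x. \<bar>f n x\<bar> \<le> F x + G n x" "\<And>x. \<bar>f0 x\<bar> \<le> F x"
    and conv: "AE x in M. (\<lambda>n. f n x) \<longlonglongrightarrow> f0 x"
  shows "(\<lambda>n. integral\<^sup>L M (f n)) \<longlonglongrightarrow> integral\<^sup>L M f0"
proof -
  have [measurable]: "F \<in> borel_measurable M" using F by auto
  have F0: "0 \<le> F x" for x using le(2)[of x] by linarith
  define g where "g n x = max (- F x) (min (F x) (f n x))" for n x
  have [measurable]: "g n \<in> borel_measurable M" for n unfolding g_def by measurable
  have g: "\<bar>g n x\<bar> \<le> F x" "\<bar>f n x - g n x\<bar> \<le> G n x" for n x
    using F0[of x] le(1)[of n x] G(2)[of n x] by (auto simp: g_def max_def min_def)
  have ig: "integrable M (g n)" for n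
    using F g(1) F0 by (intro Bochner_Integration.integrable_bound[OF F]) auto
  have if': "integrable M (f n)" for n
  proof (rule Bochner_Integration.integrable_bound)
    show "integrable M (\<lambda>x. F x + G n x)" using F G by auto
    show "AE x in M. norm (f n x) \<le> norm (F x + G n x)" using le(1)[of n] by (intro always_eventually allI) (smt (verit) real_norm_def)
  qed measurable
  have "(\<lambda>n. integral\<^sup>L M (g n)) \<longlonglongrightarrow> integral\<^sup>L M f0"
  proof (rule integral_dominated_convergence[where w = F])
    show "AE x in M. (\<lambda>n. g n x) \<longlonglongrightarrow> f0 x" using conv
    proof eventually_elim
      case (elim x)
      then have "(\<lambda>n. g n x) \<longlonglongrightarrow> max (- F x) (min (F x) (f0 x))"
        unfolding g_def by (intro tendsto_intros)
      also have "max (- F x) (min (F x) (f0 x)) = f0 x" using le(2)[of x] by linarith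
      finally show ?case .
    qed
  qed (use F g in auto)
  moreover have "(\<lambda>n. integral\<^sup>L M (f n) - integral\<^sup>L M (g n)) \<longlonglongrightarrow> 0"
  proof (rule Lim_null_comparison[OF always_eventually G(3)], rule allI)
    fix n
    have "norm (integral\<^sup>L M (f n) - integral\<^sup>L M (g n)) = \<bar>LINT x|M. f n x - g n x\<bar>" using if' ig by simp
    also have "\<dots> \<le> (LINT x|M. \<bar>f n x - g n x\<bar>)" by (rule integral_abs_bound)
    also have "\<dots> \<le> integral\<^sup>L M (G n)" using if' ig G g by (intro integral_mono) auto
    finally show "norm (integral\<^sup>L M (f n) - integral\<^sup>L M (g n)) \<le> integral\<^sup>L M (G n)" .
  qed
  ultimately show ?thesis using tendsto_add[of "\<lambda>n. integral\<^sup>L M (f n) - integral\<^sup>L M (g n)" 0 _ "\<lambda>n. integral\<^sup>L M (g n)"] by simp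
qed

lemma coupling_int_bound:
  assumes al: "0 \<le> \<alpha>" "0 \<le> \<beta>" and [measurable]: "u \<in> borel_measurable lebesgue" "v \<in> borel_measurable lebesgue"
    and i: "integrable lebesgue (\<lambda>x. \<bar>u x\<bar> powr (\<alpha> + \<beta>))" "integrable lebesgue (\<lambda>x. \<bar>v x\<bar> powr (\<alpha> + \<beta>))"
  shows "integrable lebesgue (\<lambda>x. \<bar>u x\<bar> powr \<alpha> * \<bar>v x\<bar> powr \<beta>)"
    "coupling_int \<alpha> \<beta> u v \<le> (LINT x|lebesgue. \<bar>u x\<bar> powr (\<alpha> + \<beta>)) + (LINT x|lebesgue. \<bar>v x\<bar> powr (\<alpha> + \<beta>))"
proof -
  have le: "\<bar>u x\<bar> powr \<alpha> * \<bar>v x\<bar> powr \<beta> \<le> \<bar>u x\<bar> powr (\<alpha> + \<beta>) + \<bar>v x\<bar> powr (\<alpha> + \<beta>)" for x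
    using al by (intro powr_mult_le_add) auto
  show int: "integrable lebesgue (\<lambda>x. \<bar>u x\<bar> powr \<alpha> * \<bar>v x\<bar> powr \<beta>)"
    by (rule Bochner_Integration.integrable_bound[OF Bochner_Integration.integrable_add[OF i]])
       (use le in \<open>auto intro!: always_eventually\<close>)
  have "coupling_int \<alpha> \<beta> u v \<le> (LINT x|lebesgue. \<bar>u x\<bar> powr (\<alpha> + \<beta>) + \<bar>v x\<bar> powr (\<alpha> + \<beta>))"
    unfolding coupling_int_def using i le by (intro integral_mono int) auto
  then show "coupling_int \<alpha> \<beta> u v \<le> (LINT x|lebesgue. \<bar>u x\<bar> powr (\<alpha> + \<beta>)) + (LINT x|lebesgue. \<bar>v x\<bar> powr (\<alpha> + \<beta>))"
    using i by simp
qed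

lemma coupling_int_nonneg: "0 \<le> coupling_int \<alpha> \<beta> u v"
  unfolding coupling_int_def by (intro integral_nonneg_AE always_eventually allI) auto

lemma coupling_int_scale:
  assumes "0 \<le> t"
  shows "coupling_int \<alpha> \<beta> (\<lambda>x. t * u x) (\<lambda>x. t * v x) = t powr (\<alpha> + \<beta>) * coupling_int \<alpha> \<beta> u v"
  unfolding coupling_int_def using assms
  by (subst integral_mult_right_zero[symmetric]) (simp add: abs_mult powr_mult powr_add mult_ac)

text \<open>The majorant comes from the limit pair and the small part from the differences, both in
  the norm of the total exponent; \<open>2 powr (\<alpha> + \<beta>)\<close> is the price of the
  triangle inequality.\<close>

lemma coupling_int_tendsto:
  assumes al: "0 < \<alpha>" "0 < \<beta>"
    and m [measurable]: "\<And>n. U n \<in> borel_measurable lebesgue" "u \<in> borel_measurable lebesgue"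
      "\<And>n. W n \<in> borel_measurable lebesgue" "v \<in> borel_measurable lebesgue"
    and i: "integrable lebesgue (\<lambda>x. \<bar>u x\<bar> powr (\<alpha> + \<beta>))" "integrable lebesgue (\<lambda>x. \<bar>v x\<bar> powr (\<alpha> + \<beta>))"
    and d: "\<And>n. integrable lebesgue (\<lambda>x. \<bar>U n x - u x\<bar> powr (\<alpha> + \<beta>))" "(\<lambda>n. LINT x|lebesgue. \<bar>U n x - u x\<bar> powr (\<alpha> + \<beta>)) \<longlonglongrightarrow> 0"
      "\<And>n. integrable lebesgue (\<lambda>x. \<bar>W n x - v x\<bar> powr (\<alpha> + \<beta>))" "(\<lambda>n. LINT x|lebesgue. \<bar>W n x - v x\<bar> powr (\<alpha> + \<beta>)) \<longlonglongrightarrow> 0"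
    and conv: "AE x in lebesgue. (\<lambda>n. U n x) \<longlonglongrightarrow> u x" "AE x in lebesgue. (\<lambda>n. W n x) \<longlonglongrightarrow> v x"
  shows "(\<lambda>n. coupling_int \<alpha> \<beta> (U n) (W n)) \<longlonglongrightarrow> coupling_int \<alpha> \<beta> u v"
  unfolding coupling_int_def
proof (rule integral_tendsto_dominated_plus_small)
  let ?r = "\<alpha> + \<beta>"
  let ?F = "\<lambda>x. 2 powr ?r * (\<bar>u x\<bar> powr ?r + \<bar>v x\<bar> powr ?r)"
  let ?G = "\<lambda>n x. 2 powr ?r * (\<bar>U n x - u x\<bar> powr ?r + \<bar>W n x - v x\<bar> powr ?r)"
  show "integrable lebesgue ?F" using i by (intro integrable_mult_right Bochner_Integration.integrable_add)
  show "integrable lebesgue (?G n)" for n using d by (intro integrable_mult_right Bochner_Integration.integrable_add)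
  show "(\<lambda>n. integral\<^sup>L lebesgue (?G n)) \<longlonglongrightarrow> 0"
  proof -
    have "integral\<^sup>L lebesgue (?G n) = 2 powr ?r * ((LINT x|lebesgue. \<bar>U n x - u x\<bar> powr ?r) + (LINT x|lebesgue. \<bar>W n x - v x\<bar> powr ?r))" for n
      using d by simp
    moreover have "(\<lambda>n. 2 powr ?r * ((LINT x|lebesgue. \<bar>U n x - u x\<bar> powr ?r) + (LINT x|lebesgue. \<bar>W n x - v x\<bar> powr ?r))) \<longlonglongrightarrow> 2 powr ?r * (0 + 0)"
      by (intro tendsto_mult tendsto_add tendsto_const d)
    ultimately show ?thesis by simp
  qed
  have tri: "\<bar>x\<bar> powr ?r \<le> 2 powr ?r * (\<bar>y\<bar> powr ?r + \<bar>x - y\<bar> powr ?r)" for x y :: real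
  proof -
    have "\<bar>x\<bar> powr ?r \<le> (\<bar>y\<bar> + \<bar>x - y\<bar>) powr ?r" using al by (intro powr_mono2) auto
    also have "\<dots> \<le> 2 powr ?r * (\<bar>y\<bar> powr ?r + \<bar>x - y\<bar> powr ?r)" using al by (intro powr_add_le_two) auto
    finally show ?thesis .
  qed
  show "\<bar>\<bar>U n x\<bar> powr \<alpha> * \<bar>W n x\<bar> powr \<beta>\<bar> \<le> ?F x + ?G n x" for n x
  proof -
    have "\<bar>\<bar>U n x\<bar> powr \<alpha> * \<bar>W n x\<bar> powr \<beta>\<bar> \<le> \<bar>U n x\<bar> powr ?r + \<bar>W n x\<bar> powr ?r"
      using powr_mult_le_add[of \<alpha> \<beta> "\<bar>U n x\<bar>" "\<bar>W n x\<bar>"] al by simp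
    then show ?thesis using tri[of "U n x" "u x"] tri[of "W n x" "v x"] by (simp add: distrib_left)
  qed
  show "\<bar>\<bar>u x\<bar> powr \<alpha> * \<bar>v x\<bar> powr \<beta>\<bar> \<le> ?F x" for x
  proof -
    have "\<bar>\<bar>u x\<bar> powr \<alpha> * \<bar>v x\<bar> powr \<beta>\<bar> \<le> \<bar>u x\<bar> powr ?r + \<bar>v x\<bar> powr ?r"
      using powr_mult_le_add[of \<alpha> \<beta> "\<bar>u x\<bar>" "\<bar>v x\<bar>"] al by simp
    then show ?thesis using tri[of "u x" "u x"] tri[of "v x" "v x"] by (simp add: distrib_left)
  qed
  show "AE x in lebesgue. (\<lambda>n. \<bar>U n x\<bar> powr \<alpha> * \<bar>W n x\<bar> powr \<beta>) \<longlonglongrightarrow> \<bar>u x\<bar> powr \<alpha> * \<bar>v x\<bar> powr \<beta>"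
    using conv
  proof eventually_elim
    case (elim x)
    then show ?case using al by (intro tendsto_mult tendsto_powr2 tendsto_rabs tendsto_const) auto
  qed
qed auto

lemma Xcomp_powr_integrable:
  fixes V :: "real ^ 'n \<Rightarrow> real"
  assumes sob: "sobolev_exponent TYPE('n) s r" and V: "0 < V0" "\<And>x. V0 \<le> V x" and M: "0 < M"
  obtains K where "0 < K"
    "\<And>u. u \<in> Xcomp s V \<Longrightarrow> form s V u u \<le> M \<Longrightarrow>
      integrable lebesgue (\<lambda>x. \<bar>u x\<bar> powr r) \<and> (LINT x|lebesgue. \<bar>u x\<bar> powr r) \<le> K"
proof -
  have V': "0 \<le> V x" for x using V(1) V(2)[of x] by simp
  have M0: "0 < M + M / V0" using M V(1) by (simp add: add_pos_pos)
  obtain K where K: "0 < K" and Kb: "\<And>u :: real ^ 'n \<Rightarrow> real. u \<in> borel_measurable lebesgue \<Longrightarrow>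
      (\<integral>\<^sup>+ x. ennreal ((u x)\<^sup>2) \<partial>lebesgue) \<le> ennreal (M + M / V0) \<Longrightarrow>
     gagliardo_nn s u \<le> ennreal (M + M / V0) \<Longrightarrow> (\<integral>\<^sup>+ x. ennreal (\<bar>u x\<bar> powr r) \<partial>lebesgue) \<le> ennreal K"
    using sob M0 unfolding sobolev_exponent_def by meson
  show thesis
  proof (rule that[OF K])
    fix u assume u: "u \<in> Xcomp s V" and f: "form s V u u \<le> M"
    note [measurable] = XcompD(1)[OF u]
    have "form s V u u / V0 \<le> M / V0" using f V(1) by (simp add: divide_right_mono)
    then have "(\<integral>\<^sup>+ x. ennreal ((u x)\<^sup>2) \<partial>lebesgue) \<le> ennreal (M + M / V0)"
      using M by (intro order_trans[OF Xcomp_L2_le(2)[OF u V]] ennreal_leI) linarith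
    moreover have "gagliardo_nn s u \<le> ennreal (M + M / V0)"
      using f M V by (intro order_trans[OF Xcomp_nn(1)[OF u V']] ennreal_leI) (simp add: add_increasing2)
    ultimately have *: "(\<integral>\<^sup>+ x. ennreal (\<bar>u x\<bar> powr r) \<partial>lebesgue) \<le> ennreal K" by (intro Kb) auto
    have i: "integrable lebesgue (\<lambda>x. \<bar>u x\<bar> powr r)"
      using * by (intro integrableI_bounded) (auto intro: le_less_trans)
    then show "integrable lebesgue (\<lambda>x. \<bar>u x\<bar> powr r) \<and> (LINT x|lebesgue. \<bar>u x\<bar> powr r) \<le> K"
      using * K by (simp add: nn_integral_eq_integral)
  qed
qed

text \<open>Subcriticality leaves a larger exponent \<open>q\<close> with bounded integrals;
  interpolation between it and the vanishing square integrals gives the claim.\<close>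

lemma powr_integral_tendsto_0:
  fixes V :: "real ^ 'n \<Rightarrow> real"
  assumes sob: "sobolev_exponent TYPE('n) s q" and rq: "2 < r" "r < q" and V: "0 < V0" "\<And>x. V0 \<le> V x"
    and U: "\<And>n. U n \<in> Xcomp s V" "\<And>n. form s V (U n) (U n) \<le> M"
    and conv: "(\<lambda>n. LINT x|lebesgue. (U n x)\<^sup>2) \<longlonglongrightarrow> 0"
  shows "(\<lambda>n. LINT x|lebesgue. \<bar>U n x\<bar> powr r) \<longlonglongrightarrow> 0"
proof -
  have V': "0 \<le> V x" for x using V(1) V(2)[of x] by simp
  have M1: "0 < max M 1" by simp
  have UM: "form s V (U n) (U n) \<le> max M 1" for n using U(2)[of n] by simp
  obtain K where K: "0 < K" and Kq: "\<And>u. u \<in> Xcomp s V \<Longrightarrow> form s V u u \<le> max M 1 \<Longrightarrow>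
      integrable lebesgue (\<lambda>x. \<bar>u x\<bar> powr q) \<and> (LINT x|lebesgue. \<bar>u x\<bar> powr q) \<le> K"
    by (rule Xcomp_powr_integrable[where V = V, OF sob V M1]) blast
  note iq = Kq[OF U(1) UM]
  have sob': "sobolev_exponent TYPE('n) s r" using rq by (intro sobolev_exponent_between[OF _ _ sob]) auto
  obtain K' where Kr: "\<And>u. u \<in> Xcomp s V \<Longrightarrow> form s V u u \<le> max M 1 \<Longrightarrow>
      integrable lebesgue (\<lambda>x. \<bar>u x\<bar> powr r) \<and> (LINT x|lebesgue. \<bar>u x\<bar> powr r) \<le> K'"
    by (rule Xcomp_powr_integrable[where V = V, OF sob' V M1]) blast
  note ir = Kr[OF U(1) UM]
  show ?thesis
  proof (rule order_tendstoI)
    fix e :: real assume "e < 0"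
    then show "eventually (\<lambda>n. e < (LINT x|lebesgue. \<bar>U n x\<bar> powr r)) sequentially"
      by (intro always_eventually allI) (rule less_le_trans, auto)
  next
    fix e :: real assume e: "0 < e"
    obtain C where C: "\<And>x. 0 \<le> x \<Longrightarrow> x powr r \<le> e / (2 * K) * x powr q + C * x\<^sup>2"
      using powr_interpolate[OF rq, of "e / (2 * K)"] e K by auto
    have "(\<lambda>n. C * (LINT x|lebesgue. (U n x)\<^sup>2)) \<longlonglongrightarrow> C * 0" by (intro tendsto_mult tendsto_const conv)
    then have "eventually (\<lambda>n. C * (LINT x|lebesgue. (U n x)\<^sup>2) < e / 2) sequentially"
      using e by (intro order_tendstoD(2)) auto
    then show "eventually (\<lambda>n. (LINT x|lebesgue. \<bar>U n x\<bar> powr r) < e) sequentially"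
    proof eventually_elim
      case (elim n)
      have "(LINT x|lebesgue. \<bar>U n x\<bar> powr r) \<le> (LINT x|lebesgue. e / (2 * K) * \<bar>U n x\<bar> powr q + C * (U n x)\<^sup>2)"
        using ir[of n] iq[of n] XcompD(2)[OF U(1)[of n]] C[of "\<bar>U n x\<bar>" for x]
        by (intro integral_mono Bochner_Integration.integrable_add integrable_mult_right) auto
      also have "\<dots> = e / (2 * K) * (LINT x|lebesgue. \<bar>U n x\<bar> powr q) + C * (LINT x|lebesgue. (U n x)\<^sup>2)"
        using iq[of n] XcompD(2)[OF U(1)[of n]] by simp
      also have "e / (2 * K) * (LINT x|lebesgue. \<bar>U n x\<bar> powr q) \<le> e / (2 * K) * K"
        using iq[of n] e K by (intro mult_left_mono) auto
      finally show ?case using elim K by simp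
    qed
  qed
qed

section \<open>The two thresholds\<close>

locale fractional_system =
  fixes s p q \<alpha> \<beta> \<theta> V0 :: real
    and a b V1 V2 :: "real ^ 'n \<Rightarrow> real"
  assumes s: "0 < s" "s < 1" "2 * s < real CARD('n)"
    and ab: "1 < \<alpha>" "1 < \<beta>" and r2: "2 < \<alpha> + \<beta>"
    and subcritical: "\<alpha> + \<beta> < 2 * real CARD('n) / (real CARD('n) - 2 * s)"
    and p0: "0 < p" and pq: "p \<le> q" and q1: "q < 1" and th: "0 < \<theta>"
    and aL: "a \<in> Lspace (2 / (1 + p))" and apos: "\<And>x. 0 < a x"
    and bL: "b \<in> Lspace (2 / (1 + q))" and bpos: "\<And>x. 0 < b x"
    and V0: "0 < V0"
    and V1c: "continuous_on UNIV V1" and V1: "\<And>x. V0 \<le> V1 x"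
    and V1fin: "\<And>M. 0 < M \<Longrightarrow> emeasure lebesgue {x. V1 x \<le> M} < \<infinity>"
    and V2c: "continuous_on UNIV V2" and V2: "\<And>x. V0 \<le> V2 x"
    and V2fin: "\<And>M. 0 < M \<Longrightarrow> emeasure lebesgue {x. V2 x \<le> M} < \<infinity>"
begin

lemma p1: "p < 1" and q0: "0 < q"
  using p0 pq q1 by auto

lemma V1_nonneg: "0 \<le> V1 x" and V2_nonneg: "0 \<le> V2 x"
  using V0 V1[of x] V2[of x] by auto

lemma V1_measurable: "V1 \<in> borel_measurable lebesgue" and V2_measurable: "V2 \<in> borel_measurable lebesgue"
  using V1c V2c by (auto intro: borel_measurable_lebesgue_continuous)

lemma a_measurable: "a \<in> borel_measurable lebesgue" and b_measurable: "b \<in> borel_measurable lebesgue"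
  using aL bL by (auto simp: Lspace_def)

abbreviation "X1 \<equiv> Xcomp s V1"
abbreviation "X2 \<equiv> Xcomp s V2"
abbreviation "sq u v \<equiv> normsq s V1 V2 u v"
abbreviation "S1 u \<equiv> singular_int a p u"
abbreviation "S2 v \<equiv> singular_int b q v"
abbreviation "cpl u v \<equiv> coupling_int \<alpha> \<beta> u v"
abbreviation "E lam u v \<equiv> energy s V1 V2 a b p q \<alpha> \<beta> \<theta> lam u v"
abbreviation "E1 lam u v \<equiv> energy1 s V1 V2 a b p q \<alpha> \<beta> \<theta> lam u v"
abbreviation "E2 lam u v \<equiv> energy2 s V1 V2 a b p q \<alpha> \<beta> \<theta> lam u v"
abbreviation "lam_up \<equiv> lambda_upper s V1 V2 a b p q \<alpha> \<beta> \<theta>"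
abbreviation "lam_low \<equiv> lambda_lower s V1 V2 a b p q \<alpha> \<beta> \<theta>"
abbreviation "AA \<equiv> Aset s V1 V2 \<alpha> \<beta>"

lemma ip_eq:
  assumes "u \<in> X1" "\<phi> \<in> X1" "v \<in> X2" "\<psi> \<in> X2"
  shows "ip s V1 V2 u v \<phi> \<psi> = form s V1 u \<phi> + form s V2 v \<psi>"
  using kernel_integrable[OF assms(1,2)] kernel_integrable[OF assms(3,4)]
    potential_integrable[OF assms(1,2) V1_measurable V1_nonneg] potential_integrable[OF assms(3,4) V2_measurable V2_nonneg]
  by (simp add: ip_def form_def)

lemma normsq_eq:
  assumes "u \<in> X1" "v \<in> X2"
  shows "sq u v = form s V1 u u + form s V2 v v"
  unfolding normsq_def using assms by (intro ip_eq)

lemma normsq_scale: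
  assumes "u \<in> X1" "v \<in> X2"
  shows "sq (\<lambda>x. t * u x) (\<lambda>x. t * v x) = t\<^sup>2 * sq u v"
  using assms by (simp add: normsq_eq Xcomp_scale distrib_left)

lemma singular_integrable:
  assumes "u \<in> X1" "v \<in> X2"
  shows "integrable lebesgue (\<lambda>x. a x * \<bar>u x\<bar> powr (1 - p))" "integrable lebesgue (\<lambda>x. b x * \<bar>v x\<bar> powr (1 - q))"
  using singular_int_bound(1)[OF p0 p1 aL apos] singular_int_bound(1)[OF q0 q1 bL bpos]
    XcompD(1,2)[OF assms(1)] XcompD(1,2)[OF assms(2)] by auto

lemma S_nonneg: "0 \<le> S1 u" "0 \<le> S2 v"
  by (auto intro: singular_int_nonneg apos bpos)

text \<open>Strict positivity of the weights and of \<open>V0\<close> makes both functionals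
  definite.\<close>

lemma nontrivial_pos:
  assumes "u \<in> X1" "v \<in> X2" "nontrivial u v"
  shows "0 < S1 u + S2 v" "0 < sq u v"
proof -
  show "0 < S1 u + S2 v"
  proof (rule ccontr)
    assume "\<not> 0 < S1 u + S2 v"
    then have "S1 u = 0" "S2 v = 0" using S_nonneg(1)[of u] S_nonneg(2)[of v] by linarith+
    then have "AE x in lebesgue. u x = 0" "AE x in lebesgue. v x = 0"
      using singular_int_eq_0[where a = a, OF apos] singular_int_eq_0[where a = b, OF bpos] singular_integrable[OF assms(1,2)] by auto
    then have "AE x in lebesgue. u x = 0 \<and> v x = 0" by eventually_elim simp
    then show False using assms(3) by (simp add: nontrivial_def)
  qed
  show "0 < sq u v"
  proof (rule ccontr)
    note L = Xcomp_L2_le(1)[OF assms(1) V0 V1] Xcomp_L2_le(1)[OF assms(2) V0 V2]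
    assume "\<not> 0 < sq u v"
    then have "V0 * (LINT x|lebesgue. (u x)\<^sup>2) + V0 * (LINT x|lebesgue. (v x)\<^sup>2) \<le> 0"
      using L unfolding normsq_eq[OF assms(1,2)] by linarith
    moreover have "0 \<le> V0 * (LINT x|lebesgue. (u x)\<^sup>2)" "0 \<le> V0 * (LINT x|lebesgue. (v x)\<^sup>2)"
      using V0 by auto
    ultimately have "V0 * (LINT x|lebesgue. (u x)\<^sup>2) = 0" "V0 * (LINT x|lebesgue. (v x)\<^sup>2) = 0" by linarith+
    then have "(LINT x|lebesgue. (u x)\<^sup>2) = 0" "(LINT x|lebesgue. (v x)\<^sup>2) = 0" using V0 by auto
    then have "AE x in lebesgue. (u x)\<^sup>2 = 0" "AE x in lebesgue. (v x)\<^sup>2 = 0"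
      using integral_nonneg_eq_0_iff_AE[OF XcompD(2)[OF assms(1)]] integral_nonneg_eq_0_iff_AE[OF XcompD(2)[OF assms(2)]] by auto
    then have "AE x in lebesgue. u x = 0 \<and> v x = 0" by eventually_elim simp
    then show False using assms(3) by (simp add: nontrivial_def)
  qed
qed

lemma sobolev_above:
  obtains e where "\<alpha> + \<beta> < e" "sobolev_exponent TYPE('n) s e"
proof -
  obtain e where "\<alpha> + \<beta> < e" "e < 2 * real CARD('n) / (real CARD('n) - 2 * s)"
    using dense[OF subcritical] by auto
  then show thesis using that sobolev_exponent_subcritical[OF s(1,3), of e] r2 by auto
qed

lemma sobolev_r: "sobolev_exponent TYPE('n) s (\<alpha> + \<beta>)"
  using sobolev_exponent_subcritical[OF s(1,3), of "\<alpha> + \<beta>"] r2 subcritical by simp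

lemma powr_integrable:
  shows "u \<in> X1 \<Longrightarrow> integrable lebesgue (\<lambda>x. \<bar>u x\<bar> powr (\<alpha> + \<beta>))"
    and "v \<in> X2 \<Longrightarrow> integrable lebesgue (\<lambda>x. \<bar>v x\<bar> powr (\<alpha> + \<beta>))"
proof -
  have *: "integrable lebesgue (\<lambda>x. \<bar>u x\<bar> powr (\<alpha> + \<beta>))" if "u \<in> Xcomp s V" "\<And>x. V0 \<le> V x" for u V :: "real ^ 'n \<Rightarrow> real"
  proof -
    have "0 < max 1 (form s V u u)" by simp
    from Xcomp_powr_integrable[where V = V, OF sobolev_r V0 that(2) this]
    obtain K where "\<And>w. w \<in> Xcomp s V \<Longrightarrow> form s V w w \<le> max 1 (form s V u u) \<Longrightarrow>
      integrable lebesgue (\<lambda>x. \<bar>w x\<bar> powr (\<alpha> + \<beta>)) \<and> (LINT x|lebesgue. \<bar>w x\<bar> powr (\<alpha> + \<beta>)) \<le> K" by blast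
    from this[OF that(1)] show ?thesis by simp
  qed
  show "u \<in> X1 \<Longrightarrow> integrable lebesgue (\<lambda>x. \<bar>u x\<bar> powr (\<alpha> + \<beta>))" using * V1 by blast
  show "v \<in> X2 \<Longrightarrow> integrable lebesgue (\<lambda>x. \<bar>v x\<bar> powr (\<alpha> + \<beta>))" using * V2 by blast
qed

lemma coupling_integrable:
  assumes "u \<in> X1" "v \<in> X2"
  shows "integrable lebesgue (\<lambda>x. \<bar>u x\<bar> powr \<alpha> * \<bar>v x\<bar> powr \<beta>)"
  using coupling_int_bound(1)[of \<alpha> \<beta> u v] ab powr_integrable assms XcompD(1)[OF assms(1)] XcompD(1)[OF assms(2)] by auto

lemma energy_scale:
  assumes "u \<in> X1" "v \<in> X2" "0 \<le> t"
  shows "E lam (\<lambda>x. t * u x) (\<lambda>x. t * v x) = sq u v * t\<^sup>2 / 2 - lam * S1 u / (1 - p) * t powr (1 - p)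
      - lam * S2 v / (1 - q) * t powr (1 - q) - \<theta> * cpl u v / (\<alpha> + \<beta>) * t powr (\<alpha> + \<beta>)"
    "E1 lam (\<lambda>x. t * u x) (\<lambda>x. t * v x) = sq u v * t\<^sup>2 - lam * S1 u * t powr (1 - p)
      - lam * S2 v * t powr (1 - q) - \<theta> * cpl u v * t powr (\<alpha> + \<beta>)"
    "E2 lam (\<lambda>x. t * u x) (\<lambda>x. t * v x) = 2 * sq u v * t\<^sup>2 - (1 - p) * (lam * S1 u) * t powr (1 - p)
      - (1 - q) * (lam * S2 v) * t powr (1 - q) - (\<alpha> + \<beta>) * (\<theta> * cpl u v) * t powr (\<alpha> + \<beta>)"
  using assms by (simp_all add: energy_def energy1_def energy2_def normsq_scale singular_int_scale coupling_int_scale mult_ac)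

text \<open>A positive coupling integral excludes that either component vanishes almost
  everywhere.\<close>

lemma AsetD:
  assumes "(u, v) \<in> AA"
  shows "u \<in> X1" "v \<in> X2" "0 < cpl u v" "nontrivial u v" "0 < S1 u" "0 < S2 v" "0 < sq u v"
proof -
  show X: "u \<in> X1" "v \<in> X2" and c: "0 < cpl u v" using assms by (auto simp: Aset_def Xspace_def)
  have zero: False if "AE x in lebesgue. u x = 0 \<or> v x = 0"
  proof -
    have "AE x in lebesgue. \<bar>u x\<bar> powr \<alpha> * \<bar>v x\<bar> powr \<beta> = 0" using that by eventually_elim auto
    then have "cpl u v = (LINT (x :: real ^ 'n)|lebesgue. 0)"
      unfolding coupling_int_def using XcompD(1)[OF X(1)] XcompD(1)[OF X(2)] by (intro integral_cong_AE) auto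
    then show False using c by simp
  qed
  show nt: "nontrivial u v"
  proof (rule ccontr)
    assume "\<not> nontrivial u v"
    then have "AE x in lebesgue. u x = 0 \<and> v x = 0" by (simp add: nontrivial_def)
    then have "AE x in lebesgue. u x = 0 \<or> v x = 0" by eventually_elim simp
    then show False by (rule zero)
  qed
  have "S1 u \<noteq> 0"
  proof
    assume "S1 u = 0"
    then have "AE x in lebesgue. u x = 0" using singular_int_eq_0[where a = a, OF apos] singular_integrable[OF X] by blast
    then have "AE x in lebesgue. u x = 0 \<or> v x = 0" by eventually_elim simp
    then show False by (rule zero)
  qed
  then show "0 < S1 u" using S_nonneg(1)[of u] S_nonneg(2)[of v] by simp
  have "S2 v \<noteq> 0"
  proof
    assume "S2 v = 0"
    then have "AE x in lebesgue. v x = 0" using singular_int_eq_0[where a = b, OF bpos] singular_integrable[OF X] by blast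
    then have "AE x in lebesgue. u x = 0 \<or> v x = 0" by eventually_elim simp
    then show False by (rule zero)
  qed
  then show "0 < S2 v" using S_nonneg(1)[of u] S_nonneg(2)[of v] by simp
  show "0 < sq u v" using nontrivial_pos[OF X nt] by simp
qed

lemma Rn_ray:
  assumes "u \<in> X1" "v \<in> X2" "0 < t"
  shows "Rn s V1 V2 a b p q \<alpha> \<beta> \<theta> (\<lambda>x. t * u x) (\<lambda>x. t * v x)
    = (sq u v * t\<^sup>2 - \<theta> * cpl u v * t powr (\<alpha> + \<beta>)) / (S1 u * t powr (1 - p) + S2 v * t powr (1 - q))"
  using assms by (simp add: Rn_def normsq_scale singular_int_scale coupling_int_scale mult_ac)

lemma Re_ray:
  assumes "u \<in> X1" "v \<in> X2" "0 < t"
  shows "Re_quot s V1 V2 a b p q \<alpha> \<beta> \<theta> (\<lambda>x. t * u x) (\<lambda>x. t * v x)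
    = (sq u v / 2 * t\<^sup>2 - \<theta> * cpl u v / (\<alpha> + \<beta>) * t powr (\<alpha> + \<beta>)) / (S1 u / (1 - p) * t powr (1 - p) + S2 v / (1 - q) * t powr (1 - q))"
  using assms by (simp add: Re_quot_def normsq_scale singular_int_scale coupling_int_scale mult_ac)

section \<open>Maxima along rays and comparison of the thresholds\<close>

text \<open>\<open>max_on_ray\<close> is a \<open>GREATEST\<close> and has a usable value only once
  an attained maximum is exhibited, hence the explicit maximizer.\<close>

lemma max_on_ray_eq:
  assumes "0 < t0" "\<And>t. 0 < t \<Longrightarrow> R (\<lambda>x. t * u x) (\<lambda>x. t * v x) \<le> R (\<lambda>x. t0 * u x) (\<lambda>x. t0 * v x)"
  shows "max_on_ray R u v = R (\<lambda>x. t0 * u x) (\<lambda>x. t0 * v x)"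
  unfolding max_on_ray_def using assms by (intro Greatest_equality) auto

lemma max_on_ray_Rn:
  assumes "(u, v) \<in> AA"
  obtains t0 where "0 < t0"
    "max_on_ray (Rn s V1 V2 a b p q \<alpha> \<beta> \<theta>) u v = Rn s V1 V2 a b p q \<alpha> \<beta> \<theta> (\<lambda>x. t0 * u x) (\<lambda>x. t0 * v x)"
    "\<And>t. 0 < t \<Longrightarrow> Rn s V1 V2 a b p q \<alpha> \<beta> \<theta> (\<lambda>x. t * u x) (\<lambda>x. t * v x) \<le> max_on_ray (Rn s V1 V2 a b p q \<alpha> \<beta> \<theta>) u v"
proof -
  note A = AsetD[OF assms]
  obtain t0 where t0: "0 < t0" "\<And>t. 0 < t \<Longrightarrow>
     (sq u v * t\<^sup>2 - \<theta> * cpl u v * t powr (\<alpha> + \<beta>)) / (S1 u * t powr (1 - p) + S2 v * t powr (1 - q))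
     \<le> (sq u v * t0\<^sup>2 - \<theta> * cpl u v * t0 powr (\<alpha> + \<beta>)) / (S1 u * t0 powr (1 - p) + S2 v * t0 powr (1 - q))"
    by (rule ray_quotient_max[of "sq u v" "\<theta> * cpl u v" "S1 u" "S2 v" "1 - p" "\<alpha> + \<beta>" "1 - q"]) (use A th p0 r2 in auto)
  have le: "Rn s V1 V2 a b p q \<alpha> \<beta> \<theta> (\<lambda>x. t * u x) (\<lambda>x. t * v x) \<le> Rn s V1 V2 a b p q \<alpha> \<beta> \<theta> (\<lambda>x. t0 * u x) (\<lambda>x. t0 * v x)" if "0 < t" for t
    unfolding Rn_ray[OF A(1,2) that] Rn_ray[OF A(1,2) t0(1)] by (rule t0(2)[OF that])
  from max_on_ray_eq[where R = "Rn s V1 V2 a b p q \<alpha> \<beta> \<theta>" and u = u and v = v, OF t0(1) le] le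
  show thesis by (intro that[OF t0(1)]) auto
qed

lemma max_on_ray_Re:
  assumes "(u, v) \<in> AA"
  obtains t0 where "0 < t0"
    "max_on_ray (Re_quot s V1 V2 a b p q \<alpha> \<beta> \<theta>) u v = Re_quot s V1 V2 a b p q \<alpha> \<beta> \<theta> (\<lambda>x. t0 * u x) (\<lambda>x. t0 * v x)"
    "0 < max_on_ray (Re_quot s V1 V2 a b p q \<alpha> \<beta> \<theta>) u v"
    "\<And>t. 0 < t \<Longrightarrow> Re_quot s V1 V2 a b p q \<alpha> \<beta> \<theta> (\<lambda>x. t * u x) (\<lambda>x. t * v x) \<le> max_on_ray (Re_quot s V1 V2 a b p q \<alpha> \<beta> \<theta>) u v"
proof -
  note A = AsetD[OF assms]
  let ?R = "\<lambda>t. (sq u v / 2 * t\<^sup>2 - \<theta> * cpl u v / (\<alpha> + \<beta>) * t powr (\<alpha> + \<beta>)) / (S1 u / (1 - p) * t powr (1 - p) + S2 v / (1 - q) * t powr (1 - q))"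
  obtain t0 where t0: "0 < t0" "0 < ?R t0" "\<And>t. 0 < t \<Longrightarrow> ?R t \<le> ?R t0"
    by (rule ray_quotient_max[of "sq u v / 2" "\<theta> * cpl u v / (\<alpha> + \<beta>)" "S1 u / (1 - p)" "S2 v / (1 - q)" "1 - p" "\<alpha> + \<beta>" "1 - q"])
       (use A th p0 p1 q1 r2 in auto)
  have le: "Re_quot s V1 V2 a b p q \<alpha> \<beta> \<theta> (\<lambda>x. t * u x) (\<lambda>x. t * v x) \<le> Re_quot s V1 V2 a b p q \<alpha> \<beta> \<theta> (\<lambda>x. t0 * u x) (\<lambda>x. t0 * v x)" if "0 < t" for t
    unfolding Re_ray[OF A(1,2) that] Re_ray[OF A(1,2) t0(1)] by (rule t0(3)[OF that])
  have pos: "0 < Re_quot s V1 V2 a b p q \<alpha> \<beta> \<theta> (\<lambda>x. t0 * u x) (\<lambda>x. t0 * v x)"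
    unfolding Re_ray[OF A(1,2) t0(1)] by (rule t0(2))
  from max_on_ray_eq[where R = "Re_quot s V1 V2 a b p q \<alpha> \<beta> \<theta>" and u = u and v = v, OF t0(1) le] le pos
  show thesis by (intro that[OF t0(1)]) auto
qed

lemma bump_in_Aset: "(bump 1, bump 1) \<in> AA"
proof -
  have X: "bump 1 \<in> X1" "bump 1 \<in> X2"
    using bump_in_Xcomp[OF s(1,2) V1c V1_nonneg] bump_in_Xcomp[OF s(1,2) V2c V2_nonneg] by auto
  let ?b = "bump 1 :: real ^ 'n \<Rightarrow> real"
  have "cpl ?b ?b \<noteq> 0"
  proof
    assume "cpl ?b ?b = 0"
    then have "AE x in lebesgue. \<bar>bump 1 (x :: real ^ 'n)\<bar> powr \<alpha> * \<bar>bump 1 x\<bar> powr \<beta> = 0"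
      using integral_nonneg_eq_0_iff_AE[OF coupling_integrable[OF X]] by (auto simp: coupling_int_def)
    then have "AE x in lebesgue. (x :: real ^ 'n) \<notin> ball 0 1"
      by eventually_elim (use bump_pos in force)
    then have "emeasure lebesgue (ball (0 :: real ^ 'n) 1) = 0"
      by (subst (asm) AE_iff_measurable[where N = "ball 0 1"]) auto
    then show False using unit_ball_vol_pos[of "real CARD('n)"] by (simp add: emeasure_ball)
  qed
  then have "0 < cpl ?b ?b" using coupling_int_nonneg[of \<alpha> \<beta> ?b ?b] by linarith
  then show ?thesis using X by (simp add: Aset_def Xspace_def)
qed

lemma lambda_upper_finite: "lam_up < \<infinity>"
proof -
  have "lam_up \<le> ereal (max_on_ray (Rn s V1 V2 a b p q \<alpha> \<beta> \<theta>) (bump 1) (bump 1))"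
    unfolding lambda_upper_def using INF_lower[OF bump_in_Aset, of "\<lambda>(u, v). ereal (max_on_ray (Rn s V1 V2 a b p q \<alpha> \<beta> \<theta>) u v)"] by simp
  then show ?thesis by (rule le_less_trans) simp
qed

lemma lambda_lower_finite: "lam_low < \<infinity>"
proof -
  have "lam_low \<le> ereal (max_on_ray (Re_quot s V1 V2 a b p q \<alpha> \<beta> \<theta>) (bump 1) (bump 1))"
    unfolding lambda_lower_def using INF_lower[OF bump_in_Aset, of "\<lambda>(u, v). ereal (max_on_ray (Re_quot s V1 V2 a b p q \<alpha> \<beta> \<theta>) u v)"] by simp
  then show ?thesis by (rule le_less_trans) simp
qed

text \<open>On each ray it suffices to test one point. Rescaling to norm 1 makes the Sobolev and
  singular bounds independent of the pair, and a common small multiple \<open>t\<close> then has a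
  quotient bounded below.\<close>

lemma lambda_lower_pos: "0 < lam_low"
proof -
  let ?r = "\<alpha> + \<beta>"
  obtain K1 where K1: "0 < K1" "\<And>u. u \<in> X1 \<Longrightarrow> form s V1 u u \<le> 1 \<Longrightarrow>
      integrable lebesgue (\<lambda>x. \<bar>u x\<bar> powr ?r) \<and> (LINT x|lebesgue. \<bar>u x\<bar> powr ?r) \<le> K1"
    using Xcomp_powr_integrable[where V = V1, OF sobolev_r V0 V1 zero_less_one] by blast
  obtain K2 where K2: "0 < K2" "\<And>u. u \<in> X2 \<Longrightarrow> form s V2 u u \<le> 1 \<Longrightarrow>
      integrable lebesgue (\<lambda>x. \<bar>u x\<bar> powr ?r) \<and> (LINT x|lebesgue. \<bar>u x\<bar> powr ?r) \<le> K2"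
    using Xcomp_powr_integrable[where V = V2, OF sobolev_r V0 V2 zero_less_one] by blast
  define D1 where "D1 = (LINT x|lebesgue. \<bar>a x\<bar> powr (2 / (1 + p))) + 1 / V0"
  define D2 where "D2 = (LINT x|lebesgue. \<bar>b x\<bar> powr (2 / (1 + q))) + 1 / V0"
  have D: "0 < D1" "0 < D2" using V0 by (auto simp: D1_def D2_def add_nonneg_pos)
  define K where "K = K1 + K2"
  have K: "0 < K" using K1 K2 by (simp add: K_def)
  \<comment> \<open>Chosen so that the coupling term takes away at most half of the quadratic term
    \<open>t\<^sup>2 / 2\<close>.\<close>
  define t where "t = min 1 ((?r / (4 * \<theta> * K)) powr (1 / (?r - 2)))"
  have t: "0 < t" "t \<le> 1" using K th r2 by (auto simp: t_def)
  have "t powr (?r - 2) \<le> ((?r / (4 * \<theta> * K)) powr (1 / (?r - 2))) powr (?r - 2)"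
    using t r2 by (intro powr_mono2) (auto simp: t_def)
  also have "\<dots> = ?r / (4 * \<theta> * K)" using r2 K th by (simp add: powr_powr)
  finally have tr: "\<theta> * K / ?r * t powr (?r - 2) \<le> 1 / 4" using r2 K th by (simp add: field_simps)
  define c where "c = (t\<^sup>2 / 4) / (D1 / (1 - p) + D2 / (1 - q))"
  have c: "0 < c" using t D p1 q1 by (simp add: c_def add_pos_pos)
  have "c \<le> max_on_ray (Re_quot s V1 V2 a b p q \<alpha> \<beta> \<theta>) u v" if uv: "(u, v) \<in> AA" for u v
  proof -
    note A = AsetD[OF uv]
    define \<tau> where "\<tau> = 1 / sqrt (sq u v)"
    have \<tau>: "0 < \<tau>" using A by (simp add: \<tau>_def)
    define u' v' where "u' = (\<lambda>x. \<tau> * u x)" and "v' = (\<lambda>x. \<tau> * v x)"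
    have X: "u' \<in> X1" "v' \<in> X2" using A by (auto simp: u'_def v'_def Xcomp_scale)
    have sq1: "sq u' v' = 1"
    proof -
      have "(sqrt (sq u v))\<^sup>2 = sq u v" using A by simp
      then show ?thesis using A unfolding u'_def v'_def normsq_scale[OF A(1,2)] \<tau>_def by (simp add: power_divide)
    qed
    have f: "form s V1 u' u' \<le> 1" "form s V2 v' v' \<le> 1"
      using sq1 form_nonneg[of V1 s u', OF V1_nonneg] form_nonneg[of V2 s v', OF V2_nonneg] unfolding normsq_eq[OF X] by linarith+
    have cp: "cpl u' v' \<le> K"
      using coupling_int_bound(2)[of \<alpha> \<beta> u' v'] ab powr_integrable X XcompD(1)[OF X(1)] XcompD(1)[OF X(2)] K1(2)[OF X(1) f(1)] K2(2)[OF X(2) f(2)]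
      unfolding K_def by fastforce
    have L2: "(LINT x|lebesgue. (u' x)\<^sup>2) \<le> 1 / V0" "(LINT x|lebesgue. (v' x)\<^sup>2) \<le> 1 / V0"
      using Xcomp_L2_le(1)[OF X(1) V0 V1] Xcomp_L2_le(1)[OF X(2) V0 V2] f V0 by (auto simp: field_simps)
    have SD: "S1 u' \<le> D1" "S2 v' \<le> D2"
      using singular_int_bound(2)[OF p0 p1 aL apos XcompD(1,2)[OF X(1)], of 1]
        singular_int_bound(2)[OF q0 q1 bL bpos XcompD(1,2)[OF X(2)], of 1] L2 by (auto simp: D1_def D2_def)
    have S0: "0 < S1 u'" "0 < S2 v'"
      using A \<tau> unfolding u'_def v'_def by (auto simp: singular_int_scale)
    let ?den = "S1 u' / (1 - p) * t powr (1 - p) + S2 v' / (1 - q) * t powr (1 - q)"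
    have den: "0 < ?den" "?den \<le> D1 / (1 - p) + D2 / (1 - q)"
    proof -
      show "0 < ?den" using S0 p1 q1 t by (simp add: add_pos_pos)
      have "S1 u' * t powr (1 - p) \<le> D1 * 1" "S2 v' * t powr (1 - q) \<le> D2 * 1"
        using p1 q1 t D by (intro mult_mono SD powr_le1; simp)+
      from divide_right_mono[OF this(1), of "1 - p"] divide_right_mono[OF this(2), of "1 - q"]
      show "?den \<le> D1 / (1 - p) + D2 / (1 - q)" using p1 q1 by simp
    qed
    have num: "t\<^sup>2 / 4 \<le> 1 / 2 * t\<^sup>2 - \<theta> * cpl u' v' / ?r * t powr ?r"
    proof -
      have "t powr ?r = t powr (?r - 2) * t\<^sup>2" using t powr_add[of t "?r - 2" 2] by simp
      then have "\<theta> * cpl u' v' / ?r * t powr ?r = (\<theta> * cpl u' v' / ?r * t powr (?r - 2)) * t\<^sup>2" by simp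
      also have "\<dots> \<le> (\<theta> * K / ?r * t powr (?r - 2)) * t\<^sup>2"
        using cp th r2 by (intro mult_right_mono divide_right_mono mult_left_mono) auto
      also have "\<dots> \<le> 1 / 4 * t\<^sup>2" using tr by (intro mult_right_mono) auto
      finally show ?thesis by simp
    qed
    have "0 \<le> 1 / 2 * t\<^sup>2 - \<theta> * cpl u' v' / ?r * t powr ?r" by (rule order_trans[OF _ num]) simp
    then have "c \<le> (1 / 2 * t\<^sup>2 - \<theta> * cpl u' v' / ?r * t powr ?r) / ?den"
      unfolding c_def using num den by (intro frac_le)
    also have "\<dots> = Re_quot s V1 V2 a b p q \<alpha> \<beta> \<theta> (\<lambda>x. t * u' x) (\<lambda>x. t * v' x)"
      unfolding Re_ray[OF X t(1)] sq1 ..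
    also have "\<dots> = Re_quot s V1 V2 a b p q \<alpha> \<beta> \<theta> (\<lambda>x. (t * \<tau>) * u x) (\<lambda>x. (t * \<tau>) * v x)"
      by (simp add: u'_def v'_def mult.assoc)
    also have "\<dots> \<le> max_on_ray (Re_quot s V1 V2 a b p q \<alpha> \<beta> \<theta>) u v"
      using max_on_ray_Re[OF uv] \<tau> t by (metis mult_pos_pos)
    finally show ?thesis .
  qed
  then have *: "ereal c \<le> lam_low"
    unfolding lambda_lower_def by (intro INF_greatest) auto
  have "0 < ereal c" using c by simp
  then show ?thesis using * by (rule less_le_trans)
qed

lemma lambda_lower_less_upper: "lam_low < lam_up"
proof -
  let ?r = "\<alpha> + \<beta>"
  obtain k where k: "1 < k" and kr: "\<And>A C S1 S2 t0 :: real. 0 < A \<Longrightarrow> 0 < C \<Longrightarrow> 0 < S1 \<Longrightarrow> 0 < S2 \<Longrightarrow> 0 < t0 \<Longrightarrow>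
      0 < (A / 2 * t0\<^sup>2 - C / ?r * t0 powr ?r) / (S1 / (1 - p) * t0 powr (1 - p) + S2 / (1 - q) * t0 powr (1 - q)) \<Longrightarrow>
      (\<And>t. 0 < t \<Longrightarrow> (A / 2 * t\<^sup>2 - C / ?r * t powr ?r) / (S1 / (1 - p) * t powr (1 - p) + S2 / (1 - q) * t powr (1 - q))
        \<le> (A / 2 * t0\<^sup>2 - C / ?r * t0 powr ?r) / (S1 / (1 - p) * t0 powr (1 - p) + S2 / (1 - q) * t0 powr (1 - q))) \<Longrightarrow>
      \<exists>t>0. k * ((A / 2 * t0\<^sup>2 - C / ?r * t0 powr ?r) / (S1 / (1 - p) * t0 powr (1 - p) + S2 / (1 - q) * t0 powr (1 - q)))
        \<le> (A * t\<^sup>2 - C * t powr ?r) / (S1 * t powr (1 - p) + S2 * t powr (1 - q))"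
    using ray_quotients_ratio[OF p0 pq q1 r2] by blast
  \<comment> \<open>Pointwise strictness could be lost in the infimum; a fixed factor
    \<open>k > 1\<close> is not, given that the lower threshold is positive and finite.\<close>
  obtain L where L: "lam_low = ereal L" "0 < L"
    using lambda_lower_pos lambda_lower_finite by (cases lam_low) auto
  have "k * L \<le> max_on_ray (Rn s V1 V2 a b p q \<alpha> \<beta> \<theta>) u v" if uv: "(u, v) \<in> AA" for u v
  proof -
    note A = AsetD[OF uv]
    let ?m = "max_on_ray (Re_quot s V1 V2 a b p q \<alpha> \<beta> \<theta>) u v"
    have "lam_low \<le> ereal ?m"
      unfolding lambda_lower_def using INF_lower[OF uv, of "\<lambda>(u, v). ereal (max_on_ray (Re_quot s V1 V2 a b p q \<alpha> \<beta> \<theta>) u v)"] by simp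
    then have Lm: "L \<le> ?m" using L by simp
    obtain t0 where t0: "0 < t0" "?m = Re_quot s V1 V2 a b p q \<alpha> \<beta> \<theta> (\<lambda>x. t0 * u x) (\<lambda>x. t0 * v x)" "0 < ?m"
      "\<And>t. 0 < t \<Longrightarrow> Re_quot s V1 V2 a b p q \<alpha> \<beta> \<theta> (\<lambda>x. t * u x) (\<lambda>x. t * v x) \<le> ?m"
      using max_on_ray_Re[OF uv] by blast
    note m = t0(2)[unfolded Re_ray[OF A(1,2) t0(1)]]
    have "\<exists>t>0. k * ?m \<le> (sq u v * t\<^sup>2 - \<theta> * cpl u v * t powr ?r) / (S1 u * t powr (1 - p) + S2 v * t powr (1 - q))"
      unfolding m
    proof (rule kr)
      show "0 < (sq u v / 2 * t0\<^sup>2 - \<theta> * cpl u v / ?r * t0 powr ?r) / (S1 u / (1 - p) * t0 powr (1 - p) + S2 v / (1 - q) * t0 powr (1 - q))"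
        using t0(3) unfolding m .
      show "(sq u v / 2 * t\<^sup>2 - \<theta> * cpl u v / ?r * t powr ?r) / (S1 u / (1 - p) * t powr (1 - p) + S2 v / (1 - q) * t powr (1 - q))
        \<le> (sq u v / 2 * t0\<^sup>2 - \<theta> * cpl u v / ?r * t0 powr ?r) / (S1 u / (1 - p) * t0 powr (1 - p) + S2 v / (1 - q) * t0 powr (1 - q))"
        if "0 < t" for t
        using t0(4)[OF that] unfolding m Re_ray[OF A(1,2) that] .
    qed (use A th t0 in auto)
    then obtain t where t: "0 < t" "k * ?m \<le> Rn s V1 V2 a b p q \<alpha> \<beta> \<theta> (\<lambda>x. t * u x) (\<lambda>x. t * v x)"
      using Rn_ray[OF A(1,2)] by auto
    have "k * L \<le> k * ?m" using Lm k by simp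
    also note t(2)
    also have "Rn s V1 V2 a b p q \<alpha> \<beta> \<theta> (\<lambda>x. t * u x) (\<lambda>x. t * v x) \<le> max_on_ray (Rn s V1 V2 a b p q \<alpha> \<beta> \<theta>) u v"
      using max_on_ray_Rn[OF uv] t(1) by metis
    finally show ?thesis .
  qed
  then have "ereal (k * L) \<le> lam_up"
    unfolding lambda_upper_def by (intro INF_greatest) auto
  moreover have "lam_low < ereal (k * L)" using L k by simp
  ultimately show ?thesis by (rule less_le_trans[rotated])
qed

text \<open>For pairs in \<open>Aset\<close> the radial derivative is positive where
  \<open>Rn\<close> exceeds \<open>lam\<close>, for instance at its maximum on the ray. With zero
  coupling nothing competes with the quadratic term for large \<open>t\<close>.\<close>

lemma exists_ray_energy1_pos:
  assumes lam: "0 < lam" "ereal lam < lam_up" and X: "u \<in> X1" "v \<in> X2" and nt: "nontrivial u v"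
  shows "\<exists>t>0. 0 < E1 lam (\<lambda>x. t * u x) (\<lambda>x. t * v x)"
proof (cases "(u, v) \<in> AA")
  case True
  note A = AsetD[OF True]
  obtain t0 where t0: "0 < t0"
    "max_on_ray (Rn s V1 V2 a b p q \<alpha> \<beta> \<theta>) u v = Rn s V1 V2 a b p q \<alpha> \<beta> \<theta> (\<lambda>x. t0 * u x) (\<lambda>x. t0 * v x)"
    using max_on_ray_Rn[OF True] by blast
  have "lam_up \<le> ereal (max_on_ray (Rn s V1 V2 a b p q \<alpha> \<beta> \<theta>) u v)"
    unfolding lambda_upper_def using INF_lower[OF True, of "\<lambda>(u, v). ereal (max_on_ray (Rn s V1 V2 a b p q \<alpha> \<beta> \<theta>) u v)"] by simp
  then have "ereal lam < ereal (max_on_ray (Rn s V1 V2 a b p q \<alpha> \<beta> \<theta>) u v)" by (rule less_le_trans[OF lam(2)])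
  then have "lam < (sq u v * t0\<^sup>2 - \<theta> * cpl u v * t0 powr (\<alpha> + \<beta>)) / (S1 u * t0 powr (1 - p) + S2 v * t0 powr (1 - q))"
    unfolding t0(2) Rn_ray[OF X t0(1)] by simp
  moreover have "0 < S1 u * t0 powr (1 - p) + S2 v * t0 powr (1 - q)" using A t0 by (simp add: add_pos_pos)
  ultimately have "lam * (S1 u * t0 powr (1 - p) + S2 v * t0 powr (1 - q)) < sq u v * t0\<^sup>2 - \<theta> * cpl u v * t0 powr (\<alpha> + \<beta>)"
    by (simp add: pos_less_divide_eq)
  then have "0 < E1 lam (\<lambda>x. t0 * u x) (\<lambda>x. t0 * v x)"
    using t0 unfolding energy_scale(2)[OF X less_imp_le[OF t0(1)]] by (simp add: algebra_simps)
  then show ?thesis using t0 by blast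
next
  case False
  then have c: "cpl u v = 0" using X coupling_int_nonneg[of \<alpha> \<beta> u v] by (auto simp: Aset_def Xspace_def)
  note P = nontrivial_pos[OF X nt]
  \<comment> \<open>Being at least 1, \<open>t\<close> dominates both powers below 1, and the second
    entry lets \<open>sq u v * t\<close> exceed the singular coefficients.\<close>
  define t where "t = max 1 (lam * (S1 u + S2 v) / sq u v + 1)"
  have t: "1 \<le> t" "lam * (S1 u + S2 v) / sq u v < t" by (auto simp: t_def)
  have tp: "t powr (1 - p) \<le> t" "t powr (1 - q) \<le> t"
    using powr_mono[of "1 - p" 1 t] powr_mono[of "1 - q" 1 t] t p0 q0 by auto
  have "lam * S1 u * t powr (1 - p) + lam * S2 v * t powr (1 - q) \<le> lam * S1 u * t + lam * S2 v * t"
    using tp lam S_nonneg(1)[of u] S_nonneg(2)[of v] by (intro add_mono mult_left_mono) auto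
  also have "\<dots> = (lam * (S1 u + S2 v)) * t" by (simp add: algebra_simps)
  also have "\<dots> < (sq u v * t) * t"
    using t P by (intro mult_strict_right_mono) (auto simp: field_simps)
  finally have "0 < E1 lam (\<lambda>x. t * u x) (\<lambda>x. t * v x)"
    using t c unfolding energy_scale(2)[OF X order_trans[OF zero_le_one t(1)]] by (simp add: power2_eq_square mult.assoc)
  then show ?thesis using t by (intro exI[of _ t]) auto
qed

end

section \<open>Minimization on the Nehari set\<close>

lemma form_diff_le:
  assumes "u \<in> Xcomp s V" "v \<in> Xcomp s V" and V: "V \<in> borel_measurable lebesgue" "\<And>x. 0 \<le> V x"
  shows "(\<lambda>x. u x - v x) \<in> Xcomp s V"
    "form s V (\<lambda>x. u x - v x) (\<lambda>x. u x - v x) \<le> 2 * form s V u u + 2 * form s V v v"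
proof -
  note plus = Xcomp_add_scaled[OF assms(1,2) V, of 1] and minus = Xcomp_add_scaled[OF assms(1,2) V, of "-1"]
  show "(\<lambda>x. u x - v x) \<in> Xcomp s V" using minus(1) by simp
  have "0 \<le> form s V u u + 2 * form s V u v + form s V v v"
    using plus(2) form_nonneg[of V s "\<lambda>x. u x + 1 * v x", OF V(2)] by simp
  then show "form s V (\<lambda>x. u x - v x) (\<lambda>x. u x - v x) \<le> 2 * form s V u u + 2 * form s V v v"
    using minus(2) by simp
qed

context fractional_system
begin

lemma functionals_tendsto:
  assumes X: "\<And>n. U n \<in> X1" "\<And>n. W n \<in> X2" "u \<in> X1" "v \<in> X2"
    and B: "\<And>n. form s V1 (\<lambda>x. U n x - u x) (\<lambda>x. U n x - u x) \<le> B" "\<And>n. form s V2 (\<lambda>x. W n x - v x) (\<lambda>x. W n x - v x) \<le> B"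
    and AE: "AE x in lebesgue. (\<lambda>n. U n x) \<longlonglongrightarrow> u x" "AE x in lebesgue. (\<lambda>n. W n x) \<longlonglongrightarrow> v x"
    and L2: "(\<lambda>n. LINT x|lebesgue. (U n x - u x)\<^sup>2) \<longlonglongrightarrow> 0" "(\<lambda>n. LINT x|lebesgue. (W n x - v x)\<^sup>2) \<longlonglongrightarrow> 0"
  shows "(\<lambda>n. S1 (U n)) \<longlonglongrightarrow> S1 u" "(\<lambda>n. S2 (W n)) \<longlonglongrightarrow> S2 v" "(\<lambda>n. cpl (U n) (W n)) \<longlonglongrightarrow> cpl u v"
proof -
  note D1 = form_diff_le(1)[OF X(1,3) V1_measurable V1_nonneg] and D2 = form_diff_le(1)[OF X(2,4) V2_measurable V2_nonneg]
  show "(\<lambda>n. S1 (U n)) \<longlonglongrightarrow> S1 u"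
    by (rule singular_int_tendsto[OF p0 p1 aL apos XcompD(1)[OF X(1)] XcompD(1)[OF X(3)] XcompD(2)[OF X(1)] XcompD(2)[OF X(3)] XcompD(2)[OF D1] L2(1)])
  show "(\<lambda>n. S2 (W n)) \<longlonglongrightarrow> S2 v"
    by (rule singular_int_tendsto[OF q0 q1 bL bpos XcompD(1)[OF X(2)] XcompD(1)[OF X(4)] XcompD(2)[OF X(2)] XcompD(2)[OF X(4)] XcompD(2)[OF D2] L2(2)])
  obtain e where e: "\<alpha> + \<beta> < e" "sobolev_exponent TYPE('n) s e" by (rule sobolev_above)
  have "(\<lambda>n. LINT x|lebesgue. \<bar>U n x - u x\<bar> powr (\<alpha> + \<beta>)) \<longlonglongrightarrow> 0"
    by (rule powr_integral_tendsto_0[OF e(2) r2 e(1) V0 V1 D1 B(1) L2(1)])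
  moreover have "(\<lambda>n. LINT x|lebesgue. \<bar>W n x - v x\<bar> powr (\<alpha> + \<beta>)) \<longlonglongrightarrow> 0"
    by (rule powr_integral_tendsto_0[OF e(2) r2 e(1) V0 V2 D2 B(2) L2(2)])
  ultimately show "(\<lambda>n. cpl (U n) (W n)) \<longlonglongrightarrow> cpl u v"
    using ab by (intro coupling_int_tendsto AE XcompD(1)[OF X(1)] XcompD(1)[OF X(2)] XcompD(1)[OF X(3)] XcompD(1)[OF X(4)]
      powr_integrable X D1 D2) auto
qed

lemma compact_embedding:
  fixes V :: "real ^ 'n \<Rightarrow> real"
  assumes U: "\<And>n. U n \<in> Xcomp s V" "\<And>n. form s V (U n) (U n) \<le> B"
    and Vm: "V \<in> borel_measurable lebesgue" and V: "\<And>x. V0 \<le> V x"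
    and Vfin: "\<And>M. 0 < M \<Longrightarrow> emeasure lebesgue {x. V x \<le> M} < \<infinity>"
  obtains r u where "strict_mono (r :: nat \<Rightarrow> nat)" "u \<in> borel_measurable lebesgue" "integrable lebesgue (\<lambda>x. (u x)\<^sup>2)"
    "AE x in lebesgue. (\<lambda>n. U (r n) x) \<longlonglongrightarrow> (u x :: real)"
    "(\<lambda>n. LINT x|lebesgue. (U (r n) x - u x)\<^sup>2) \<longlonglongrightarrow> 0"
proof -
  have V': "0 \<le> V x" for x using V0 V[of x] by simp
  define C where "C = max 1 (max B (B / V0))"
  have C: "0 < C" by (simp add: C_def)
  have "form s V (U n) (U n) / V0 \<le> B / V0" for n using U(2)[of n] V0 by (simp add: divide_right_mono)
  then have c: "form s V (U n) (U n) \<le> C" "form s V (U n) (U n) / V0 \<le> C" for n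
    using U(2)[of n] by (auto simp: C_def le_max_iff_disj)
  have 1: "(\<integral>\<^sup>+ x. ennreal ((U n x)\<^sup>2) \<partial>lebesgue) \<le> ennreal C" for n
    by (rule order_trans[OF Xcomp_L2_le(2)[OF U(1) V0 V] ennreal_leI[OF c(2)]])
  have 2: "gagliardo_nn s (U n) \<le> ennreal C" for n
    by (rule order_trans[OF Xcomp_nn(1)[OF U(1) V'] ennreal_leI[OF c(1)]])
  have 3: "(\<integral>\<^sup>+ x. ennreal (V x * (U n x)\<^sup>2) \<partial>lebesgue) \<le> ennreal C" for n
    by (rule order_trans[OF Xcomp_nn(2)[OF U(1) V'] ennreal_leI[OF c(1)]])
  obtain r u where r: "strict_mono (r :: nat \<Rightarrow> nat)" and u [measurable]: "u \<in> borel_measurable lebesgue"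
    and AE: "AE x in lebesgue. (\<lambda>n. U (r n) x) \<longlonglongrightarrow> u x"
    and L: "(\<lambda>n. \<integral>\<^sup>+ x. ennreal ((U (r n) x - u x)\<^sup>2) \<partial>lebesgue) \<longlonglongrightarrow> 0"
    by (rule rellich[OF s(1) XcompD(1)[OF U(1)] Vm Vfin C 1 2 3]) blast
  note [measurable] = XcompD(1)[OF U(1)]
  have "(\<integral>\<^sup>+ x. ennreal ((u x)\<^sup>2) \<partial>lebesgue) = (\<integral>\<^sup>+ x. liminf (\<lambda>n. ennreal ((U (r n) x)\<^sup>2)) \<partial>lebesgue)"
  proof (rule nn_integral_cong_AE)
    show "AE x in lebesgue. ennreal ((u x)\<^sup>2) = liminf (\<lambda>n. ennreal ((U (r n) x)\<^sup>2))"
      using AE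
    proof eventually_elim
      fix x assume "(\<lambda>n. U (r n) x) \<longlonglongrightarrow> u x"
      then have "(\<lambda>n. ennreal ((U (r n) x)\<^sup>2)) \<longlonglongrightarrow> ennreal ((u x)\<^sup>2)" by (intro tendsto_ennrealI tendsto_intros)
      then show "ennreal ((u x)\<^sup>2) = liminf (\<lambda>n. ennreal ((U (r n) x)\<^sup>2))" by (intro lim_imp_Liminf[symmetric]) simp_all
    qed
  qed
  also have "\<dots> \<le> liminf (\<lambda>n. \<integral>\<^sup>+ x. ennreal ((U (r n) x)\<^sup>2) \<partial>lebesgue)" by (rule nn_integral_liminf) measurable
  also have "\<dots> \<le> ennreal C" using 1 by (intro Liminf_le) (auto intro: always_eventually)
  finally have u2: "integrable lebesgue (\<lambda>x. (u x)\<^sup>2)" by (intro integrableI_bounded) (auto intro: le_less_trans)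
  have D: "integrable lebesgue (\<lambda>x. (U (r n) x - u x)\<^sup>2)" for n
    using XcompD(2)[OF U(1)] u2 by (intro integrable_square_diff) auto
  have "(\<lambda>n. ennreal (LINT x|lebesgue. (U (r n) x - u x)\<^sup>2)) \<longlonglongrightarrow> ennreal 0"
    using L D by (simp add: nn_integral_eq_integral)
  then have "(\<lambda>n. LINT x|lebesgue. (U (r n) x - u x)\<^sup>2) \<longlonglongrightarrow> 0"
    by (subst (asm) tendsto_ennreal_iff) (auto intro: always_eventually)
  then show thesis using that[OF r u u2 AE] by blast
qed

text \<open>The norms are made convergent by a further subsequence, but their limit \<open>L\<close>
  may exceed the norm of the limit pair. The inequality is all that is kept.\<close>

lemma bounded_pair_limit:
  assumes X: "\<And>n. U n \<in> X1" "\<And>n. W n \<in> X2"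
    and B: "\<And>n. form s V1 (U n) (U n) \<le> B" "\<And>n. form s V2 (W n) (W n) \<le> B"
  obtains r u v L where "strict_mono (r :: nat \<Rightarrow> nat)" "u \<in> X1" "v \<in> X2"
    "(\<lambda>n. S1 (U (r n))) \<longlonglongrightarrow> S1 u" "(\<lambda>n. S2 (W (r n))) \<longlonglongrightarrow> S2 v" "(\<lambda>n. cpl (U (r n)) (W (r n))) \<longlonglongrightarrow> cpl u v"
    "(\<lambda>n. sq (U (r n)) (W (r n))) \<longlonglongrightarrow> L" "sq u v \<le> L"
proof -
  obtain r1 u where r1: "strict_mono (r1 :: nat \<Rightarrow> nat)" and u: "u \<in> borel_measurable lebesgue"
    and u1: "AE x in lebesgue. (\<lambda>n. U (r1 n) x) \<longlonglongrightarrow> u x" "(\<lambda>n. LINT x|lebesgue. (U (r1 n) x - u x)\<^sup>2) \<longlonglongrightarrow> 0"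
    by (rule compact_embedding[where U = U and V = V1, OF X(1) B(1) V1_measurable V1 V1fin]) blast
  obtain r2 v where r2: "strict_mono (r2 :: nat \<Rightarrow> nat)" and v: "v \<in> borel_measurable lebesgue"
    and v1: "AE x in lebesgue. (\<lambda>n. W (r1 (r2 n)) x) \<longlonglongrightarrow> v x" "(\<lambda>n. LINT x|lebesgue. (W (r1 (r2 n)) x - v x)\<^sup>2) \<longlonglongrightarrow> 0"
    by (rule compact_embedding[where U = "\<lambda>n. W (r1 n)" and V = V2, OF X(2) B(2) V2_measurable V2 V2fin]) blast
  define f where "f n = (form s V1 (U (r1 (r2 n))) (U (r1 (r2 n))), form s V2 (W (r1 (r2 n))) (W (r1 (r2 n))))" for n
  have "bounded (range f)"
  proof (rule boundedI)
    fix z assume "z \<in> range f"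
    then obtain n where z: "z = f n" by auto
    have "norm (f n) \<le> norm (fst (f n)) + norm (snd (f n))" unfolding f_def fst_conv snd_conv by (rule norm_Pair_le)
    also have "\<dots> \<le> B + B"
      using B(1)[of "r1 (r2 n)"] B(2)[of "r1 (r2 n)"] form_nonneg[of V1 s, OF V1_nonneg] form_nonneg[of V2 s, OF V2_nonneg]
      by (simp add: f_def add_mono)
    finally show "norm z \<le> B + B" unfolding z .
  qed
  then obtain r3 l where r3: "strict_mono (r3 :: nat \<Rightarrow> nat)" "(f \<circ> r3) \<longlonglongrightarrow> l"
    using bounded_imp_convergent_subsequence by blast
  define r where "r n = r1 (r2 (r3 n))" for n
  have r: "strict_mono r" unfolding r_def using r1 r2 r3(1) by (simp add: strict_mono_def)
  have l1: "(\<lambda>n. form s V1 (U (r n)) (U (r n))) \<longlonglongrightarrow> fst l" "(\<lambda>n. form s V2 (W (r n)) (W (r n))) \<longlonglongrightarrow> snd l"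
    using tendsto_fst[OF r3(2)] tendsto_snd[OF r3(2)] by (simp_all add: f_def r_def o_def)
  have sub1: "strict_mono (\<lambda>n. r2 (r3 n))" using r2 r3(1) by (simp add: strict_mono_def)
  have AEu: "AE x in lebesgue. (\<lambda>n. U (r n) x) \<longlonglongrightarrow> u x"
    using u1(1) by eventually_elim (use LIMSEQ_subseq_LIMSEQ[OF _ sub1] in \<open>simp add: o_def r_def\<close>)
  have AEv: "AE x in lebesgue. (\<lambda>n. W (r n) x) \<longlonglongrightarrow> v x"
    using v1(1) by eventually_elim (use LIMSEQ_subseq_LIMSEQ[OF _ r3(1)] in \<open>simp add: o_def r_def\<close>)
  have Lu: "(\<lambda>n. LINT x|lebesgue. (U (r n) x - u x)\<^sup>2) \<longlonglongrightarrow> 0"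
    using LIMSEQ_subseq_LIMSEQ[OF u1(2) sub1] by (simp add: o_def r_def)
  have Lv: "(\<lambda>n. LINT x|lebesgue. (W (r n) x - v x)\<^sup>2) \<longlonglongrightarrow> 0"
    using LIMSEQ_subseq_LIMSEQ[OF v1(2) r3(1)] by (simp add: o_def r_def)
  note lu = form_lower_semicontinuous[where U = "\<lambda>n. U (r n)" and V = V1, OF X(1) u V1_measurable V0 V1 AEu l1(1)]
  note lv = form_lower_semicontinuous[where U = "\<lambda>n. W (r n)" and V = V2, OF X(2) v V2_measurable V0 V2 AEv l1(2)]
  define B' where "B' = 2 * B + 2 * form s V1 u u + 2 * form s V2 v v"
  have fn: "0 \<le> form s V1 u u" "0 \<le> form s V2 v v" by (rule form_nonneg V1_nonneg V2_nonneg)+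
  have Bu: "form s V1 (\<lambda>x. U (r n) x - u x) (\<lambda>x. U (r n) x - u x) \<le> B'" for n
    using form_diff_le(2)[OF X(1) lu(1) V1_measurable V1_nonneg, of "r n"] B(1)[of "r n"] fn unfolding B'_def by linarith
  have Bv: "form s V2 (\<lambda>x. W (r n) x - v x) (\<lambda>x. W (r n) x - v x) \<le> B'" for n
    using form_diff_le(2)[OF X(2) lv(1) V2_measurable V2_nonneg, of "r n"] B(2)[of "r n"] fn unfolding B'_def by linarith
  note conv = functionals_tendsto[where U = "\<lambda>n. U (r n)" and W = "\<lambda>n. W (r n)", OF X lu(1) lv(1) Bu Bv AEu AEv Lu Lv]
  have "(\<lambda>n. sq (U (r n)) (W (r n))) \<longlonglongrightarrow> fst l + snd l"
    unfolding normsq_eq[OF X] by (intro tendsto_add l1)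
  moreover have "sq u v \<le> fst l + snd l" unfolding normsq_eq[OF lu(1) lv(1)] using lu(2) lv(2) by simp
  ultimately show thesis using that[OF r lu(1) lv(1) conv] by blast
qed

lemma singular_le_form:
  assumes "0 < e"
  obtains C where "0 \<le> C" "\<And>u. u \<in> X1 \<Longrightarrow> S1 u \<le> e * form s V1 u u + C" "\<And>v. v \<in> X2 \<Longrightarrow> S2 v \<le> e * form s V2 v v + C"
proof -
  have *: "\<exists>C\<ge>0. \<forall>u \<in> Xcomp s V. singular_int c g u \<le> e * form s V u u + C"
    if g: "0 < g" "g < 1" and c: "c \<in> Lspace (2 / (1 + g))" "\<And>x. 0 < c x" and V: "\<And>x. V0 \<le> V x" for c V :: "real ^ 'n \<Rightarrow> real" and g
  proof -
    \<comment> \<open>Solves \<open>d powr (- 2 / (1 - g)) = e * V0\<close>, so the square integral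
      is paid for by \<open>e\<close> times the form.\<close>
    define d where "d = (e * V0) powr (- (1 - g) / 2)"
    have d: "0 < d" using assms V0 by (simp add: d_def)
    have "- (1 - g) / 2 * (- 2 / (1 - g)) = 1" using g by (simp add: field_simps)
    then have dP: "d powr (- 2 / (1 - g)) = e * V0" using assms V0 by (simp only: d_def powr_powr) simp
    let ?C = "d powr (2 / (1 + g)) * (LINT x|lebesgue. \<bar>c x\<bar> powr (2 / (1 + g)))"
    have "singular_int c g u \<le> e * form s V u u + ?C" if u: "u \<in> Xcomp s V" for u
    proof -
      have "singular_int c g u \<le> ?C + e * V0 * (LINT x|lebesgue. (u x)\<^sup>2)"
        using singular_int_bound(2)[OF g c XcompD(1,2)[OF u] d] unfolding dP .
      also have "e * V0 * (LINT x|lebesgue. (u x)\<^sup>2) \<le> e * form s V u u"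
        using mult_left_mono[OF Xcomp_L2_le(1)[OF u V0 V], of e] assms by (simp add: mult.assoc)
      finally show ?thesis by simp
    qed
    then show ?thesis by (intro exI[of _ ?C]) auto
  qed
  obtain C1 where C1: "0 \<le> C1" "\<forall>u\<in>X1. S1 u \<le> e * form s V1 u u + C1" using *[OF p0 p1 aL apos, of V1] V1 by auto
  obtain C2 where C2: "0 \<le> C2" "\<forall>v\<in>X2. S2 v \<le> e * form s V2 v v + C2" using *[OF q0 q1 bL bpos, of V2] V2 by auto
  show thesis
  proof (rule that[of "C1 + C2"])
    show "S1 u \<le> e * form s V1 u u + (C1 + C2)" if "u \<in> X1" for u using C1 C2(1) that by fastforce
    show "S2 v \<le> e * form s V2 v v + (C1 + C2)" if "v \<in> X2" for v using C2 C1(1) that by fastforce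
  qed (use C1 C2 in simp)
qed

text \<open>Eliminating the coupling through \<open>E1 lam u v = 0\<close> leaves the norm with the
  positive factor \<open>1 / 2 - 1 / (\<alpha> + \<beta>)\<close> and singular terms of lower
  growth.\<close>

lemma coercive:
  assumes lam: "0 < lam"
  obtains k C where "0 < k" "\<And>u v. u \<in> X1 \<Longrightarrow> v \<in> X2 \<Longrightarrow> E1 lam u v = 0 \<Longrightarrow> k * sq u v - C \<le> E lam u v"
proof -
  let ?r = "\<alpha> + \<beta>"
  define k where "k = 1 / 2 - 1 / ?r"
  have k: "0 < k" using r2 by (simp add: k_def field_simps)
  define c1 c2 where "c1 = lam * (1 / (1 - p) - 1 / ?r)" and "c2 = lam * (1 / (1 - q) - 1 / ?r)"
  have "1 / ?r < 1 / (1 - g)" if "0 < g" "g < 1" for g using r2 that by (simp add: frac_less2)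
  then have c: "0 < c1" "0 < c2" using lam p0 p1 q0 q1 by (auto simp: c1_def c2_def)
  \<comment> \<open>The singular terms then absorb exactly half of the coefficient
    \<open>k\<close>.\<close>
  define e where "e = k / (2 * (c1 + c2))"
  have e: "0 < e" using c k by (simp add: e_def)
  obtain C where C: "0 \<le> C" "\<And>u. u \<in> X1 \<Longrightarrow> S1 u \<le> e * form s V1 u u + C" "\<And>v. v \<in> X2 \<Longrightarrow> S2 v \<le> e * form s V2 v v + C"
    by (rule singular_le_form[OF e]) blast
  show thesis
  proof (rule that)
    show "0 < k / 2" using k by simp
    fix u v assume X: "u \<in> X1" "v \<in> X2" and E0: "E1 lam u v = 0"
    have f: "form s V1 u u \<le> sq u v" "form s V2 v v \<le> sq u v"
      using form_nonneg[of V1 s u, OF V1_nonneg] form_nonneg[of V2 s v, OF V2_nonneg] unfolding normsq_eq[OF X] by auto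
    have "S1 u \<le> e * sq u v + C" "S2 v \<le> e * sq u v + C"
      using C(2)[OF X(1)] C(3)[OF X(2)] mult_left_mono[OF f(1) less_imp_le[OF e]] mult_left_mono[OF f(2) less_imp_le[OF e]]
      by linarith+
    then have "c1 * S1 u \<le> c1 * (e * sq u v + C)" "c2 * S2 v \<le> c2 * (e * sq u v + C)"
      using c by (auto intro: mult_left_mono)
    moreover have "c1 + c2 \<noteq> 0" using c by simp
    then have "(c1 + c2) * e = k / 2" by (simp add: e_def field_simps)
    then have "c1 * (e * sq u v + C) + c2 * (e * sq u v + C) = k / 2 * sq u v + (c1 + c2) * C"
      by (metis distrib_left distrib_right mult.assoc)
    moreover have "E lam u v = k * sq u v - c1 * S1 u - c2 * S2 v"
    proof -
      have "\<theta> * cpl u v = sq u v - lam * S1 u - lam * S2 v" using E0 by (simp add: energy1_def)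
      then have "\<theta> / ?r * cpl u v = (sq u v - lam * S1 u - lam * S2 v) / ?r" by simp
      then show ?thesis unfolding energy_def k_def c1_def c2_def by (simp add: algebra_simps add_divide_distrib diff_divide_distrib)
    qed
    ultimately show "k / 2 * sq u v - (c1 + c2) * C \<le> E lam u v" by linarith
  qed
qed

lemma nontrivial_scale:
  assumes "nontrivial u v" "t \<noteq> 0"
  shows "nontrivial (\<lambda>x. t * u x) (\<lambda>x. t * v x)"
  using assms by (simp add: nontrivial_def)

lemma ray_first_zero:
  assumes lam: "0 < lam" "ereal lam < lam_up" and X: "u \<in> X1" "v \<in> X2" and nt: "nontrivial u v"
  obtains \<tau> where "0 < \<tau>" "E1 lam (\<lambda>x. \<tau> * u x) (\<lambda>x. \<tau> * v x) = 0" "0 < E2 lam (\<lambda>x. \<tau> * u x) (\<lambda>x. \<tau> * v x)"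
    "E lam (\<lambda>x. \<tau> * u x) (\<lambda>x. \<tau> * v x) < 0"
    "\<And>t. 0 < t \<Longrightarrow> t \<le> \<tau> \<Longrightarrow> E1 lam (\<lambda>x. t * u x) (\<lambda>x. t * v x) \<le> 0"
    "\<And>t t'. 0 < t \<Longrightarrow> t \<le> t' \<Longrightarrow> 0 \<le> E1 lam (\<lambda>x. t' * u x) (\<lambda>x. t' * v x) \<Longrightarrow>
      E lam (\<lambda>x. \<tau> * u x) (\<lambda>x. \<tau> * v x) \<le> E lam (\<lambda>x. t * u x) (\<lambda>x. t * v x)"
proof -
  note P = nontrivial_pos[OF X nt]
  obtain t0 where t0: "0 < t0" "0 < E1 lam (\<lambda>x. t0 * u x) (\<lambda>x. t0 * v x)"
    using exists_ray_energy1_pos[OF lam X nt] by blast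
  show thesis
  proof (rule fibering_first_zero[of "sq u v" "\<theta> * cpl u v" "lam * S1 u" "lam * S2 v" p q "\<alpha> + \<beta>" t0])
    show "0 \<le> \<theta> * cpl u v" using th coupling_int_nonneg[of \<alpha> \<beta> u v] by simp
    show "0 \<le> lam * S1 u" "0 \<le> lam * S2 v" using lam S_nonneg by auto
    show "0 < lam * S1 u + lam * S2 v" using P(1) lam by (simp flip: distrib_left)
    show "0 < sq u v * t0\<^sup>2 - lam * S1 u * t0 powr (1 - p) - lam * S2 v * t0 powr (1 - q) - \<theta> * cpl u v * t0 powr (\<alpha> + \<beta>)"
      using t0 energy_scale(2)[OF X less_imp_le[OF t0(1)]] by simp
    fix \<tau> assume \<tau>: "0 < \<tau>"
      "sq u v * \<tau>\<^sup>2 - lam * S1 u * \<tau> powr (1 - p) - lam * S2 v * \<tau> powr (1 - q) - \<theta> * cpl u v * \<tau> powr (\<alpha> + \<beta>) = 0"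
      "0 < 2 * sq u v * \<tau>\<^sup>2 - (1 - p) * (lam * S1 u) * \<tau> powr (1 - p) - (1 - q) * (lam * S2 v) * \<tau> powr (1 - q) - (\<alpha> + \<beta>) * (\<theta> * cpl u v) * \<tau> powr (\<alpha> + \<beta>)"
      "sq u v * \<tau>\<^sup>2 / 2 - lam * S1 u / (1 - p) * \<tau> powr (1 - p) - lam * S2 v / (1 - q) * \<tau> powr (1 - q) - \<theta> * cpl u v / (\<alpha> + \<beta>) * \<tau> powr (\<alpha> + \<beta>) < 0"
      "\<And>t. 0 < t \<Longrightarrow> t \<le> \<tau> \<Longrightarrow> sq u v * t\<^sup>2 - lam * S1 u * t powr (1 - p) - lam * S2 v * t powr (1 - q) - \<theta> * cpl u v * t powr (\<alpha> + \<beta>) \<le> 0"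
      "\<And>t t'. 0 < t \<Longrightarrow> t \<le> t' \<Longrightarrow> 0 \<le> sq u v * t'\<^sup>2 - lam * S1 u * t' powr (1 - p) - lam * S2 v * t' powr (1 - q) - \<theta> * cpl u v * t' powr (\<alpha> + \<beta>) \<Longrightarrow>
        sq u v * \<tau>\<^sup>2 / 2 - lam * S1 u / (1 - p) * \<tau> powr (1 - p) - lam * S2 v / (1 - q) * \<tau> powr (1 - q) - \<theta> * cpl u v / (\<alpha> + \<beta>) * \<tau> powr (\<alpha> + \<beta>)
        \<le> sq u v * t\<^sup>2 / 2 - lam * S1 u / (1 - p) * t powr (1 - p) - lam * S2 v / (1 - q) * t powr (1 - q) - \<theta> * cpl u v / (\<alpha> + \<beta>) * t powr (\<alpha> + \<beta>)"
    note es = energy_scale[OF X, where lam = lam]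
    show thesis
    proof (rule that[OF \<tau>(1)])
      show "E1 lam (\<lambda>x. \<tau> * u x) (\<lambda>x. \<tau> * v x) = 0" using es(2) \<tau>(1,2) by simp
      show "0 < E2 lam (\<lambda>x. \<tau> * u x) (\<lambda>x. \<tau> * v x)" using es(3) \<tau>(1,3) by simp
      show "E lam (\<lambda>x. \<tau> * u x) (\<lambda>x. \<tau> * v x) < 0" using es(1) \<tau>(1,4) by simp
      show "E1 lam (\<lambda>x. t * u x) (\<lambda>x. t * v x) \<le> 0" if "0 < t" "t \<le> \<tau>" for t using es(2) \<tau>(5)[OF that] that by simp
      show "E lam (\<lambda>x. \<tau> * u x) (\<lambda>x. \<tau> * v x) \<le> E lam (\<lambda>x. t * u x) (\<lambda>x. t * v x)"
        if "0 < t" "t \<le> t'" "0 \<le> E1 lam (\<lambda>x. t' * u x) (\<lambda>x. t' * v x)" for t t'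
        using \<tau>(6)[of t t'] that \<tau>(1) es(1)[of t] es(1)[of \<tau>] es(2)[of t'] by simp
    qed
  qed (use P p0 p1 q0 q1 r2 t0 in auto)
qed

lemma energy_abs_le:
  assumes X: "u \<in> X1" "v \<in> X2"
  shows "E lam (\<lambda>x. \<bar>u x\<bar>) (\<lambda>x. \<bar>v x\<bar>) \<le> E lam u v" "E1 lam (\<lambda>x. \<bar>u x\<bar>) (\<lambda>x. \<bar>v x\<bar>) \<le> E1 lam u v"
proof -
  have "sq (\<lambda>x. \<bar>u x\<bar>) (\<lambda>x. \<bar>v x\<bar>) \<le> sq u v"
    unfolding normsq_eq[OF X] normsq_eq[OF Xcomp_abs(1)[OF X(1)] Xcomp_abs(1)[OF X(2)]]
    by (intro add_mono Xcomp_abs(2) X)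
  moreover have "S1 (\<lambda>x. \<bar>u x\<bar>) = S1 u" "S2 (\<lambda>x. \<bar>v x\<bar>) = S2 v" "cpl (\<lambda>x. \<bar>u x\<bar>) (\<lambda>x. \<bar>v x\<bar>) = cpl u v"
    by (simp_all add: singular_int_def coupling_int_def)
  ultimately show "E lam (\<lambda>x. \<bar>u x\<bar>) (\<lambda>x. \<bar>v x\<bar>) \<le> E lam u v" "E1 lam (\<lambda>x. \<bar>u x\<bar>) (\<lambda>x. \<bar>v x\<bar>) \<le> E1 lam u v"
    by (simp_all add: energy_def energy1_def)
qed

text \<open>The infimum is over the whole Nehari set; positivity of \<open>E2\<close> is not imposed
  but comes from choosing first zeros. The last conclusion admits competitors off the Nehari set,
  which is what the perturbation arguments require.\<close>

lemma nehari_minimizer: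
  assumes lam: "0 < lam" "ereal lam < lam_up"
  obtains u v where "u \<in> X1" "v \<in> X2" "nontrivial u v" "\<And>x. 0 \<le> u x" "\<And>x. 0 \<le> v x"
    "E1 lam u v = 0" "0 < E2 lam u v" "E lam u v < 0"
    "\<And>u' v' t. u' \<in> X1 \<Longrightarrow> v' \<in> X2 \<Longrightarrow> nontrivial u' v' \<Longrightarrow> 1 \<le> t \<Longrightarrow>
      0 \<le> E1 lam (\<lambda>x. t * u' x) (\<lambda>x. t * v' x) \<Longrightarrow> E lam u v \<le> E lam u' v'"
proof -
  define N where "N = {(u, v). u \<in> X1 \<and> v \<in> X2 \<and> nontrivial u v \<and> E1 lam u v = 0}"
  define m where "m = (INF (u, v) \<in> N. E lam u v)"
  obtain k C where k: "0 < k" and kC: "\<And>u v. u \<in> X1 \<Longrightarrow> v \<in> X2 \<Longrightarrow> E1 lam u v = 0 \<Longrightarrow> k * sq u v - C \<le> E lam u v"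
    using coercive[OF lam(1)] by blast
  have bdd: "bdd_below ((\<lambda>(u, v). E lam u v) ` N)"
  proof (rule bdd_belowI[of _ "- C"])
    fix e assume "e \<in> (\<lambda>(u, v). E lam u v) ` N"
    then obtain u v where uv: "u \<in> X1" "v \<in> X2" "nontrivial u v" "E1 lam u v = 0" "e = E lam u v" by (auto simp: N_def)
    have "0 \<le> k * sq u v" using nontrivial_pos(2)[OF uv(1-3)] k by simp
    then show "- C \<le> e" using kC[OF uv(1,2,4)] uv(5) by linarith
  qed
  have m_le: "m \<le> E lam u v" if "u \<in> X1" "v \<in> X2" "nontrivial u v" "E1 lam u v = 0" for u v
    unfolding m_def using cINF_lower[OF bdd, of "(u, v)"] that by (simp add: N_def)
  have key: "m \<le> E lam u' v'" if X: "u' \<in> X1" "v' \<in> X2" "nontrivial u' v'" "1 \<le> t" "0 \<le> E1 lam (\<lambda>x. t * u' x) (\<lambda>x. t * v' x)" for u' v' t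
  proof -
    obtain \<tau> where \<tau>: "0 < \<tau>" "E1 lam (\<lambda>x. \<tau> * u' x) (\<lambda>x. \<tau> * v' x) = 0"
      "\<And>t t'. 0 < t \<Longrightarrow> t \<le> t' \<Longrightarrow> 0 \<le> E1 lam (\<lambda>x. t' * u' x) (\<lambda>x. t' * v' x) \<Longrightarrow>
      E lam (\<lambda>x. \<tau> * u' x) (\<lambda>x. \<tau> * v' x) \<le> E lam (\<lambda>x. t * u' x) (\<lambda>x. t * v' x)"
      by (rule ray_first_zero[OF lam X(1-3)]) blast
    have "m \<le> E lam (\<lambda>x. \<tau> * u' x) (\<lambda>x. \<tau> * v' x)"
      by (rule m_le) (use X \<tau> in \<open>auto intro: Xcomp_scale nontrivial_scale\<close>)
    also have "\<dots> \<le> E lam (\<lambda>x. 1 * u' x) (\<lambda>x. 1 * v' x)" by (rule \<tau>(3)[of 1 t]) (use X in auto)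
    finally show ?thesis by simp
  qed
  have Nne: "N \<noteq> {}" and m_neg: "m < 0"
  proof -
    note A = AsetD[OF bump_in_Aset]
    obtain \<tau> where \<tau>: "0 < \<tau>" "E1 lam (\<lambda>x. \<tau> * bump 1 x) (\<lambda>x. \<tau> * bump 1 x) = 0" "E lam (\<lambda>x. \<tau> * bump 1 x) (\<lambda>x. \<tau> * bump 1 x) < 0"
      by (rule ray_first_zero[OF lam A(1,2,4)]) blast
    have "((\<lambda>x. \<tau> * bump 1 x), (\<lambda>x. \<tau> * bump 1 x)) \<in> N"
      using A \<tau> Xcomp_scale(1)[OF A(1)] Xcomp_scale(1)[OF A(2)] nontrivial_scale[OF A(4), of \<tau>] by (simp add: N_def)
    then show "N \<noteq> {}" by blast
    have "m \<le> E lam (\<lambda>x. \<tau> * bump 1 x) (\<lambda>x. \<tau> * bump 1 x)"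
      by (rule m_le) (use A \<tau> in \<open>auto intro: Xcomp_scale nontrivial_scale\<close>)
    then show "m < 0" using \<tau>(3) by simp
  qed
  \<comment> \<open>Moving each minimizing pair to the first zero of its ray does not raise the
    energy and adds the sign of \<open>E1\<close> up to \<open>t = 1\<close>, which, unlike the
    equation itself, survives a drop of the norm in the limit.\<close>
  have "\<exists>u v. u \<in> X1 \<and> v \<in> X2 \<and> nontrivial u v \<and> E1 lam u v = 0 \<and> E lam u v < m + 1 / real (Suc n)
    \<and> (\<forall>t. 0 < t \<longrightarrow> t \<le> 1 \<longrightarrow> E1 lam (\<lambda>x. t * u x) (\<lambda>x. t * v x) \<le> 0)" for n
  proof -
    have "m < m + 1 / real (Suc n)" by simp
    then obtain w where w: "w \<in> N" "(\<lambda>(u, v). E lam u v) w < m + 1 / real (Suc n)"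
      unfolding m_def using cINF_less_iff[OF Nne bdd] by blast
    then obtain u v where uv: "u \<in> X1" "v \<in> X2" "nontrivial u v" "E1 lam u v = 0" "E lam u v < m + 1 / real (Suc n)"
      by (auto simp: N_def)
    obtain \<tau> where \<tau>: "0 < \<tau>" "E1 lam (\<lambda>x. \<tau> * u x) (\<lambda>x. \<tau> * v x) = 0"
      "\<And>t. 0 < t \<Longrightarrow> t \<le> \<tau> \<Longrightarrow> E1 lam (\<lambda>x. t * u x) (\<lambda>x. t * v x) \<le> 0"
      "\<And>t t'. 0 < t \<Longrightarrow> t \<le> t' \<Longrightarrow> 0 \<le> E1 lam (\<lambda>x. t' * u x) (\<lambda>x. t' * v x) \<Longrightarrow>
      E lam (\<lambda>x. \<tau> * u x) (\<lambda>x. \<tau> * v x) \<le> E lam (\<lambda>x. t * u x) (\<lambda>x. t * v x)"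
      by (rule ray_first_zero[OF lam uv(1-3)]) blast
    let ?u = "\<lambda>x. \<tau> * u x" and ?v = "\<lambda>x. \<tau> * v x"
    have "E lam ?u ?v \<le> E lam (\<lambda>x. 1 * u x) (\<lambda>x. 1 * v x)" using uv by (intro \<tau>(4)[of 1 1]) auto
    then have "E lam ?u ?v < m + 1 / real (Suc n)" using uv by simp
    moreover have "E1 lam (\<lambda>x. t * ?u x) (\<lambda>x. t * ?v x) \<le> 0" if "0 < t" "t \<le> 1" for t
      using \<tau>(3)[of "t * \<tau>"] that \<tau>(1) by (simp add: mult.assoc mult_left_le_one_le)
    ultimately show ?thesis
      using \<tau>(1,2) uv Xcomp_scale(1)[OF uv(1)] Xcomp_scale(1)[OF uv(2)] nontrivial_scale[OF uv(3), of \<tau>]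
      by (intro exI[of _ ?u] exI[of _ ?v]) auto
  qed
  then obtain U W where UW: "\<And>n. U n \<in> X1" "\<And>n. W n \<in> X2" "\<And>n. nontrivial (U n) (W n)" "\<And>n. E1 lam (U n) (W n) = 0"
    "\<And>n. E lam (U n) (W n) < m + 1 / real (Suc n)"
    "\<And>n t. 0 < t \<Longrightarrow> t \<le> 1 \<Longrightarrow> E1 lam (\<lambda>x. t * U n x) (\<lambda>x. t * W n x) \<le> 0"
    by metis
  define B where "B = (m + 1 + C) / k"
  have sqB: "sq (U n) (W n) \<le> B" for n
  proof -
    have "1 / real (Suc n) \<le> 1" by simp
    then have "k * sq (U n) (W n) \<le> m + 1 + C" using kC[OF UW(1,2,4), of n] UW(5)[of n] by linarith
    then show ?thesis using k by (simp add: B_def field_simps)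
  qed
  have B1: "form s V1 (U n) (U n) \<le> B" "form s V2 (W n) (W n) \<le> B" for n
    using sqB[of n] form_nonneg[of V1 s "U n", OF V1_nonneg] form_nonneg[of V2 s "W n", OF V2_nonneg]
    unfolding normsq_eq[OF UW(1,2)] by auto
  obtain r u v L where r: "strict_mono (r :: nat \<Rightarrow> nat)" and X: "u \<in> X1" "v \<in> X2"
    and lim: "(\<lambda>n. S1 (U (r n))) \<longlonglongrightarrow> S1 u" "(\<lambda>n. S2 (W (r n))) \<longlonglongrightarrow> S2 v" "(\<lambda>n. cpl (U (r n)) (W (r n))) \<longlonglongrightarrow> cpl u v"
    "(\<lambda>n. sq (U (r n)) (W (r n))) \<longlonglongrightarrow> L" and L: "sq u v \<le> L"
    by (rule bounded_pair_limit[where U = U and W = W, OF UW(1,2) B1]) blast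
  have "E lam u v \<le> L / 2 - lam / (1 - p) * S1 u - lam / (1 - q) * S2 v - \<theta> / (\<alpha> + \<beta>) * cpl u v"
    using L by (simp add: energy_def)
  also have "\<dots> \<le> m + 0"
  proof (rule LIMSEQ_le)
    show "(\<lambda>n. E lam (U (r n)) (W (r n))) \<longlonglongrightarrow> L / 2 - lam / (1 - p) * S1 u - lam / (1 - q) * S2 v - \<theta> / (\<alpha> + \<beta>) * cpl u v"
      unfolding energy_def by (intro tendsto_intros lim) simp
    have "(\<lambda>n. 1 / real (Suc n)) \<longlonglongrightarrow> 0" by (rule inverse_Suc_tendsto_0)
    then have "(\<lambda>n. 1 / real (Suc (r n))) \<longlonglongrightarrow> 0" using LIMSEQ_subseq_LIMSEQ[OF _ r] by (simp add: o_def)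
    then show "(\<lambda>n. m + 1 / real (Suc (r n))) \<longlonglongrightarrow> m + 0" by (intro tendsto_add tendsto_const)
    show "\<exists>N. \<forall>n\<ge>N. E lam (U (r n)) (W (r n)) \<le> m + 1 / real (Suc (r n))" using UW(5) by (auto intro: less_imp_le)
  qed
  finally have Em: "E lam u v \<le> m" by simp
  \<comment> \<open>Replacing \<open>L\<close> by the smaller norm of the limit only lowers
    \<open>E1\<close>.\<close>
  have E1t: "E1 lam (\<lambda>x. t * u x) (\<lambda>x. t * v x) \<le> 0" if t: "0 < t" "t \<le> 1" for t
  proof -
    have "E1 lam (\<lambda>x. t * u x) (\<lambda>x. t * v x) \<le> L * t\<^sup>2 - lam * S1 u * t powr (1 - p) - lam * S2 v * t powr (1 - q) - \<theta> * cpl u v * t powr (\<alpha> + \<beta>)"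
      unfolding energy_scale(2)[OF X less_imp_le[OF t(1)]] using L by (simp add: mult_right_mono)
    also have "\<dots> \<le> 0"
    proof (rule LIMSEQ_le_const2)
      show "(\<lambda>n. E1 lam (\<lambda>x. t * U (r n) x) (\<lambda>x. t * W (r n) x)) \<longlonglongrightarrow> L * t\<^sup>2 - lam * S1 u * t powr (1 - p) - lam * S2 v * t powr (1 - q) - \<theta> * cpl u v * t powr (\<alpha> + \<beta>)"
        unfolding energy_scale(2)[OF UW(1,2) less_imp_le[OF t(1)]] by (intro tendsto_diff tendsto_mult tendsto_const lim)
      show "\<exists>N. \<forall>n\<ge>N. E1 lam (\<lambda>x. t * U (r n) x) (\<lambda>x. t * W (r n) x) \<le> 0" using UW(6) t by blast
    qed
    finally show ?thesis .
  qed
  define u0 v0 where "u0 = (\<lambda>x. \<bar>u x\<bar>)" and "v0 = (\<lambda>x. \<bar>v x\<bar>)"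
  have X0: "u0 \<in> X1" "v0 \<in> X2" unfolding u0_def v0_def by (intro Xcomp_abs X)+
  have Em0: "E lam u0 v0 \<le> m" using energy_abs_le(1)[OF X, of lam] Em unfolding u0_def v0_def by linarith
  have E1t0: "E1 lam (\<lambda>x. t * u0 x) (\<lambda>x. t * v0 x) \<le> 0" if t: "0 < t" "t \<le> 1" for t
    using energy_abs_le(2)[OF Xcomp_scale(1)[OF X(1), of t] Xcomp_scale(1)[OF X(2), of t], of lam] E1t[OF t] t
    unfolding u0_def v0_def by (simp add: abs_mult)
  \<comment> \<open>The zero pair has energy 0, but the limit has energy at most
    \<open>m < 0\<close>.\<close>
  have nt: "nontrivial u0 v0"
  proof (rule ccontr)
    assume "\<not> nontrivial u0 v0"
    then have AE: "AE x in lebesgue. u0 x = 0 \<and> v0 x = 0" by (simp add: nontrivial_def)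
    note [measurable] = XcompD(1)[OF X0(1)] XcompD(1)[OF X0(2)]
    note [measurable] = a_measurable b_measurable
    have "S1 u0 = 0" by (rule singular_int_AE_0) (use AE in \<open>auto elim: eventually_mono\<close>)
    moreover have "S2 v0 = 0" by (rule singular_int_AE_0) (use AE in \<open>auto elim: eventually_mono\<close>)
    moreover have "cpl u0 v0 = (LINT (x :: real ^ 'n)|lebesgue. 0)" unfolding coupling_int_def
      by (rule integral_cong_AE) (use AE in \<open>auto elim: eventually_mono\<close>)
    moreover have "0 \<le> sq u0 v0"
      using form_nonneg[of V1 s u0, OF V1_nonneg] form_nonneg[of V2 s v0, OF V2_nonneg] unfolding normsq_eq[OF X0] by simp
    ultimately have "0 \<le> E lam u0 v0" by (simp add: energy_def)
    then show False using Em0 m_neg by linarith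
  qed
  obtain t1 where t1: "0 < t1" "0 < E1 lam (\<lambda>x. t1 * u0 x) (\<lambda>x. t1 * v0 x)"
    using exists_ray_energy1_pos[OF lam X0 nt] by blast
  \<comment> \<open>On rays through \<open>(u0, v0)\<close> the derivative is nonpositive up to 1,
    so its positive value occurs later and the ray comparison is valid at
    \<open>t = 1\<close>.\<close>
  have t11: "1 \<le> t1" using E1t0[of t1] t1 by linarith
  obtain \<tau> where \<tau>: "0 < \<tau>" "E1 lam (\<lambda>x. \<tau> * u0 x) (\<lambda>x. \<tau> * v0 x) = 0" "0 < E2 lam (\<lambda>x. \<tau> * u0 x) (\<lambda>x. \<tau> * v0 x)"
    "E lam (\<lambda>x. \<tau> * u0 x) (\<lambda>x. \<tau> * v0 x) < 0"
    "\<And>t t'. 0 < t \<Longrightarrow> t \<le> t' \<Longrightarrow> 0 \<le> E1 lam (\<lambda>x. t' * u0 x) (\<lambda>x. t' * v0 x) \<Longrightarrow>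
      E lam (\<lambda>x. \<tau> * u0 x) (\<lambda>x. \<tau> * v0 x) \<le> E lam (\<lambda>x. t * u0 x) (\<lambda>x. t * v0 x)"
    by (rule ray_first_zero[OF lam X0 nt]) blast
  have "E lam (\<lambda>x. \<tau> * u0 x) (\<lambda>x. \<tau> * v0 x) \<le> E lam (\<lambda>x. 1 * u0 x) (\<lambda>x. 1 * v0 x)"
    using t1 t11 by (intro \<tau>(5)[of 1 t1]) auto
  then have Em\<tau>: "E lam (\<lambda>x. \<tau> * u0 x) (\<lambda>x. \<tau> * v0 x) \<le> m" using Em0 by simp
  show thesis
  proof (rule that)
    show "(\<lambda>x. \<tau> * u0 x) \<in> X1" "(\<lambda>x. \<tau> * v0 x) \<in> X2" by (intro Xcomp_scale X0)+
    show "nontrivial (\<lambda>x. \<tau> * u0 x) (\<lambda>x. \<tau> * v0 x)" using nontrivial_scale[OF nt, of \<tau>] \<tau> by simp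
    show "0 \<le> \<tau> * u0 x" "0 \<le> \<tau> * v0 x" for x using \<tau>(1) by (auto simp: u0_def v0_def)
    show "E lam (\<lambda>x. \<tau> * u0 x) (\<lambda>x. \<tau> * v0 x) \<le> E lam u' v'"
      if "u' \<in> X1" "v' \<in> X2" "nontrivial u' v'" "1 \<le> t" "0 \<le> E1 lam (\<lambda>x. t * u' x) (\<lambda>x. t * v' x)" for u' v' t
      using key[OF that] Em\<tau> by linarith
  qed (use \<tau> in auto)
qed

end

section \<open>The Euler-Lagrange equation\<close>

lemma filterlim_inverse_Suc: "filterlim (\<lambda>n. 1 / real (Suc n)) (at 0) sequentially"
  using inverse_Suc_tendsto_0 by (auto simp: filterlim_at intro: always_eventually)

text \<open>The steps \<open>1 / real (Suc n)\<close> fit the sequential form of dominated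
  convergence and of Fatou's lemma. Equality of \<open>g\<close> and \<open>f\<close> is asked
  eventually because the absolute values disappear only once the perturbed point is
  positive.\<close>

lemma difference_quotient_tendsto:
  assumes "(f has_real_derivative D) (at 0)" and "eventually (\<lambda>n. g n = f (1 / real (Suc n))) sequentially"
  shows "(\<lambda>n. (g n - f 0) / (1 / real (Suc n))) \<longlonglongrightarrow> D"
proof -
  have "((\<lambda>h. (f h - f 0) / h) \<longlongrightarrow> D) (at 0)" using assms(1) by (simp add: DERIV_def)
  then have "(\<lambda>n. (f (1 / real (Suc n)) - f 0) / (1 / real (Suc n))) \<longlonglongrightarrow> D"
    by (rule filterlim_compose[OF _ filterlim_inverse_Suc])
  then show ?thesis
    by (rule Lim_transform_eventually) (use assms(2) in \<open>auto elim: eventually_mono\<close>)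
qed

lemma eventually_perturbation_pos:
  assumes "0 < (y :: real)"
  shows "eventually (\<lambda>n. 0 < y + 1 / real (Suc n) * h) sequentially"
proof -
  have "(\<lambda>n. y + 1 / real (Suc n) * h) \<longlonglongrightarrow> y + 0 * h" by (intro tendsto_intros inverse_Suc_tendsto_0)
  then show ?thesis using assms by (intro order_tendstoD(1)) auto
qed

text \<open>Minimality bounds the growth of the singular term linearly in the step size \<open>t\<close>, whereas
  on the zero set of \<open>w\<close> this term grows like \<open>t powr (1 - g)\<close>.\<close>

lemma singular_growth_positive:
  fixes c :: "real ^ 'n \<Rightarrow> real"
  assumes g: "0 < g" "g < 1" and c: "\<And>x. 0 < c x" and [measurable]: "w \<in> borel_measurable lebesgue" "\<phi> \<in> borel_measurable lebesgue" "c \<in> borel_measurable lebesgue"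
    and nn: "\<And>x. 0 \<le> w x" "\<And>x. 0 \<le> \<phi> x"
    and int: "\<And>t. integrable lebesgue (\<lambda>x. c x * \<bar>w x + t * \<phi> x\<bar> powr (1 - g))"
    and growth: "eventually (\<lambda>n. singular_int c g (\<lambda>x. w x + 1 / real (Suc n) * \<phi> x) - singular_int c g w \<le> K * (1 / real (Suc n))) sequentially"
  shows "AE x in lebesgue. w x = 0 \<longrightarrow> \<phi> x = 0"
proof -
  have int0: "integrable lebesgue (\<lambda>x. c x * \<bar>w x\<bar> powr (1 - g))" using int[of 0] by simp
  \<comment> \<open>The exact increment on the zero set of \<open>w\<close>, without the factor
    \<open>t powr (1 - g)\<close>; elsewhere the increment is nonnegative. The linear growth bound
    gives \<open>J <= K * t powr g\<close>, which forces \<open>J = 0\<close>.\<close>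
  define j where "j x = c x * \<phi> x powr (1 - g) * (if w x = 0 then 1 else 0)" for x
  have j0: "0 \<le> j x" for x using c[of x] by (simp add: j_def less_imp_le)
  have jle: "t powr (1 - g) * j x \<le> c x * \<bar>w x + t * \<phi> x\<bar> powr (1 - g) - c x * \<bar>w x\<bar> powr (1 - g)" if "0 < t" for t x
  proof (cases "w x = 0")
    case True
    then show ?thesis using that nn(2)[of x] by (simp add: j_def powr_mult abs_mult mult_ac)
  next
    case False
    have "\<bar>w x\<bar> powr (1 - g) \<le> \<bar>w x + t * \<phi> x\<bar> powr (1 - g)"
      using nn[of x] g that by (intro powr_mono2) auto
    then show ?thesis using False c[of x] by (simp add: j_def)
  qed
  have jm [measurable]: "j \<in> borel_measurable lebesgue" unfolding j_def by measurable
  have ij: "integrable lebesgue j"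
  proof (rule Bochner_Integration.integrable_bound)
    show "integrable lebesgue (\<lambda>x. c x * \<bar>w x + 1 * \<phi> x\<bar> powr (1 - g) - c x * \<bar>w x\<bar> powr (1 - g))"
      by (intro Bochner_Integration.integrable_diff int int0)
    show "AE x in lebesgue. norm (j x) \<le> norm (c x * \<bar>w x + 1 * \<phi> x\<bar> powr (1 - g) - c x * \<bar>w x\<bar> powr (1 - g))"
    proof (intro always_eventually allI)
      fix x
      show "norm (j x) \<le> norm (c x * \<bar>w x + 1 * \<phi> x\<bar> powr (1 - g) - c x * \<bar>w x\<bar> powr (1 - g))"
        using jle[of 1 x] j0[of x] by simp
    qed
  qed measurable
  define J where "J = integral\<^sup>L lebesgue j"
  have "eventually (\<lambda>n. J \<le> K * (1 / real (Suc n)) powr g) sequentially"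
    using growth
  proof eventually_elim
    case (elim n)
    let ?e = "1 / real (Suc n)"
    have e: "0 < ?e" by simp
    have "?e powr (1 - g) * J = (LINT x|lebesgue. ?e powr (1 - g) * j x)" by (simp add: J_def)
    also have "\<dots> \<le> (LINT x|lebesgue. c x * \<bar>w x + ?e * \<phi> x\<bar> powr (1 - g) - c x * \<bar>w x\<bar> powr (1 - g))"
      by (intro integral_mono integrable_mult_right ij Bochner_Integration.integrable_diff int int0 jle e)
    also have "\<dots> = singular_int c g (\<lambda>x. w x + ?e * \<phi> x) - singular_int c g w"
      unfolding singular_int_def by (intro Bochner_Integration.integral_diff int int0)
    also have "\<dots> \<le> K * ?e" by (rule elim)
    finally have "?e powr g * (?e powr (1 - g) * J) \<le> ?e powr g * (K * ?e)" by (intro mult_left_mono) auto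
    moreover have "?e powr g * ?e powr (1 - g) = ?e" using e by (simp flip: powr_add)
    ultimately have "?e * J \<le> ?e * (K * ?e powr g)" by (metis mult.assoc mult.commute)
    then show ?case using e by (subst (asm) mult_le_cancel_left_pos) auto
  qed
  moreover have "(\<lambda>n. K * (1 / real (Suc n)) powr g) \<longlonglongrightarrow> K * 0"
  proof -
    have "(\<lambda>n. (1 / real (Suc n)) powr g) \<longlonglongrightarrow> 0 powr g"
      by (rule tendsto_powr2[OF inverse_Suc_tendsto_0 tendsto_const]) (use g in auto)
    then show ?thesis by (intro tendsto_mult tendsto_const) simp
  qed
  ultimately have "J \<le> K * 0" by (intro tendsto_le[OF sequentially_bot _ tendsto_const]) auto
  moreover have "0 \<le> J" unfolding J_def using j0 by (intro integral_nonneg_AE always_eventually allI)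
  ultimately have "J = 0" by simp
  then have "AE x in lebesgue. j x = 0"
    using integral_nonneg_eq_0_iff_AE[OF ij] j0 by (simp add: J_def)
  then show ?thesis
    by eventually_elim (use c nn in \<open>auto simp: j_def less_imp_neq[symmetric]\<close>)
qed

text \<open>The tangent bound at the perturbed point estimates the difference quotient from below by
  a nonnegative function that converges to the claimed integrand where \<open>w\<close> is positive.
  The growth bound makes the integrals bounded, and Fatou's lemma concludes.\<close>

lemma singular_growth_integrable:
  fixes c :: "real ^ 'n \<Rightarrow> real"
  assumes g: "0 < g" "g < 1" and c: "\<And>x. 0 < c x" and [measurable]: "w \<in> borel_measurable lebesgue" "\<phi> \<in> borel_measurable lebesgue" "c \<in> borel_measurable lebesgue"
    and nn: "\<And>x. 0 \<le> w x" "\<And>x. 0 \<le> \<phi> x" and pos: "AE x in lebesgue. 0 < w x"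
    and int: "\<And>t. integrable lebesgue (\<lambda>x. c x * \<bar>w x + t * \<phi> x\<bar> powr (1 - g))"
    and growth: "eventually (\<lambda>n. singular_int c g (\<lambda>x. w x + 1 / real (Suc n) * \<phi> x) - singular_int c g w \<le> K * (1 / real (Suc n))) sequentially"
  shows "integrable lebesgue (\<lambda>x. c x * \<bar>w x\<bar> powr (- g) * \<phi> x)"
proof -
  have int0: "integrable lebesgue (\<lambda>x. c x * \<bar>w x\<bar> powr (1 - g))" using int[of 0] by simp
  let ?e = "\<lambda>n. 1 / real (Suc n)"
  let ?f = "\<lambda>n x. c x * (w x + ?e n * \<phi> x) powr (- g) * \<phi> x"
  have f0: "0 \<le> ?f n x" for n x using c[of x] nn[of x] by (simp add: less_imp_le)
  have fle: "(1 - g) * ?e n * ?f n x \<le> c x * \<bar>w x + ?e n * \<phi> x\<bar> powr (1 - g) - c x * \<bar>w x\<bar> powr (1 - g)" for n x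
  proof (cases "\<phi> x = 0")
    case False
    then have "0 < ?e n * \<phi> x" using nn(2)[of x] by (simp add: less_le)
    from powr_diff_ge[of "1 - g" "w x", OF _ _ nn(1) this] g
    have "(1 - g) * (?e n * \<phi> x) * (w x + ?e n * \<phi> x) powr (- g) \<le> (w x + ?e n * \<phi> x) powr (1 - g) - w x powr (1 - g)" by simp
    then have "c x * ((1 - g) * (?e n * \<phi> x) * (w x + ?e n * \<phi> x) powr (- g)) \<le> c x * ((w x + ?e n * \<phi> x) powr (1 - g) - w x powr (1 - g))"
      using c[of x] by (intro mult_left_mono) auto
    moreover have "(1 - g) * ?e n * ?f n x = c x * ((1 - g) * (?e n * \<phi> x) * (w x + ?e n * \<phi> x) powr (- g))"
      by (simp only: mult_ac)
    ultimately show ?thesis using nn[of x] by (simp only: right_diff_distrib) simp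
  qed simp
  have "eventually (\<lambda>n. (\<integral>\<^sup>+ x. ennreal (?f n x) \<partial>lebesgue) \<le> ennreal (K / (1 - g))) sequentially"
    using growth
  proof eventually_elim
    case (elim n)
    have i: "integrable lebesgue (\<lambda>x. (1 - g) * ?e n * ?f n x)"
    proof (rule Bochner_Integration.integrable_bound)
      show "integrable lebesgue (\<lambda>x. c x * \<bar>w x + ?e n * \<phi> x\<bar> powr (1 - g) - c x * \<bar>w x\<bar> powr (1 - g))"
        by (intro Bochner_Integration.integrable_diff int int0)
      show "AE x in lebesgue. norm ((1 - g) * ?e n * ?f n x) \<le> norm (c x * \<bar>w x + ?e n * \<phi> x\<bar> powr (1 - g) - c x * \<bar>w x\<bar> powr (1 - g))"
      proof (intro always_eventually allI)
        fix x
        have "0 \<le> (1 - g) * ?e n * ?f n x" by (rule mult_nonneg_nonneg[OF _ f0]) (use g in simp)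
        then show "norm ((1 - g) * ?e n * ?f n x) \<le> norm (c x * \<bar>w x + ?e n * \<phi> x\<bar> powr (1 - g) - c x * \<bar>w x\<bar> powr (1 - g))"
          using fle[of n x] by simp
      qed
    qed measurable
    have ge: "(1 - g) * ?e n \<noteq> 0" using g by simp
    have if': "integrable lebesgue (?f n)" using i ge by (subst (asm) integrable_mult_left_iff) blast
    have "(1 - g) * ?e n * (LINT x|lebesgue. ?f n x) = (LINT x|lebesgue. (1 - g) * ?e n * ?f n x)" by simp
    also have "\<dots> \<le> (LINT x|lebesgue. c x * \<bar>w x + ?e n * \<phi> x\<bar> powr (1 - g) - c x * \<bar>w x\<bar> powr (1 - g))"
      by (intro integral_mono i Bochner_Integration.integrable_diff int int0 fle)
    also have "\<dots> = singular_int c g (\<lambda>x. w x + ?e n * \<phi> x) - singular_int c g w"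
      unfolding singular_int_def by (intro Bochner_Integration.integral_diff int int0)
    also have "\<dots> \<le> K * ?e n" by (rule elim)
    finally have "?e n * ((1 - g) * (LINT x|lebesgue. ?f n x)) \<le> ?e n * K" by (simp only: mult_ac)
    then have "(1 - g) * (LINT x|lebesgue. ?f n x) \<le> K" by (subst (asm) mult_le_cancel_left_pos) auto
    then have "(LINT x|lebesgue. ?f n x) \<le> K / (1 - g)" using g by (simp add: field_simps)
    then show ?case using if' f0 by (subst nn_integral_eq_integral) (auto intro: ennreal_leI)
  qed
  then have ev: "liminf (\<lambda>n. \<integral>\<^sup>+ x. ennreal (?f n x) \<partial>lebesgue) \<le> ennreal (K / (1 - g))"
    by (intro Liminf_le) auto
  have "(\<integral>\<^sup>+ x. ennreal (c x * \<bar>w x\<bar> powr (- g) * \<phi> x) \<partial>lebesgue) = (\<integral>\<^sup>+ x. liminf (\<lambda>n. ennreal (?f n x)) \<partial>lebesgue)"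
  proof (rule nn_integral_cong_AE)
    show "AE x in lebesgue. ennreal (c x * \<bar>w x\<bar> powr (- g) * \<phi> x) = liminf (\<lambda>n. ennreal (?f n x))"
      using pos
    proof eventually_elim
      fix x assume wx: "0 < w x"
      have "(\<lambda>n. w x + ?e n * \<phi> x) \<longlonglongrightarrow> w x + 0 * \<phi> x" by (intro tendsto_intros inverse_Suc_tendsto_0)
      then have "(\<lambda>n. w x + ?e n * \<phi> x) \<longlonglongrightarrow> w x" by simp
      then have "(\<lambda>n. (w x + ?e n * \<phi> x) powr (- g)) \<longlonglongrightarrow> w x powr (- g)"
        by (rule tendsto_powr[OF _ tendsto_const]) (use wx in auto)
      then have "(\<lambda>n. ?f n x) \<longlonglongrightarrow> c x * w x powr (- g) * \<phi> x" by (intro tendsto_mult tendsto_const)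
      then have "(\<lambda>n. ennreal (?f n x)) \<longlonglongrightarrow> ennreal (c x * w x powr (- g) * \<phi> x)" by (rule tendsto_ennrealI)
      then have "ennreal (c x * w x powr (- g) * \<phi> x) = liminf (\<lambda>n. ennreal (?f n x))" by (intro lim_imp_Liminf[symmetric]) simp_all
      then show "ennreal (c x * \<bar>w x\<bar> powr (- g) * \<phi> x) = liminf (\<lambda>n. ennreal (?f n x))" using wx by simp
    qed
  qed
  also have "\<dots> \<le> liminf (\<lambda>n. \<integral>\<^sup>+ x. ennreal (?f n x) \<partial>lebesgue)" by (rule nn_integral_liminf) measurable
  also note ev
  finally have fin: "(\<integral>\<^sup>+ x. ennreal (c x * \<bar>w x\<bar> powr (- g) * \<phi> x) \<partial>lebesgue) \<le> ennreal (K / (1 - g))" .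
  show ?thesis
  proof (rule integrableI_nonneg)
    show "AE x in lebesgue. 0 \<le> c x * \<bar>w x\<bar> powr (- g) * \<phi> x" using c nn by (auto simp: less_imp_le)
    show "(\<integral>\<^sup>+ x. ennreal (c x * \<bar>w x\<bar> powr (- g) * \<phi> x) \<partial>lebesgue) < \<infinity>" using fin by (rule le_less_trans) simp
  qed measurable
qed

text \<open>Once the limiting integrand is known to be integrable it is itself a majorant of the
  quotients, by \<open>powr_diff_abs_le\<close>. From here on \<open>\<phi>\<close> may change
  sign.\<close>

lemma singular_int_derivative:
  fixes c :: "real ^ 'n \<Rightarrow> real"
  assumes g: "0 < g" "g < 1" and c: "\<And>x. 0 < c x" and [measurable]: "w \<in> borel_measurable lebesgue" "\<phi> \<in> borel_measurable lebesgue" "c \<in> borel_measurable lebesgue"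
    and pos: "AE x in lebesgue. 0 < w x"
    and int: "\<And>t. integrable lebesgue (\<lambda>x. c x * \<bar>w x + t * \<phi> x\<bar> powr (1 - g))"
    and i: "integrable lebesgue (\<lambda>x. c x * \<bar>w x\<bar> powr (- g) * \<phi> x)"
  shows "(\<lambda>n. (singular_int c g (\<lambda>x. w x + 1 / real (Suc n) * \<phi> x) - singular_int c g w) / (1 / real (Suc n)))
    \<longlonglongrightarrow> (1 - g) * (LINT x|lebesgue. c x * \<bar>w x\<bar> powr (- g) * \<phi> x)"
proof -
  have int0: "integrable lebesgue (\<lambda>x. c x * \<bar>w x\<bar> powr (1 - g))" using int[of 0] by simp
  let ?e = "\<lambda>n. 1 / real (Suc n)"
  let ?q = "\<lambda>n x. (c x * \<bar>w x + ?e n * \<phi> x\<bar> powr (1 - g) - c x * \<bar>w x\<bar> powr (1 - g)) / ?e n"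
  have "(\<lambda>n. LINT x|lebesgue. ?q n x) \<longlonglongrightarrow> (LINT x|lebesgue. (1 - g) * (c x * \<bar>w x\<bar> powr (- g) * \<phi> x))"
  proof (rule integral_dominated_convergence[where w = "\<lambda>x. \<bar>c x * \<bar>w x\<bar> powr (- g) * \<phi> x\<bar>"])
    show "integrable lebesgue (\<lambda>x. \<bar>c x * \<bar>w x\<bar> powr (- g) * \<phi> x\<bar>)" using i by (rule integrable_abs)
    show "AE x in lebesgue. (\<lambda>n. ?q n x) \<longlonglongrightarrow> (1 - g) * (c x * \<bar>w x\<bar> powr (- g) * \<phi> x)"
      using pos
    proof eventually_elim
      fix x assume wx: "0 < w x"
      let ?f = "\<lambda>t. c x * (w x + t * \<phi> x) powr (1 - g)"
      have "(?f has_real_derivative (1 - g) * (c x * w x powr (- g) * \<phi> x)) (at 0)"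
        using wx by (auto intro!: derivative_eq_intros)
      moreover have "eventually (\<lambda>n. c x * \<bar>w x + ?e n * \<phi> x\<bar> powr (1 - g) = ?f (?e n)) sequentially"
        using eventually_perturbation_pos[OF wx, of "\<phi> x"] by eventually_elim simp
      ultimately have "(\<lambda>n. (c x * \<bar>w x + ?e n * \<phi> x\<bar> powr (1 - g) - ?f 0) / ?e n) \<longlonglongrightarrow> (1 - g) * (c x * w x powr (- g) * \<phi> x)"
        by (rule difference_quotient_tendsto)
      then show "(\<lambda>n. ?q n x) \<longlonglongrightarrow> (1 - g) * (c x * \<bar>w x\<bar> powr (- g) * \<phi> x)" using wx by simp
    qed
    show "AE x in lebesgue. norm (?q n x) \<le> \<bar>c x * \<bar>w x\<bar> powr (- g) * \<phi> x\<bar>" for n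
      using pos
    proof eventually_elim
      fix x assume wx: "0 < w x"
      have e: "0 < ?e n" by simp
      have "\<bar>\<bar>w x + ?e n * \<phi> x\<bar> powr (1 - g) - w x powr (1 - g)\<bar> \<le> w x powr (1 - g - 1) * \<bar>\<bar>w x + ?e n * \<phi> x\<bar> - w x\<bar>"
        using g wx by (intro powr_diff_abs_le) auto
      also have "\<dots> \<le> w x powr (- g) * (?e n * \<bar>\<phi> x\<bar>)"
      proof -
        have "\<bar>\<bar>w x + ?e n * \<phi> x\<bar> - w x\<bar> \<le> \<bar>?e n * \<phi> x\<bar>" using wx by linarith
        also have "\<bar>?e n * \<phi> x\<bar> = ?e n * \<bar>\<phi> x\<bar>" by (simp add: abs_mult)
        finally show ?thesis by (intro mult_mono) auto
      qed
      finally have "c x * \<bar>\<bar>w x + ?e n * \<phi> x\<bar> powr (1 - g) - w x powr (1 - g)\<bar> \<le> c x * (w x powr (- g) * (?e n * \<bar>\<phi> x\<bar>))"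
        using c[of x] by (intro mult_left_mono) auto
      then have "\<bar>c x * \<bar>w x + ?e n * \<phi> x\<bar> powr (1 - g) - c x * \<bar>w x\<bar> powr (1 - g)\<bar> \<le> \<bar>c x * \<bar>w x\<bar> powr (- g) * \<phi> x\<bar> * ?e n"
        using c[of x] wx by (simp add: abs_mult mult_ac flip: right_diff_distrib)
      then have "\<bar>c x * \<bar>w x + ?e n * \<phi> x\<bar> powr (1 - g) - c x * \<bar>w x\<bar> powr (1 - g)\<bar> / ?e n \<le> \<bar>c x * \<bar>w x\<bar> powr (- g) * \<phi> x\<bar>"
        using e by (simp only: pos_divide_le_eq)
      then show "norm (?q n x) \<le> \<bar>c x * \<bar>w x\<bar> powr (- g) * \<phi> x\<bar>" using e by (simp only: real_norm_def abs_divide abs_of_pos)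
    qed
  qed measurable
  moreover have "(LINT x|lebesgue. ?q n x) = (singular_int c g (\<lambda>x. w x + ?e n * \<phi> x) - singular_int c g w) / ?e n" for n
    unfolding singular_int_def using int[of "?e n"] int0 by (simp add: Bochner_Integration.integral_diff del: of_nat_Suc)
  ultimately show ?thesis by simp
qed

text \<open>Dominated convergence with a majorant built from the largest values reached for step
  sizes up to 1, hence the hypotheses on \<open>u + \<bar>\<phi>\<bar>\<close> and
  \<open>v + \<bar>\<psi>\<bar>\<close>. Integrability of the derivative comes along.\<close>

lemma coupling_int_derivative:
  fixes u v :: "real ^ 'n \<Rightarrow> real"
  assumes al: "1 < \<alpha>" "1 < \<beta>"
    and [measurable]: "u \<in> borel_measurable lebesgue" "\<phi> \<in> borel_measurable lebesgue" "v \<in> borel_measurable lebesgue" "\<psi> \<in> borel_measurable lebesgue"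
    and nn: "\<And>x. 0 \<le> u x" "\<And>x. 0 \<le> v x" and pos: "AE x in lebesgue. 0 < u x" "AE x in lebesgue. 0 < v x"
    and int: "\<And>t. integrable lebesgue (\<lambda>x. \<bar>u x + t * \<phi> x\<bar> powr \<alpha> * \<bar>v x + t * \<psi> x\<bar> powr \<beta>)"
    and i: "integrable lebesgue (\<lambda>x. \<bar>u x + \<bar>\<phi> x\<bar>\<bar> powr (\<alpha> + \<beta>))" "integrable lebesgue (\<lambda>x. \<bar>v x + \<bar>\<psi> x\<bar>\<bar> powr (\<alpha> + \<beta>))"
  shows "integrable lebesgue (coupling_deriv \<alpha> \<beta> u v \<phi> \<psi>)"
    "(\<lambda>n. (coupling_int \<alpha> \<beta> (\<lambda>x. u x + 1 / real (Suc n) * \<phi> x) (\<lambda>x. v x + 1 / real (Suc n) * \<psi> x) - coupling_int \<alpha> \<beta> u v) / (1 / real (Suc n)))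
    \<longlonglongrightarrow> (LINT x|lebesgue. coupling_deriv \<alpha> \<beta> u v \<phi> \<psi> x)"
proof -
  have int0: "integrable lebesgue (\<lambda>x. \<bar>u x\<bar> powr \<alpha> * \<bar>v x\<bar> powr \<beta>)" using int[of 0] by simp
  let ?e = "\<lambda>n. 1 / real (Suc n)" and ?r = "\<alpha> + \<beta>"
  let ?q = "\<lambda>n x. (\<bar>u x + ?e n * \<phi> x\<bar> powr \<alpha> * \<bar>v x + ?e n * \<psi> x\<bar> powr \<beta> - \<bar>u x\<bar> powr \<alpha> * \<bar>v x\<bar> powr \<beta>) / ?e n"
  let ?w = "\<lambda>x. ?r * (2 powr ?r * (2 powr ?r * (\<bar>u x + \<bar>\<phi> x\<bar>\<bar> powr ?r + \<bar>v x + \<bar>\<psi> x\<bar>\<bar> powr ?r)))"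
  have iw: "integrable lebesgue ?w" using i by (intro integrable_mult_right Bochner_Integration.integrable_add)
  have cm [measurable]: "coupling_deriv \<alpha> \<beta> u v \<phi> \<psi> \<in> borel_measurable lebesgue"
    unfolding coupling_deriv_def by measurable
  have lim: "AE x in lebesgue. (\<lambda>n. ?q n x) \<longlonglongrightarrow> coupling_deriv \<alpha> \<beta> u v \<phi> \<psi> x"
    using pos
  proof eventually_elim
    fix x assume ux: "0 < u x" and vx: "0 < v x"
    let ?f = "\<lambda>t. (u x + t * \<phi> x) powr \<alpha> * (v x + t * \<psi> x) powr \<beta>"
    have "(?f has_real_derivative \<alpha> * (u x powr (\<alpha> - 1) * \<phi> x * v x powr \<beta>) + \<beta> * (u x powr \<alpha> * v x powr (\<beta> - 1) * \<psi> x)) (at 0)"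
      using ux vx by (auto intro!: derivative_eq_intros simp: mult_ac)
    moreover have "u x powr (\<alpha> - 1) = u x powr (\<alpha> - 2) * u x" "v x powr (\<beta> - 1) = v x powr (\<beta> - 2) * v x"
      using powr_add[of "u x" "\<alpha> - 2" 1] powr_add[of "v x" "\<beta> - 2" 1] ux vx by simp_all
    ultimately have d: "(?f has_real_derivative coupling_deriv \<alpha> \<beta> u v \<phi> \<psi> x) (at 0)"
      using ux vx by (simp add: coupling_deriv_def mult_ac)
    have "eventually (\<lambda>n. \<bar>u x + ?e n * \<phi> x\<bar> powr \<alpha> * \<bar>v x + ?e n * \<psi> x\<bar> powr \<beta> = ?f (?e n)) sequentially"
      using eventually_perturbation_pos[OF ux, of "\<phi> x"] eventually_perturbation_pos[OF vx, of "\<psi> x"] by eventually_elim simp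
    from difference_quotient_tendsto[OF d this] show "(\<lambda>n. ?q n x) \<longlonglongrightarrow> coupling_deriv \<alpha> \<beta> u v \<phi> \<psi> x" using ux vx by simp
  qed
  have bound: "norm (?q n x) \<le> ?w x" for n x
  proof -
    define e where "e = ?e n"
    have e: "0 < e" "e \<le> 1" by (auto simp: e_def)
    define X Y where "X = \<bar>u x + e * \<phi> x\<bar>" and "Y = \<bar>v x + e * \<psi> x\<bar>"
    \<comment> \<open>One quantity above everything in the estimate; the 2 covers the sums
      \<open>X + u x\<close> and \<open>Y + v x\<close> produced by
      \<open>powr_lipschitz\<close>.\<close>
    define Z where "Z = 2 * ((u x + \<bar>\<phi> x\<bar>) + (v x + \<bar>\<psi> x\<bar>))"
    have ep: "\<bar>e * \<phi> x\<bar> = e * \<bar>\<phi> x\<bar>" "\<bar>e * \<psi> x\<bar> = e * \<bar>\<psi> x\<bar>" "e * \<bar>\<phi> x\<bar> \<le> \<bar>\<phi> x\<bar>" "e * \<bar>\<psi> x\<bar> \<le> \<bar>\<psi> x\<bar>"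
      using e by (auto simp: abs_mult mult_left_le_one_le)
    have Z: "0 \<le> Z" "X + u x \<le> Z" "Y + v x \<le> Z" "u x \<le> Z" "Y \<le> Z" "\<bar>\<phi> x\<bar> \<le> Z" "\<bar>\<psi> x\<bar> \<le> Z"
    proof -
      have "0 \<le> \<bar>\<phi> x\<bar>" "0 \<le> \<bar>\<psi> x\<bar>" by simp_all
      moreover have "X \<le> u x + \<bar>\<phi> x\<bar>" "Y \<le> v x + \<bar>\<psi> x\<bar>"
        using abs_triangle_ineq[of "u x" "e * \<phi> x"] abs_triangle_ineq[of "v x" "e * \<psi> x"] nn[of x] ep
        unfolding X_def Y_def by simp_all
      moreover note nn[of x]
      ultimately show "0 \<le> Z" "X + u x \<le> Z" "Y + v x \<le> Z" "u x \<le> Z" "Y \<le> Z" "\<bar>\<phi> x\<bar> \<le> Z" "\<bar>\<psi> x\<bar> \<le> Z"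
        unfolding Z_def by simp_all
    qed
    have XY: "0 \<le> X" "0 \<le> Y" by (auto simp: X_def Y_def)
    have Zs: "Z powr (\<alpha> - 1) * Z * Z powr \<beta> = Z powr ?r" "Z powr \<alpha> * (Z powr (\<beta> - 1) * Z) = Z powr ?r"
    proof -
      have "Z powr (\<alpha> - 1) * Z = Z powr \<alpha>" "Z powr (\<beta> - 1) * Z = Z powr \<beta>"
        using powr_add[of Z "\<alpha> - 1" 1] powr_add[of Z "\<beta> - 1" 1] Z(1) by (auto simp: less_eq_real_def)
      then show "Z powr (\<alpha> - 1) * Z * Z powr \<beta> = Z powr ?r" "Z powr \<alpha> * (Z powr (\<beta> - 1) * Z) = Z powr ?r" by (simp_all add: powr_add)
    qed
    have 1: "\<bar>X powr \<alpha> - u x powr \<alpha>\<bar> * Y powr \<beta> \<le> e * (\<alpha> * Z powr ?r)"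
    proof -
      have "\<bar>X powr \<alpha> - u x powr \<alpha>\<bar> \<le> \<alpha> * (X + u x) powr (\<alpha> - 1) * \<bar>X - u x\<bar>"
        using al XY nn by (intro powr_lipschitz) auto
      also have "\<dots> \<le> \<alpha> * Z powr (\<alpha> - 1) * (e * Z)"
      proof (intro mult_mono powr_mono2)
        have "\<bar>X - u x\<bar> \<le> e * \<bar>\<phi> x\<bar>" using nn(1)[of x] ep unfolding X_def by linarith
        also have "\<dots> \<le> e * Z" using Z e by (intro mult_left_mono) auto
        finally show "\<bar>X - u x\<bar> \<le> e * Z" .
      qed (use Z XY nn al in auto)
      finally have "\<bar>X powr \<alpha> - u x powr \<alpha>\<bar> * Y powr \<beta> \<le> (\<alpha> * Z powr (\<alpha> - 1) * (e * Z)) * Z powr \<beta>"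
        using Z XY al e by (intro mult_mono powr_mono2) auto
      also have "\<dots> = e * (\<alpha> * (Z powr (\<alpha> - 1) * Z * Z powr \<beta>))" by (simp only: mult_ac)
      finally show ?thesis unfolding Zs .
    qed
    have 2: "u x powr \<alpha> * \<bar>Y powr \<beta> - v x powr \<beta>\<bar> \<le> e * (\<beta> * Z powr ?r)"
    proof -
      have "\<bar>Y powr \<beta> - v x powr \<beta>\<bar> \<le> \<beta> * (Y + v x) powr (\<beta> - 1) * \<bar>Y - v x\<bar>"
        using al XY nn by (intro powr_lipschitz) auto
      also have "\<dots> \<le> \<beta> * Z powr (\<beta> - 1) * (e * Z)"
      proof (intro mult_mono powr_mono2)
        have "\<bar>Y - v x\<bar> \<le> e * \<bar>\<psi> x\<bar>" using nn(2)[of x] ep unfolding Y_def by linarith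
        also have "\<dots> \<le> e * Z" using Z e by (intro mult_left_mono) auto
        finally show "\<bar>Y - v x\<bar> \<le> e * Z" .
      qed (use Z XY nn al in auto)
      finally have "u x powr \<alpha> * \<bar>Y powr \<beta> - v x powr \<beta>\<bar> \<le> Z powr \<alpha> * (\<beta> * Z powr (\<beta> - 1) * (e * Z))"
        using Z nn al e by (intro mult_mono powr_mono2) auto
      also have "\<dots> = e * (\<beta> * (Z powr \<alpha> * (Z powr (\<beta> - 1) * Z)))" by (simp only: mult_ac)
      finally show ?thesis unfolding Zs .
    qed
    have "X powr \<alpha> * Y powr \<beta> - u x powr \<alpha> * v x powr \<beta> = (X powr \<alpha> - u x powr \<alpha>) * Y powr \<beta> + u x powr \<alpha> * (Y powr \<beta> - v x powr \<beta>)"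
      by (simp add: algebra_simps)
    then have "\<bar>X powr \<alpha> * Y powr \<beta> - u x powr \<alpha> * v x powr \<beta>\<bar> \<le> \<bar>X powr \<alpha> - u x powr \<alpha>\<bar> * Y powr \<beta> + u x powr \<alpha> * \<bar>Y powr \<beta> - v x powr \<beta>\<bar>"
      using abs_triangle_ineq[of "(X powr \<alpha> - u x powr \<alpha>) * Y powr \<beta>" "u x powr \<alpha> * (Y powr \<beta> - v x powr \<beta>)"] by (simp add: abs_mult)
    also have "\<dots> \<le> e * (\<alpha> * Z powr ?r) + e * (\<beta> * Z powr ?r)" using 1 2 by (rule add_mono)
    also have "\<dots> = (?r * Z powr ?r) * e" by (simp add: algebra_simps)
    finally have "\<bar>X powr \<alpha> * Y powr \<beta> - u x powr \<alpha> * v x powr \<beta>\<bar> / e \<le> ?r * Z powr ?r"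
      using e by (simp add: pos_divide_le_eq)
    also have "\<dots> \<le> ?w x"
    proof (intro mult_left_mono)
      have "Z powr ?r = 2 powr ?r * ((u x + \<bar>\<phi> x\<bar>) + (v x + \<bar>\<psi> x\<bar>)) powr ?r"
        unfolding Z_def using nn by (intro powr_mult)
      also have "((u x + \<bar>\<phi> x\<bar>) + (v x + \<bar>\<psi> x\<bar>)) powr ?r \<le> 2 powr ?r * ((u x + \<bar>\<phi> x\<bar>) powr ?r + (v x + \<bar>\<psi> x\<bar>) powr ?r)"
        using nn al by (intro powr_add_le_two) auto
      finally show "Z powr ?r \<le> 2 powr ?r * (2 powr ?r * (\<bar>u x + \<bar>\<phi> x\<bar>\<bar> powr ?r + \<bar>v x + \<bar>\<psi> x\<bar>\<bar> powr ?r))"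
        using nn by (simp add: add_nonneg_nonneg)
    qed (use al in auto)
    finally have *: "\<bar>X powr \<alpha> * Y powr \<beta> - u x powr \<alpha> * v x powr \<beta>\<bar> / e \<le> ?w x" .
    have "\<bar>u x\<bar> = u x" "\<bar>v x\<bar> = v x" "\<bar>?e n\<bar> = ?e n" using nn[of x] by auto
    then show ?thesis using * unfolding X_def Y_def e_def by (simp only: real_norm_def abs_divide)
  qed
  have qm: "?q n \<in> borel_measurable lebesgue" for n by measurable
  show "integrable lebesgue (coupling_deriv \<alpha> \<beta> u v \<phi> \<psi>)"
    by (rule integrable_dominated_convergence[OF cm qm iw lim]) (use bound in \<open>auto intro: always_eventually\<close>)
  have "(\<lambda>n. LINT x|lebesgue. ?q n x) \<longlonglongrightarrow> (LINT x|lebesgue. coupling_deriv \<alpha> \<beta> u v \<phi> \<psi> x)"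
    by (rule integral_dominated_convergence[OF cm qm iw lim]) (use bound in \<open>auto intro: always_eventually\<close>)
  moreover have "(LINT x|lebesgue. ?q n x) = (coupling_int \<alpha> \<beta> (\<lambda>x. u x + ?e n * \<phi> x) (\<lambda>x. v x + ?e n * \<psi> x) - coupling_int \<alpha> \<beta> u v) / ?e n" for n
    unfolding coupling_int_def using int[of "?e n"] int0 by (simp add: Bochner_Integration.integral_diff del: of_nat_Suc)
  ultimately show "(\<lambda>n. (coupling_int \<alpha> \<beta> (\<lambda>x. u x + ?e n * \<phi> x) (\<lambda>x. v x + ?e n * \<psi> x) - coupling_int \<alpha> \<beta> u v) / ?e n)
    \<longlonglongrightarrow> (LINT x|lebesgue. coupling_deriv \<alpha> \<beta> u v \<phi> \<psi> x)" by simp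
qed

lemma form_zero_right: "form s V u (\<lambda>x. 0) = 0"
  by (simp add: form_def gagliardo_kernel_def split_beta)

lemma singular_integrand_pos:
  assumes "u x > 0"
  shows "singular_integrand c g u \<phi> x = ereal (c x * \<bar>u x\<bar> powr (- g) * \<phi> x)"
  using assms by (simp add: singular_integrand_def neg_power_def)

text \<open>Positivity almost everywhere removes the infinite values, so the extended integral
  reduces to an ordinary one.\<close>

lemma singular_integrand_ext_integrable:
  fixes c :: "real ^ 'n \<Rightarrow> real"
  assumes [measurable]: "c \<in> borel_measurable lebesgue" "u \<in> borel_measurable lebesgue" "\<phi> \<in> borel_measurable lebesgue"
    and pos: "AE x in lebesgue. 0 < u x" and i: "integrable lebesgue (\<lambda>x. c x * \<bar>u x\<bar> powr (- g) * \<phi> x)"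
  shows "ext_integrable lebesgue (singular_integrand c g u \<phi>)"
    "ext_integral lebesgue (singular_integrand c g u \<phi>) = (LINT x|lebesgue. c x * \<bar>u x\<bar> powr (- g) * \<phi> x)"
proof -
  have m [measurable]: "singular_integrand c g u \<phi> \<in> borel_measurable lebesgue"
    unfolding singular_integrand_def neg_power_def by measurable
  have AE: "AE x in lebesgue. singular_integrand c g u \<phi> x = ereal (c x * \<bar>u x\<bar> powr (- g) * \<phi> x)"
    using pos by eventually_elim (rule singular_integrand_pos)
  have "(\<integral>\<^sup>+ x. e2ennreal \<bar>singular_integrand c g u \<phi> x\<bar> \<partial>lebesgue) = (\<integral>\<^sup>+ x. ennreal \<bar>c x * \<bar>u x\<bar> powr (- g) * \<phi> x\<bar> \<partial>lebesgue)"
    by (rule nn_integral_cong_AE) (use AE in \<open>auto elim!: eventually_mono simp: ennreal_def[symmetric] e2ennreal_ereal\<close>)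
  also have "\<dots> < \<infinity>" using i by (simp add: integrable_iff_bounded)
  finally show "ext_integrable lebesgue (singular_integrand c g u \<phi>)" using m by (simp add: ext_integrable_def)
  show "ext_integral lebesgue (singular_integrand c g u \<phi>) = (LINT x|lebesgue. c x * \<bar>u x\<bar> powr (- g) * \<phi> x)"
    unfolding ext_integral_def
    by (rule integral_cong_AE) (use AE in \<open>auto elim!: eventually_mono\<close>)
qed

context fractional_system
begin

lemma energy_perturbed:
  assumes X: "u \<in> X1" "v \<in> X2" "\<phi> \<in> X1" "\<psi> \<in> X2"
  shows "sq (\<lambda>x. u x + t * \<phi> x) (\<lambda>x. v x + t * \<psi> x)
      = sq u v + 2 * t * (form s V1 u \<phi> + form s V2 v \<psi>) + t\<^sup>2 * (form s V1 \<phi> \<phi> + form s V2 \<psi> \<psi>)"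
    "E lam (\<lambda>x. u x + t * \<phi> x) (\<lambda>x. v x + t * \<psi> x) - E lam u v
      = t * (form s V1 u \<phi> + form s V2 v \<psi>) + t\<^sup>2 / 2 * (form s V1 \<phi> \<phi> + form s V2 \<psi> \<psi>)
        - lam / (1 - p) * (S1 (\<lambda>x. u x + t * \<phi> x) - S1 u) - lam / (1 - q) * (S2 (\<lambda>x. v x + t * \<psi> x) - S2 v)
        - \<theta> / (\<alpha> + \<beta>) * (cpl (\<lambda>x. u x + t * \<phi> x) (\<lambda>x. v x + t * \<psi> x) - cpl u v)"
proof -
  note a1 = Xcomp_add_scaled[OF X(1,3) V1_measurable V1_nonneg] and a2 = Xcomp_add_scaled[OF X(2,4) V2_measurable V2_nonneg]
  show sq: "sq (\<lambda>x. u x + t * \<phi> x) (\<lambda>x. v x + t * \<psi> x)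
      = sq u v + 2 * t * (form s V1 u \<phi> + form s V2 v \<psi>) + t\<^sup>2 * (form s V1 \<phi> \<phi> + form s V2 \<psi> \<psi>)"
    unfolding normsq_eq[OF a1(1) a2(1)] normsq_eq[OF X(1,2)] a1(2) a2(2) by (simp add: algebra_simps)
  show "E lam (\<lambda>x. u x + t * \<phi> x) (\<lambda>x. v x + t * \<psi> x) - E lam u v
      = t * (form s V1 u \<phi> + form s V2 v \<psi>) + t\<^sup>2 / 2 * (form s V1 \<phi> \<phi> + form s V2 \<psi> \<psi>)
        - lam / (1 - p) * (S1 (\<lambda>x. u x + t * \<phi> x) - S1 u) - lam / (1 - q) * (S2 (\<lambda>x. v x + t * \<psi> x) - S2 v)
        - \<theta> / (\<alpha> + \<beta>) * (cpl (\<lambda>x. u x + t * \<phi> x) (\<lambda>x. v x + t * \<psi> x) - cpl u v)"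
    unfolding energy_def sq by (simp add: algebra_simps add_divide_distrib)
qed

text \<open>Testing with the solution itself puts every weak solution on the Nehari set; this links
  minimality there to ground states.\<close>

lemma weak_solution_energy1:
  assumes w: "weak_solution s V1 V2 a b p q \<alpha> \<beta> \<theta> lam u v"
  shows "u \<in> X1" "v \<in> X2" "E1 lam u v = 0"
proof -
  show X: "u \<in> X1" "v \<in> X2" using w by (auto simp: weak_solution_def Xspace_def)
  note [measurable] = XcompD(1)[OF X(1)] XcompD(1)[OF X(2)] a_measurable b_measurable
  have nn: "AE x in lebesgue. 0 \<le> u x \<and> 0 \<le> v x" using w by (simp add: weak_solution_def)
  have ext: "ext_integral lebesgue (singular_integrand c g w w) = singular_int c g w"
    if [measurable]: "c \<in> borel_measurable lebesgue" "w \<in> borel_measurable lebesgue" and AE: "AE x in lebesgue. 0 \<le> w x"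
    for c w :: "real ^ 'n \<Rightarrow> real" and g
  proof -
    have [measurable]: "singular_integrand c g w w \<in> borel_measurable lebesgue"
      unfolding singular_integrand_def neg_power_def by measurable
    have "AE x in lebesgue. real_of_ereal (singular_integrand c g w w x) = c x * \<bar>w x\<bar> powr (1 - g)"
      using AE
    proof eventually_elim
      fix x assume "0 \<le> w x"
      then consider "w x = 0" | "0 < w x" by linarith
      then show "real_of_ereal (singular_integrand c g w w x) = c x * \<bar>w x\<bar> powr (1 - g)"
      proof cases
        \<comment> \<open>Here the integrand is infinity times 0, that is 0, in agreement with
          \<open>0 powr (1 - g) = 0\<close>.\<close>
        case 1
        then show ?thesis by (simp add: singular_integrand_def zero_ereal_def[symmetric])
      next
        case 2
        then have "w x powr (1 - g) = w x powr (- g) * w x" using powr_add[of "w x" "- g" 1] by simp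
        then show ?thesis using 2 by (simp add: singular_integrand_pos)
      qed
    qed
    then show ?thesis unfolding ext_integral_def singular_int_def by (intro integral_cong_AE) auto
  qed
  have e1: "ext_integral lebesgue (singular_integrand a p u u) = S1 u"
    by (rule ext) (use nn in \<open>auto elim: eventually_mono\<close>)
  have e2: "ext_integral lebesgue (singular_integrand b q v v) = S2 v"
    by (rule ext) (use nn in \<open>auto elim: eventually_mono\<close>)
  have pw: "\<bar>t\<bar> powr (c - 2) * t * t = \<bar>t\<bar> powr c" for c t :: real
  proof (cases "t = 0")
    case False
    then have "\<bar>t\<bar> powr (c - 2) * t\<^sup>2 = \<bar>t\<bar> powr c" using powr_add[of "\<bar>t\<bar>" "c - 2" 2] by simp
    then show ?thesis by (simp add: power2_eq_square mult.assoc)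
  qed simp
  have "coupling_deriv \<alpha> \<beta> u v u v x = (\<alpha> + \<beta>) * (\<bar>u x\<bar> powr \<alpha> * \<bar>v x\<bar> powr \<beta>)" for x
  proof -
    have "coupling_deriv \<alpha> \<beta> u v u v x = \<alpha> * ((\<bar>u x\<bar> powr (\<alpha> - 2) * u x * u x) * \<bar>v x\<bar> powr \<beta>)
      + \<beta> * (\<bar>u x\<bar> powr \<alpha> * (\<bar>v x\<bar> powr (\<beta> - 2) * v x * v x))" by (simp add: coupling_deriv_def mult_ac)
    then show ?thesis unfolding pw by (simp add: algebra_simps)
  qed
  then have cd: "(LINT x|lebesgue. coupling_deriv \<alpha> \<beta> u v u v x) = (\<alpha> + \<beta>) * cpl u v"
    by (simp add: coupling_int_def)
  have "ip s V1 V2 u v u v - \<theta> / (\<alpha> + \<beta>) * (LINT x|lebesgue. coupling_deriv \<alpha> \<beta> u v u v x)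
        - lam * (ext_integral lebesgue (singular_integrand a p u u) + ext_integral lebesgue (singular_integrand b q v v)) = 0"
    using w X unfolding weak_solution_def weak_formulation_def Xspace_def by fastforce
  then have "sq u v - \<theta> / (\<alpha> + \<beta>) * ((\<alpha> + \<beta>) * cpl u v) - lam * (S1 u + S2 v) = 0"
    unfolding cd e1 e2 normsq_def .
  moreover have "\<theta> / (\<alpha> + \<beta>) * ((\<alpha> + \<beta>) * cpl u v) = \<theta> * cpl u v" using r2 by simp
  ultimately show "E1 lam u v = 0" by (simp add: energy1_def algebra_simps)
qed

section \<open>First-order conditions at a Nehari minimizer\<close>

context
  fixes lam :: real and u v :: "real ^ 'n \<Rightarrow> real"
  assumes lam: "0 < lam"
    and X: "u \<in> X1" "v \<in> X2" and nt: "nontrivial u v" and nn: "\<And>x. 0 \<le> u x" "\<And>x. 0 \<le> v x"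
    and E1_0: "E1 lam u v = 0" and E2_pos: "0 < E2 lam u v"
    and min: "\<And>u' v' t. u' \<in> X1 \<Longrightarrow> v' \<in> X2 \<Longrightarrow> nontrivial u' v' \<Longrightarrow> 1 \<le> t \<Longrightarrow>
      0 \<le> E1 lam (\<lambda>x. t * u' x) (\<lambda>x. t * v' x) \<Longrightarrow> E lam u v \<le> E lam u' v'"
begin

text \<open>The derivative of \<open>E1\<close> along the ray at \<open>t = 1\<close> is
  \<open>E2 lam u v\<close>. The strict inequality obtained is an open condition.\<close>

lemma energy1_pos_beyond: "\<exists>t>1. 0 < E1 lam (\<lambda>x. t * u x) (\<lambda>x. t * v x)"
proof -
  define g where "g t = sq u v * t\<^sup>2 - lam * S1 u * t powr (1 - p) - lam * S2 v * t powr (1 - q) - \<theta> * cpl u v * t powr (\<alpha> + \<beta>)" for t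
  have g: "E1 lam (\<lambda>x. t * u x) (\<lambda>x. t * v x) = g t" if "0 \<le> t" for t
    unfolding g_def by (rule energy_scale(2)[OF X that])
  have "(g has_real_derivative E2 lam u v) (at 1)"
    unfolding g_def energy2_def by (auto intro!: derivative_eq_intros simp: mult_ac)
  then obtain d where d: "d > 0" "\<And>h. 0 < h \<Longrightarrow> h < d \<Longrightarrow> g 1 < g (1 + h)"
    using DERIV_pos_inc_right E2_pos by blast
  have "g 1 = 0" using E1_0 by (simp add: g_def energy1_def)
  then have "0 < g (1 + d / 2)" using d(1) d(2)[of "d / 2"] by simp
  then show ?thesis using d(1) g[of "1 + d / 2"] by (intro exI[of _ "1 + d / 2"]) auto
qed

text \<open>All functionals converge along the perturbation, so the fixed \<open>t\<close> just
  beyond 1 keeps \<open>E1\<close> positive for small steps and the comparison \<open>min\<close>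
  applies. The perturbed pair stays nontrivial because \<open>S1 + S2\<close> stays
  positive.\<close>

lemma perturbed_energy_ge:
  assumes Y: "\<phi> \<in> X1" "\<psi> \<in> X2"
  shows "eventually (\<lambda>n. E lam u v \<le> E lam (\<lambda>x. u x + 1 / real (Suc n) * \<phi> x) (\<lambda>x. v x + 1 / real (Suc n) * \<psi> x)) sequentially"
proof -
  let ?e = "\<lambda>n. 1 / real (Suc n)"
  let ?U = "\<lambda>n x. u x + ?e n * \<phi> x" and ?W = "\<lambda>n x. v x + ?e n * \<psi> x"
  note e0 = inverse_Suc_tendsto_0
  have e1: "0 < ?e n" "?e n \<le> 1" for n by auto
  have XU: "?U n \<in> X1" for n by (rule Xcomp_add_scaled(1)[OF X(1) Y(1) V1_measurable V1_nonneg])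
  have XW: "?W n \<in> X2" for n by (rule Xcomp_add_scaled(1)[OF X(2) Y(2) V2_measurable V2_nonneg])
  have f0: "0 \<le> form s V1 \<phi> \<phi>" "0 \<le> form s V2 \<psi> \<psi>" by (rule form_nonneg V1_nonneg V2_nonneg)+
  have e2: "(?e n)\<^sup>2 \<le> 1" for n using e1[of n] by (intro power_le_one) auto
  have B1: "form s V1 (\<lambda>x. ?U n x - u x) (\<lambda>x. ?U n x - u x) \<le> form s V1 \<phi> \<phi> + form s V2 \<psi> \<psi>" for n
    using Xcomp_scale(2)[OF Y(1), of "?e n"] mult_right_mono[OF e2 f0(1), of n] f0 by simp
  have B2: "form s V2 (\<lambda>x. ?W n x - v x) (\<lambda>x. ?W n x - v x) \<le> form s V1 \<phi> \<phi> + form s V2 \<psi> \<psi>" for n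
    using Xcomp_scale(2)[OF Y(2), of "?e n"] mult_right_mono[OF e2 f0(2), of n] f0 by simp
  have AE1: "AE x in lebesgue. (\<lambda>n. ?U n x) \<longlonglongrightarrow> u x" "AE x in lebesgue. (\<lambda>n. ?W n x) \<longlonglongrightarrow> v x"
  proof -
    have "(\<lambda>n. c + ?e n * d) \<longlonglongrightarrow> c + 0 * d" for c d by (intro tendsto_add tendsto_mult tendsto_const e0)
    then show "AE x in lebesgue. (\<lambda>n. ?U n x) \<longlonglongrightarrow> u x" "AE x in lebesgue. (\<lambda>n. ?W n x) \<longlonglongrightarrow> v x"
      by (auto intro!: always_eventually)
  qed
  have L2: "(\<lambda>n. LINT x|lebesgue. (c x + ?e n * d x - c x)\<^sup>2) \<longlonglongrightarrow> 0" for c d :: "real ^ 'n \<Rightarrow> real"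
  proof -
    have "(LINT x|lebesgue. (c x + ?e n * d x - c x)\<^sup>2) = (?e n)\<^sup>2 * (LINT x|lebesgue. (d x)\<^sup>2)" for n
      by (subst integral_mult_right_zero[symmetric]) (simp add: power_mult_distrib power_divide del: of_nat_Suc)
    moreover have "(\<lambda>n. (?e n)\<^sup>2 * (LINT x|lebesgue. (d x)\<^sup>2)) \<longlonglongrightarrow> 0\<^sup>2 * (LINT x|lebesgue. (d x)\<^sup>2)"
      by (intro tendsto_mult tendsto_power tendsto_const e0)
    ultimately show ?thesis by simp
  qed
  note conv = functionals_tendsto[where U = ?U and W = ?W, OF XU XW X B1 B2 AE1 L2 L2]
  have sqc: "(\<lambda>n. sq (?U n) (?W n)) \<longlonglongrightarrow> sq u v"
  proof -
    have "(\<lambda>n. sq u v + 2 * ?e n * (form s V1 u \<phi> + form s V2 v \<psi>) + (?e n)\<^sup>2 * (form s V1 \<phi> \<phi> + form s V2 \<psi> \<psi>))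
      \<longlonglongrightarrow> sq u v + 2 * 0 * (form s V1 u \<phi> + form s V2 v \<psi>) + 0\<^sup>2 * (form s V1 \<phi> \<phi> + form s V2 \<psi> \<psi>)"
      by (intro tendsto_add tendsto_mult tendsto_power tendsto_const e0)
    then show ?thesis unfolding energy_perturbed(1)[OF X Y] by simp
  qed
  obtain t where t: "1 < t" "0 < E1 lam (\<lambda>x. t * u x) (\<lambda>x. t * v x)" using energy1_pos_beyond by blast
  have t0: "0 \<le> t" using t by simp
  have "(\<lambda>n. E1 lam (\<lambda>x. t * ?U n x) (\<lambda>x. t * ?W n x)) \<longlonglongrightarrow> E1 lam (\<lambda>x. t * u x) (\<lambda>x. t * v x)"
    unfolding energy_scale(2)[OF XU XW t0] energy_scale(2)[OF X t0]
    by (intro tendsto_diff tendsto_mult tendsto_const conv sqc)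
  then have ev1: "eventually (\<lambda>n. 0 < E1 lam (\<lambda>x. t * ?U n x) (\<lambda>x. t * ?W n x)) sequentially"
    using t(2) by (rule order_tendstoD(1))
  then have ev2: "eventually (\<lambda>n. 0 < S1 (?U n) + S2 (?W n)) sequentially"
    using nontrivial_pos(1)[OF X nt] tendsto_add[OF conv(1,2)] by (intro order_tendstoD(1)) auto
  show ?thesis
    using ev1 ev2
  proof eventually_elim
    case (elim n)
    have "nontrivial (?U n) (?W n)"
    proof (rule ccontr)
      assume "\<not> nontrivial (?U n) (?W n)"
      then have AE: "AE x in lebesgue. ?U n x = 0 \<and> ?W n x = 0" by (simp add: nontrivial_def)
      have "S1 (?U n) = 0" by (rule singular_int_AE_0[OF a_measurable XcompD(1)[OF XU]]) (rule eventually_mono[OF AE], blast)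
      moreover have "S2 (?W n) = 0" by (rule singular_int_AE_0[OF b_measurable XcompD(1)[OF XW]]) (rule eventually_mono[OF AE], blast)
      ultimately show False using elim(2) by simp
    qed
    then show ?case using elim(1) t(1) by (intro min[OF XU XW, of n n t]) auto
  qed
qed

text \<open>A nonnegative direction can only increase the coupling, so that term drops out of the
  energy comparison and the singular increment is bounded by the quadratic part, which is linear in
  the step up to \<open>e\<^sup>2 <= e\<close>.\<close>

lemma singular_growth1:
  assumes Y: "\<phi> \<in> X1" and pos: "\<And>x. 0 \<le> \<phi> x"
  shows "\<exists>K. eventually (\<lambda>n. S1 (\<lambda>x. u x + 1 / real (Suc n) * \<phi> x) - S1 u \<le> K * (1 / real (Suc n))) sequentially"
proof (intro exI)
  let ?K = "(1 - p) / lam * (form s V1 u \<phi> + form s V1 \<phi> \<phi>)"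
  have f0: "0 \<le> form s V1 \<phi> \<phi>" by (rule form_nonneg V1_nonneg)+
  show "eventually (\<lambda>n. S1 (\<lambda>x. u x + 1 / real (Suc n) * \<phi> x) - S1 u \<le> ?K * (1 / real (Suc n))) sequentially"
    using perturbed_energy_ge[OF Y Xcomp_zero]
  proof eventually_elim
    case (elim n)
    define e where "e = 1 / real (Suc n)"
    have e: "0 < e" "e \<le> 1" by (auto simp: e_def)
    have XU: "(\<lambda>x. u x + e * \<phi> x) \<in> X1" by (rule Xcomp_add_scaled(1)[OF X(1) Y V1_measurable V1_nonneg])
    have "cpl u v \<le> cpl (\<lambda>x. u x + e * \<phi> x) v"
      unfolding coupling_int_def using nn pos e ab
      by (intro integral_mono coupling_integrable X XU mult_right_mono powr_mono2) auto
    then have c: "0 \<le> \<theta> / (\<alpha> + \<beta>) * (cpl (\<lambda>x. u x + e * \<phi> x) v - cpl u v)" using th ab by simp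
    have "0 \<le> E lam (\<lambda>x. u x + e * \<phi> x) (\<lambda>x. v x + e * 0) - E lam u v" using elim unfolding e_def by simp
    then have "lam / (1 - p) * (S1 (\<lambda>x. u x + e * \<phi> x) - S1 u) \<le> e * form s V1 u \<phi> + e\<^sup>2 / 2 * form s V1 \<phi> \<phi>"
      using c unfolding energy_perturbed(2)[OF X Y Xcomp_zero] by (simp add: form_zero_right)
    also have "e\<^sup>2 / 2 * form s V1 \<phi> \<phi> \<le> e * form s V1 \<phi> \<phi>"
      using e f0 mult_mono[of e 1 e e] by (intro mult_right_mono) (auto simp: power2_eq_square)
    finally have "lam / (1 - p) * (S1 (\<lambda>x. u x + e * \<phi> x) - S1 u) \<le> e * (form s V1 u \<phi> + form s V1 \<phi> \<phi>)"
      by (simp add: distrib_left)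
    then show ?case unfolding e_def[symmetric] using lam p1 by (simp add: field_simps)
  qed
qed

lemma singular_growth2:
  assumes Y: "\<psi> \<in> X2" and pos: "\<And>x. 0 \<le> \<psi> x"
  shows "\<exists>K. eventually (\<lambda>n. S2 (\<lambda>x. v x + 1 / real (Suc n) * \<psi> x) - S2 v \<le> K * (1 / real (Suc n))) sequentially"
proof (intro exI)
  let ?K = "(1 - q) / lam * (form s V2 v \<psi> + form s V2 \<psi> \<psi>)"
  have f0: "0 \<le> form s V2 \<psi> \<psi>" by (rule form_nonneg V2_nonneg)+
  show "eventually (\<lambda>n. S2 (\<lambda>x. v x + 1 / real (Suc n) * \<psi> x) - S2 v \<le> ?K * (1 / real (Suc n))) sequentially"
    using perturbed_energy_ge[OF Xcomp_zero Y]
  proof eventually_elim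
    case (elim n)
    define e where "e = 1 / real (Suc n)"
    have e: "0 < e" "e \<le> 1" by (auto simp: e_def)
    have XW: "(\<lambda>x. v x + e * \<psi> x) \<in> X2" by (rule Xcomp_add_scaled(1)[OF X(2) Y V2_measurable V2_nonneg])
    have "cpl u v \<le> cpl u (\<lambda>x. v x + e * \<psi> x)"
      unfolding coupling_int_def using nn pos e ab
      by (intro integral_mono coupling_integrable X XW mult_left_mono powr_mono2) auto
    then have c: "0 \<le> \<theta> / (\<alpha> + \<beta>) * (cpl u (\<lambda>x. v x + e * \<psi> x) - cpl u v)" using th ab by simp
    have "0 \<le> E lam (\<lambda>x. u x + e * 0) (\<lambda>x. v x + e * \<psi> x) - E lam u v" using elim unfolding e_def by simp
    then have "lam / (1 - q) * (S2 (\<lambda>x. v x + e * \<psi> x) - S2 v) \<le> e * form s V2 v \<psi> + e\<^sup>2 / 2 * form s V2 \<psi> \<psi>"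
      using c unfolding energy_perturbed(2)[OF X Xcomp_zero Y] by (simp add: form_zero_right)
    also have "e\<^sup>2 / 2 * form s V2 \<psi> \<psi> \<le> e * form s V2 \<psi> \<psi>"
      using e f0 mult_mono[of e 1 e e] by (intro mult_right_mono) (auto simp: power2_eq_square)
    finally have "lam / (1 - q) * (S2 (\<lambda>x. v x + e * \<psi> x) - S2 v) \<le> e * (form s V2 v \<psi> + form s V2 \<psi> \<psi>)"
      by (simp add: distrib_left)
    then show ?case unfolding e_def[symmetric] using lam q1 by (simp add: field_simps)
  qed
qed

lemma singular_integrable_perturbed:
  shows "\<phi> \<in> X1 \<Longrightarrow> integrable lebesgue (\<lambda>x. a x * \<bar>u x + t * \<phi> x\<bar> powr (1 - p))"
    and "\<psi> \<in> X2 \<Longrightarrow> integrable lebesgue (\<lambda>x. b x * \<bar>v x + t * \<psi> x\<bar> powr (1 - q))"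
  using singular_integrable(1)[OF Xcomp_add_scaled(1)[OF X(1) _ V1_measurable V1_nonneg] X(2)]
    singular_integrable(2)[OF X(1) Xcomp_add_scaled(1)[OF X(2) _ V2_measurable V2_nonneg]] by auto

text \<open>Tents of integer radius exhaust the space, so only countably many null sets are
  combined.\<close>

lemma minimizer_positive: "AE x in lebesgue. 0 < u x" "AE x in lebesgue. 0 < v x"
proof -
  have b1: "bump (real (Suc k)) \<in> X1" and b2: "bump (real (Suc k)) \<in> X2" for k
    using bump_in_Xcomp[OF s(1,2) V1c V1_nonneg] bump_in_Xcomp[OF s(1,2) V2c V2_nonneg] by auto
  have inside: "\<exists>k. norm x < real (Suc k)" for x :: "real ^ 'n"
    using reals_Archimedean2[of "norm x"] by (metis less_trans of_nat_less_iff lessI)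
  have "AE x in lebesgue. u x = 0 \<longrightarrow> bump (real (Suc k)) x = 0" for k
  proof -
    obtain K where "eventually (\<lambda>n. S1 (\<lambda>x. u x + 1 / real (Suc n) * bump (real (Suc k)) x) - S1 u \<le> K * (1 / real (Suc n))) sequentially"
      using singular_growth1[OF b1 bump_nonneg] by blast
    then show ?thesis
      by (intro singular_growth_positive[OF p0 p1 apos XcompD(1)[OF X(1)] XcompD(1)[OF b1] a_measurable nn(1) bump_nonneg singular_integrable_perturbed(1)[OF b1]])
  qed
  then have "AE x in lebesgue. \<forall>k. u x = 0 \<longrightarrow> bump (real (Suc k)) x = 0" by (subst AE_all_countable) auto
  then show "AE x in lebesgue. 0 < u x"
  proof eventually_elim
    case (elim x)
    obtain k where "norm x < real (Suc k)" using inside by blast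
    then have "u x \<noteq> 0" using elim bump_pos[of x "real (Suc k)"] by fastforce
    then show ?case using nn(1)[of x] by simp
  qed
  have "AE x in lebesgue. v x = 0 \<longrightarrow> bump (real (Suc k)) x = 0" for k
  proof -
    obtain K where "eventually (\<lambda>n. S2 (\<lambda>x. v x + 1 / real (Suc n) * bump (real (Suc k)) x) - S2 v \<le> K * (1 / real (Suc n))) sequentially"
      using singular_growth2[OF b2 bump_nonneg] by blast
    then show ?thesis
      by (intro singular_growth_positive[OF q0 q1 bpos XcompD(1)[OF X(2)] XcompD(1)[OF b2] b_measurable nn(2) bump_nonneg singular_integrable_perturbed(2)[OF b2]])
  qed
  then have "AE x in lebesgue. \<forall>k. v x = 0 \<longrightarrow> bump (real (Suc k)) x = 0" by (subst AE_all_countable) auto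
  then show "AE x in lebesgue. 0 < v x"
  proof eventually_elim
    case (elim x)
    obtain k where "norm x < real (Suc k)" using inside by blast
    then have "v x \<noteq> 0" using elim bump_pos[of x "real (Suc k)"] by fastforce
    then show ?case using nn(2)[of x] by simp
  qed
qed

lemma singular_derivative_integrable1:
  assumes Y: "\<phi> \<in> X1"
  shows "integrable lebesgue (\<lambda>x. a x * \<bar>u x\<bar> powr (- p) * \<phi> x)"
proof -
  note [measurable] = XcompD(1)[OF X(1)] XcompD(1)[OF Y] a_measurable
  \<comment> \<open>The growth bound needs a nonnegative direction; integrability for the absolute
    value of \<open>\<phi>\<close> gives it for \<open>\<phi>\<close>.\<close>
  note Ya = Xcomp_abs(1)[OF Y]
  obtain K where "eventually (\<lambda>n. S1 (\<lambda>x. u x + 1 / real (Suc n) * \<bar>\<phi> x\<bar>) - S1 u \<le> K * (1 / real (Suc n))) sequentially"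
    using singular_growth1[OF Ya] by auto
  from singular_growth_integrable[OF p0 p1 apos XcompD(1)[OF X(1)] XcompD(1)[OF Ya] a_measurable nn(1) _ minimizer_positive(1) singular_integrable_perturbed(1)[OF Ya] this]
  have "integrable lebesgue (\<lambda>x. a x * \<bar>u x\<bar> powr (- p) * \<bar>\<phi> x\<bar>)" by simp
  then show ?thesis
    by (rule Bochner_Integration.integrable_bound) (use apos in \<open>auto simp: abs_mult less_imp_le intro!: always_eventually\<close>)
qed

lemma singular_derivative_integrable2:
  assumes Y: "\<psi> \<in> X2"
  shows "integrable lebesgue (\<lambda>x. b x * \<bar>v x\<bar> powr (- q) * \<psi> x)"
proof -
  note [measurable] = XcompD(1)[OF X(2)] XcompD(1)[OF Y] b_measurable
  note Ya = Xcomp_abs(1)[OF Y]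
  obtain K where "eventually (\<lambda>n. S2 (\<lambda>x. v x + 1 / real (Suc n) * \<bar>\<psi> x\<bar>) - S2 v \<le> K * (1 / real (Suc n))) sequentially"
    using singular_growth2[OF Ya] by auto
  from singular_growth_integrable[OF q0 q1 bpos XcompD(1)[OF X(2)] XcompD(1)[OF Ya] b_measurable nn(2) _ minimizer_positive(2) singular_integrable_perturbed(2)[OF Ya] this]
  have "integrable lebesgue (\<lambda>x. b x * \<bar>v x\<bar> powr (- q) * \<bar>\<psi> x\<bar>)" by simp
  then show ?thesis
    by (rule Bochner_Integration.integrable_bound) (use bpos in \<open>auto simp: abs_mult less_imp_le intro!: always_eventually\<close>)
qed

text \<open>Only positive steps are taken, so this is one-sided; the reverse inequality follows from
  the opposite direction.\<close>

lemma energy_derivative_ge: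
  assumes Y: "\<phi> \<in> X1" "\<psi> \<in> X2"
  shows "integrable lebesgue (coupling_deriv \<alpha> \<beta> u v \<phi> \<psi>)"
    "0 \<le> form s V1 u \<phi> + form s V2 v \<psi> - \<theta> / (\<alpha> + \<beta>) * (LINT x|lebesgue. coupling_deriv \<alpha> \<beta> u v \<phi> \<psi> x)
      - lam * ((LINT x|lebesgue. a x * \<bar>u x\<bar> powr (- p) * \<phi> x) + (LINT x|lebesgue. b x * \<bar>v x\<bar> powr (- q) * \<psi> x))"
proof -
  let ?e = "\<lambda>n. 1 / real (Suc n)"
  let ?U = "\<lambda>n x. u x + ?e n * \<phi> x" and ?W = "\<lambda>n x. v x + ?e n * \<psi> x"
  note e0 = inverse_Suc_tendsto_0
  have XU: "(\<lambda>x. u x + t * \<phi> x) \<in> X1" "(\<lambda>x. v x + t * \<psi> x) \<in> X2" for t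
    by (rule Xcomp_add_scaled(1)[OF X(1) Y(1) V1_measurable V1_nonneg] Xcomp_add_scaled(1)[OF X(2) Y(2) V2_measurable V2_nonneg])+
  have Xa: "(\<lambda>x. u x + 1 * \<bar>\<phi> x\<bar>) \<in> X1" "(\<lambda>x. v x + 1 * \<bar>\<psi> x\<bar>) \<in> X2"
    by (rule Xcomp_add_scaled(1)[OF X(1) Xcomp_abs(1)[OF Y(1)] V1_measurable V1_nonneg] Xcomp_add_scaled(1)[OF X(2) Xcomp_abs(1)[OF Y(2)] V2_measurable V2_nonneg])+
  note d1 = singular_int_derivative[OF p0 p1 apos XcompD(1)[OF X(1)] XcompD(1)[OF Y(1)] a_measurable minimizer_positive(1)
      singular_integrable_perturbed(1)[OF Y(1)] singular_derivative_integrable1[OF Y(1)]]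
  note d2 = singular_int_derivative[OF q0 q1 bpos XcompD(1)[OF X(2)] XcompD(1)[OF Y(2)] b_measurable minimizer_positive(2)
      singular_integrable_perturbed(2)[OF Y(2)] singular_derivative_integrable2[OF Y(2)]]
  have pi: "integrable lebesgue (\<lambda>x. \<bar>u x + \<bar>\<phi> x\<bar>\<bar> powr (\<alpha> + \<beta>))" "integrable lebesgue (\<lambda>x. \<bar>v x + \<bar>\<psi> x\<bar>\<bar> powr (\<alpha> + \<beta>))"
    using powr_integrable(1)[OF Xa(1)] powr_integrable(2)[OF Xa(2)] by simp_all
  note d3 = coupling_int_derivative[OF ab XcompD(1)[OF X(1)] XcompD(1)[OF Y(1)] XcompD(1)[OF X(2)] XcompD(1)[OF Y(2)] nn
      minimizer_positive coupling_integrable[OF XU] pi]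
  show "integrable lebesgue (coupling_deriv \<alpha> \<beta> u v \<phi> \<psi>)" by (rule d3(1))
  let ?F = "\<lambda>n. (form s V1 u \<phi> + form s V2 v \<psi>) + ?e n / 2 * (form s V1 \<phi> \<phi> + form s V2 \<psi> \<psi>)
        - lam / (1 - p) * ((S1 (?U n) - S1 u) / ?e n) - lam / (1 - q) * ((S2 (?W n) - S2 v) / ?e n)
        - \<theta> / (\<alpha> + \<beta>) * ((cpl (?U n) (?W n) - cpl u v) / ?e n)"
  let ?L = "(form s V1 u \<phi> + form s V2 v \<psi>) + 0 / 2 * (form s V1 \<phi> \<phi> + form s V2 \<psi> \<psi>)
        - lam / (1 - p) * ((1 - p) * (LINT x|lebesgue. a x * \<bar>u x\<bar> powr (- p) * \<phi> x))
        - lam / (1 - q) * ((1 - q) * (LINT x|lebesgue. b x * \<bar>v x\<bar> powr (- q) * \<psi> x))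
        - \<theta> / (\<alpha> + \<beta>) * (LINT x|lebesgue. coupling_deriv \<alpha> \<beta> u v \<phi> \<psi> x)"
  have "?F \<longlonglongrightarrow> ?L"
    by (intro tendsto_diff tendsto_add tendsto_mult tendsto_divide tendsto_const d1 d2 d3(2) e0) simp
  moreover have "eventually (\<lambda>n. 0 \<le> ?F n) sequentially"
    using perturbed_energy_ge[OF Y]
  proof eventually_elim
    case (elim n)
    define e where "e = ?e n"
    have e: "0 < e" by (simp add: e_def)
    have "0 \<le> E lam (\<lambda>x. u x + e * \<phi> x) (\<lambda>x. v x + e * \<psi> x) - E lam u v" using elim unfolding e_def by simp
    then have "0 \<le> (e * (form s V1 u \<phi> + form s V2 v \<psi>) + e\<^sup>2 / 2 * (form s V1 \<phi> \<phi> + form s V2 \<psi> \<psi>)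
        - lam / (1 - p) * (S1 (\<lambda>x. u x + e * \<phi> x) - S1 u) - lam / (1 - q) * (S2 (\<lambda>x. v x + e * \<psi> x) - S2 v)
        - \<theta> / (\<alpha> + \<beta>) * (cpl (\<lambda>x. u x + e * \<phi> x) (\<lambda>x. v x + e * \<psi> x) - cpl u v)) / e"
      unfolding energy_perturbed(2)[OF X Y] using e by simp
    also have "\<dots> = (form s V1 u \<phi> + form s V2 v \<psi>) + e / 2 * (form s V1 \<phi> \<phi> + form s V2 \<psi> \<psi>)
        - lam / (1 - p) * ((S1 (\<lambda>x. u x + e * \<phi> x) - S1 u) / e) - lam / (1 - q) * ((S2 (\<lambda>x. v x + e * \<psi> x) - S2 v) / e)
        - \<theta> / (\<alpha> + \<beta>) * ((cpl (\<lambda>x. u x + e * \<phi> x) (\<lambda>x. v x + e * \<psi> x) - cpl u v) / e)"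
    proof -
      have "(e * A + e\<^sup>2 / 2 * B - l * x - k * y - m * z) / e = A + e / 2 * B - l * (x / e) - k * (y / e) - m * (z / e)"
        for A B l k m x y z :: real
        using e by (simp add: field_simps power2_eq_square)
      then show ?thesis .
    qed
    finally show ?case unfolding e_def .
  qed
  ultimately have "0 \<le> ?L" by (intro tendsto_le[OF sequentially_bot _ tendsto_const]) auto
  then show "0 \<le> form s V1 u \<phi> + form s V2 v \<psi> - \<theta> / (\<alpha> + \<beta>) * (LINT x|lebesgue. coupling_deriv \<alpha> \<beta> u v \<phi> \<psi> x)
      - lam * ((LINT x|lebesgue. a x * \<bar>u x\<bar> powr (- p) * \<phi> x) + (LINT x|lebesgue. b x * \<bar>v x\<bar> powr (- q) * \<psi> x))"
  proof -
    have "lam / (1 - p) * ((1 - p) * x) = lam * x" "lam / (1 - q) * ((1 - q) * x) = lam * x" for x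
      using p1 q1 by simp_all
    with \<open>0 \<le> ?L\<close> show ?thesis by (simp only: distrib_left)
  qed
qed

lemma minimizer_weak_formulation: "weak_formulation s V1 V2 a b p q \<alpha> \<beta> \<theta> lam u v"
  unfolding weak_formulation_def
proof (intro ballI, clarify, intro conjI)
  fix \<phi> \<psi> assume "(\<phi>, \<psi>) \<in> Xspace s V1 V2"
  then have Y: "\<phi> \<in> X1" "\<psi> \<in> X2" by (auto simp: Xspace_def)
  note m = XcompD(1)[OF X(1)] XcompD(1)[OF X(2)] XcompD(1)[OF Y(1)] XcompD(1)[OF Y(2)]
  note s1 = singular_integrand_ext_integrable[OF a_measurable m(1,3) minimizer_positive(1) singular_derivative_integrable1[OF Y(1)]]
  note s2 = singular_integrand_ext_integrable[OF b_measurable m(2,4) minimizer_positive(2) singular_derivative_integrable2[OF Y(2)]]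
  show "integrable lebesgue (coupling_deriv \<alpha> \<beta> u v \<phi> \<psi>)" by (rule energy_derivative_ge(1)[OF Y])
  show "ext_integrable lebesgue (singular_integrand a p u \<phi>)" by (rule s1(1))
  show "ext_integrable lebesgue (singular_integrand b q v \<psi>)" by (rule s2(1))
  let ?D = "\<lambda>\<phi> \<psi>. form s V1 u \<phi> + form s V2 v \<psi> - \<theta> / (\<alpha> + \<beta>) * (LINT x|lebesgue. coupling_deriv \<alpha> \<beta> u v \<phi> \<psi> x)
      - lam * ((LINT x|lebesgue. a x * \<bar>u x\<bar> powr (- p) * \<phi> x) + (LINT x|lebesgue. b x * \<bar>v x\<bar> powr (- q) * \<psi> x))"
  have Yn: "(\<lambda>x. - \<phi> x) \<in> X1" "(\<lambda>x. - \<psi> x) \<in> X2"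
    using Xcomp_scale(1)[OF Y(1), of "- 1"] Xcomp_scale(1)[OF Y(2), of "- 1"] by simp_all
  have cdn: "coupling_deriv \<alpha> \<beta> u v (\<lambda>x. - \<phi> x) (\<lambda>x. - \<psi> x) x = - coupling_deriv \<alpha> \<beta> u v \<phi> \<psi> x" for x
    by (simp add: coupling_deriv_def)
  have "?D (\<lambda>x. - \<phi> x) (\<lambda>x. - \<psi> x) = - ?D \<phi> \<psi>"
    unfolding form_minus_right cdn by (simp add: algebra_simps)
  \<comment> \<open>\<open>?D\<close> is odd, so nonnegativity in both directions gives
    equality.\<close>
  then have "?D \<phi> \<psi> = 0" using energy_derivative_ge(2)[OF Y] energy_derivative_ge(2)[OF Yn] by linarith
  then show "ip s V1 V2 u v \<phi> \<psi> - \<theta> / (\<alpha> + \<beta>) * (LINT x|lebesgue. coupling_deriv \<alpha> \<beta> u v \<phi> \<psi> x)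
        - lam * (ext_integral lebesgue (singular_integrand a p u \<phi>) + ext_integral lebesgue (singular_integrand b q v \<psi>)) = 0"
    unfolding s1(2) s2(2) ip_eq[OF X(1) Y(1) X(2) Y(2)] .
qed

lemma minimizer_in_Aset: "(u, v) \<in> AA"
proof -
  have "cpl u v \<noteq> 0"
  proof
    assume "cpl u v = 0"
    then have "AE x in lebesgue. \<bar>u x\<bar> powr \<alpha> * \<bar>v x\<bar> powr \<beta> = 0"
      using integral_nonneg_eq_0_iff_AE[OF coupling_integrable[OF X]] by (simp add: coupling_int_def)
    then have "AE x in lebesgue. u x = 0 \<and> v x = 0"
      using minimizer_positive by eventually_elim auto
    then show False using nt by (simp add: nontrivial_def)
  qed
  then have "0 < cpl u v" using coupling_int_nonneg[of \<alpha> \<beta> u v] by linarith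
  then show ?thesis using X by (simp add: Aset_def Xspace_def)
qed

lemma minimizer_ground_state: "ground_state s V1 V2 a b p q \<alpha> \<beta> \<theta> lam u v"
proof -
  have "weak_solution s V1 V2 a b p q \<alpha> \<beta> \<theta> lam u v"
    using X nn minimizer_weak_formulation by (simp add: weak_solution_def Xspace_def)
  moreover have "E lam u v \<le> E lam u' v'"
    if "weak_solution s V1 V2 a b p q \<alpha> \<beta> \<theta> lam u' v'" "nontrivial u' v'" for u' v'
    \<comment> \<open>A weak solution satisfies \<open>E1 = 0\<close>, so the multiple
      \<open>t = 1\<close> meets the hypothesis of the comparison.\<close>
    using weak_solution_energy1[OF that(1)] that(2) by (intro min[of u' v' 1]) auto
  ultimately show ?thesis using nt by (simp add: ground_state_def)
qed

end

end

theorem theorem1p1: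
  fixes s p q \<alpha> \<beta> \<theta> V0 :: real
    and a b V1 V2 :: "real ^ 'n \<Rightarrow> real"
  assumes "0 < s" and "s < 1" and "2 * s < real CARD('n)"
    and "1 < \<alpha>" and "1 < \<beta>" and "2 < \<alpha> + \<beta>"
    and "\<alpha> + \<beta> < 2 * real CARD('n) / (real CARD('n) - 2 * s)"
    and "0 < p" and "p \<le> q" and "q < 1" and "0 < \<theta>"
    and "a \<in> Lspace (2 / (1 + p))" and "\<And>x. 0 < a x"
    and "b \<in> Lspace (2 / (1 + q))" and "\<And>x. 0 < b x"
    and "0 < V0"
    and "continuous_on UNIV V1" and "\<And>x. V0 \<le> V1 x"
    and "\<And>M. 0 < M \<Longrightarrow> emeasure lebesgue {x. V1 x \<le> M} < \<infinity>"
    and "continuous_on UNIV V2" and "\<And>x. V0 \<le> V2 x"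
    and "\<And>M. 0 < M \<Longrightarrow> emeasure lebesgue {x. V2 x \<le> M} < \<infinity>"
  shows "0 < lambda_lower s V1 V2 a b p q \<alpha> \<beta> \<theta>
    \<and> lambda_lower s V1 V2 a b p q \<alpha> \<beta> \<theta> < lambda_upper s V1 V2 a b p q \<alpha> \<beta> \<theta>
    \<and> lambda_upper s V1 V2 a b p q \<alpha> \<beta> \<theta> < \<infinity>
    \<and> (\<forall>lam::real. 0 < lam \<and> ereal lam < lambda_upper s V1 V2 a b p q \<alpha> \<beta> \<theta> \<longrightarrow>
        (\<exists>u v. ground_state s V1 V2 a b p q \<alpha> \<beta> \<theta> lam u v
           \<and> (u, v) \<in> Aset s V1 V2 \<alpha> \<beta>
           \<and> energy2 s V1 V2 a b p q \<alpha> \<beta> \<theta> lam u v > 0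
           \<and> (u, v) \<in> nehari_plus s V1 V2 a b p q \<alpha> \<beta> \<theta> lam \<inter> Aset s V1 V2 \<alpha> \<beta>
           \<and> (\<exists>C<0. energy s V1 V2 a b p q \<alpha> \<beta> \<theta> lam u v \<le> C)))"
proof -
  interpret fractional_system s p q \<alpha> \<beta> \<theta> V0 a b V1 V2
    by (rule fractional_system.intro) (fact assms)+
  have "\<exists>u v. ground_state s V1 V2 a b p q \<alpha> \<beta> \<theta> lam u v
           \<and> (u, v) \<in> AA \<and> E2 lam u v > 0
           \<and> (u, v) \<in> nehari_plus s V1 V2 a b p q \<alpha> \<beta> \<theta> lam \<inter> AA
           \<and> (\<exists>C<0. E lam u v \<le> C)"
    if lam: "0 < lam" "ereal lam < lam_up" for lam
  proof -
    obtain u v where m: "u \<in> X1" "v \<in> X2" "nontrivial u v" "\<And>x. 0 \<le> u x" "\<And>x. 0 \<le> v x"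
      "E1 lam u v = 0" "0 < E2 lam u v" and neg: "E lam u v < 0"
      and min: "\<And>u' v' t. u' \<in> X1 \<Longrightarrow> v' \<in> X2 \<Longrightarrow> nontrivial u' v' \<Longrightarrow> 1 \<le> t \<Longrightarrow>
        0 \<le> E1 lam (\<lambda>x. t * u' x) (\<lambda>x. t * v' x) \<Longrightarrow> E lam u v \<le> E lam u' v'"
      using nehari_minimizer[OF lam] by blast
    have "(u, v) \<in> AA" by (rule minimizer_in_Aset[OF lam(1) m min])
    moreover have "ground_state s V1 V2 a b p q \<alpha> \<beta> \<theta> lam u v" by (rule minimizer_ground_state[OF lam(1) m min])
    moreover have "(u, v) \<in> nehari_plus s V1 V2 a b p q \<alpha> \<beta> \<theta> lam"
      using m by (simp add: nehari_plus_def nehari_def Xspace_def)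
    \<comment> \<open>The energy of the minimizer itself serves as \<open>C\<close>.\<close>
    ultimately show ?thesis using m(7) neg by blast
  qed
  then show ?thesis using lambda_lower_pos lambda_lower_less_upper lambda_upper_finite by blast
qed

end
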